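(* Let $d\ge 1$, $p\ge 1$ be integers and $0<\alpha\le 2$ with $d<\alpha p$. Let $X_1(t),\dots,X_p(t)$ be independent, identically distributed $d$-dimensional symmetric $\alpha$-stable processes started at $0$, with $\mathbb{E}e^{i\lambda\cdot X_j(t)}=e^{-t\psi(\lambda)}$, where $\psi\ge 0$ is continuous on $\mathbb{R}^d$, $\psi(r\lambda)=r^\alpha\psi(\lambda)$, $\psi(-\lambda)=\psi(\lambda)$ for $r>0$, $\lambda\in\mathbb{R}^d$, and $C^{-1}|\lambda|^\alpha\le\psi(\lambda)\le C|\lambda|^\alpha$ for some constant $C>0$. Let $\eta^x(I)$ be the local time of the additive stable process $\overline{X}(t_1,\dots,t_p)=X_1(t_1)+\cdots+X_p(t_p)$ (defined in the context). Then $$\lim_{t\to\infty}t^{-\alpha/d}\log\mathbb{P}\{\eta^0([0,1]^p)\ge t\}=-(2\pi)^\alpha\frac{d}{\alpha}\Big(1-\frac{d}{\alpha p}\Big)^{(\alpha p-d)/d}\rho^{-\alpha/d},$$ where $$\rho=\sup_{\|f\|_2=1}\int_{\mathbb{R}^d}\Big[\int_{\mathbb{R}^d}\frac{f(\lambda+\gamma)f(\gamma)}{\sqrt{1+\psi(\lambda+\gamma)}\sqrt{1+\psi(\gamma)}}\,d\gamma\Big]^p d\lambda,$$ the supremum being over real-valued $f\in L^2(\mathbb{R}^d)$ with $\|f\|_2=(\int f^2)^{1/2}=1$.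
   Context: For a box $I\subset(\mathbb{R}^+)^p$, the occupation measure is $\mu_I(A)=\int_I \mathbb{1}_A(X_1(s_1)+\cdots+X_p(s_p))\,ds_1\cdots ds_p$ for Borel $A\subset\mathbb{R}^d$. When $d<\alpha p$, $\mu_I$ is a.s. absolutely continuous with respect to Lebesgue measure for every such box, and the local time $\eta^x(I)$ is its density at $x$; a version can be chosen so that $(x,t)\mapsto\eta^x([0,t]^p)$ is jointly continuous. Under $d<\alpha p$, $0<\rho<\infty$. *)

theory Defs
  imports "HOL-Probability.Probability"
begin

definition stable_exponent :: "real \<Rightarrow> (real^'d::finite \<Rightarrow> real) \<Rightarrow> bool" where
  "stable_exponent \<alpha> \<psi> \<longleftrightarrow>
     continuous_on UNIV \<psi> \<and> (\<forall>\<xi>. 0 \<le> \<psi> \<xi>) \<and>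
     (\<forall>r>0. \<forall>\<xi>. \<psi> (r *\<^sub>R \<xi>) = r powr \<alpha> * \<psi> \<xi>) \<and>
     (\<forall>\<xi>. \<psi> (- \<xi>) = \<psi> \<xi>) \<and>
     (\<exists>C>0. \<forall>\<xi>. inverse C * norm \<xi> powr \<alpha> \<le> \<psi> \<xi> \<and> \<psi> \<xi> \<le> C * norm \<xi> powr \<alpha>)"

definition levy_process_exp ::
    "'a measure \<Rightarrow> (real \<Rightarrow> 'a \<Rightarrow> real^'d::finite) \<Rightarrow> (real^'d \<Rightarrow> real) \<Rightarrow> bool" where
  "levy_process_exp M X \<psi> \<longleftrightarrow>
     (\<forall>t\<ge>0. X t \<in> borel_measurable M) \<and>
     (AE \<omega> in M. X 0 \<omega> = 0) \<and>
     (AE \<omega> in M. (\<forall>t\<ge>0. continuous (at_right t) (\<lambda>s. X s \<omega>)) \<and>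
                  (\<forall>t>0. \<exists>l. ((\<lambda>s. X s \<omega>) \<longlongrightarrow> l) (at_left t))) \<and>
     (\<forall>n (t::nat \<Rightarrow> real). 0 \<le> t 0 \<and> (\<forall>k<n. t k \<le> t (Suc k)) \<longrightarrow>
        prob_space.indep_vars M (\<lambda>_. borel) (\<lambda>k \<omega>. X (t (Suc k)) \<omega> - X (t k) \<omega>) {..<n}) \<and>
     (\<forall>s t. 0 \<le> s \<and> s \<le> t \<longrightarrow>
        distr M borel (\<lambda>\<omega>. X t \<omega> - X s \<omega>) = distr M borel (X (t - s))) \<and>
     (\<forall>t\<ge>0. \<forall>\<xi>. prob_space.expectation M (\<lambda>\<omega>. cis (\<xi> \<bullet> X t \<omega>))
                  = complex_of_real (exp (- (t * \<psi> \<xi>))))"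

definition cube :: "real \<Rightarrow> (real^'p::finite) set" where
  "cube t = {s. \<forall>j. 0 \<le> s $ j \<and> s $ j \<le> t}"

definition occupation :: "('p::finite \<Rightarrow> real \<Rightarrow> 'a \<Rightarrow> real^'d::finite) \<Rightarrow> 'a \<Rightarrow> (real^'p) set
                          \<Rightarrow> (real^'d) set \<Rightarrow> ennreal" where
  "occupation X \<omega> I A = (\<integral>\<^sup>+ s. indicator I s * indicator A (\<Sum>j\<in>UNIV. X j (s $ j) \<omega>) \<partial>lborel)"

definition local_time ::
    "'a measure \<Rightarrow> ('p::finite \<Rightarrow> real \<Rightarrow> 'a \<Rightarrow> real^'d::finite) \<Rightarrow> (real^'d \<Rightarrow> real \<Rightarrow> 'a \<Rightarrow> real) \<Rightarrow> bool" where
  "local_time M X \<eta> \<longleftrightarrow>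
     (\<forall>x t. (\<eta> x t) \<in> borel_measurable M) \<and>
     (AE \<omega> in M. continuous_on (UNIV \<times> {0..}) (\<lambda>(x,t). \<eta> x t \<omega>) \<and>
        (\<forall>t\<ge>0. (\<forall>x. 0 \<le> \<eta> x t \<omega>) \<and>
           (\<forall>A\<in>sets borel. occupation X \<omega> (cube t) A = (\<integral>\<^sup>+ x. indicator A x * ennreal (\<eta> x t \<omega>) \<partial>lborel))))"

definition stable_rho :: "nat \<Rightarrow> (real^'d::finite \<Rightarrow> real) \<Rightarrow> real" where
  "stable_rho p \<psi> = Sup {(\<integral>\<xi>. (\<integral>\<gamma>. f (\<xi> + \<gamma>) * f \<gamma> /
                           (sqrt (1 + \<psi> (\<xi> + \<gamma>)) * sqrt (1 + \<psi> \<gamma>)) \<partial>lborel) ^ p \<partial>lborel) | f.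
        f \<in> borel_measurable lborel \<and> integrable lborel (\<lambda>x. (f x)\<^sup>2) \<and> (\<integral>x. (f x)\<^sup>2 \<partial>lborel) = 1}"

end

theory Submission
  imports Defs "HOL-Combinatorics.Multiset_Permutations" "HOL-Real_Asymp.Real_Asymp"
begin

text \<open>The tail of the local time is read off from its moments by Chebyshev's inequality and tilting. The \<open>m\<close>-th moment
  is \<open>(2 \<pi>)\<close> to the power \<open>- m d\<close> times the integral of the \<open>p\<close>-th power of the joint characteristic function of the
  occupation measure of one component. That function is a sum over permutations of time integrals; at an independent
  exponential time it becomes \<open>m!\<close> times the symmetrised product of \<open>Q = 1 / (1 + \<psi>)\<close> along the partial sums.

  Upper bound: a Fejer kernel dominates the local time by a lattice sum. The part of the lattice far from the origin is
  negligible. On the finite rest the symmetric function is constant on types of words, so Hoelder duality costs only a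
  polynomial factor and reduces the sum to powers of a nonnegative matrix, whose norm is at most \<open>\<rho>\<close> up to a factor
  close to one: averages of modulated bumps embed the lattice problem into the variational problem for \<open>\<rho>\<close>.

  Lower bound: Gaussian mollification gives the moment formula with an inequality, and Hoelder's inequality against the
  \<open>m\<close>-fold product of a near-optimal autocorrelation leaves powers of a symmetric operator, which grow by
  log-convexity.\<close>

text \<open>The constant has three sources. Fourier inversion gives (2 \<pi>)^(-d) per point. By
  duality the p-th root of \<rho> is the supremum of quadratic forms with kernel sqrt(Q(x)) b(y -
  x)^(p-1) sqrt(Q(y)) over weights b in the unit ball of L^p, and such forms govern walks. The power
  of 1 - d / (\<alpha> p) comes from passing between exponential time and time 1: the upper bound
  discounts time at a rate T, which scaling turns into a dilation of the frequencies, and the best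
  rate is T = m (1 - d / (\<alpha> p)); the lower bound meets a gamma integral that peaks at the
  same point, so the two bounds match. The obstacle is the p-th power of a symmetrised product,
  which is not a product along a walk. Jensen's inequality over the permutations makes it one, but
  with a wrong exponential rate; this is affordable only for the far part of the lattice, where the
  rate is made small anyway. Only m-th roots of moments matter, so polynomial factors are free
  throughout.\<close>

abbreviation nn_lborel :: "('v::euclidean_space => ennreal) => ennreal" (binder "NN " 10) where
  "nn_lborel f \<equiv> nn_integral lborel f"

abbreviation (input) bm :: "'a measure => ('a => 'b::topological_space) set" where "bm \<equiv> borel_measurable"

abbreviation (input) ind :: "'a set => 'a => 'b::zero_neq_one" where "ind \<equiv> indicator"

section \<open>Hoelder, Jensen and Minkowski inequalities for natural powers\<close>

text \<open>Young's inequality for the conjugate exponents p = n + 1 and p / n in a form without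
  roots. The induction step multiplies by \<open>b\<close> and adds the nonnegative product (a^(n+1)
  - b^(n+1)) (a - b). Hoelder and Jensen below are this inequality summed or integrated.\<close>

lemma young_power:
 fixes a b :: real
 assumes "0 <= a" "0 <= b"
 shows "real (Suc n) * a * b ^ n <= a ^ Suc n + real n * b ^ Suc n"
proof (induction n)
 case (Suc n)
 have "0 <= (a ^ Suc n - b ^ Suc n) * (a - b)"
 proof (cases "a <= b")
  case True
  hence "a ^ Suc n <= b ^ Suc n" using assms by (intro power_mono) auto
  thus ?thesis using True by (simp add: mult_nonpos_nonpos del: power_Suc)
 next
  case False
  hence "b ^ Suc n <= a ^ Suc n" using assms by (intro power_mono) auto
  thus ?thesis using False by (simp del: power_Suc)
 qed
 moreover have "b * (real (Suc n) * a * b ^ n) <= b * (a ^ Suc n + real n * b ^ Suc n)"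
  using Suc assms by (intro mult_left_mono) auto
 ultimately show ?case by (simp add: algebra_simps)
qed simp

lemma young_power_ennreal:
 fixes a b :: ennreal
 shows "of_nat (Suc n) * (a * b ^ n) <= a ^ Suc n + of_nat n * b ^ Suc n"
proof (cases "a = \<top> \<or> (b = \<top> & n > 0)")
 case True
 thus ?thesis by (auto simp: ennreal_mult_top ennreal_top_mult top_power_ennreal)
next
 case False
 then consider "n = 0" | "a ~= \<top>" "b ~= \<top>" by auto
 thus ?thesis
 proof cases
  case 2
  then obtain x y where xy: "a = ennreal x" "b = ennreal y" "0 <= x" "0 <= y" by (metis ennreal_cases)
  have "ennreal (real (Suc n) * x * y ^ n) <= ennreal (x ^ Suc n + real n * y ^ Suc n)"
   using young_power[OF xy(3,4)] by (intro ennreal_leI)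
  thus ?thesis using xy by (simp add: ennreal_mult'' ennreal_power ennreal_of_nat_eq_real_of_nat ennreal_plus mult.assoc
   del: power_Suc of_nat_Suc)
 qed simp
qed

text \<open>A dual unit vector is written as \<open>g ^ n\<close> with \<open>g\<close> in the unit
  ball of L^p, so no conjugate exponent appears; the duality arguments below all use this shape. The
  proof integrates Young's inequality for \<open>f / K\<close> and \<open>g\<close>.\<close>

lemma hoelder_power_nn:
 fixes f g :: "'a => ennreal"
 assumes [measurable]: "f \<in> bm N" "g \<in> bm N"
  and f: "(\<integral>\<^sup>+x. f x ^ Suc n \<partial>N) <= ennreal K ^ Suc n" and g: "(\<integral>\<^sup>+x. g x ^ Suc n \<partial>N) <= 1"
  and K: "0 < K"
 shows "(\<integral>\<^sup>+x. f x * g x ^ n \<partial>N) <= ennreal K"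
proof -
 have "of_nat (Suc n) * (\<integral>\<^sup>+x. (f x / ennreal K) * g x ^ n \<partial>N)
   <= (\<integral>\<^sup>+x. (f x / ennreal K) ^ Suc n + of_nat n * g x ^ Suc n \<partial>N)"
  by (subst nn_integral_cmult[symmetric]) (auto intro!: nn_integral_mono young_power_ennreal simp del: of_nat_Suc power_Suc)
 also have "... = (\<integral>\<^sup>+x. f x ^ Suc n \<partial>N) / ennreal K ^ Suc n + of_nat n * (\<integral>\<^sup>+x. g x ^ Suc n \<partial>N)"
  by (simp add: nn_integral_add nn_integral_cmult divide_ennreal_def
   power_mult_distrib nn_integral_multc ennreal_inverse_power del: power_Suc)
 also have "... <= 1 + of_nat n * 1"
 proof (intro add_mono mult_left_mono g)
  have "(\<integral>\<^sup>+x. f x ^ Suc n \<partial>N) / ennreal K ^ Suc n <= ennreal K ^ Suc n / ennreal K ^ Suc n"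
   by (intro divide_right_mono_ennreal f)
  also have "... = 1" using K by (simp add: ennreal_power ennreal_divide_self del: power_Suc)
  finally show "(\<integral>\<^sup>+x. f x ^ Suc n \<partial>N) / ennreal K ^ Suc n <= 1" .
 qed simp
 finally have "of_nat (Suc n) * (\<integral>\<^sup>+x. (f x / ennreal K) * g x ^ n \<partial>N) <= of_nat (Suc n) * 1" by simp
 hence "(\<integral>\<^sup>+x. (f x / ennreal K) * g x ^ n \<partial>N) <= 1"
  by (subst (asm) ennreal_mult_le_mult_iff) (auto simp: ennreal_of_nat_eq_real_of_nat simp del: of_nat_Suc)
 moreover have "(\<integral>\<^sup>+x. (f x / ennreal K) * g x ^ n \<partial>N) = (\<integral>\<^sup>+x. f x * g x ^ n \<partial>N) / ennreal K"
 proof -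
  have "(\<integral>\<^sup>+x. (f x / ennreal K) * g x ^ n \<partial>N) = (\<integral>\<^sup>+x. (f x * g x ^ n) * inverse (ennreal K) \<partial>N)"
   by (intro nn_integral_cong) (simp add: divide_ennreal_def mult_ac)
  thus ?thesis by (simp add: nn_integral_multc divide_ennreal_def)
 qed
 ultimately have "ennreal K * ((\<integral>\<^sup>+x. f x * g x ^ n \<partial>N) / ennreal K) <= ennreal K * 1"
  by (intro mult_left_mono) auto
 moreover have "ennreal K * (X / ennreal K) = X" for X
  using K ennreal_mult_divide_eq[of "ennreal K" X] by (simp add: ennreal_times_divide mult.commute)
 ultimately show ?thesis by simp
qed

lemma hoelder_power_sum:
 fixes f g :: "'a => real"
 assumes "!!x. x \<in> A ==> 0 <= f x" "!!x. x \<in> A ==> 0 <= g x"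
  and f: "(\<Sum>x\<in>A. f x ^ Suc n) <= K ^ Suc n" and g: "(\<Sum>x\<in>A. g x ^ Suc n) <= 1"
  and K: "0 < K"
 shows "(\<Sum>x\<in>A. f x * g x ^ n) <= K"
proof -
 have "real (Suc n) * (\<Sum>x\<in>A. (f x / K) * g x ^ n) <= (\<Sum>x\<in>A. (f x / K) ^ Suc n + real n * g x ^ Suc n)"
  unfolding sum_distrib_left mult.assoc[symmetric] using assms by (intro sum_mono young_power) auto
 also have "... = (\<Sum>x\<in>A. f x ^ Suc n) / K ^ Suc n + real n * (\<Sum>x\<in>A. g x ^ Suc n)"
  by (simp add: sum.distrib sum_distrib_left power_divide sum_divide_distrib del: power_Suc)
 also have "... <= 1 + real n * 1" using f g K by (intro add_mono mult_left_mono) (auto simp: divide_le_eq)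
 finally have "real (Suc n) * (\<Sum>x\<in>A. (f x / K) * g x ^ n) <= real (Suc n) * 1" by simp
 hence "(\<Sum>x\<in>A. (f x / K) * g x ^ n) <= 1" by (subst (asm) mult_le_cancel_left_pos) auto
 moreover have "(\<Sum>x\<in>A. (f x / K) * g x ^ n) = (\<Sum>x\<in>A. f x * g x ^ n) / K" by (simp add: sum_divide_distrib)
 ultimately show ?thesis using K by (simp add: divide_le_eq)
qed

text \<open>Young's inequality with the mean as its second argument, averaged against
  \<open>w\<close>: the \<open>n\<close> copies on the right cancel all but one of the
  \<open>n + 1\<close> copies on the left.\<close>

lemma jensen_power:
 fixes w y :: "'a => real"
 assumes "!!x. x \<in> A ==> 0 <= w x" "!!x. x \<in> A ==> 0 <= y x" and w: "(\<Sum>x\<in>A. w x) = 1"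
 shows "(\<Sum>x\<in>A. w x * y x) ^ Suc n <= (\<Sum>x\<in>A. w x * y x ^ Suc n)"
proof -
 define G where "G = (\<Sum>x\<in>A. w x * y x)"
 have G: "0 <= G" unfolding G_def using assms by (intro sum_nonneg) auto
 have "(\<Sum>x\<in>A. w x * (real (Suc n) * y x * G ^ n)) <= (\<Sum>x\<in>A. w x * (y x ^ Suc n + real n * G ^ Suc n))"
  using assms G by (intro sum_mono mult_left_mono young_power) auto
 moreover have "(\<Sum>x\<in>A. w x * (real (Suc n) * y x * G ^ n)) = real (Suc n) * G ^ Suc n"
 proof -
  have "(\<Sum>x\<in>A. w x * (real (Suc n) * y x * G ^ n)) = (\<Sum>x\<in>A. w x * y x) * (real (Suc n) * G ^ n)"
   unfolding sum_distrib_right by (intro sum.cong) (simp_all add: mult_ac del: of_nat_Suc)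
  thus ?thesis by (simp add: G_def[symmetric] mult_ac)
 qed
 moreover have "(\<Sum>x\<in>A. w x * (y x ^ Suc n + real n * G ^ Suc n)) = (\<Sum>x\<in>A. w x * y x ^ Suc n) + real n * G ^ Suc n"
  by (simp add: distrib_left sum.distrib sum_distrib_right[symmetric] w del: power_Suc)
 ultimately show ?thesis unfolding G_def[symmetric] by (simp add: algebra_simps)
qed

text \<open>The triangle inequality of L^p for bounds given as p-th powers. Jensen with weights
  \<open>c i / C\<close> makes the \<open>i\<close>-th term contribute
  \<open>R * C ^ n * c i\<close>, and these add up without a root being taken. Dividing by the
  weights is why every \<open>c i\<close> must be positive.\<close>

lemma minkowski_power:
 fixes g :: "'a => 'b => real" and c :: "'a => real"
 assumes [measurable]: "!!i. i \<in> I ==> g i \<in> bm N"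
  and I: "finite I" "I ~= {}"
  and g: "!!i x. i \<in> I ==> 0 <= g i x" and c: "!!i. i \<in> I ==> 0 < c i"
  and le: "!!i. i \<in> I ==> (\<integral>\<^sup>+x. ennreal (g i x ^ Suc n) \<partial>N) <= ennreal (R * c i ^ Suc n)"
  and R: "0 <= R"
 shows "(\<integral>\<^sup>+x. ennreal ((\<Sum>i\<in>I. g i x) ^ Suc n) \<partial>N) <= ennreal (R * (\<Sum>i\<in>I. c i) ^ Suc n)"
proof -
 define C where "C = (\<Sum>i\<in>I. c i)"
 have C: "0 < C" unfolding C_def using I c by (intro sum_pos) auto
 have pt: "(\<Sum>i\<in>I. g i x) ^ Suc n <= (\<Sum>i\<in>I. (c i / C) * (g i x / (c i / C)) ^ Suc n)" for x
 proof -
  have "(\<Sum>i\<in>I. g i x) = (\<Sum>i\<in>I. (c i / C) * (g i x / (c i / C)))"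
  proof (rule sum.cong)
   fix i assume "i \<in> I"
   thus "g i x = (c i / C) * (g i x / (c i / C))" using C c[of i] by (simp add: field_simps)
  qed simp
  also have "... ^ Suc n <= (\<Sum>i\<in>I. (c i / C) * (g i x / (c i / C)) ^ Suc n)"
  proof (rule jensen_power)
   show "(\<Sum>x\<in>I. c x / C) = 1" using C by (simp add: sum_divide_distrib[symmetric] C_def[symmetric])
  qed (use C c g in \<open>auto intro!: divide_nonneg_nonneg simp: less_imp_le\<close>)
  finally show ?thesis .
 qed
 have "(\<integral>\<^sup>+x. ennreal ((\<Sum>i\<in>I. g i x) ^ Suc n) \<partial>N)
  <= (\<integral>\<^sup>+x. (\<Sum>i\<in>I. ennreal ((c i / C) / (c i / C) ^ Suc n) * ennreal (g i x ^ Suc n)) \<partial>N)"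
 proof (rule nn_integral_mono)
  fix x
  have "ennreal ((\<Sum>i\<in>I. g i x) ^ Suc n) <= ennreal (\<Sum>i\<in>I. (c i / C) * (g i x / (c i / C)) ^ Suc n)"
   by (intro ennreal_leI pt)
  also have "... = (\<Sum>i\<in>I. ennreal ((c i / C) * (g i x / (c i / C)) ^ Suc n))"
   using C c g by (subst sum_ennreal) (auto intro!: mult_nonneg_nonneg zero_le_power divide_nonneg_nonneg simp: less_imp_le simp del: power_Suc)
  also have "... = (\<Sum>i\<in>I. ennreal ((c i / C) / (c i / C) ^ Suc n) * ennreal (g i x ^ Suc n))"
  proof (intro sum.cong refl)
   fix i assume i: "i \<in> I"
   have "0 <= (c i / C) / (c i / C) ^ Suc n" using c[OF i] C by (intro divide_nonneg_nonneg zero_le_power) auto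
   thus "ennreal ((c i / C) * (g i x / (c i / C)) ^ Suc n) = ennreal ((c i / C) / (c i / C) ^ Suc n) * ennreal (g i x ^ Suc n)"
   by (subst ennreal_mult'[symmetric]) (simp_all only: power_divide times_divide_eq_left times_divide_eq_right)
  qed
  finally show "ennreal ((\<Sum>i\<in>I. g i x) ^ Suc n) <= (\<Sum>i\<in>I. ennreal ((c i / C) / (c i / C) ^ Suc n) * ennreal (g i x ^ Suc n))" .
 qed
 also have "... = (\<Sum>i\<in>I. ennreal ((c i / C) / (c i / C) ^ Suc n) * (\<integral>\<^sup>+x. ennreal (g i x ^ Suc n) \<partial>N))"
  by (subst nn_integral_sum) (auto simp: nn_integral_cmult)
 also have "... <= (\<Sum>i\<in>I. ennreal ((c i / C) / (c i / C) ^ Suc n) * ennreal (R * c i ^ Suc n))"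
  by (intro sum_mono mult_left_mono le) auto
 also have "... = (\<Sum>i\<in>I. ennreal (R * C ^ n * c i))"
 proof (intro sum.cong refl)
  fix i assume i: "i \<in> I"
  thus "ennreal ((c i / C) / (c i / C) ^ Suc n) * ennreal (R * c i ^ Suc n) = ennreal (R * C ^ n * c i)"
   using c[OF i] C R by (subst ennreal_mult[symmetric]) (auto simp: field_simps power_divide)
 qed
 also have "... = ennreal (\<Sum>i\<in>I. R * C ^ n * c i)"
  using c C R by (intro sum_ennreal) (auto intro!: mult_nonneg_nonneg simp: less_imp_le)
 also have "(\<Sum>i\<in>I. R * C ^ n * c i) = R * C ^ Suc n" by (simp add: sum_distrib_left[symmetric] C_def)
 finally show ?thesis by (simp add: C_def)
qed

section \<open>Product measures under permutation and scaling; walks as iterated kernels\<close>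

lemma product_sigma_finite_lborel: "product_sigma_finite (%_. lborel)"
 by (simp add: product_sigma_finite_def sigma_finite_lborel)

lemma product_sigma_finite_const: "sigma_finite_measure N ==> product_sigma_finite (%_. N)"
 by (simp add: product_sigma_finite_def)

lemma nn_integral_PiM_permute:
 fixes N :: "'b measure" and I :: "'a set"
 assumes N: "sigma_finite_measure N" and I: "finite I" and sg: "sg permutes I"
  and f[measurable]: "f \<in> bm (PiM I (%_. N))"
 shows "(\<integral>\<^sup>+x. f (\<lambda>i\<in>I. x (sg i)) \<partial>PiM I (%_. N)) = (\<integral>\<^sup>+x. f x \<partial>PiM I (%_. N))"
proof -
 interpret product_sigma_finite "%_::'a. N" by (rule product_sigma_finite_const[OF N])
 have m[measurable]: "(%x. \<lambda>i\<in>I. x (sg i)) \<in> measurable (PiM I (%_. N)) (PiM I (%_. N))"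
  using sg by (intro measurable_restrict measurable_component_singleton) (simp add: permutes_in_image)
 have "distr (PiM I (%_. N)) (PiM I (%_. N)) (%x. \<lambda>i\<in>I. x (sg i)) = PiM I (%_. N)"
 proof (rule PiM_eqI[OF I])
  fix A assume A: "!!i. i \<in> I ==> A i \<in> sets N"
  have "(%x. \<lambda>i\<in>I. x (sg i)) -` Pi\<^sub>E I A \<inter> space (PiM I (%_. N)) = Pi\<^sub>E I (%i. A (inv sg i))"
  proof (intro set_eqI iffI)
   fix x assume x: "x \<in> (%x. \<lambda>i\<in>I. x (sg i)) -` Pi\<^sub>E I A \<inter> space (PiM I (%_. N))"
   hence x1: "!!i. i \<in> I ==> x (sg i) \<in> A i" and x2: "x \<in> extensional I" by (auto simp: space_PiM PiE_iff)
   show "x \<in> Pi\<^sub>E I (%i. A (inv sg i))"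
   proof (rule PiE_I)
   fix i assume "i \<in> I"
   thus "x i \<in> A (inv sg i)" using x1[of "inv sg i"] sg by (simp add: permutes_inverses permutes_in_image[OF permutes_inv])
   qed (use x2 in \<open>auto simp: extensional_def\<close>)
  next
   fix x assume x: "x \<in> Pi\<^sub>E I (%i. A (inv sg i))"
   hence "x (sg i) \<in> A i" if "i \<in> I" for i
   using that sg PiE_mem[OF x, of "sg i"] by (simp add: permutes_inverses permutes_in_image)
   moreover have "x \<in> space (PiM I (%_. N))" unfolding space_PiM
   proof (rule PiE_I)
   fix i assume "i \<in> I"
   thus "x i \<in> space N" using PiE_mem[OF x, of i] A[of "inv sg i", THEN sets.sets_into_space] sg
   by (auto simp: permutes_in_image[OF permutes_inv])
   qed (use x in \<open>auto simp: PiE_iff extensional_def\<close>)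
   ultimately show "x \<in> (%x. \<lambda>i\<in>I. x (sg i)) -` Pi\<^sub>E I A \<inter> space (PiM I (%_. N))" by auto
  qed
  hence "emeasure (distr (PiM I (%_. N)) (PiM I (%_. N)) (%x. \<lambda>i\<in>I. x (sg i))) (Pi\<^sub>E I A)
   = emeasure (PiM I (%_. N)) (Pi\<^sub>E I (%i. A (inv sg i)))"
   using A I by (subst emeasure_distr) (auto intro!: sets_PiM_I_finite)
  also have "... = (\<Prod>i\<in>I. emeasure N (A (inv sg i)))"
   using A I sg by (intro emeasure_PiM) (auto simp: permutes_in_image[OF permutes_inv])
  also have "... = (\<Prod>i\<in>I. emeasure N (A i))"
   using prod.permute[OF permutes_inv[OF sg], of "%i. emeasure N (A i)"] by (simp add: comp_def)
  finally show "emeasure (distr (PiM I (%_. N)) (PiM I (%_. N)) (%x. \<lambda>i\<in>I. x (sg i))) (Pi\<^sub>E I A) = (\<Prod>i\<in>I. emeasure N (A i))" .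
 qed simp
 hence "(\<integral>\<^sup>+x. f x \<partial>PiM I (%_. N)) = (\<integral>\<^sup>+x. f x \<partial>distr (PiM I (%_. N)) (PiM I (%_. N)) (%x. \<lambda>i\<in>I. x (sg i)))"
  by simp
 thus ?thesis by (simp add: nn_integral_distr)
qed

lemma nn_integral_lborel_scale:
 fixes f :: "'v::euclidean_space => ennreal"
 assumes r: "0 < r" and [measurable]: "f \<in> bm borel"
 shows "(NN x. f x) = ennreal (r ^ DIM('v)) * (NN x. f (r *\<^sub>R x))"
 using r by (subst lborel_affine[of r 0]) (auto simp: nn_integral_density nn_integral_distr nn_integral_cmult)

lemma nn_integral_PiM_scale:
 fixes f :: "('a => 'v::euclidean_space) => ennreal"
 assumes I: "finite I" and r: "0 < r" and f: "f \<in> bm (PiM I (%_. lborel))"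
 shows "(\<integral>\<^sup>+x. f x \<partial>PiM I (%_. lborel)) = ennreal (r ^ (DIM('v) * card I)) * (\<integral>\<^sup>+x. f (\<lambda>i\<in>I. r *\<^sub>R x i) \<partial>PiM I (%_. lborel))"
 using I f
proof (induction I arbitrary: f)
 case empty
 interpret product_sigma_finite "%_::'a. lborel :: 'v measure" by (rule product_sigma_finite_lborel)
 show ?case by (simp add: PiM_empty nn_integral_count_space_finite max.absorb2 restrict_def)
next
 case (insert i I)
 interpret product_sigma_finite "%_::'a. lborel :: 'v measure" by (rule product_sigma_finite_lborel)
 interpret I: finite_product_sigma_finite "%_::'a. lborel :: 'v measure" I by unfold_locales fact
 have f[measurable]: "f \<in> bm (PiM (insert i I) (%_. lborel))" by fact
 have f2[measurable]: "(%(x, y). f (x(i := y))) \<in> bm (PiM I (%_. lborel) \<Otimes>\<^sub>M lborel)" by measurable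
 have [measurable]: "(%x. \<lambda>k\<in>I. r *\<^sub>R x k) \<in> measurable (PiM I (%_. lborel :: 'v measure)) (PiM I (%_. lborel))"
  "(%x. \<lambda>k\<in>insert i I. r *\<^sub>R x k) \<in> measurable (PiM (insert i I) (%_. lborel :: 'v measure)) (PiM (insert i I) (%_. lborel))"
  by (intro measurable_restrict; measurable)+
 have "(\<integral>\<^sup>+x. f x \<partial>PiM (insert i I) (%_. lborel)) = (\<integral>\<^sup>+x. (NN y. f (x(i := y))) \<partial>PiM I (%_. lborel))"
  by (rule product_nn_integral_insert) (use insert in auto)
 also have "... = (\<integral>\<^sup>+x. ennreal (r ^ DIM('v)) * (NN y. f (x(i := r *\<^sub>R y))) \<partial>PiM I (%_. lborel))"
 proof (intro nn_integral_cong nn_integral_lborel_scale[OF r])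
  fix x assume [measurable]: "x \<in> space (PiM I (%_. lborel :: 'v measure))"
  show "(%y. f (x(i := y))) \<in> bm borel" using measurable_Pair2[OF f2, of x] \<open>x \<in> _\<close> by simp
 qed
 also have "... = ennreal (r ^ (DIM('v) * card I)) * (\<integral>\<^sup>+x. ennreal (r ^ DIM('v)) * (NN y. f ((\<lambda>k\<in>I. r *\<^sub>R x k)(i := r *\<^sub>R y))) \<partial>PiM I (%_. lborel))"
  by (rule insert.IH) measurable
 also have "(\<integral>\<^sup>+x. ennreal (r ^ DIM('v)) * (NN y. f ((\<lambda>k\<in>I. r *\<^sub>R x k)(i := r *\<^sub>R y))) \<partial>PiM I (%_. lborel))
  = ennreal (r ^ DIM('v)) * (\<integral>\<^sup>+x. (NN y. f ((\<lambda>k\<in>I. r *\<^sub>R x k)(i := r *\<^sub>R y))) \<partial>PiM I (%_. lborel))"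
  by (rule nn_integral_cmult) measurable
 also have "(\<integral>\<^sup>+x. (NN y. f ((\<lambda>k\<in>I. r *\<^sub>R x k)(i := r *\<^sub>R y))) \<partial>PiM I (%_. lborel))
  = (\<integral>\<^sup>+x. (NN y. f (\<lambda>k\<in>insert i I. r *\<^sub>R (x(i := y)) k)) \<partial>PiM I (%_. lborel))"
  using insert by (intro nn_integral_cong arg_cong[where f = f]) (auto simp: fun_eq_iff)
 also have "... = (\<integral>\<^sup>+x. f (\<lambda>k\<in>insert i I. r *\<^sub>R x k) \<partial>PiM (insert i I) (%_. lborel))"
  by (rule product_nn_integral_insert[symmetric]) (use insert in auto)
 finally show ?case using insert r
  by (simp add: mult.assoc[symmetric] ennreal_mult[symmetric] power_add[symmetric] add.commute restrict_def)
qed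

text \<open>One step of a walk: the increment has law \<open>N\<close> with weight \<open>g\<close>, the new position has weight \<open>q\<close>.\<close>

definition walk_step :: "'v::euclidean_space measure => ('v => ennreal) => ('v => ennreal) => ('v => ennreal) => 'v => ennreal" where
 "walk_step N g q \<phi> x = (\<integral>\<^sup>+l. g l * q (x + l) * \<phi> (x + l) \<partial>N)"

lemma borel_measurable_walk_step[measurable]:
 assumes N: "sigma_finite_measure N" "sets N = sets borel"
  and [measurable]: "g \<in> bm borel" "q \<in> bm borel" "\<phi> \<in> bm borel"
 shows "walk_step N g q \<phi> \<in> bm borel"
proof -
 interpret sigma_finite_measure N by fact
 note [measurable_cong] = N(2)
 show ?thesis unfolding walk_step_def by measurable
qed

text \<open>In increment coordinates the last factor sees the past only through the partial sum, so
  integrating out the last increment is one application of the operator to \<open>\<phi>\<close>.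
  Hence the induction generalises over \<open>\<phi>\<close>.\<close>

lemma nn_integral_walk:
 fixes N :: "'v::euclidean_space measure"
 assumes N: "sigma_finite_measure N" "sets N = sets borel"
  and [measurable]: "g \<in> bm borel" "q \<in> bm borel" and "\<phi> \<in> bm borel"
 shows "(\<integral>\<^sup>+l. (\<Prod>k<m. g (l k) * q (x + (\<Sum>i\<le>k. l i))) * \<phi> (x + (\<Sum>i<m. l i)) \<partial>PiM {..<m} (%_. N))
  = (walk_step N g q ^^ m) \<phi> x" using assms(5)
proof (induction m arbitrary: \<phi>)
 case 0
 interpret product_sigma_finite "%_::nat. N" by (rule product_sigma_finite_const[OF N(1)])
 show ?case by (simp add: PiM_empty nn_integral_count_space_finite max.absorb2)
next
 case (Suc m)
 interpret product_sigma_finite "%_::nat. N" by (rule product_sigma_finite_const[OF N(1)])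
 note [measurable] = Suc.prems
 note [measurable_cong] = N(2)
 let ?F = "%m \<phi> l. (\<Prod>k<m. g (l k) * q (x + (\<Sum>i\<le>k. l i))) * \<phi> (x + (\<Sum>i<m. l i))"
 have "(\<integral>\<^sup>+l. ?F (Suc m) \<phi> l \<partial>PiM (insert m {..<m}) (%_. N))
  = (\<integral>\<^sup>+l. (\<integral>\<^sup>+y. ?F (Suc m) \<phi> (l(m := y)) \<partial>N) \<partial>PiM {..<m} (%_. N))"
  by (rule product_nn_integral_insert) (auto simp flip: lessThan_Suc)
 also have "... = (\<integral>\<^sup>+l. ?F m (walk_step N g q \<phi>) l \<partial>PiM {..<m} (%_. N))"
 proof (rule nn_integral_cong)
  fix l
  have "?F (Suc m) \<phi> (l(m := y)) = (\<Prod>k<m. g (l k) * q (x + (\<Sum>i\<le>k. l i))) *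
   (g y * q ((x + (\<Sum>i<m. l i)) + y) * \<phi> ((x + (\<Sum>i<m. l i)) + y))" for y
  proof -
   have "(\<Prod>k<m. g ((l(m := y)) k) * q (x + (\<Sum>i\<le>k. (l(m := y)) i))) = (\<Prod>k<m. g (l k) * q (x + (\<Sum>i\<le>k. l i)))"
   by (intro prod.cong refl arg_cong2[where f = "(*)"] arg_cong[where f = q] arg_cong2[where f = "(+)"] sum.cong) auto
   moreover have "(\<Sum>i\<le>m. (l(m := y)) i) = (\<Sum>i<m. l i) + y" by (simp add: lessThan_Suc_atMost[symmetric])
   ultimately show ?thesis by (simp add: mult_ac add.assoc)
  qed
  thus "(\<integral>\<^sup>+y. ?F (Suc m) \<phi> (l(m := y)) \<partial>N) = ?F m (walk_step N g q \<phi>) l"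
   by (simp add: walk_step_def nn_integral_cmult)
 qed
 also have "... = (walk_step N g q ^^ m) (walk_step N g q \<phi>) x" by (rule Suc.IH) (use N in measurable)
 finally show ?case by (simp add: lessThan_Suc funpow_swap1)
qed

definition lattice_step :: "'v::comm_monoid_add set => ('v => real) => ('v => real) => ('v => real) => 'v => real" where
 "lattice_step A g q \<phi> x = (\<Sum>l\<in>A. g l * q (x + l) * \<phi> (x + l))"

lemma sum_PiE_Suc:
 fixes f :: "(nat => 'b) => 'c::comm_monoid_add"
 shows "(\<Sum>l\<in>PiE {..<Suc m} (%_. A). f l) = (\<Sum>l\<in>PiE {..<m} (%_. A). \<Sum>y\<in>A. f (l(m := y)))"
proof -
 have "(\<Sum>l\<in>PiE {..<Suc m} (%_. A). f l) = (\<Sum>z\<in>A \<times> PiE {..<m} (%_. A). f ((snd z)(m := fst z)))"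
  unfolding lessThan_Suc PiE_insert_eq by (subst sum.reindex) (auto simp: case_prod_beta intro!: inj_combinator)
 also have "... = (\<Sum>y\<in>A. \<Sum>l\<in>PiE {..<m} (%_. A). f (l(m := y)))"
  by (subst sum.cartesian_product) (simp add: case_prod_beta)
 finally show ?thesis by (subst sum.swap)
qed

lemma sum_lattice_walk:
 "(\<Sum>l\<in>PiE {..<m} (%_. A). (\<Prod>k<m. g (l k) * q (x + (\<Sum>i\<le>k. l i))) * \<phi> (x + (\<Sum>i<m. l i)))
  = (lattice_step A g q ^^ m) \<phi> x"
proof (induction m arbitrary: \<phi>)
 case (Suc m)
 let ?F = "%m \<phi> l. (\<Prod>k<m. g (l k) * q (x + (\<Sum>i\<le>k. l i))) * \<phi> (x + (\<Sum>i<m. l i))"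
 have "(\<Sum>l\<in>PiE {..<Suc m} (%_. A). ?F (Suc m) \<phi> l) = (\<Sum>l\<in>PiE {..<m} (%_. A). ?F m (lattice_step A g q \<phi>) l)"
  unfolding sum_PiE_Suc
 proof (rule sum.cong[OF refl])
  fix l
  have "?F (Suc m) \<phi> (l(m := y)) = (\<Prod>k<m. g (l k) * q (x + (\<Sum>i\<le>k. l i))) *
   (g y * q ((x + (\<Sum>i<m. l i)) + y) * \<phi> ((x + (\<Sum>i<m. l i)) + y))" for y
  proof -
   have "(\<Prod>k<m. g ((l(m := y)) k) * q (x + (\<Sum>i\<le>k. (l(m := y)) i))) = (\<Prod>k<m. g (l k) * q (x + (\<Sum>i\<le>k. l i)))"
   by (intro prod.cong refl arg_cong2[where f = "(*)"] arg_cong[where f = q] arg_cong2[where f = "(+)"] sum.cong) auto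
   moreover have "(\<Sum>i\<le>m. (l(m := y)) i) = (\<Sum>i<m. l i) + y" by (simp add: lessThan_Suc_atMost[symmetric])
   ultimately show ?thesis by (simp add: mult_ac add.assoc)
  qed
  thus "(\<Sum>y\<in>A. ?F (Suc m) \<phi> (l(m := y))) = ?F m (lattice_step A g q \<phi>) l"
   unfolding lattice_step_def sum_distrib_left by presburger
 qed
 thus ?case by (simp add: Suc.IH funpow_swap1)
qed simp

text \<open>Hoelder against the constant 1, with \<open>K\<close> the p-th root of the right-hand
  side. The values 0 and infinity are treated apart because Hoelder is available for a positive real
  \<open>K\<close> only.\<close>

lemma jensen_power_nn:
 fixes w :: "'a => ennreal"
 assumes N: "emeasure N (space N) <= 1" and [measurable]: "w \<in> bm N"
 shows "(\<integral>\<^sup>+x. w x \<partial>N) ^ Suc n <= (\<integral>\<^sup>+x. w x ^ Suc n \<partial>N)"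
proof -
 consider "(\<integral>\<^sup>+x. w x ^ Suc n \<partial>N) = \<top>" | "(\<integral>\<^sup>+x. w x ^ Suc n \<partial>N) = 0"
  | K where "0 < K" "(\<integral>\<^sup>+x. w x ^ Suc n \<partial>N) = ennreal K"
  by (metis ennreal_cases ennreal_eq_0_iff not_less)
 thus ?thesis
 proof cases
  case 2
  hence "AE x in N. w x ^ Suc n = 0" by (subst (asm) nn_integral_0_iff_AE) auto
  hence "AE x in N. w x = 0" by (auto simp del: power_Suc)
  hence "(\<integral>\<^sup>+x. w x \<partial>N) = 0" by (subst nn_integral_0_iff_AE) auto
  thus ?thesis by simp
 next
  case (3 K)
  define r where "r = root (Suc n) K"
  have r: "0 < r" "r ^ Suc n = K" unfolding r_def using 3 by (auto simp: real_root_gt_zero simp del: power_Suc)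
  have "(\<integral>\<^sup>+x. w x * 1 ^ n \<partial>N) <= ennreal r"
   using 3 r N by (intro hoelder_power_nn) (auto simp: ennreal_power simp del: power_Suc)
  hence "(\<integral>\<^sup>+x. w x \<partial>N) ^ Suc n <= ennreal r ^ Suc n" by (intro power_mono) auto
  thus ?thesis using r 3 by (simp add: ennreal_power del: power_Suc)
 qed simp
qed

lemma nn_integral_lborel_shift:
 fixes f :: "'v::euclidean_space => ennreal"
 assumes [measurable]: "f \<in> bm borel"
 shows "(NN x. f (c + x)) = (NN x. f x)" by (subst (2) lborel_distr_plus[of c, symmetric]) (simp add: nn_integral_distr)

lemma nn_integral_one_plus_abs_powr_finite:
 fixes b :: real
 assumes b: "1 < b"
 shows "(NN s. ennreal ((1 + \<bar>s\<bar>) powr (- b))) < \<top>"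
proof -
 have pos: "(NN s. ennreal ((1 + \<bar>s\<bar>) powr (- b)) * ind {0..} s) < \<top>"
 proof -
  have "(\<integral>\<^sup>+s\<in>{0..}. ennreal ((1 + \<bar>s\<bar>) powr (- b)) \<partial>lborel) = ennreal (0 - (- ((1 + 0) powr (1 - b)) / (b - 1)))"
  proof (rule nn_integral_FTC_atLeast)
   show "((%x. - ((1 + x) powr (1 - b)) / (b - 1)) has_real_derivative (1 + \<bar>x\<bar>) powr - b) (at x)" if "0 <= x" for x
   proof -
   have "((%x. - ((1 + x) powr (1 - b)) / (b - 1)) has_real_derivative - ((1 - b) * (1 + x) powr (1 - b - 1)) / (b - 1)) (at x)"
   using that b by (auto intro!: derivative_eq_intros)
   moreover have "- ((1 - b) * (1 + x) powr (1 - b - 1)) / (b - 1) = (1 + \<bar>x\<bar>) powr - b"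
   using that b by (simp add: field_simps)
   ultimately show ?thesis by simp
   qed
   show "((%x. - ((1 + x) powr (1 - b)) / (b - 1)) \<longlongrightarrow> 0) at_top" using b by real_asymp
  qed (auto)
  thus ?thesis using ennreal_less_top by (simp only:)
 qed
 have "(NN s. ennreal ((1 + \<bar>s\<bar>) powr (- b)))
  <= (NN s. ennreal ((1 + \<bar>s\<bar>) powr (- b)) * ind {0..} s + ennreal ((1 + \<bar>-s\<bar>) powr (- b)) * ind {0..} (-s))"
  by (intro nn_integral_mono) (auto split: split_indicator)
 also have "... = (NN s. ennreal ((1 + \<bar>s\<bar>) powr (- b)) * ind {0..} s)
  + (NN s. ennreal ((1 + \<bar>-s\<bar>) powr (- b)) * ind {0..} (-s))" by (rule nn_integral_add) measurable
 also have "(NN s. ennreal ((1 + \<bar>-s\<bar>) powr (- b)) * ind {0..} (-s))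
   = (NN s. ennreal ((1 + \<bar>s\<bar>) powr (- b)) * ind {0..} s)"
  using nn_integral_real_affine[of "%s. ennreal ((1 + \<bar>s\<bar>) powr (- b)) * ind {0..} s" "-1" 0] by simp
 finally show ?thesis using pos by (simp add: order_le_less_trans)
qed

text \<open>The norm dominates every coordinate, so the radial weight lies below a product of
  one-dimensional weights with exponent b / D > 1. This avoids polar coordinates.\<close>

lemma nn_integral_one_plus_norm_powr_finite:
 assumes b: "real DIM('v::euclidean_space) < b"
 shows "(NN x. ennreal ((1 + norm (x::'v)) powr (- b))) < \<top>"
proof -
 define c where "c = b / real DIM('v)"
 have D: "0 < real DIM('v)" by simp
 have c: "1 < c" unfolding c_def using b D by (simp add: less_divide_eq)
 have "(NN x. ennreal ((1 + norm (x::'v)) powr (- b))) <= (NN x. ennreal (\<Prod>e\<in>Basis. (1 + \<bar>(x::'v) \<bullet> e\<bar>) powr (- c)))"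
 proof (intro nn_integral_mono ennreal_leI)
  fix x :: 'v
  have "(1 + norm x) powr (- b) = (\<Prod>e\<in>(Basis::'v set). (1 + norm x) powr (- c))"
  proof -
   have "(1 + norm x) powr (- b) = ((1 + norm x) powr (- c)) powr real DIM('v)" unfolding powr_powr c_def using D by simp
   also have "... = ((1 + norm x) powr (- c)) ^ DIM('v)"
   using add_pos_nonneg[OF zero_less_one norm_ge_zero[of x]] by (subst powr_realpow) auto
   finally show ?thesis by simp
  qed
  also have "... <= (\<Prod>e\<in>Basis. (1 + \<bar>x \<bullet> e\<bar>) powr (- c))"
   using c by (intro prod_mono) (auto intro!: powr_mono2' Basis_le_norm)
  finally show "(1 + norm x) powr (- b) <= (\<Prod>e\<in>Basis. (1 + \<bar>x \<bullet> e\<bar>) powr (- c))" .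
 qed
 also have "... = (NN x. (\<Prod>e\<in>Basis. ennreal ((1 + \<bar>(x::'v) \<bullet> e\<bar>) powr (- c))))"
  by (simp add: prod_ennreal)
 also have "... = (\<Prod>e\<in>(Basis::'v set). (NN s. ennreal ((1 + \<bar>s\<bar>) powr (- c))))"
  by (subst nn_integral_lborel_prod) auto
 also have "... < \<top>" using nn_integral_one_plus_abs_powr_finite[OF c] by (simp add: power_less_top_ennreal)
 finally show ?thesis .
qed

lemma tendsto_power_ennreal:
 fixes u :: "'a => ennreal"
 assumes "(u \<longlongrightarrow> l) F"
 shows "((%x. u x ^ n) \<longlongrightarrow> l ^ n) F"
proof (induction n)
 case (Suc n)
 have "~ (l = 0 & l ^ n = \<infinity> \<or> l = \<infinity> & l ^ n = 0)" by (cases "n = 0") (auto simp: power_0_left)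
 thus ?case using tendsto_mult_ennreal[OF assms Suc] by simp
qed simp

text \<open>With \<open>h = f / sqrt (1 + \<psi>)\<close> this is the inner integral in the definition of \<open>stable_rho\<close>.\<close>

definition corr :: "('v::euclidean_space => real) => 'v => ennreal" where
 "corr h l = (NN y. ennreal (h (l + y)) * ennreal (h y))"

lemma borel_measurable_corr[measurable]:
 assumes [measurable]: "h \<in> bm borel"
 shows "corr h \<in> bm borel" unfolding corr_def by measurable

lemma corr_mono: "(!!x. h x <= h' x) ==> corr h l <= corr h' l"
 unfolding corr_def by (intro nn_integral_mono mult_mono ennreal_leI) auto

lemma corr_minus:
 assumes [measurable]: "h \<in> bm borel"
 shows "corr h (- l) = corr h l"
proof -
 have "corr h (- l) = (NN y. ennreal (h (- l + (l + y))) * ennreal (h (l + y)))"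
  unfolding corr_def by (rule nn_integral_lborel_shift[symmetric]) measurable
 thus ?thesis by (simp add: corr_def mult.commute)
qed

lemma nn_integral_corr:
 assumes [measurable]: "h \<in> bm borel"
 shows "(NN l. corr h l) = (NN x. ennreal (h x))\<^sup>2"
proof -
 have "(NN l. corr h l) = (NN y. (NN l. ennreal (h (l + y)) * ennreal (h y)))"
  unfolding corr_def by (rule lborel_pair.Fubini') measurable
 also have "... = (NN y. (NN l. ennreal (h l)) * ennreal (h y))"
 proof (intro nn_integral_cong)
  fix y
  have "(NN l. ennreal (h (l + y)) * ennreal (h y)) = (NN l. ennreal (h (y + l)) * ennreal (h y))" by (simp add: add.commute)
  also have "... = (NN l. ennreal (h l) * ennreal (h y))"
   by (rule nn_integral_lborel_shift[of "%z. ennreal (h z) * ennreal (h y)" y]) measurable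
  finally show "(NN l. ennreal (h (l + y)) * ennreal (h y)) = (NN l. ennreal (h l)) * ennreal (h y)"
   by (simp add: nn_integral_multc)
 qed
 finally show ?thesis by (simp add: nn_integral_cmult power2_eq_square)
qed

section \<open>The exponent \<psi> and the resolvent symbol \<open>Q\<close>\<close>

text \<open>\<open>Suc n\<close> is the number p of components; the successor form fits the pairing
  of p-th with \<open>n\<close>-th powers. The function \<open>Q\<close> of this locale is the
  Laplace transform at 1 of t -> exp(- t \<psi>).\<close>

locale stable_setup =
 fixes \<alpha> :: real and \<psi> :: "real^'d::finite => real" and n :: nat
 assumes \<alpha>0: "0 < \<alpha>" and \<psi>: "stable_exponent \<alpha> \<psi>" and dp: "real CARD('d) < \<alpha> * real (Suc n)"
begin

definition Q :: "real^'d => real" where "Q x = 1 / (1 + \<psi> x)"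

lemma \<psi>_cont: "continuous_on UNIV \<psi>" and \<psi>_nn[simp]: "0 <= \<psi> x"
 and \<psi>_scale: "0 < r ==> \<psi> (r *\<^sub>R x) = r powr \<alpha> * \<psi> x" and \<psi>_minus[simp]: "\<psi> (- x) = \<psi> x"
 and \<psi>_bounds: "\<exists>C>0. \<forall>\<xi>. inverse C * norm \<xi> powr \<alpha> <= \<psi> \<xi> & \<psi> \<xi> <= C * norm \<xi> powr \<alpha>"
 using \<psi> unfolding stable_exponent_def by auto

lemma \<psi>_meas[measurable]: "\<psi> \<in> bm borel" using \<psi>_cont by (rule borel_measurable_continuous_onI)

lemma \<psi>_0[simp]: "\<psi> 0 = 0"
proof -
 obtain C where "\<psi> 0 <= C * norm (0::real^'d) powr \<alpha>" using \<psi>_bounds by blast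
 thus ?thesis using \<psi>_nn[of 0] by simp
qed

lemma Q_meas[measurable]: "Q \<in> bm borel" unfolding Q_def by measurable
lemma one_plus_\<psi>_pos[simp]: "0 < 1 + \<psi> x" by (simp add: add_pos_nonneg)
lemma Q_pos[simp]: "0 < Q x" and Q_nonneg[simp]: "0 <= Q x" and Q_le_1: "Q x <= 1"
 using \<psi>_nn[of x] unfolding Q_def by (auto simp: less_imp_le)
lemma Q_minus[simp]: "Q (- x) = Q x" by (simp add: Q_def)
text \<open>The relative oscillation has to be small uniformly over all of space, while \<psi> is
  merely continuous. Dividing by s = max(1, |x|) brings the points into a fixed ball, where uniform
  continuity gives an additive error; homogeneity turns it into \<open>e' * s powr \<alpha>\<close>,
  and the lower bound on \<psi> absorbs s^\<alpha> into (1 + C) (1 + \<psi>(x)).\<close>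

lemma \<psi>_local_upper:
 assumes e: "0 < e"
 obtains r where "0 < r" "!!x u. norm u <= r ==> 1 + \<psi> (x + u) <= (1 + e) * (1 + \<psi> x)"
proof -
 obtain C where C: "0 < C" "!!\<xi>. inverse C * norm \<xi> powr \<alpha> <= \<psi> \<xi>" using \<psi>_bounds by auto
 define e' where "e' = e / (1 + C)"
 have e': "0 < e'" using e C by (simp add: e'_def)
 have "uniformly_continuous_on (cball 0 2) \<psi>"
  by (intro compact_uniformly_continuous continuous_on_subset[OF \<psi>_cont]) auto
 then obtain d where d: "0 < d" "!!x x'. x \<in> cball 0 2 ==> x' \<in> cball 0 2 ==> dist x' x < d ==> dist (\<psi> x') (\<psi> x) < e'"
  using e' unfolding uniformly_continuous_on_def by blast
 define r where "r = min 1 (d / 2)"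
 show ?thesis
 proof (rule that[of r])
  show "0 < r" using d by (simp add: r_def)
  fix x u :: "real^'d" assume u: "norm u <= r"
  define s where "s = max 1 (norm x)"
  have s: "1 <= s" "norm x <= s" by (auto simp: s_def)
  have "norm (x /\<^sub>R s) <= 1" using s by (simp add: divide_le_eq field_simps)
  moreover have nu: "norm (u /\<^sub>R s) <= r"
  proof -
   have "norm (u /\<^sub>R s) <= norm u" using s divide_left_mono[of 1 s "norm u"] by (simp add: divide_inverse mult.commute)
   thus ?thesis using u by simp
  qed
  moreover have "r <= 1" "r < d" using d by (auto simp: r_def)
  ultimately have "norm (x /\<^sub>R s) <= 2" "norm (x /\<^sub>R s + u /\<^sub>R s) <= 2" "norm (u /\<^sub>R s) < d"
   using norm_triangle_ineq[of "x /\<^sub>R s" "u /\<^sub>R s"] by linarith+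
  hence "x /\<^sub>R s \<in> cball 0 2" "x /\<^sub>R s + u /\<^sub>R s \<in> cball 0 2" "dist (x /\<^sub>R s + u /\<^sub>R s) (x /\<^sub>R s) < d"
   by (simp_all only: mem_cball_0 dist_norm add_diff_cancel_left')
  hence "\<psi> (x /\<^sub>R s + u /\<^sub>R s) <= \<psi> (x /\<^sub>R s) + e'" using d(2)[of "x /\<^sub>R s" "x /\<^sub>R s + u /\<^sub>R s"] by (auto simp: dist_real_def)
  hence "s powr \<alpha> * \<psi> (x /\<^sub>R s + u /\<^sub>R s) <= s powr \<alpha> * (\<psi> (x /\<^sub>R s) + e')" by (intro mult_left_mono) auto
  moreover have "s powr \<alpha> * \<psi> (x /\<^sub>R s + u /\<^sub>R s) = \<psi> (x + u)"
   using s by (subst \<psi>_scale[symmetric]) (auto simp: scaleR_add_right)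
  moreover have "s powr \<alpha> * \<psi> (x /\<^sub>R s) = \<psi> x" using s by (subst \<psi>_scale[symmetric]) auto
  ultimately have 1: "\<psi> (x + u) <= \<psi> x + e' * s powr \<alpha>" by (simp add: algebra_simps)
  have "s powr \<alpha> <= 1 + norm x powr \<alpha>" by (auto simp: s_def max_def)
  also have "norm x powr \<alpha> <= C * \<psi> x" using C(2)[of x] C(1) by (simp add: field_simps)
  finally have "s powr \<alpha> <= 1 + C * \<psi> x" by simp
  moreover have "(1 + C) * (1 + \<psi> x) = 1 + C * \<psi> x + (C + \<psi> x)" by algebra
  ultimately have "s powr \<alpha> <= (1 + C) * (1 + \<psi> x)" using C(1) \<psi>_nn[of x] by linarith
  hence "e' * s powr \<alpha> <= e' * ((1 + C) * (1 + \<psi> x))" using e' by (intro mult_left_mono) auto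
  also have "... = e * (1 + \<psi> x)" using C(1) by (simp add: e'_def)
  finally show "1 + \<psi> (x + u) <= (1 + e) * (1 + \<psi> x)" using 1 by (simp add: algebra_simps)
 qed
qed

definition IQ :: real where "IQ = enn2real (NN x. ennreal (Q x ^ Suc n))"

text \<open>Here d < \<alpha> p enters: \<open>Q\<close> decays like |x|^(-\<alpha>), so its p-th
  power is integrable. \<open>IQ\<close> then serves as the scale of the a priori bounds.\<close>

lemma nn_integral_Q: "(NN x. ennreal (Q x ^ Suc n)) = ennreal IQ" and IQ_pos: "0 < IQ"
proof -
 obtain C where C: "0 < C" "!!\<xi>. inverse C * norm \<xi> powr \<alpha> <= \<psi> \<xi>" using \<psi>_bounds by auto
 define D where "D = 2 powr \<alpha> * (1 + C)"
 have D: "0 < D" using C by (auto simp: D_def)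
 have le: "Q x <= D * (1 + norm x) powr (- \<alpha>)" for x
 proof -
  have "(1 + norm x) powr \<alpha> <= (2 * max 1 (norm x)) powr \<alpha>" using \<alpha>0 by (intro powr_mono2) auto
  also have "... = 2 powr \<alpha> * max 1 (norm x) powr \<alpha>" by (simp add: powr_mult)
  also have "max 1 (norm x) powr \<alpha> <= 1 + norm x powr \<alpha>" by (auto simp: max_def)
  also have "norm x powr \<alpha> <= C * \<psi> x" using C(2)[of x] C(1) by (simp add: field_simps)
  also have "1 + C * \<psi> x <= (1 + C) * (1 + \<psi> x)" using C(1) \<psi>_nn[of x] by (simp add: algebra_simps)
  finally have "(1 + norm x) powr \<alpha> <= D * (1 + \<psi> x)" by (simp add: D_def)
  moreover have "0 < (1 + norm x) powr \<alpha>" using add_pos_nonneg[OF zero_less_one norm_ge_zero[of x]] by simp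
  ultimately have "1 / (1 + \<psi> x) <= D / (1 + norm x) powr \<alpha>"
   using one_plus_\<psi>_pos[of x] by (simp add: frac_le_eq pos_divide_le_eq divide_le_eq mult.commute)
  thus ?thesis unfolding Q_def powr_minus by (simp add: divide_inverse)
 qed
 have "(NN x. ennreal (Q x ^ Suc n)) <= (NN x. ennreal (D ^ Suc n) * ennreal ((1 + norm (x::real^'d)) powr (- (\<alpha> * real (Suc n)))))"
 proof (intro nn_integral_mono)
  fix x
  have "Q x ^ Suc n <= (D * (1 + norm x) powr (- \<alpha>)) ^ Suc n" by (intro power_mono le) auto
  also have "... = D ^ Suc n * (1 + norm x) powr (- (\<alpha> * real (Suc n)))"
  proof -
   have "((1 + norm x) powr (- \<alpha>)) ^ Suc n = ((1 + norm x) powr (- \<alpha>)) powr real (Suc n)"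
   using add_pos_nonneg[OF zero_less_one norm_ge_zero[of x]] by (subst powr_realpow) auto
   thus ?thesis by (simp add: power_mult_distrib powr_powr del: power_Suc of_nat_Suc)
  qed
  finally show "ennreal (Q x ^ Suc n) <= ennreal (D ^ Suc n) * ennreal ((1 + norm x) powr (- (\<alpha> * real (Suc n))))"
   using D by (subst ennreal_mult[symmetric]) (auto intro!: ennreal_leI simp del: power_Suc)
 qed
 also have "... < \<top>" using nn_integral_one_plus_norm_powr_finite[where 'v = "real^'d", of "\<alpha> * real (Suc n)"] dp
  by (simp add: nn_integral_cmult ennreal_mult_less_top del: of_nat_Suc power_Suc)
 finally have fin: "(NN x. ennreal (Q x ^ Suc n)) < \<top>" .
 thus 1: "(NN x. ennreal (Q x ^ Suc n)) = ennreal IQ" unfolding IQ_def by (simp del: power_Suc)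
 have "(NN x. ennreal (Q x ^ Suc n)) ~= 0"
 proof
  assume "(NN x. ennreal (Q x ^ Suc n)) = 0"
  hence "AE x in (lborel :: (real^'d) measure). ennreal (Q x ^ Suc n) = 0" by (subst (asm) nn_integral_0_iff_AE) auto
  hence "AE x in (lborel :: (real^'d) measure). False"
  proof eventually_elim
   case (elim x)
   thus ?case using zero_less_power[OF Q_pos[of x], of "Suc n"] by (simp only: ennreal_eq_0_iff not_le)
  qed
  thus False by (simp add: trivial_limit_def[symmetric] ae_filter_eq_bot_iff)
 qed
 thus "0 < IQ" using 1 by (cases "IQ <= 0") (simp_all add: ennreal_neg)
qed

text \<open>The source of the finiteness of \<rho>. With f = h sqrt(1 + \<psi>), the function y ->
  f(l + y) f(y) has mass at most 1, so Jensen moves the p-th power onto sqrt(Q(l + y) Q(y)). The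
  result is again an autocorrelation, whose total mass is a square, and Cauchy-Schwarz splits this
  square into the norm of f and \<open>IQ\<close>.\<close>

lemma nn_integral_corr_power_le:
 assumes [measurable]: "h \<in> bm borel" and h: "!!x. 0 <= h x"
  and s: "(NN x. ennreal ((h x)\<^sup>2 * (1 + \<psi> x))) <= 1"
 shows "(NN l. corr h l ^ Suc n) <= ennreal IQ"
proof -
 define f where "f x = h x * sqrt (1 + \<psi> x)" for x
 have f[measurable]: "f \<in> bm borel" and fnn[simp]: "!!x. 0 <= f x" unfolding f_def using h by auto
 have hf: "h x = f x * sqrt (Q x)" for x
  unfolding f_def Q_def using one_plus_\<psi>_pos[of x] by (simp add: real_sqrt_divide less_imp_neq[THEN not_sym])
 have f2: "(f x)\<^sup>2 = (h x)\<^sup>2 * (1 + \<psi> x)" for x unfolding f_def by (simp add: power_mult_distrib less_imp_le)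
 have half: "ennreal (1/2 * A + 1/2 * B) = ennreal (1/2) * ennreal A + ennreal (1/2) * ennreal B"
  if "0 <= A" "0 <= B" for A B :: real
  using that by (subst ennreal_plus) (auto simp only: ennreal_mult zero_le_mult_iff zero_le_divide_1_iff zero_le_numeral)
 have step: "corr h l ^ Suc n <= (NN y. ennreal (f (l + y) * sqrt (Q (l + y)) ^ Suc n) * ennreal (f y * sqrt (Q y) ^ Suc n))" for l
 proof -
  let ?a = "%y. ennreal (f (l + y) * f y)"
  let ?w = "%y. ennreal (sqrt (Q (l + y)) * sqrt (Q y))"
  have "emeasure (density lborel ?a) (space (density lborel ?a)) = (NN y. ?a y)" by (simp add: emeasure_density)
  also have "... <= (NN y. ennreal (1/2) * ennreal ((f (l + y))\<^sup>2) + ennreal (1/2) * ennreal ((f y)\<^sup>2))"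
  proof (intro nn_integral_mono)
   fix y
   have "f (l + y) * f y <= 1/2 * (f (l + y))\<^sup>2 + 1/2 * (f y)\<^sup>2"
   using sum_squares_bound[of "f (l + y)" "f y"] by simp
   hence "?a y <= ennreal (1/2 * (f (l + y))\<^sup>2 + 1/2 * (f y)\<^sup>2)" by (rule ennreal_leI)
   thus "?a y <= ennreal (1/2) * ennreal ((f (l + y))\<^sup>2) + ennreal (1/2) * ennreal ((f y)\<^sup>2)"
   by (simp only: half zero_le_power2)
  qed
  also have "... = ennreal (1/2) * (NN y. ennreal ((f (l + y))\<^sup>2)) + ennreal (1/2) * (NN y. ennreal ((f y)\<^sup>2))"
   by (simp add: nn_integral_add nn_integral_cmult)
  also have "(NN y. ennreal ((f (l + y))\<^sup>2)) = (NN y. ennreal ((f y)\<^sup>2))"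
   by (rule nn_integral_lborel_shift[of "%z. ennreal ((f z)\<^sup>2)"]) measurable
  also have "ennreal (1/2) * (NN y. ennreal ((f y)\<^sup>2)) + ennreal (1/2) * (NN y. ennreal ((f y)\<^sup>2)) <= ennreal (1/2) * 1 + ennreal (1/2) * 1"
   using s unfolding f2 by (intro add_mono mult_left_mono) auto
  also have "... = 1" using half[OF zero_le_one zero_le_one] by (simp only: ennreal_1 mult_1_right field_sum_of_halves)
  finally have le1: "emeasure (density lborel ?a) (space (density lborel ?a)) <= 1" .
  have "corr h l = (\<integral>\<^sup>+y. ?w y \<partial>density lborel ?a)"
   unfolding corr_def by (subst nn_integral_density) (auto intro!: nn_integral_cong simp: hf ennreal_mult[symmetric] mult_ac)
  hence "corr h l ^ Suc n <= (\<integral>\<^sup>+y. ?w y ^ Suc n \<partial>density lborel ?a)"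
   using jensen_power_nn[OF le1, of ?w n] by simp
  also have "... = (NN y. ?a y * ?w y ^ Suc n)" by (rule nn_integral_density) measurable
  also have "... = (NN y. ennreal (f (l + y) * sqrt (Q (l + y)) ^ Suc n) * ennreal (f y * sqrt (Q y) ^ Suc n))"
   by (auto intro!: nn_integral_cong simp: ennreal_mult[symmetric] ennreal_power power_mult_distrib mult_ac simp del: power_Suc)
  finally show ?thesis .
 qed
 have "(NN l. corr h l ^ Suc n) <= (NN l. corr (%y. f y * sqrt (Q y) ^ Suc n) l)"
  by (rule nn_integral_mono) (use step in \<open>simp add: corr_def del: power_Suc\<close>)
 also have "... = (NN y. ennreal (f y) * ennreal (sqrt (Q y) ^ Suc n))\<^sup>2"
  by (subst nn_integral_corr) (auto intro!: arg_cong[where f = "%x. x\<^sup>2"] nn_integral_cong simp: ennreal_mult[symmetric] simp del: power_Suc)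
 also have "... <= (NN y. (ennreal (f y))\<^sup>2) * (NN y. (ennreal (sqrt (Q y) ^ Suc n))\<^sup>2)"
  by (rule Cauchy_Schwarz_nn_integral) measurable
 also have "(NN y. (ennreal (f y))\<^sup>2) = (NN x. ennreal ((h x)\<^sup>2 * (1 + \<psi> x)))" by (simp add: ennreal_power f2)
 also have "(NN y. (ennreal (sqrt (Q y) ^ Suc n))\<^sup>2) = ennreal IQ"
 proof -
  have "(sqrt (Q y) ^ Suc n)\<^sup>2 = Q y ^ Suc n" for y by (metis Q_nonneg power_mult mult.commute real_sqrt_pow2)
  thus ?thesis by (subst nn_integral_Q[symmetric]) (simp add: ennreal_power del: power_Suc)
 qed
 also have "(NN x. ennreal ((h x)\<^sup>2 * (1 + \<psi> x))) * ennreal IQ <= 1 * ennreal IQ" by (intro mult_right_mono s) auto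
 finally show ?thesis by simp
qed

end

section \<open>The variational constant \<rho>\<close>

context stable_setup
begin

abbreviation \<rho> :: real where "\<rho> \<equiv> stable_rho (Suc n) \<psi>"

abbreviation rho_integral :: "(real^'d => real) => real" where
 "rho_integral f \<equiv> (\<integral>\<xi>. (\<integral>ga. f (\<xi> + ga) * f ga /
   (sqrt (1 + \<psi> (\<xi> + ga)) * sqrt (1 + \<psi> ga)) \<partial>lborel) ^ Suc n \<partial>lborel)"

abbreviation rho_class :: "(real^'d => real) set" where
 "rho_class \<equiv> {f. f \<in> bm lborel & integrable lborel (%x. (f x)\<^sup>2) & (\<integral>x. (f x)\<^sup>2 \<partial>lborel) = 1}"

lemma rho_eq: "\<rho> = Sup (rho_integral ` rho_class)" unfolding stable_rho_def by (intro arg_cong[where f = Sup]) auto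

lemma rho_class_scaled:
 assumes "f \<in> rho_class"
 defines "h \<equiv> %x. \<bar>f x\<bar> * sqrt (Q x)"
 shows "h \<in> bm borel" "!!x. 0 <= h x"
  "(NN x. ennreal ((h x)\<^sup>2 * (1 + \<psi> x))) <= 1"
proof -
 have [measurable]: "f \<in> bm borel" using assms by auto
 show "h \<in> bm borel" unfolding h_def by measurable
 show "!!x. 0 <= h x" unfolding h_def by (intro mult_nonneg_nonneg) (auto simp: less_imp_le)
 have "(h x)\<^sup>2 * (1 + \<psi> x) = (f x)\<^sup>2" for x
  unfolding h_def Q_def using one_plus_\<psi>_pos[of x] by (simp add: power_mult_distrib less_imp_le less_imp_neq[THEN not_sym] del: one_plus_\<psi>_pos)
 thus "(NN x. ennreal ((h x)\<^sup>2 * (1 + \<psi> x))) <= 1" using assms(1) by (subst nn_integral_eq_integral) auto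
qed

text \<open>Replacing f by its modulus can only increase the functional. Functions whose inner or
  outer integral does not exist are covered as well, since the Bochner integral is then 0.\<close>

lemma rho_integral_le_corr:
 assumes f: "f \<in> rho_class"
 shows "ennreal (rho_integral f) <= (NN l. corr (%x. \<bar>f x\<bar> * sqrt (Q x)) l ^ Suc n)"
proof -
 have [measurable]: "f \<in> bm borel" using f by auto
 let ?h = "%x. \<bar>f x\<bar> * sqrt (Q x)"
 let ?i = "%\<xi> ga. f (\<xi> + ga) * f ga / (sqrt (1 + \<psi> (\<xi> + ga)) * sqrt (1 + \<psi> ga))"
 have norm_le: "ennreal \<bar>integral\<^sup>L N u\<bar> <= (\<integral>\<^sup>+x. ennreal \<bar>u x\<bar> \<partial>N)" for N :: "(real^'d) measure" and u :: "real^'d => real"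
  using integral_norm_bound_ennreal[of N u] by (cases "integrable N u") (auto simp: not_integrable_integral_eq)
 have 1: "ennreal \<bar>\<integral>ga. ?i \<xi> ga \<partial>lborel\<bar> <= corr ?h \<xi>" for \<xi>
 proof -
  have "ennreal \<bar>?i \<xi> ga\<bar> = ennreal (?h (\<xi> + ga)) * ennreal (?h ga)" for ga
   by (simp add: ennreal_mult[symmetric] Q_def abs_mult real_sqrt_divide less_imp_le)
  thus ?thesis unfolding corr_def using norm_le[of lborel "?i \<xi>"] by simp
 qed
 have "ennreal (rho_integral f) <= (NN \<xi>. ennreal \<bar>(\<integral>ga. ?i \<xi> ga \<partial>lborel) ^ Suc n\<bar>)"
  by (rule order_trans[OF ennreal_leI[OF abs_ge_self] norm_le])
 also have "... <= (NN l. corr ?h l ^ Suc n)"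
 proof (intro nn_integral_mono)
  fix \<xi>
  have "ennreal \<bar>(\<integral>ga. ?i \<xi> ga \<partial>lborel) ^ Suc n\<bar> = ennreal \<bar>\<integral>ga. ?i \<xi> ga \<partial>lborel\<bar> ^ Suc n"
   unfolding power_abs by (subst ennreal_power) auto
  also have "... <= corr ?h \<xi> ^ Suc n" by (intro power_mono 1) auto
  finally show "ennreal \<bar>(\<integral>ga. ?i \<xi> ga \<partial>lborel) ^ Suc n\<bar> <= corr ?h \<xi> ^ Suc n" .
 qed
 finally show ?thesis .
qed

text \<open>The supremum in \<open>stable_rho\<close> is taken in the reals, where only a bounded
  set has a meaningful one.\<close>

lemma bdd_above_rho_integral: "bdd_above (rho_integral ` rho_class)"
proof (rule bdd_aboveI2)
 fix f assume f: "f \<in> rho_class"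
 have "ennreal (rho_integral f) <= ennreal IQ"
  using rho_integral_le_corr[OF f] nn_integral_corr_power_le[OF rho_class_scaled[OF f]] by (rule order_trans)
 thus "rho_integral f <= IQ" using IQ_pos by (subst (asm) ennreal_le_iff) auto
qed

lemma nn_integral_corr_power_le_rho_1:
 assumes [measurable]: "h \<in> bm borel" and h: "!!x. 0 <= h x"
  and s: "(NN x. ennreal ((h x)\<^sup>2 * (1 + \<psi> x))) = 1"
 shows "(NN l. corr h l ^ Suc n) <= ennreal \<rho>"
proof -
 define f where "f x = h x * sqrt (1 + \<psi> x)" for x
 have [measurable]: "f \<in> bm borel" unfolding f_def by measurable
 have f2: "(f x)\<^sup>2 = (h x)\<^sup>2 * (1 + \<psi> x)" for x unfolding f_def by (simp add: power_mult_distrib less_imp_le)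
 have "integrable lborel (%x. (f x)\<^sup>2)" by (rule integrableI_nonneg) (use s in \<open>auto simp: f2\<close>)
 moreover have "(\<integral>x. (f x)\<^sup>2 \<partial>lborel) = 1"
  by (subst integral_eq_nn_integral) (use s in \<open>auto simp: f2\<close>)
 ultimately have f: "f \<in> rho_class" by simp
 have le: "(NN l. corr h l ^ Suc n) <= ennreal IQ" by (rule nn_integral_corr_power_le) (use h s in auto)
 hence ne: "(NN l. corr h l ^ Suc n) ~= \<infinity>" by (metis ennreal_neq_top infinity_ennreal_def neq_top_trans)
 hence "AE l in lborel. corr h l ^ Suc n ~= \<infinity>" by (intro nn_integral_noteq_infinite) auto
 hence fin: "AE l in lborel. corr h l ~= \<top>" by eventually_elim auto
 have inner: "(\<integral>ga. f (\<xi> + ga) * f ga / (sqrt (1 + \<psi> (\<xi> + ga)) * sqrt (1 + \<psi> ga)) \<partial>lborel) = enn2real (corr h \<xi>)" for \<xi>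
 proof -
  have "f (\<xi> + ga) * f ga / (sqrt (1 + \<psi> (\<xi> + ga)) * sqrt (1 + \<psi> ga)) = h (\<xi> + ga) * h ga" for ga
   unfolding f_def using one_plus_\<psi>_pos[of ga] one_plus_\<psi>_pos[of "\<xi> + ga"] by (simp add: less_imp_neq[THEN not_sym] del: one_plus_\<psi>_pos)
  thus ?thesis by (simp add: integral_eq_nn_integral h corr_def ennreal_mult)
 qed
 have "rho_integral f = (\<integral>\<xi>. enn2real (corr h \<xi>) ^ Suc n \<partial>lborel)" unfolding inner ..
 also have "... = enn2real (NN \<xi>. ennreal (enn2real (corr h \<xi>) ^ Suc n))" by (rule integral_eq_nn_integral) auto
 also have "(NN \<xi>. ennreal (enn2real (corr h \<xi>) ^ Suc n)) = (NN \<xi>. corr h \<xi> ^ Suc n)"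
  by (rule nn_integral_cong_AE) (use fin in eventually_elim, simp add: ennreal_power[symmetric] less_top del: power_Suc)
 finally have "enn2real (NN \<xi>. corr h \<xi> ^ Suc n) = rho_integral f" ..
 also have "... <= \<rho>" unfolding rho_eq by (intro cSup_upper bdd_above_rho_integral imageI f)
 finally have "ennreal (enn2real (NN \<xi>. corr h \<xi> ^ Suc n)) <= ennreal \<rho>" by (rule ennreal_leI)
 thus ?thesis using ne by (simp only: ennreal_enn2real less_top infinity_ennreal_def)
qed

lemma nn_integral_lborel_pos:
 fixes g :: "real^'d => real"
 assumes [measurable]: "g \<in> bm borel" and g: "!!x. 0 < g x"
 shows "(NN x. ennreal (g x)) ~= 0"
proof
 assume "(NN x. ennreal (g x)) = 0"
 hence "AE x in lborel. ennreal (g x) = 0" by (subst (asm) nn_integral_0_iff_AE) auto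
 hence "AE x in (lborel :: (real^'d) measure). False"
 proof eventually_elim
  case (elim x)
  thus ?case using g[of x] by (simp add: ennreal_eq_0_iff)
 qed
 thus False by (simp add: trivial_limit_def[symmetric] ae_filter_eq_bot_iff)
qed

text \<open>Homogeneity: normalise \<open>h\<close> by the actual value \<open>t\<close> of the
  weighted norm; for t = 0 the function vanishes almost everywhere. \<open>ennreal \<rho>\<close>
  stands as a separate factor because the positivity of \<rho> is deduced from this very
  bound.\<close>

lemma nn_integral_corr_power_le_ennreal_rho:
 assumes [measurable]: "h \<in> bm borel" and h: "!!x. 0 <= h x" and s: "0 < s"
   and I: "(NN x. ennreal ((h x)\<^sup>2 * (1 + \<psi> x))) <= ennreal s"
 shows "(NN l. corr h l ^ Suc n) <= ennreal \<rho> * ennreal s ^ Suc n"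
proof -
 define t where "t = enn2real (NN x. ennreal ((h x)\<^sup>2 * (1 + \<psi> x)))"
 have t: "(NN x. ennreal ((h x)\<^sup>2 * (1 + \<psi> x))) = ennreal t" "0 <= t"
  unfolding t_def using le_less_trans[OF I ennreal_less_top] by simp_all
 have ts: "t <= s" using I s unfolding t(1) by (simp add: ennreal_le_iff)
 show ?thesis
 proof (cases "t = 0")
  case True
  hence "(NN x. ennreal ((h x)\<^sup>2 * (1 + \<psi> x))) = 0" using t(1) by simp
  hence "AE x in lborel. ennreal ((h x)\<^sup>2 * (1 + \<psi> x)) = 0" by (subst (asm) nn_integral_0_iff_AE) auto
  hence "AE x in lborel. h x = 0"
  proof eventually_elim
   case (elim x)
   thus ?case using one_plus_\<psi>_pos[of x] by (simp add: mult_le_0_iff not_le ennreal_eq_0_iff del: one_plus_\<psi>_pos)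
  qed
  hence "AE y in lborel. ennreal (h (l + y)) * ennreal (h y) = 0" for l by eventually_elim simp
  hence "corr h l = 0" for l unfolding corr_def by (subst nn_integral_0_iff_AE) auto
  thus ?thesis by simp
 next
  case False
  hence t0: "0 < t" using t by simp
  define h1 where "h1 x = h x / sqrt t" for x
  have [measurable]: "h1 \<in> bm borel" unfolding h1_def by measurable
  have "(NN x. ennreal ((h1 x)\<^sup>2 * (1 + \<psi> x))) = (NN x. ennreal (1 / t) * ennreal ((h x)\<^sup>2 * (1 + \<psi> x)))"
  proof (rule nn_integral_cong)
   fix x
   have "(h1 x)\<^sup>2 * (1 + \<psi> x) = 1 / t * ((h x)\<^sup>2 * (1 + \<psi> x))" using t0 by (simp add: h1_def power_divide)
   moreover have "0 <= 1 / t" "0 <= (h x)\<^sup>2 * (1 + \<psi> x)" using t0 by (simp_all add: less_imp_le)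
   ultimately show "ennreal ((h1 x)\<^sup>2 * (1 + \<psi> x)) = ennreal (1 / t) * ennreal ((h x)\<^sup>2 * (1 + \<psi> x))"
   by (simp only: ennreal_mult)
  qed
  also have "... = ennreal (1 / t) * ennreal t" by (simp add: nn_integral_cmult t)
  also have "... = ennreal (1 / t * t)" using t0 by (intro ennreal_mult[symmetric]) auto
  also have "... = 1" using t0 by simp
  finally have "(NN l. corr h1 l ^ Suc n) <= ennreal \<rho>"
   using h t0 by (intro nn_integral_corr_power_le_rho_1) (auto simp: h1_def)
  moreover have "corr h l = ennreal t * corr h1 l" for l
  proof -
   have "ennreal (h (l + y)) * ennreal (h y) = ennreal t * (ennreal (h1 (l + y)) * ennreal (h1 y))" for y
   proof -
   have "h (l + y) * h y = t * (h1 (l + y) * h1 y)" using t0 by (simp add: h1_def)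
   moreover have "0 <= h1 z" for z using h t0 by (simp add: h1_def)
   ultimately show ?thesis using h t0 by (simp only: ennreal_mult[symmetric] mult_nonneg_nonneg less_imp_le)
   qed
   thus ?thesis unfolding corr_def by (simp add: nn_integral_cmult)
  qed
  hence "(NN l. corr h l ^ Suc n) = ennreal t ^ Suc n * (NN l. corr h1 l ^ Suc n)"
   by (simp add: power_mult_distrib nn_integral_cmult del: power_Suc)
  ultimately have "(NN l. corr h l ^ Suc n) <= ennreal t ^ Suc n * ennreal \<rho>" by (simp add: mult_left_mono del: power_Suc)
  also have "... <= ennreal s ^ Suc n * ennreal \<rho>" using ts by (intro mult_right_mono power_mono ennreal_leI) auto
  finally show ?thesis by (simp only: mult.commute)
 qed
qed

text \<open>The test function Q^((p+1)/2) is positive everywhere and its weighted norm is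
  \<open>IQ\<close>, since Q (1 + \<psi>) = 1. Its autocorrelation has positive integral, so \<rho>
  cannot be 0 or negative.\<close>

lemma rho_pos: "0 < \<rho>"
proof -
 define h where "h x = sqrt (Q x ^ Suc (Suc n))" for x
 have [measurable]: "h \<in> bm borel" unfolding h_def by measurable
 have "(h x)\<^sup>2 * (1 + \<psi> x) = Q x ^ Suc n" for x
 proof -
  have "Q x * (1 + \<psi> x) = 1" using less_imp_neq[OF one_plus_\<psi>_pos[of x]] by (simp add: Q_def)
  thus ?thesis by (simp add: h_def)
 qed
 hence I: "(NN x. ennreal ((h x)\<^sup>2 * (1 + \<psi> x))) <= ennreal IQ" using nn_integral_Q by simp
 have hpos: "0 < h x" for x by (simp add: h_def)
 have "(NN l. corr h l ^ Suc n) ~= 0"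
 proof
  assume "(NN l. corr h l ^ Suc n) = 0"
  hence "AE l in lborel. corr h l ^ Suc n = 0" by (subst (asm) nn_integral_0_iff_AE) auto
  hence "AE l in lborel. corr h l = 0" by eventually_elim auto
  hence "(NN l. corr h l) = 0" by (subst nn_integral_0_iff_AE) auto
  thus False using nn_integral_lborel_pos[of h] hpos by (simp add: nn_integral_corr)
 qed
 hence "ennreal \<rho> ~= 0" using nn_integral_corr_power_le_ennreal_rho[of h IQ] I IQ_pos hpos by (auto simp: less_imp_le)
 thus ?thesis by (metis ennreal_neg not_le)
qed

lemma nn_integral_corr_power_le_rho:
 assumes "h \<in> bm borel" "!!x. 0 <= h x" "0 < s"
  "(NN x. ennreal ((h x)\<^sup>2 * (1 + \<psi> x))) <= ennreal s"
 shows "(NN l. corr h l ^ Suc n) <= ennreal (\<rho> * s ^ Suc n)"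
 using nn_integral_corr_power_le_ennreal_rho[OF assms] rho_pos \<open>0 < s\<close>
 by (simp add: ennreal_mult ennreal_power del: power_Suc)

text \<open>Cutting at height and radius k increases with k, so monotone convergence keeps the
  functional above \<open>c\<close> for large k. Boundedness and compact support are what later
  allows the ends of a walk to be replaced by constants.\<close>

lemma near_optimal_truncated:
 assumes c: "0 <= c" "c < \<rho>"
 obtains h R B where "h \<in> bm borel" "!!x. 0 <= h x" "!!x. h x <= B" "!!x. R < norm x ==> h x = 0"
  "(NN x. ennreal ((h x)\<^sup>2 * (1 + \<psi> x))) <= 1"
  "ennreal c < (NN l. corr h l ^ Suc n)"
proof -
 \<comment> \<open>Needed to extract a member from the supremum. The function Q^(p/2), normalised by
   the square root of \<open>IQ\<close>, is a unit vector.\<close>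
 have "rho_integral ` rho_class ~= {}"
 proof
  assume "rho_integral ` rho_class = {}"
  hence *: "f \<notin> rho_class" for f by blast
  define h where "h x = sqrt (Q x ^ Suc n)" for x
  have [measurable]: "h \<in> bm borel" unfolding h_def by measurable
  have h2: "(h x)\<^sup>2 = Q x ^ Suc n" for x by (simp add: h_def del: power_Suc)
  have I: "(NN x. ennreal ((h x / sqrt IQ)\<^sup>2)) = 1"
  proof -
   have "(NN x. ennreal ((h x / sqrt IQ)\<^sup>2)) = (NN x. ennreal (1 / IQ) * ennreal (Q x ^ Suc n))"
   using IQ_pos by (intro nn_integral_cong) (simp add: power_divide h2 ennreal_mult[symmetric] del: power_Suc)
   also have "... = ennreal (1 / IQ) * ennreal IQ" by (subst nn_integral_cmult) (simp_all only: nn_integral_Q, measurable)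
   also have "... = ennreal (1 / IQ * IQ)" using IQ_pos by (intro ennreal_mult[symmetric]) auto
   finally show ?thesis using IQ_pos by simp
  qed
  have "(%x. h x / sqrt IQ) \<in> rho_class" using I by (auto intro!: integrableI_nonneg simp: integral_eq_nn_integral)
  thus False using * by blast
 qed
 then obtain f where f: "f \<in> rho_class" and cf: "c < rho_integral f"
  using c(2) bdd_above_rho_integral unfolding rho_eq by (subst (asm) less_cSup_iff) blast+
 define h where "h x = \<bar>f x\<bar> * sqrt (Q x)" for x
 have h: "h \<in> bm borel" "!!x. 0 <= h x" "(NN x. ennreal ((h x)\<^sup>2 * (1 + \<psi> x))) <= 1"
  using rho_class_scaled[OF f] by (simp_all add: h_def[abs_def])
 note [measurable] = h(1)
 have big: "ennreal c < (NN l. corr h l ^ Suc n)"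
 proof -
  have "ennreal c < ennreal (rho_integral f)" using cf c(1) by (simp add: ennreal_less_iff)
  also have "... <= (NN l. corr h l ^ Suc n)" using rho_integral_le_corr[OF f] by (simp only: h_def[abs_def])
  finally show ?thesis .
 qed
 define g where "g k x = (if norm x <= real k then min (h x) (real k) else 0)" for k :: nat and x
 have gm[measurable]: "g k \<in> bm borel" for k unfolding g_def by measurable
 have g0: "0 <= g k x" and gh: "g k x <= h x" for k x using h(2) by (auto simp: g_def)
 have ginc: "g k x <= g k' x" if "k <= k'" for k k' x using that h(2)[of x] by (auto simp: g_def)
 have geq: "\<forall>\<^sub>F k in sequentially. g k x = h x" for x
 proof -
  obtain k0 :: nat where "max (norm x) (h x) <= real k0" using real_arch_simple by blast
  hence "g k x = h x" if "k0 <= k" for k using that by (auto simp: g_def)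
  thus ?thesis by (auto simp: eventually_sequentially)
 qed
 have cg: "(%k. corr (g k) l) \<longlonglongrightarrow> corr h l" for l unfolding corr_def
 proof (rule nn_integral_LIMSEQ)
  show "incseq (%k y. ennreal (g k (l + y)) * ennreal (g k y))" by (intro incseq_SucI le_funI mult_mono ennreal_leI ginc) auto
  show "(%k. ennreal (g k (l + y)) * ennreal (g k y)) \<longlonglongrightarrow> ennreal (h (l + y)) * ennreal (h y)" for y
   by (rule tendsto_eventually, use geq[of "l + y"] geq[of y] in eventually_elim) simp
 qed measurable
 have "(%k. \<integral>\<^sup>+l. corr (g k) l ^ Suc n \<partial>lborel) \<longlonglongrightarrow> (NN l. corr h l ^ Suc n)"
  by (rule nn_integral_LIMSEQ)
   (auto intro!: incseq_SucI le_funI power_mono corr_mono ginc tendsto_power_ennreal cg simp del: power_Suc)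
 hence "\<forall>\<^sub>F k in sequentially. ennreal c < (NN l. corr (g k) l ^ Suc n)" using big by (rule order_tendstoD)
 then obtain k where k: "ennreal c < (NN l. corr (g k) l ^ Suc n)" by (auto simp: eventually_sequentially)
 have "(NN x. ennreal ((g k x)\<^sup>2 * (1 + \<psi> x))) <= (NN x. ennreal ((h x)\<^sup>2 * (1 + \<psi> x)))"
  by (intro nn_integral_mono ennreal_leI mult_right_mono power_mono gh g0) (simp add: less_imp_le)
 hence "(NN x. ennreal ((g k x)\<^sup>2 * (1 + \<psi> x))) <= 1" using h(3) by (rule order_trans)
 thus thesis using k g0 by (intro that[of "g k" "real k" "real k"]) (auto simp: g_def)
qed

end

section \<open>From even moments to the tail\<close>

text \<open>Along even m the m-th moment is (m^ga e^(kap + o(1)))^m. Even orders suffice, and they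
  are the ones for which signed approximations of \<open>Y\<close> can be estimated.\<close>

locale moment_asymptotics = prob_space M for M :: "'a measure" +
 fixes Y :: "'a => real" and ga kap :: real
 assumes Ym[measurable]: "Y \<in> bm M"
  and Y0: "AE om in M. 0 <= Y om"
  and ga0: "0 < ga"
  and Yint: "!!m. integrable M (%om. Y om ^ (2 * m))"
  and mom_pos: "!!m. 0 < expectation (%om. Y om ^ (2 * m))"
  and lim: "(%m. ln (expectation (%om. Y om ^ (2 * m))) / real (2 * m) - ga * ln (real (2 * m))) \<longlonglongrightarrow> kap"
begin

definition mom :: "nat => real" where "mom m = expectation (%om. Y om ^ (2 * m))"
definition ell :: "nat => real" where "ell m = ln (mom m) / real (2 * m) - ga * ln (real (2 * m))"
text \<open>The logarithm of the u-th moment is about u (kap + ga ln u), and the derivative of this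
  in u is the logarithm of \<open>level u\<close>. It is the height near which the law tilted by Y^u
  concentrates; Chebyshev at this height gives the rate exp (- ga u).\<close>

definition level :: "real => real" where "level u = exp (kap + ga) * u powr ga"
definition tail :: "real => real" where "tail t = measure M {om \<in> space M. Y om >= t}"

lemma ell_lim: "ell \<longlonglongrightarrow> kap" using lim by (simp add: ell_def[abs_def] mom_def)
lemma mom0: "0 < mom m" using mom_pos by (simp add: mom_def)
lemma ln_mom: "0 < m ==> ln (mom m) = real (2 * m) * (ell m + ga * ln (real (2 * m)))" by (simp add: ell_def field_simps)
lemma ln_level: "0 < u ==> ln (level u) = kap + ga + ga * ln u" by (simp add: level_def ln_mult ln_powr)
lemma level_pos: "0 < u ==> 0 < level u" by (simp add: level_def)

lemma tail_le: assumes t: "0 < t" shows "tail t * t ^ (2 * m) <= mom m"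
proof -
 have "tail t * t ^ (2 * m) = (\<integral>om. t ^ (2 * m) * ind {om \<in> space M. Y om >= t} om \<partial>M)"
  by (simp add: tail_def)
 also have "... <= mom m" unfolding mom_def
 proof (rule integral_mono_AE[OF _ Yint])
  show "integrable M (%om. t ^ (2 * m) * ind {om \<in> space M. Y om >= t} om)" by (simp add: less_top[symmetric])
  show "AE om in M. t ^ (2 * m) * ind {om \<in> space M. Y om >= t} om <= Y om ^ (2 * m)"
   using t by (auto split: split_indicator intro!: power_mono simp: zero_le_even_power)
 qed
 finally show ?thesis .
qed

lemma tail_antimono: "s <= t ==> tail t <= tail s" unfolding tail_def by (intro finite_measure_mono) auto

text \<open>Below \<open>lo\<close> the power is compared with a smaller moment, above
  \<open>hi\<close> with a larger one. If both comparisons are negligible, the moment of order 2 m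
  lives between \<open>lo\<close> and \<open>hi\<close> and forces a lower bound on the tail at
  \<open>lo\<close>.\<close>

lemma mom_split:
 assumes lo: "0 < lo" and hi: "0 < hi" and m: "m1 <= m" "m <= m2"
 shows "mom m <= hi ^ (2 * m) * tail lo + lo ^ (2 * (m - m1)) * mom m1 + mom m2 / hi ^ (2 * (m2 - m))"
proof -
 have "mom m <= (\<integral>om. hi ^ (2 * m) * ind {om \<in> space M. Y om >= lo} om + lo ^ (2 * (m - m1)) * Y om ^ (2 * m1) + Y om ^ (2 * m2) / hi ^ (2 * (m2 - m)) \<partial>M)"
  unfolding mom_def
 proof (rule integral_mono_AE[OF Yint])
  show "integrable M (%om. hi ^ (2 * m) * ind {om \<in> space M. Y om >= lo} om + lo ^ (2 * (m - m1)) * Y om ^ (2 * m1) + Y om ^ (2 * m2) / hi ^ (2 * (m2 - m)))"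
   using Yint by (auto intro!: Bochner_Integration.integrable_add integrable_real_mult_indicator simp: less_top[symmetric])
  show "AE om in M. Y om ^ (2 * m) <= hi ^ (2 * m) * ind {om \<in> space M. Y om >= lo} om + lo ^ (2 * (m - m1)) * Y om ^ (2 * m1) + Y om ^ (2 * m2) / hi ^ (2 * (m2 - m))"
   using Y0 AE_space
  proof eventually_elim
   case (elim om)
   hence y: "0 <= Y om" "om \<in> space M" by auto
   have nn: "0 <= hi ^ (2 * m) * ind {om \<in> space M. Y om >= lo} om" "0 <= lo ^ (2 * (m - m1)) * Y om ^ (2 * m1)"
   "0 <= Y om ^ (2 * m2) / hi ^ (2 * (m2 - m))" using lo hi y by auto
   consider "Y om < lo" | "lo <= Y om" "Y om <= hi" | "hi < Y om" by linarith
   thus ?case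
   proof cases
   case 1
   have "Y om ^ (2 * m) = Y om ^ (2 * (m - m1)) * Y om ^ (2 * m1)"
   using m by (simp add: power_add[symmetric] distrib_left[symmetric] del: mult_Suc)
   also have "... <= lo ^ (2 * (m - m1)) * Y om ^ (2 * m1)" using 1 y by (intro mult_right_mono power_mono) auto
   finally show ?thesis using nn by linarith
   next
   case 2
   hence "Y om ^ (2 * m) <= hi ^ (2 * m) * ind {om \<in> space M. Y om >= lo} om" using y by (auto intro!: power_mono)
   thus ?thesis using nn by linarith
   next
   case 3
   have "Y om ^ (2 * m) * hi ^ (2 * (m2 - m)) <= Y om ^ (2 * m) * Y om ^ (2 * (m2 - m))"
   using 3 hi y by (intro mult_left_mono power_mono) auto
   also have "... = Y om ^ (2 * m2)" using m by (simp add: power_add[symmetric] distrib_left[symmetric])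
   finally have "Y om ^ (2 * m) <= Y om ^ (2 * m2) / hi ^ (2 * (m2 - m))" using hi by (simp add: le_divide_eq)
   thus ?thesis using nn by linarith
   qed
  qed
 qed
 also have "... = hi ^ (2 * m) * tail lo + lo ^ (2 * (m - m1)) * mom m1 + mom m2 / hi ^ (2 * (m2 - m))"
 proof -
  have "integrable M (%om. hi ^ (2 * m) * ind {om \<in> space M. Y om >= lo} om)" by (simp add: less_top[symmetric])
  thus ?thesis using Yint by (simp add: mom_def tail_def)
 qed
 finally show ?thesis .
qed

text \<open>The neighbouring orders (k - 1) j and (k + 1) j lie at relative distance 1 / k from k j.
  First order terms cancel because \<open>level\<close> is the saddle point, the second order costs
  at most ga / k, and the window around \<open>level\<close> gains - ln (1 - \<eta>) below and ln (1
  + \<eta>) above; so a fixed large k wins.\<close>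

lemma tail_lower_level:
 assumes \<eta>: "0 < \<eta>" "\<eta> < 1"
 obtains k where "0 < k" "\<forall>\<^sub>F j in sequentially. mom (k * j) / 2 <= ((1 + \<eta>) * level (real (2 * (k * j)))) ^ (2 * (k * j)) * tail ((1 - \<eta>) * level (real (2 * (k * j))))"
proof -
 define c where "c = min (- ln (1 - \<eta>)) (ln (1 + \<eta>))"
 have c: "0 < c" using \<eta> by (simp add: c_def)
 obtain k0 :: nat where k0: "ga / c < real k0" using reals_Archimedean2 by blast
 define k where "k = max 2 k0"
 have k: "2 <= k" by (simp add: k_def)
 have "ga / c < real k" using k0 by (simp add: k_def)
 hence kc: "ga / real k < c" using c k by (simp add: field_simps)
 \<comment> \<open>\<open>c1\<close> and \<open>c2\<close> are the limiting exponential rates, per 2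
   j, of the two outer contributions relative to the moment of order 2 k j.\<close>
 define c1 where "c1 = ln (1 - \<eta>) + ga + ga * ((real k - 1) * ln ((real k - 1) / real k))"
 define c2 where "c2 = - ln (1 + \<eta>) - ga + ga * ((real k + 1) * ln ((real k + 1) / real k))"
 have c1: "c1 < 0"
 proof -
  have "ln ((real k - 1) / real k) <= (real k - 1) / real k - 1" using k by (intro ln_le_minus_one) auto
  also have "... = - 1 / real k" using k by (simp add: field_simps)
  finally have "(real k - 1) * ln ((real k - 1) / real k) <= (real k - 1) * (- 1 / real k)"
   using k by (intro mult_left_mono) auto
  also have "... = - 1 + 1 / real k" using k by (simp add: field_simps)
  finally have "ga * ((real k - 1) * ln ((real k - 1) / real k)) <= ga * (- 1 + 1 / real k)"
   using ga0 by (intro mult_left_mono) auto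
  thus ?thesis using kc unfolding c1_def c_def by (simp add: algebra_simps)
 qed
 have c2: "c2 < 0"
 proof -
  have "ln ((real k + 1) / real k) <= (real k + 1) / real k - 1" using k by (intro ln_le_minus_one) auto
  also have "... = 1 / real k" using k by (simp add: field_simps)
  finally have "(real k + 1) * ln ((real k + 1) / real k) <= (real k + 1) * (1 / real k)" using k by (intro mult_left_mono) auto
  also have "... = 1 + 1 / real k" using k by (simp add: field_simps)
  finally have "ga * ((real k + 1) * ln ((real k + 1) / real k)) <= ga * (1 + 1 / real k)"
   using ga0 by (intro mult_left_mono) auto
  thus ?thesis using kc unfolding c2_def c_def by (simp add: algebra_simps)
 qed
 have sub: "filterlim (%j. a * j) sequentially sequentially" if "0 < a" for a :: nat
  using that by (intro filterlim_subseq) (auto simp: strict_mono_def)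
 have L: "(%j. ell (a * j)) \<longlonglongrightarrow> kap" if "0 < a" for a using filterlim_compose[OF ell_lim sub[OF that]] .
 define R1 where "R1 j = ((1 - \<eta>) * level (real (2 * (k * j)))) ^ (2 * (k * j - (k - 1) * j)) * mom ((k - 1) * j) / mom (k * j)" for j
 define R2 where "R2 j = mom ((k + 1) * j) / ((1 + \<eta>) * level (real (2 * (k * j)))) ^ (2 * ((k + 1) * j - k * j)) / mom (k * j)" for j
 have d1: "k * j - (k - 1) * j = j" and d2: "(k + 1) * j - k * j = j" for j
  using k by (simp_all add: diff_mult_distrib[symmetric])
 have lnR1: "ln (R1 j) = real (2 * j) * (c1 + (kap + (real k - 1) * ell ((k - 1) * j) - real k * ell (k * j)))" if j: "0 < j" for j
 proof -
  have kj: "0 < real (2 * (k * j))" "0 < (k - 1) * j" "0 < k * j" using k j by auto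
  have "ln (R1 j) = real (2 * j) * (ln (1 - \<eta>) + ln (level (real (2 * (k * j))))) + ln (mom ((k - 1) * j)) - ln (mom (k * j))"
   unfolding R1_def d1 using level_pos[OF kj(1)] \<eta> mom0
   by (simp add: ln_div ln_mult ln_realpow mom0[THEN less_imp_neq, THEN not_sym])
  also have "ln (level (real (2 * (k * j)))) = kap + ga + ga * (ln (real k) + ln (real (2 * j)))"
   using kj k j by (subst ln_level) (auto simp: ln_mult)
  also have "ln (mom ((k - 1) * j)) = real (2 * j) * ((real k - 1) * (ell ((k - 1) * j) + ga * (ln (real k - 1) + ln (real (2 * j)))))"
   using kj k j by (subst ln_mom) (auto simp: ln_mult of_nat_diff)
  also have "ln (mom (k * j)) = real (2 * j) * (real k * (ell (k * j) + ga * (ln (real k) + ln (real (2 * j)))))"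
   using kj k j by (subst ln_mom) (auto simp: ln_mult)
  finally show ?thesis unfolding c1_def using k by (simp add: ln_div algebra_simps)
 qed
 have lnR2: "ln (R2 j) = real (2 * j) * (c2 + ((real k + 1) * ell ((k + 1) * j) - real k * ell (k * j) - kap))" if j: "0 < j" for j
 proof -
  have kj: "0 < real (2 * (k * j))" "0 < (k + 1) * j" "0 < k * j" using k j by auto
  have "ln (R2 j) = ln (mom ((k + 1) * j)) - real (2 * j) * (ln (1 + \<eta>) + ln (level (real (2 * (k * j))))) - ln (mom (k * j))"
   unfolding R2_def d2 using level_pos[OF kj(1)] \<eta> mom0
   by (simp add: ln_div ln_mult ln_realpow mom0[THEN less_imp_neq, THEN not_sym])
  also have "ln (level (real (2 * (k * j)))) = kap + ga + ga * (ln (real k) + ln (real (2 * j)))"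
   using kj k j by (subst ln_level) (auto simp: ln_mult)
  also have "ln (mom ((k + 1) * j)) = real (2 * j) * ((real k + 1) * (ell ((k + 1) * j) + ga * (ln (real k + 1) + ln (real (2 * j)))))"
  proof -
   have "real (2 * ((k + 1) * j)) = (real k + 1) * real (2 * j)" by (simp add: algebra_simps)
   thus ?thesis using kj k j ln_mom[OF kj(2)] by (simp only: ln_mult) (simp add: ln_mult)
  qed
  also have "ln (mom (k * j)) = real (2 * j) * (real k * (ell (k * j) + ga * (ln (real k) + ln (real (2 * j)))))"
   using kj k j by (subst ln_mom) (auto simp: ln_mult)
  finally show ?thesis unfolding c2_def using k by (simp add: ln_div algebra_simps)
 qed
 have small: "\<forall>\<^sub>F j in sequentially. R j <= 1 / 4"
  if c: "c < 0" and pos: "!!j. 0 < j ==> 0 < R j" and ln: "!!j. 0 < j ==> ln (R j) = real (2 * j) * (c + z j)" and z: "z \<longlonglongrightarrow> 0"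
  for c :: real and R z :: "nat => real"
 proof -
  have "\<forall>\<^sub>F j in sequentially. z j < - c / 2" using order_tendstoD(2)[OF z, of "- c / 2"] c by simp
  moreover have "\<forall>\<^sub>F j in sequentially. real j * c <= - ln 4" using c by real_asymp
  ultimately show ?thesis using eventually_gt_at_top[of 0]
  proof eventually_elim
   case (elim j)
   have "ln (R j) <= real (2 * j) * (c / 2)" unfolding ln[OF elim(3)] using elim by (intro mult_left_mono) auto
   also have "... <= ln (1 / 4)" using elim by (simp add: ln_div)
   finally show ?case using pos[OF elim(3)] by (subst (asm) ln_le_cancel_iff) auto
  qed
 qed
 have e1: "\<forall>\<^sub>F j in sequentially. R1 j <= 1 / 4"
 proof (rule small[OF c1 _ lnR1])
  show "0 < R1 j" if "0 < j" for j
   unfolding R1_def using level_pos[of "real (2 * (k * j))"] that k \<eta> mom0 by (auto intro!: divide_pos_pos mult_pos_pos)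
  have "(%j. kap + (real k - 1) * ell ((k - 1) * j) - real k * ell (k * j)) \<longlonglongrightarrow> kap + (real k - 1) * kap - real k * kap"
   using k by (intro tendsto_intros L) auto
  thus "(%j. kap + (real k - 1) * ell ((k - 1) * j) - real k * ell (k * j)) \<longlonglongrightarrow> 0"
   by (simp add: algebra_simps)
 qed
 have e2: "\<forall>\<^sub>F j in sequentially. R2 j <= 1 / 4"
 proof (rule small[OF c2 _ lnR2])
  show "0 < R2 j" if "0 < j" for j
   unfolding R2_def using level_pos[of "real (2 * (k * j))"] that k \<eta> mom0 by (auto intro!: divide_pos_pos mult_pos_pos)
  have "(%j. (real k + 1) * ell ((k + 1) * j) - real k * ell (k * j) - kap) \<longlonglongrightarrow> (real k + 1) * kap - real k * kap - kap"
   using k by (intro tendsto_intros L) auto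
  thus "(%j. (real k + 1) * ell ((k + 1) * j) - real k * ell (k * j) - kap) \<longlonglongrightarrow> 0"
   by (simp add: algebra_simps)
 qed
 have "\<forall>\<^sub>F j in sequentially. mom (k * j) / 2 <= ((1 + \<eta>) * level (real (2 * (k * j)))) ^ (2 * (k * j)) * tail ((1 - \<eta>) * level (real (2 * (k * j))))"
  using e1 e2 eventually_gt_at_top[of 0]
 proof eventually_elim
  case (elim j)
  have lp: "0 < level (real (2 * (k * j)))" using elim k by (intro level_pos) auto
  have "mom (k * j) <= ((1 + \<eta>) * level (real (2 * (k * j)))) ^ (2 * (k * j)) * tail ((1 - \<eta>) * level (real (2 * (k * j))))
   + ((1 - \<eta>) * level (real (2 * (k * j)))) ^ (2 * (k * j - (k - 1) * j)) * mom ((k - 1) * j)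
   + mom ((k + 1) * j) / ((1 + \<eta>) * level (real (2 * (k * j)))) ^ (2 * ((k + 1) * j - k * j))"
   using \<eta> lp by (intro mom_split) auto
  also have "((1 - \<eta>) * level (real (2 * (k * j)))) ^ (2 * (k * j - (k - 1) * j)) * mom ((k - 1) * j) = R1 j * mom (k * j)"
   using mom0[of "k * j"] by (simp add: R1_def)
  also have "mom ((k + 1) * j) / ((1 + \<eta>) * level (real (2 * (k * j)))) ^ (2 * ((k + 1) * j - k * j)) = R2 j * mom (k * j)"
   using mom0[of "k * j"] by (simp add: R2_def)
  finally show ?case
   using mult_right_mono[OF elim(1), of "mom (k * j)"] mult_right_mono[OF elim(2), of "mom (k * j)"] mom0[of "k * j"]
   by linarith
 qed
 thus thesis using k by (intro that[of k]) auto
qed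

lemma tail_lower:
 assumes \<eta>: "0 < \<eta>" "\<eta> < 1" and e: "0 < e"
 defines "b \<equiv> (1 - \<eta>) powr (1 / ga)"
 shows "\<forall>\<^sub>F u in at_top. 0 < tail (level u) & - (ga + ln (1 + \<eta>)) / b - e <= ln (tail (level u)) / u"
proof -
 have b: "0 < b" "b powr ga = 1 - \<eta>" using \<eta> ga0 by (auto simp: b_def powr_powr)
 obtain k where k: "0 < k" and ev: "\<forall>\<^sub>F j in sequentially. mom (k * j) / 2 <= ((1 + \<eta>) * level (real (2 * (k * j)))) ^ (2 * (k * j)) * tail ((1 - \<eta>) * level (real (2 * (k * j))))"
  using tail_lower_level[OF \<eta>] by blast
 \<comment> \<open>Rounding up makes b times the order 2 k J at least u. As b^ga = 1 - \<eta>, the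
   height \<open>level u\<close> then stays below 1 - \<eta> times the level of that order, where
   the tail is already bounded from below.\<close>
 define J where "J u = nat \<lceil>u / (2 * real k * b)\<rceil>" for u :: real
 have Jinf: "filterlim J sequentially at_top" unfolding filterlim_at_top
 proof
  fix Z
  show "\<forall>\<^sub>F u in at_top. Z <= J u" using eventually_ge_at_top[of "real Z * (2 * real k * b)"]
  proof eventually_elim
   case (elim u)
   hence "real Z <= u / (2 * real k * b)" using b k by (simp add: le_divide_eq)
   thus ?case unfolding J_def by linarith
  qed
 qed
 have Jlim: "((%u. real (2 * (k * J u)) / u) \<longlongrightarrow> 1 / b) at_top"
 proof (rule tendsto_sandwich)
  show "\<forall>\<^sub>F u in at_top. 1 / b <= real (2 * (k * J u)) / u" using eventually_gt_at_top[of 0]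
  proof eventually_elim
   case (elim u)
   have "u / (2 * real k * b) <= real (J u)" unfolding J_def by linarith
   thus ?case using elim b k by (simp add: field_simps)
  qed
  show "\<forall>\<^sub>F u in at_top. real (2 * (k * J u)) / u <= 1 / b + 2 * real k / u" using eventually_gt_at_top[of 0]
  proof eventually_elim
   case (elim u)
   have "0 <= u / (2 * real k * b)" using elim b by simp
   hence "real (J u) <= u / (2 * real k * b) + 1" unfolding J_def by linarith
   hence "real (J u) * (2 * real k / u) <= (u / (2 * real k * b) + 1) * (2 * real k / u)" using elim by (intro mult_right_mono) auto
   also have "... = 1 / b + 2 * real k / u" using elim b k by (simp add: field_simps)
   finally show ?case by (simp add: mult_ac)
  qed
  show "((%u. 1 / b + 2 * real k / u) \<longlongrightarrow> 1 / b) at_top" by real_asymp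
 qed simp
 have el: "((%u. ell (k * J u)) \<longlongrightarrow> kap) at_top"
  using k by (intro filterlim_compose[OF ell_lim] filterlim_compose[OF _ Jinf] filterlim_subseq) (auto simp: strict_mono_def)
 have "((%u. real (2 * (k * J u)) / u * (ell (k * J u) - kap - ga - ln (1 + \<eta>)) - ln 2 / u) \<longlongrightarrow> 1 / b * (kap - kap - ga - ln (1 + \<eta>)) - 0) at_top"
  by (intro tendsto_intros Jlim el) real_asymp
 hence "\<forall>\<^sub>F u in at_top. - (ga + ln (1 + \<eta>)) / b - e < real (2 * (k * J u)) / u * (ell (k * J u) - kap - ga - ln (1 + \<eta>)) - ln 2 / u"
  using e by (intro order_tendstoD(1)) (auto simp: field_simps)
 moreover have "\<forall>\<^sub>F u in at_top. mom (k * J u) / 2 <= ((1 + \<eta>) * level (real (2 * (k * J u)))) ^ (2 * (k * J u)) * tail ((1 - \<eta>) * level (real (2 * (k * J u))))"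
  by (rule eventually_compose_filterlim[OF ev Jinf])
 ultimately show ?thesis using eventually_gt_at_top[of 0]
 proof eventually_elim
  case (elim u)
  define j where "j = J u"
  have ju: "u / (2 * real k * b) <= real j" unfolding j_def J_def by linarith
  hence j0: "0 < j" using elim b k by (cases "j = 0") (auto simp: field_simps)
  let ?T = "level (real (2 * (k * j)))"
  have lp: "0 < ?T" using j0 k by (intro level_pos) auto
  have "level u <= (1 - \<eta>) * ?T"
  proof -
   have "u <= b * real (2 * (k * j))" using ju b k by (simp add: field_simps)
   hence "u powr ga <= (b * real (2 * (k * j))) powr ga" using elim ga0 by (intro powr_mono2) auto
   also have "... = (1 - \<eta>) * real (2 * (k * j)) powr ga" using b by (simp add: powr_mult)
   finally show ?thesis by (simp add: level_def mult_ac)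
  qed
  hence tl: "tail ((1 - \<eta>) * ?T) <= tail (level u)" by (rule tail_antimono)
  have A: "mom (k * j) / 2 <= ((1 + \<eta>) * ?T) ^ (2 * (k * j)) * tail (level u)"
   using elim(2)[folded j_def] by (rule order_trans) (intro mult_left_mono tl zero_le_power, use lp \<eta> in simp)
  have tp: "0 < tail (level u)"
  proof (rule ccontr)
   assume "~ 0 < tail (level u)"
   hence "tail (level u) = 0" by (simp add: tail_def not_less measure_le_0_iff)
   thus False using A mom0[of "k * j"] by simp
  qed
  have "ln (mom (k * j) / 2) <= ln (((1 + \<eta>) * ?T) ^ (2 * (k * j)) * tail (level u))"
   using A mom0[of "k * j"] lp \<eta> tp by (subst ln_le_cancel_iff) auto
  also have "... = real (2 * (k * j)) * (ln (1 + \<eta>) + ln ?T) + ln (tail (level u))"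
   using lp \<eta> tp by (simp add: ln_mult ln_realpow)
  finally have "ln (mom (k * j)) - ln 2 - real (2 * (k * j)) * (ln (1 + \<eta>) + ln ?T) <= ln (tail (level u))"
   using mom0[of "k * j"] by (simp add: ln_div)
  also have "ln (mom (k * j)) = real (2 * (k * j)) * (ell (k * j) + ga * ln (real (2 * (k * j))))"
   using j0 k by (intro ln_mom) auto
  also have "ln ?T = kap + ga + ga * ln (real (2 * (k * j)))" using j0 k by (intro ln_level) auto
  finally have "real (2 * (k * j)) * (ell (k * j) - kap - ga - ln (1 + \<eta>)) - ln 2 <= ln (tail (level u))"
   by (simp add: algebra_simps)
  hence "(real (2 * (k * j)) * (ell (k * j) - kap - ga - ln (1 + \<eta>)) - ln 2) / u <= ln (tail (level u)) / u"
   using elim by (intro divide_right_mono) auto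
  thus ?case using tp elim(1) unfolding j_def by (simp add: diff_divide_distrib)
 qed
qed

lemma tail_upper:
 assumes e: "0 < e"
 shows "\<forall>\<^sub>F u in at_top. 0 < tail (level u) --> ln (tail (level u)) / u <= - ga + e"
proof -
 \<comment> \<open>Chebyshev at \<open>level u\<close> is best with a moment of order u; the largest
   even order up to u differs from it by a bounded amount, invisible in the limit.\<close>
 define J where "J u = nat \<lfloor>u / 2\<rfloor>" for u :: real
 have Jinf: "filterlim J sequentially at_top" unfolding J_def
  by (intro filterlim_compose[OF filterlim_nat_sequentially] filterlim_compose[OF filterlim_floor_sequentially]) real_asymp
 have Jlim: "((%u. real (2 * J u) / u) \<longlongrightarrow> 1) at_top"
 proof (rule tendsto_sandwich)
  show "\<forall>\<^sub>F u in at_top. 1 - 2 / u <= real (2 * J u) / u" using eventually_gt_at_top[of 0]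
  proof eventually_elim
   case (elim u)
   have "u / 2 - 1 <= real (J u)" unfolding J_def by linarith
   hence "(u - 2) / u <= real (2 * J u) / u" using elim by (intro divide_right_mono) auto
   thus ?case using elim by (simp add: diff_divide_distrib)
  qed
  show "\<forall>\<^sub>F u in at_top. real (2 * J u) / u <= 1" using eventually_gt_at_top[of 0]
  proof eventually_elim
   case (elim u)
   have "real (J u) <= u / 2" using elim unfolding J_def by linarith
   thus ?case using elim by (simp add: field_simps)
  qed
  show "((%u. 1 - 2 / u) \<longlongrightarrow> (1::real)) at_top" by real_asymp
 qed simp
 have "((%u. real (2 * J u) / u * (ell (J u) - kap - ga)) \<longlongrightarrow> 1 * (kap - kap - ga)) at_top"
  by (intro tendsto_intros Jlim filterlim_compose[OF ell_lim Jinf])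
 hence "\<forall>\<^sub>F u in at_top. real (2 * J u) / u * (ell (J u) - kap - ga) < - ga + e"
  using e by (intro order_tendstoD(2)) auto
 thus ?thesis using eventually_gt_at_top[of 2]
 proof eventually_elim
  case (elim u)
  define j where "j = J u"
  have j: "0 < j" "real (2 * j) <= u" using elim unfolding j_def J_def by linarith+
  show ?case
  proof
   assume tp: "0 < tail (level u)"
   have lp: "0 < level u" using elim by (intro level_pos) auto
   have "ln (tail (level u) * level u ^ (2 * j)) <= ln (mom j)"
   using tail_le[OF lp, of j] tp lp mom0[of j] by (subst ln_le_cancel_iff) auto
   hence "ln (tail (level u)) <= ln (mom j) - real (2 * j) * ln (level u)" using tp lp by (simp add: ln_mult ln_realpow)
   also have "... = real (2 * j) * (ell j - kap - ga + ga * (ln (real (2 * j)) - ln u))"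
   using j elim by (simp add: ln_mom ln_level algebra_simps)
   also have "... <= real (2 * j) * (ell j - kap - ga)"
   proof (rule mult_left_mono)
   have "ln (real (2 * j)) <= ln u" using j by (subst ln_le_cancel_iff) auto
   thus "ell j - kap - ga + ga * (ln (real (2 * j)) - ln u) <= ell j - kap - ga" using ga0 by (simp add: mult_le_0_iff)
   qed simp
   finally have "ln (tail (level u)) / u <= real (2 * j) * (ell j - kap - ga) / u" using elim by (intro divide_right_mono) auto
   thus "ln (tail (level u)) / u <= - ga + e" using elim(1) by (simp add: j_def)
  qed
 qed
qed

lemma tail_level_limit: "((%u. ln (tail (level u)) / u) \<longlongrightarrow> - ga) at_top"
proof (rule order_tendstoI)
 fix a assume a: "a < - ga"
 have "((%\<eta>. - (ga + ln (1 + \<eta>)) / ((1 - \<eta>) powr (1 / ga))) \<longlongrightarrow> - ga) (at_right 0)"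
  by (rule tendsto_eq_intros refl | simp)+
 hence "\<forall>\<^sub>F \<eta> in at_right 0. (a - ga) / 2 < - (ga + ln (1 + \<eta>)) / ((1 - \<eta>) powr (1 / ga))"
  using a by (intro order_tendstoD(1)) auto
 moreover have "\<forall>\<^sub>F \<eta> in at_right (0::real). 0 < \<eta> & \<eta> < 1"
  by (rule eventually_conj[OF eventually_at_right_less]) (auto simp: eventually_at_right[of 0 1] intro: exI[of _ 1])
 ultimately have "\<exists>\<eta>. (a - ga) / 2 < - (ga + ln (1 + \<eta>)) / ((1 - \<eta>) powr (1 / ga)) & 0 < \<eta> & \<eta> < 1"
  by (intro eventually_happens'[OF _ eventually_conj]) auto
 then obtain \<eta> where \<eta>: "(a - ga) / 2 < - (ga + ln (1 + \<eta>)) / ((1 - \<eta>) powr (1 / ga))" "0 < \<eta>" "\<eta> < 1" by blast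
 show "\<forall>\<^sub>F u in at_top. a < ln (tail (level u)) / u" using tail_lower[OF \<eta>(2,3), of "(- a - ga) / 2"] a
  by (auto elim!: eventually_mono) (use \<eta>(1) in \<open>simp add: field_simps\<close>)
next
 fix a assume a: "- ga < a"
 have "\<forall>\<^sub>F u in at_top. 0 < tail (level u)" using tail_lower[of "1/2" 1] by (auto elim!: eventually_mono)
 moreover have "\<forall>\<^sub>F u in at_top. 0 < tail (level u) --> ln (tail (level u)) / u <= - ga + (a + ga) / 2"
  using a by (intro tail_upper) simp
 ultimately show "\<forall>\<^sub>F u in at_top. ln (tail (level u)) / u < a"
 proof eventually_elim
  case (elim u)
  moreover have "- ga + (a + ga) / 2 < a" using a by (simp add: field_simps)
  ultimately show ?case by linarith
 qed
qed

theorem tail_limit: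
 "((%t. t powr (- 1 / ga) * ln (measure M {om \<in> space M. Y om >= t})) \<longlongrightarrow> - ga * exp (- (kap + ga) / ga)) at_top"
proof -
 \<comment> \<open>The inverse of \<open>level\<close>, obtained by solving exp (kap + ga) u^ga = t
   for u.\<close>
 define U where "U t = (t * exp (- (kap + ga))) powr (1 / ga)" for t :: real
 have "filterlim U at_top at_top" unfolding U_def using ga0 by real_asymp
 hence "((%t. ln (tail (level (U t))) / U t) \<longlongrightarrow> - ga) at_top"
  by (rule filterlim_compose[OF tail_level_limit])
 hence "((%t. ln (tail (level (U t))) / U t * exp (- (kap + ga) / ga)) \<longlongrightarrow> - ga * exp (- (kap + ga) / ga)) at_top"
  by (intro tendsto_intros)
 moreover have "\<forall>\<^sub>F t in at_top. ln (tail (level (U t))) / U t * exp (- (kap + ga) / ga) = t powr (- 1 / ga) * ln (tail t)"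
  using eventually_gt_at_top[of 0]
 proof eventually_elim
  case (elim t)
  have "level (U t) = t * (exp (kap + ga) * exp (- (kap + ga)))" using elim ga0 by (simp add: level_def U_def powr_powr)
  hence "level (U t) = t" by (simp only: exp_minus_inverse mult_1_right)
  moreover have "exp (- (kap + ga) / ga) / U t = t powr (- 1 / ga)"
  proof -
   have "U t = t powr (1 / ga) * exp (- (kap + ga) / ga)" using elim by (simp add: U_def powr_mult exp_powr_real)
   thus ?thesis using elim by (simp add: powr_minus_divide)
  qed
  ultimately show ?case by (metis mult.commute times_divide_eq_left)
 qed
 ultimately show ?thesis unfolding tail_def by (rule Lim_transform_eventually)
qed

end

section \<open>Characters, lattices and the discretised variational problem\<close>

text \<open>A character of the group (Z / N)^d with index \<open>a\<close>. Averages over all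
  \<open>a\<close> single out w = 0 among vectors whose coordinates are below N in modulus.\<close>

definition unit_phase :: "nat => ('d::finite => nat) => int^'d => complex" where
 "unit_phase N a w = cis (\<Sum>i\<in>UNIV. 2 * pi * real (a i) * real_of_int (w $ i) / real N)"

lemma unit_phase_add: "unit_phase N a (w + w') = unit_phase N a w * unit_phase N a w'"
 by (simp add: unit_phase_def cis_mult sum.distrib[symmetric] distrib_left add_divide_distrib)

lemma unit_phase_minus: "unit_phase N a (- w) = cnj (unit_phase N a w)" by (simp add: unit_phase_def cis_cnj sum_negf)

lemma norm_unit_phase[simp]: "norm (unit_phase N a w) = 1" by (simp add: unit_phase_def)

lemma sum_unit_phase_0: "(\<Sum>a\<in>PiE (UNIV :: 'd::finite set) (%_. {..<N}). unit_phase N a 0) = of_nat N ^ CARD('d)"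
 by (simp add: unit_phase_def card_PiE)

lemma sum_cis_roots_0:
 fixes w :: int
 assumes w: "w ~= 0" "\<bar>w\<bar> < int N"
 shows "(\<Sum>k<N. cis (2 * pi * real k * real_of_int w / real N)) = 0"
proof -
 define x where "x = cis (2 * pi * real_of_int w / real N)"
 have N: "0 < N" using w by linarith
 have "(\<Sum>k<N. cis (2 * pi * real k * real_of_int w / real N)) = (\<Sum>k<N. x ^ k)"
  unfolding x_def by (intro sum.cong refl) (simp add: Complex.DeMoivre mult_ac)
 moreover have "x ^ N = 1"
 proof -
  have "x ^ N = cis (2 * pi * real_of_int w)" using N unfolding x_def by (simp add: Complex.DeMoivre)
  thus ?thesis by (simp add: cis_multiple_2pi)
 qed
 moreover have "x ~= 1"
 proof
  assume "x = 1"
  hence "cos (2 * pi * real_of_int w / real N) = 1" unfolding x_def by (metis cis.sel(1) one_complex.sel(1))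
  then obtain k :: int where "2 * pi * real_of_int w / real N = real_of_int k * 2 * pi" using cos_one_2pi_int by auto
  hence "real_of_int w = real_of_int k * real N" using N by (simp add: field_simps)
  hence "w = k * int N" by (metis of_int_eq_iff of_int_mult of_int_of_nat_eq)
  thus False using w by (cases "k = 0") (auto simp: abs_mult)
 qed
 ultimately show ?thesis by (simp add: geometric_sum)
qed

lemma sum_unit_phase_neq_0:
 fixes w :: "int^'d::finite"
 assumes w: "w ~= 0" "!!i. \<bar>w $ i\<bar> < int N"
 shows "(\<Sum>a\<in>PiE (UNIV :: 'd set) (%_. {..<N}). unit_phase N a w) = 0"
proof -
 obtain i where i: "w $ i ~= 0" using w(1) by (auto simp: vec_eq_iff)
 have cis_sum: "cis (sum f A) = (\<Prod>i\<in>A. cis (f i))" if "finite A" for f :: "'d => real" and A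
  using that by (induction A) (auto simp: cis_mult[symmetric])
 have "(\<Sum>a\<in>PiE (UNIV :: 'd set) (%_. {..<N}). unit_phase N a w)
  = (\<Sum>a\<in>PiE (UNIV :: 'd set) (%_. {..<N}). \<Prod>i\<in>UNIV. cis (2 * pi * real (a i) * real_of_int (w $ i) / real N))"
  by (simp add: unit_phase_def cis_sum)
 also have "... = (\<Prod>i\<in>UNIV. \<Sum>k<N. cis (2 * pi * real k * real_of_int (w $ i) / real N))"
  by (rule prod_sum_PiE[symmetric]) auto
 also have "... = 0" using sum_cis_roots_0[OF i w(2)] by (intro prod_zero) auto
 finally show ?thesis .
qed

definition lat :: "real => int^'d => real^'d" where "lat dl z = (\<chi> i. dl * real_of_int (z $ i))"

lemma lat_nth[simp]: "lat dl z $ i = dl * real_of_int (z $ i)" by (simp add: lat_def)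
lemma lat_add: "lat dl (z + w) = lat dl z + lat dl w" by (simp add: vec_eq_iff distrib_left)
lemma lat_diff: "lat dl (z - w) = lat dl z - lat dl w" by (simp add: vec_eq_iff right_diff_distrib)
lemma lat_minus: "lat dl (- z) = - lat dl z" by (simp add: vec_eq_iff)
lemma lat_0[simp]: "lat dl 0 = 0" by (simp add: vec_eq_iff)

lemma integral_lborel_shift:
 fixes f :: "'v::euclidean_space => 'b::{banach, second_countable_topology}"
 assumes [measurable]: "f \<in> bm borel"
 shows "(\<integral>x. f (c + x) \<partial>lborel) = (\<integral>x. f x \<partial>lborel)"
 by (subst (2) lborel_distr_plus[of c, symmetric]) (simp add: integral_distr)

abbreviation cube_vec :: "real => real^'d::finite" where "cube_vec s \<equiv> (\<chi> i. s)"

lemma emeasure_box_cube: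
 assumes "0 <= s"
 shows "emeasure lborel (box c (c + cube_vec s :: real^'d::finite)) = ennreal (s ^ CARD('d))"
  "emeasure lborel (cbox c (c + cube_vec s :: real^'d::finite)) = ennreal (s ^ CARD('d))"
proof -
 have b: "(c + cube_vec s - c) \<bullet> b = s" if "b \<in> Basis" for b :: "real^'d"
  using that by (auto simp: Basis_vec_def inner_axis)
 have le: "c \<bullet> b <= (c + cube_vec s) \<bullet> b" if "b \<in> Basis" for b :: "real^'d"
  using that assms by (auto simp: Basis_vec_def inner_axis)
 have "(\<Prod>b\<in>Basis. (c + cube_vec s - c) \<bullet> b) = s ^ CARD('d)" using b by (simp add: prod_constant)
 thus "emeasure lborel (box c (c + cube_vec s :: real^'d::finite)) = ennreal (s ^ CARD('d))"
  "emeasure lborel (cbox c (c + cube_vec s :: real^'d::finite)) = ennreal (s ^ CARD('d))"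
  using le by (simp_all add: emeasure_lborel_box_eq emeasure_lborel_cbox_eq)
qed

lemma norm_le_cube:
 fixes x :: "real^'d::finite"
 assumes "!!i. \<bar>x $ i\<bar> <= s"
 shows "norm x <= real CARD('d) * s"
proof -
 have "norm x <= (\<Sum>i\<in>UNIV. \<bar>x $ i\<bar>)" by (rule norm_le_l1_cart)
 also have "... <= (\<Sum>i\<in>(UNIV :: 'd set). s)" by (intro sum_mono assms)
 finally show ?thesis by simp
qed

text \<open>A lower Riemann sum. Open cells are disjoint, and the points they leave uncovered only
  help the inequality because \<open>G\<close> is nonnegative.\<close>

lemma sum_cells_le_nn_integral:
 fixes C :: "int^'d::finite => real" and G :: "real^'d => ennreal"
 assumes dl: "0 < dl" and A: "finite A" and C0: "!!l. l \<in> A ==> 0 <= C l"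
  and le: "!!l x. l \<in> A ==> x \<in> box (lat dl l) (lat dl l + cube_vec dl) ==> ennreal (C l) <= G x"
 shows "ennreal (\<Sum>l\<in>A. C l * dl ^ CARD('d)) <= (NN x. G x)"
proof -
 let ?B = "%l. box (lat dl l) (lat dl l + cube_vec dl) :: (real^'d) set"
 have disj: "disjoint_family_on ?B A"
 proof (unfold disjoint_family_on_def, intro ballI impI)
  fix l l' :: "int^'d" assume "l ~= l'"
  then obtain i where i: "l $ i ~= l' $ i" by (auto simp: vec_eq_iff)
  show "?B l \<inter> ?B l' = {}"
  proof (rule ccontr)
   assume "?B l \<inter> ?B l' ~= {}"
   then obtain x where "x \<in> ?B l" "x \<in> ?B l'" by blast
   hence "dl * l $ i < x $ i" "x $ i < dl * l $ i + dl" "dl * l' $ i < x $ i" "x $ i < dl * l' $ i + dl"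
   by (auto simp: mem_box_cart)
   hence "dl * l $ i < dl * (l' $ i + 1)" "dl * l' $ i < dl * (l $ i + 1)" by (auto simp: distrib_left)
   hence "real_of_int (l $ i) < l' $ i + 1" "real_of_int (l' $ i) < l $ i + 1" using dl by auto
   thus False using i by linarith
  qed
 qed
 have "ennreal (\<Sum>l\<in>A. C l * dl ^ CARD('d)) = (\<Sum>l\<in>A. \<integral>\<^sup>+x. ennreal (C l) * ind (?B l) x \<partial>lborel)"
  using dl C0 by (subst sum_ennreal[symmetric])
   (auto simp: nn_integral_cmult_indicator emeasure_box_cube ennreal_mult'' intro!: sum.cong)
 also have "... = (NN x. (\<Sum>l\<in>A. ennreal (C l) * ind (?B l) x))" by (rule nn_integral_sum[symmetric]) measurable
 also have "... <= (NN x. G x)"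
 proof (rule nn_integral_mono)
  fix x
  show "(\<Sum>l\<in>A. ennreal (C l) * ind (?B l) x) <= G x"
  proof (cases "\<exists>l\<in>A. x \<in> ?B l")
   case True
   then obtain l where l: "l \<in> A" "x \<in> ?B l" by blast
   have "(\<Sum>l'\<in>A. ennreal (C l') * ind (?B l') x) = (\<Sum>l'\<in>A. if l' = l then ennreal (C l') else 0)"
   using disj l by (intro sum.cong refl) (auto simp: disjoint_family_on_def split: split_indicator)
   also have "... = ennreal (C l)" using A l by (simp add: sum.delta)
   finally show ?thesis using le[OF l] by simp
  next
   case False
   hence "(\<Sum>l\<in>A. ennreal (C l) * ind (?B l) x) = 0" by (intro sum.neutral) (auto split: split_indicator)
   thus ?thesis by simp
  qed
 qed
 finally show ?thesis .
qed

text \<open>The lattice autocorrelation is recovered from autocorrelations of modulated bumps by averaging over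
 characters; the bumps have size \<open>s\<close> with \<open>dl \<ll> s \<ll> 1\<close>.\<close>

lemma (in stable_setup) lattice_corr_bump:
 fixes h :: "int^'d => real"
 assumes e: "0 <= e" and s: "0 < s" and dl: "0 < dl" "dl < s"
  and loc: "!!x u. norm u <= real CARD('d) * s ==> 1 + \<psi> (x + u) <= (1 + e) * (1 + \<psi> x)"
  and Z: "finite Z" and h0: "!!z. 0 <= h z" and hZ: "!!z. z \<notin> Z ==> h z = 0" and A: "finite A"
 shows "dl ^ CARD('d) * ((s - dl) ^ CARD('d)) ^ Suc n * (\<Sum>l\<in>A. (\<Sum>z\<in>Z. h z * h (z + l)) ^ Suc n)
  <= \<rho> * ((1 + e) * s ^ CARD('d) * (\<Sum>z\<in>Z. (h z)\<^sup>2 * (1 + \<psi> (lat dl z)))) ^ Suc n"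
proof -
 let ?d = "CARD('d)"
 define bp :: "real^'d => real" where "bp = ind (cbox 0 (cube_vec s))"
 have bp_m[measurable]: "bp \<in> bm borel" unfolding bp_def by measurable
 have bp_b: "0 <= bp x" "bp x <= 1" "(bp x)\<^sup>2 = bp x" for x by (auto simp: bp_def split: split_indicator)
 have bp_int: "integrable lborel bp" unfolding bp_def by (intro integrable_real_indicator emeasure_lborel_cbox_finite) simp
 have int2: "integrable lborel (%y. bp (v + y) * bp (w + y))" for v w
 proof (rule Bochner_Integration.integrable_bound)
  show "integrable lborel (%y. bp (w + y))"
   using bp_int by (subst (asm) lborel_distr_plus[of w, symmetric]) (simp add: integrable_distr_eq)
 qed (use bp_b in \<open>auto intro!: mult_left_le_one_le\<close>)
 define c where "c v = (\<integral>y. bp (v + y) * bp y \<partial>lborel)" for v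
 have c_shift: "(\<integral>y. bp (v + y) * bp (w + y) \<partial>lborel) = c (v - w)" for v w
  using integral_lborel_shift[of "%y. bp (v - w + y) * bp y" w] by (simp add: c_def add_ac)
 \<comment> \<open>Two cubes of side s displaced by less than dl in every coordinate share a cube of
   side s - dl.\<close>
 have c_ge: "(s - dl) ^ ?d <= c v" if v: "v \<in> box 0 (cube_vec dl)" for v
 proof -
  have "measure lborel (cbox 0 (cube_vec (s - dl)) :: (real^'d) set) = (s - dl) ^ ?d"
   using emeasure_box_cube(2)[of "s - dl" "0::real^'d"] dl by (simp add: measure_def)
  hence "(s - dl) ^ ?d = (\<integral>y. ind (cbox 0 (cube_vec (s - dl)) :: (real^'d) set) y \<partial>lborel)" by simp
  also have "... <= c v" unfolding c_def
  proof (rule integral_mono)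
   show "integrable lborel (ind (cbox 0 (cube_vec (s - dl)) :: (real^'d) set) :: _ => real)"
   by (intro integrable_real_indicator emeasure_lborel_cbox_finite) simp
   show "integrable lborel (%y. bp (v + y) * bp y)" using int2[of v 0] by simp
   fix y :: "real^'d"
   show "ind (cbox 0 (cube_vec (s - dl))) y <= bp (v + y) * bp y"
   proof (cases "y \<in> cbox 0 (cube_vec (s - dl))")
   case True
   have y: "0 <= y $ i" "y $ i <= s - dl" "0 < v $ i" "v $ i < dl" for i using True v by (auto simp: mem_box_cart)
   have "v + y \<in> cbox 0 (cube_vec s)" "y \<in> cbox 0 (cube_vec s)"
   unfolding mem_box_cart using dl y by (auto intro: add_nonneg_nonneg less_imp_le) (smt (verit) y)+
   thus ?thesis by (simp add: bp_def)
   qed (use bp_b in auto)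
  qed
  finally show ?thesis .
 qed
 \<comment> \<open>N exceeds all coordinates of the differences that occur, so there is no
   wraparound and averaging over the characters detects exact equality.\<close>
 obtain N :: nat where N: "0 < N" "!!z z' l i. z \<in> Z ==> z' \<in> Z ==> l \<in> insert 0 A ==> \<bar>(z - z' - l) $ i\<bar> < int N"
 proof -
  define W where "W = (%(z, z', l, i). \<bar>(z - z' - l) $ i\<bar>) ` (Z \<times> Z \<times> insert 0 A \<times> (UNIV :: 'd set))"
  have "finite W" unfolding W_def using Z A by simp
  have le: "\<bar>(z - z' - l) $ i\<bar> <= Max (insert 0 W)" if "z \<in> Z" "z' \<in> Z" "l \<in> insert 0 A" for z z' l i
  proof (rule Max_ge)
   have "\<bar>(z - z' - l) $ i\<bar> \<in> W" unfolding W_def by (rule image_eqI[where x = "(z, z', l, i)"]) (use that in auto)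
   thus "\<bar>(z - z' - l) $ i\<bar> \<in> insert 0 W" by simp
  qed (use \<open>finite W\<close> in simp)
  have M0: "0 <= Max (insert 0 W)" using \<open>finite W\<close> by simp
  show thesis
  proof (rule that[of "nat (Max (insert 0 W)) + 1"])
   fix z z' l i assume "z \<in> Z" "z' \<in> Z" "l \<in> insert 0 A"
   from le[OF this, of i] show "\<bar>(z - z' - l) $ i\<bar> < int (nat (Max (insert 0 W)) + 1)" using M0 by linarith
  qed simp
 qed
 define \<A> where "\<A> = PiE (UNIV :: 'd set) (%_. {..<N})"
 have fA: "finite \<A>" unfolding \<A>_def by (intro finite_PiE) auto
 have neA: "\<A> ~= {}" using N(1) unfolding \<A>_def by (auto simp: PiE_eq_empty_iff)
 have cardA: "real (card \<A>) = real N ^ ?d" unfolding \<A>_def by (simp add: card_PiE)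
 let ?e = "unit_phase N"
 have orth: "(\<Sum>a\<in>\<A>. ?e a (z - z' - l)) = (if z = z' + l then of_nat N ^ ?d else 0)"
  if "z \<in> Z" "z' \<in> Z" "l \<in> insert 0 A" for z z' l
 proof (cases "z = z' + l")
  case True
  thus ?thesis using sum_unit_phase_0[where 'd = 'd] by (simp add: \<A>_def)
 next
  case False
  hence "z - z' - l ~= 0" by (auto simp: algebra_simps)
  thus ?thesis using False sum_unit_phase_neq_0[of "z - z' - l" N] N(2)[OF that] by (simp add: \<A>_def)
 qed
 \<comment> \<open>Since s > dl, neighbouring bumps overlap; the phases are there to cancel the
   cross terms after averaging over \<open>a\<close>. \<open>F a\<close> is the complex
   autocorrelation of \<open>H a\<close>.\<close>
 define H where "H a x = (\<Sum>z\<in>Z. of_real (h z) * ?e a z * of_real (bp (x - lat dl z)))" for a x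
 define F where "F a x = (\<Sum>z\<in>Z. \<Sum>z'\<in>Z. of_real (h z * h z') * (?e a z * cnj (?e a z')) * of_real (c (x - lat dl z + lat dl z')))" for a x
 have Hm[measurable]: "H a \<in> bm borel" for a unfolding H_def by measurable
 have cm[measurable]: "c \<in> bm borel" unfolding c_def by measurable
 have Fm[measurable]: "F a \<in> bm borel" for a unfolding F_def by measurable
 have F_le: "ennreal (norm (F a x)) <= corr (%y. norm (H a y)) x" for a x
 proof -
  let ?t = "%z z' y. of_real (h z * h z') * (?e a z * cnj (?e a z')) * of_real (bp (x + y - lat dl z) * bp (y - lat dl z')) :: complex"
  have e1: "x - lat dl z + y = x + y - lat dl z" and e2: "- lat dl z + y = y - lat dl z" for y :: "real^'d" and z
   by (simp_all add: algebra_simps)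
  have eq: "H a (x + y) * cnj (H a y) = (\<Sum>z\<in>Z. \<Sum>z'\<in>Z. ?t z z' y)" for y
   unfolding H_def cnj_sum sum_product by (intro sum.cong refl) (simp add: mult_ac)
  have it: "integrable lborel (?t z z')" for z z'
   using int2[of "x - lat dl z" "- lat dl z'"] unfolding e1 e2 by (intro integrable_mult_right integrable_of_real)
  have "(\<integral>y. H a (x + y) * cnj (H a y) \<partial>lborel) = (\<Sum>z\<in>Z. \<Sum>z'\<in>Z. (\<integral>y. ?t z z' y \<partial>lborel))"
   unfolding eq using it by (simp add: Bochner_Integration.integral_sum Bochner_Integration.integrable_sum)
  also have "... = F a x" unfolding F_def
  proof (intro sum.cong refl)
   fix z z'
   have "(\<integral>y. bp (x + y - lat dl z) * bp (y - lat dl z') \<partial>lborel) = (\<integral>y. bp (x - lat dl z + y) * bp (- lat dl z' + y) \<partial>lborel)"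
   by (simp only: e1 e2)
   also have "... = c (x - lat dl z + lat dl z')" by (simp only: c_shift diff_minus_eq_add)
   finally have cs: "(\<integral>y. bp (x + y - lat dl z) * bp (y - lat dl z') \<partial>lborel) = c (x - lat dl z + lat dl z')" .
   have "(\<integral>y. ?t z z' y \<partial>lborel) = of_real (h z * h z') * (?e a z * cnj (?e a z')) * of_real (\<integral>y. bp (x + y - lat dl z) * bp (y - lat dl z') \<partial>lborel)"
   by (subst integral_mult_right_zero) (simp only: integral_complex_of_real)
   thus "(\<integral>y. ?t z z' y \<partial>lborel) = of_real (h z * h z') * (?e a z * cnj (?e a z')) * of_real (c (x - lat dl z + lat dl z'))"
   by (simp only: cs)
  qed
  finally have Feq: "F a x = (\<integral>y. H a (x + y) * cnj (H a y) \<partial>lborel)" ..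
  have "integrable lborel (%y. H a (x + y) * cnj (H a y))" unfolding eq by (intro Bochner_Integration.integrable_sum it)
  hence "ennreal (norm (F a x)) <= (NN y. ennreal (norm (H a (x + y) * cnj (H a y))))"
   unfolding Feq by (rule integral_norm_bound_ennreal)
  also have "... = corr (%y. norm (H a y)) x"
   unfolding corr_def by (intro nn_integral_cong) (simp only: norm_mult complex_mod_cnj ennreal_mult norm_ge_zero)
  finally show ?thesis .
 qed
 \<comment> \<open>The conjugate phase at l selects the pairs z = z' + l. For these the lattice
   shifts cancel inside \<open>c\<close>, and only the offset v within the cell is left.\<close>
 have avg: "real N ^ ?d * ((\<Sum>z\<in>Z. h z * h (z + l)) * c v) <= (\<Sum>a\<in>\<A>. norm (F a (lat dl l + v)))" if l: "l \<in> A" for l v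
 proof -
  have "(\<Sum>a\<in>\<A>. cnj (?e a l) * F a (lat dl l + v))
   = (\<Sum>z\<in>Z. \<Sum>z'\<in>Z. of_real (h z * h z' * c (lat dl l + v - lat dl z + lat dl z')) * (\<Sum>a\<in>\<A>. ?e a (z - z' - l)))"
  proof -
   have ph: "cnj (?e a l) * (?e a z * cnj (?e a z')) = ?e a (z - z' - l)" for a z z'
   by (simp only: unit_phase_minus[symmetric] unit_phase_add[symmetric]) (simp add: algebra_simps)
   have "(\<Sum>a\<in>\<A>. cnj (?e a l) * F a (lat dl l + v)) = (\<Sum>a\<in>\<A>. \<Sum>z\<in>Z. \<Sum>z'\<in>Z. of_real (h z * h z' * c (lat dl l + v - lat dl z + lat dl z')) * ?e a (z - z' - l))"
   unfolding F_def sum_distrib_left ph[symmetric] by (intro sum.cong refl) (simp add: mult_ac)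
   also have "... = (\<Sum>z\<in>Z. \<Sum>z'\<in>Z. \<Sum>a\<in>\<A>. of_real (h z * h z' * c (lat dl l + v - lat dl z + lat dl z')) * ?e a (z - z' - l))"
   by (subst sum.swap) (intro sum.cong refl sum.swap)
   finally show ?thesis by (simp add: sum_distrib_left)
  qed
  also have "... = (\<Sum>z\<in>Z. \<Sum>z'\<in>Z. if z = z' + l then of_real (h (z' + l) * h z' * c v) * of_nat N ^ ?d else 0)"
   using l by (intro sum.cong refl) (auto simp: orth lat_add)
  also have "... = (\<Sum>z'\<in>Z. \<Sum>z\<in>Z. if z = z' + l then of_real (h (z' + l) * h z' * c v) * of_nat N ^ ?d else 0)"
   by (rule sum.swap)
  also have "... = (\<Sum>z'\<in>Z. of_real (h (z' + l) * h z' * c v) * of_nat N ^ ?d)"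
   using Z hZ by (intro sum.cong refl) (auto simp: sum.delta)
  also have "... = of_real (real N ^ ?d * ((\<Sum>z\<in>Z. h z * h (z + l)) * c v))"
   by (simp add: sum_distrib_left sum_distrib_right mult_ac)
  finally have eqn: "(\<Sum>a\<in>\<A>. cnj (?e a l) * F a (lat dl l + v)) = of_real (real N ^ ?d * ((\<Sum>z\<in>Z. h z * h (z + l)) * c v))" .
  have "real N ^ ?d * ((\<Sum>z\<in>Z. h z * h (z + l)) * c v) <= norm (\<Sum>a\<in>\<A>. cnj (?e a l) * F a (lat dl l + v))"
   unfolding eqn norm_of_real by (rule abs_ge_self)
  also have "... <= (\<Sum>a\<in>\<A>. norm (cnj (?e a l) * F a (lat dl l + v)))" by (rule norm_sum)
  finally show ?thesis by (simp add: norm_mult)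
 qed
 define S where "S = (\<Sum>z\<in>Z. (h z)\<^sup>2 * (1 + \<psi> (lat dl z)))"
 have S0: "0 <= S" unfolding S_def by (intro sum_nonneg mult_nonneg_nonneg) (auto simp: less_imp_le)
 define E where "E a = (NN x. ennreal ((norm (H a x))\<^sup>2 * (1 + \<psi> x)))" for a
 have Esum: "(\<Sum>a\<in>\<A>. E a) <= ennreal (real N ^ ?d * ((1 + e) * s ^ ?d * S))"
 proof -
  \<comment> \<open>On the average over the characters the squared modulus behaves as if the bumps
    were disjoint.\<close>
  have sq: "(\<Sum>a\<in>\<A>. (norm (H a x))\<^sup>2) = real N ^ ?d * (\<Sum>z\<in>Z. (h z)\<^sup>2 * bp (x - lat dl z))" for x
  proof -
   have ph: "?e a z * cnj (?e a z') = ?e a (z - z' - 0)" for a z z'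
   by (simp only: unit_phase_minus[symmetric] unit_phase_add[symmetric]) simp
   have "of_real (\<Sum>a\<in>\<A>. (norm (H a x))\<^sup>2) = (\<Sum>a\<in>\<A>. H a x * cnj (H a x))"
   by (simp only: of_real_sum complex_norm_square)
   also have "... = (\<Sum>a\<in>\<A>. \<Sum>z\<in>Z. \<Sum>z'\<in>Z. of_real (h z * h z' * bp (x - lat dl z) * bp (x - lat dl z')) * ?e a (z - z' - 0))"
   unfolding H_def ph[symmetric] cnj_sum sum_product by (intro sum.cong refl) (simp add: mult_ac)
   also have "... = (\<Sum>z\<in>Z. \<Sum>z'\<in>Z. \<Sum>a\<in>\<A>. of_real (h z * h z' * bp (x - lat dl z) * bp (x - lat dl z')) * ?e a (z - z' - 0))"
   by (subst sum.swap) (intro sum.cong refl sum.swap)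
   also have "... = (\<Sum>z\<in>Z. \<Sum>z'\<in>Z. if z = z' then of_real ((h z)\<^sup>2 * (bp (x - lat dl z))\<^sup>2) * of_nat N ^ ?d else 0)"
   proof (intro sum.cong refl)
   fix z z' assume "z \<in> Z" "z' \<in> Z"
   thus "(\<Sum>a\<in>\<A>. of_real (h z * h z' * bp (x - lat dl z) * bp (x - lat dl z')) * ?e a (z - z' - 0))
   = (if z = z' then of_real ((h z)\<^sup>2 * (bp (x - lat dl z))\<^sup>2) * of_nat N ^ ?d else 0)"
   unfolding sum_distrib_left[symmetric] using orth[of z z' 0] by (simp add: power2_eq_square)
   qed
   also have "... = of_real (real N ^ ?d * (\<Sum>z\<in>Z. (h z)\<^sup>2 * bp (x - lat dl z)))"
   using Z by (simp add: bp_b sum_distrib_left mult_ac)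
   finally show ?thesis by (simp only: of_real_eq_iff)
  qed
  have "(\<Sum>a\<in>\<A>. E a) = (NN x. (\<Sum>a\<in>\<A>. ennreal ((norm (H a x))\<^sup>2 * (1 + \<psi> x))))"
   unfolding E_def by (rule nn_integral_sum[symmetric]) measurable
  also have "... = (NN x. (\<Sum>z\<in>Z. ennreal (real N ^ ?d * (h z)\<^sup>2 * (bp (x - lat dl z) * (1 + \<psi> x)))))"
  proof (intro nn_integral_cong)
   fix x
   have "(\<Sum>a\<in>\<A>. ennreal ((norm (H a x))\<^sup>2 * (1 + \<psi> x))) = ennreal ((\<Sum>a\<in>\<A>. (norm (H a x))\<^sup>2) * (1 + \<psi> x))"
   by (subst sum_ennreal) (auto simp: sum_distrib_right less_imp_le)
   also have "... = ennreal (\<Sum>z\<in>Z. real N ^ ?d * (h z)\<^sup>2 * (bp (x - lat dl z) * (1 + \<psi> x)))"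
   unfolding sq by (simp only: sum_distrib_left sum_distrib_right mult_ac)
   also have "... = (\<Sum>z\<in>Z. ennreal (real N ^ ?d * (h z)\<^sup>2 * (bp (x - lat dl z) * (1 + \<psi> x))))"
   using bp_b by (subst sum_ennreal) (auto intro!: mult_nonneg_nonneg simp: less_imp_le)
   finally show "(\<Sum>a\<in>\<A>. ennreal ((norm (H a x))\<^sup>2 * (1 + \<psi> x))) = (\<Sum>z\<in>Z. ennreal (real N ^ ?d * (h z)\<^sup>2 * (bp (x - lat dl z) * (1 + \<psi> x))))" .
  qed
  also have "... = (\<Sum>z\<in>Z. \<integral>\<^sup>+x. ennreal (real N ^ ?d * (h z)\<^sup>2 * (bp (x - lat dl z) * (1 + \<psi> x))) \<partial>lborel)"
   by (rule nn_integral_sum) measurable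
  also have "... <= (\<Sum>z\<in>Z. ennreal (real N ^ ?d * ((1 + e) * s ^ ?d * ((h z)\<^sup>2 * (1 + \<psi> (lat dl z))))))"
  proof (rule sum_mono)
   fix z
   let ?K = "real N ^ ?d * (h z)\<^sup>2 * ((1 + e) * (1 + \<psi> (lat dl z)))"
   have K0: "0 <= ?K" using e by (intro mult_nonneg_nonneg) (auto simp: less_imp_le)
   have "(NN x. ennreal (real N ^ ?d * (h z)\<^sup>2 * (bp (x - lat dl z) * (1 + \<psi> x))))
   <= (NN x. ennreal ?K * ind (cbox (lat dl z) (lat dl z + cube_vec s)) x)"
   proof (intro nn_integral_mono)
   fix x
   show "ennreal (real N ^ ?d * (h z)\<^sup>2 * (bp (x - lat dl z) * (1 + \<psi> x))) <= ennreal ?K * ind (cbox (lat dl z) (lat dl z + cube_vec s)) x"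
   proof (cases "x \<in> cbox (lat dl z) (lat dl z + cube_vec s)")
   case True
   hence "norm (x - lat dl z) <= real ?d * s"
   by (intro norm_le_cube) (auto simp: mem_box_cart abs_le_iff field_simps, (smt (verit) mem_box_cart)?)
   hence "1 + \<psi> x <= (1 + e) * (1 + \<psi> (lat dl z))" using loc[of "x - lat dl z" "lat dl z"] by simp
   hence "bp (x - lat dl z) * (1 + \<psi> x) <= 1 * ((1 + e) * (1 + \<psi> (lat dl z)))"
   using bp_b by (intro mult_mono) (auto simp: less_imp_le)
   hence "real N ^ ?d * (h z)\<^sup>2 * (bp (x - lat dl z) * (1 + \<psi> x)) <= ?K" by (intro mult_left_mono) auto
   thus ?thesis using True by (simp add: ennreal_leI)
   next
   case False
   hence "bp (x - lat dl z) = 0" by (auto simp: bp_def mem_box_cart field_simps split: split_indicator)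
   thus ?thesis by simp
   qed
   qed
   also have "... = ennreal ?K * ennreal (s ^ ?d)" using s by (subst nn_integral_cmult_indicator) (auto simp: emeasure_box_cube)
   also have "... = ennreal (real N ^ ?d * ((1 + e) * s ^ ?d * ((h z)\<^sup>2 * (1 + \<psi> (lat dl z)))))"
   using K0 s by (subst ennreal_mult[symmetric]) (auto simp: mult_ac)
   finally show "(NN x. ennreal (real N ^ ?d * (h z)\<^sup>2 * (bp (x - lat dl z) * (1 + \<psi> x)))) <= ennreal (real N ^ ?d * ((1 + e) * s ^ ?d * ((h z)\<^sup>2 * (1 + \<psi> (lat dl z)))))" .
  qed
  also have "... = ennreal (real N ^ ?d * ((1 + e) * s ^ ?d * S))"
   unfolding S_def sum_distrib_left using e s by (subst sum_ennreal) (auto intro!: mult_nonneg_nonneg simp: less_imp_le)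
  finally show ?thesis .
 qed
 have Efin: "E a = ennreal (enn2real (E a))" if "a \<in> \<A>" for a
 proof -
  have "E a <= (\<Sum>a\<in>\<A>. E a)" using fA that by (intro member_le_sum) auto
  hence "E a < \<top>" using Esum by (meson ennreal_less_top order_le_less_trans)
  thus ?thesis by simp
 qed
 have Esum': "(\<Sum>a\<in>\<A>. enn2real (E a)) <= real N ^ ?d * ((1 + e) * s ^ ?d * S)"
 proof -
  have "ennreal (\<Sum>a\<in>\<A>. enn2real (E a)) = (\<Sum>a\<in>\<A>. E a)"
   using Efin by (subst sum_ennreal[symmetric]) (auto intro!: sum.cong)
  hence "ennreal (\<Sum>a\<in>\<A>. enn2real (E a)) <= ennreal (real N ^ ?d * ((1 + e) * s ^ ?d * S))" using Esum by (simp only:)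
  thus ?thesis by (subst (asm) ennreal_le_iff) (use e s S0 in auto)
 qed
 \<comment> \<open>The slack \<eta> keeps the weights in Minkowski's inequality positive where
   \<open>E a\<close> vanishes; it tends to 0 at the end. The number N^d of characters appears on
   both sides and cancels.\<close>
 have main: "dl ^ ?d * ((s - dl) ^ ?d) ^ Suc n * (\<Sum>l\<in>A. (\<Sum>z\<in>Z. h z * h (z + l)) ^ Suc n) <= \<rho> * ((1 + e) * s ^ ?d * S + \<eta>) ^ Suc n"
  if \<eta>: "0 < \<eta>" for \<eta>
 proof -
  define t where "t a = enn2real (E a) + \<eta>" for a
  have t0: "0 < t a" for a using \<eta> by (simp add: t_def add_nonneg_pos)
  have "(NN x. ennreal ((\<Sum>a\<in>\<A>. norm (F a x)) ^ Suc n)) <= ennreal (\<rho> * (\<Sum>a\<in>\<A>. t a) ^ Suc n)"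
  proof (rule minkowski_power[OF _ fA neA])
   fix a assume a: "a \<in> \<A>"
   have "(NN x. ennreal (norm (F a x) ^ Suc n)) <= (NN x. corr (%y. norm (H a y)) x ^ Suc n)"
   by (intro nn_integral_mono) (auto simp: ennreal_power[symmetric] intro!: power_mono F_le simp del: power_Suc)
   also have "... <= ennreal (\<rho> * t a ^ Suc n)"
   using Efin[OF a] \<eta> t0 by (intro nn_integral_corr_power_le_rho) (auto simp: E_def[symmetric] t_def intro!: ennreal_leI)
   finally show "(NN x. ennreal (norm (F a x) ^ Suc n)) <= ennreal (\<rho> * t a ^ Suc n)" .
  qed (use t0 rho_pos in auto)
  also have "... <= ennreal (\<rho> * (real N ^ ?d * ((1 + e) * s ^ ?d * S + \<eta>)) ^ Suc n)"
  proof (intro ennreal_leI mult_left_mono power_mono)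
   show "(\<Sum>a\<in>\<A>. t a) <= real N ^ ?d * ((1 + e) * s ^ ?d * S + \<eta>)"
   using Esum' by (simp add: t_def sum.distrib cardA distrib_left)
  qed (use t0 rho_pos in \<open>auto intro!: sum_nonneg simp: less_imp_le\<close>)
  finally have up: "(NN x. ennreal ((\<Sum>a\<in>\<A>. norm (F a x)) ^ Suc n)) <= ennreal (\<rho> * (real N ^ ?d * ((1 + e) * s ^ ?d * S + \<eta>)) ^ Suc n)" .
  let ?C = "%l. (real N ^ ?d * ((\<Sum>z\<in>Z. h z * h (z + l)) * (s - dl) ^ ?d)) ^ Suc n"
  have C0: "0 <= ?C l" for l using h0 dl by (intro zero_le_power mult_nonneg_nonneg sum_nonneg) auto
  have "ennreal (\<Sum>l\<in>A. ?C l * dl ^ ?d) <= (NN x. ennreal ((\<Sum>a\<in>\<A>. norm (F a x)) ^ Suc n))"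
  proof (rule sum_cells_le_nn_integral[OF dl(1) A C0])
   fix l x assume l: "l \<in> A" "x \<in> box (lat dl l) (lat dl l + cube_vec dl)"
   show "ennreal (?C l) <= ennreal ((\<Sum>a\<in>\<A>. norm (F a x)) ^ Suc n)"
   proof (intro ennreal_leI power_mono)
   define v where "v = x - lat dl l"
   have v: "v \<in> box 0 (cube_vec dl)" using l(2) by (auto simp: v_def mem_box_cart field_simps)
   have "real N ^ ?d * ((\<Sum>z\<in>Z. h z * h (z + l)) * (s - dl) ^ ?d) <= real N ^ ?d * ((\<Sum>z\<in>Z. h z * h (z + l)) * c v)"
   using h0 by (intro mult_left_mono c_ge[OF v] sum_nonneg) auto
   also have "... <= (\<Sum>a\<in>\<A>. norm (F a x))" using avg[OF l(1), of v] by (simp add: v_def)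
   finally show "real N ^ ?d * ((\<Sum>z\<in>Z. h z * h (z + l)) * (s - dl) ^ ?d) <= (\<Sum>a\<in>\<A>. norm (F a x))" .
   qed (use h0 dl in \<open>auto intro!: mult_nonneg_nonneg sum_nonneg\<close>)
  qed
  also note up
  finally have "(\<Sum>l\<in>A. ?C l * dl ^ ?d) <= \<rho> * (real N ^ ?d * ((1 + e) * s ^ ?d * S + \<eta>)) ^ Suc n"
   using rho_pos e s S0 \<eta> by (subst (asm) ennreal_le_iff) (auto intro!: mult_nonneg_nonneg add_nonneg_nonneg simp: less_imp_le)
  moreover have "(\<Sum>l\<in>A. ?C l * dl ^ ?d) = (real N ^ ?d) ^ Suc n * (dl ^ ?d * ((s - dl) ^ ?d) ^ Suc n * (\<Sum>l\<in>A. (\<Sum>z\<in>Z. h z * h (z + l)) ^ Suc n))"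
   unfolding power_mult_distrib sum_distrib_left by (intro sum.cong refl) (simp only: mult_ac)
  moreover have "\<rho> * (real N ^ ?d * ((1 + e) * s ^ ?d * S + \<eta>)) ^ Suc n = (real N ^ ?d) ^ Suc n * (\<rho> * ((1 + e) * s ^ ?d * S + \<eta>) ^ Suc n)"
   unfolding power_mult_distrib by (simp only: mult_ac)
  ultimately have "(real N ^ ?d) ^ Suc n * (dl ^ ?d * ((s - dl) ^ ?d) ^ Suc n * (\<Sum>l\<in>A. (\<Sum>z\<in>Z. h z * h (z + l)) ^ Suc n)) <= (real N ^ ?d) ^ Suc n * (\<rho> * ((1 + e) * s ^ ?d * S + \<eta>) ^ Suc n)"
   by (simp only:)
  moreover have "0 < (real N ^ ?d) ^ Suc n" using N(1) by simp
  ultimately show ?thesis by (subst (asm) mult_le_cancel_left_pos)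
 qed
 have "((%\<eta>. \<rho> * ((1 + e) * s ^ ?d * S + \<eta>) ^ Suc n) \<longlongrightarrow> \<rho> * ((1 + e) * s ^ ?d * S + 0) ^ Suc n) (at_right 0)"
  by (intro tendsto_intros)
 hence "dl ^ ?d * ((s - dl) ^ ?d) ^ Suc n * (\<Sum>l\<in>A. (\<Sum>z\<in>Z. h z * h (z + l)) ^ Suc n) <= \<rho> * ((1 + e) * s ^ ?d * S + 0) ^ Suc n"
  by (rule tendsto_lowerbound) (use main in \<open>auto simp: eventually_at_right_less[of 0] eventually_at_right_field intro!: exI[of _ 1]\<close>)
 thus ?thesis by (simp add: S_def)
qed

section \<open>Stirling bounds with polynomial loss\<close>

text \<open>The two inductions rest on (1 + 1/k)^k <= e and e <= (1 + 1/k)^(k+1)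
  respectively.\<close>

lemma fact_exp_bounds:
 "real k ^ k <= fact k * exp (real k)" "fact k * exp (real k) <= exp 1 * (real k + 1) * real k ^ k"
proof -
 show "real k ^ k <= fact k * exp (real k)"
 proof (induction k)
  case (Suc k)
  show ?case
  proof (cases "k = 0")
   case False
   have "ln (1 + 1 / real k) <= 1 / real k" using False by (intro ln_add_one_self_le_self) auto
   hence "real k * ln (1 + 1 / real k) <= 1" using False by (simp add: field_simps)
   hence "exp (real k * ln (1 + 1 / real k)) <= exp 1" by simp
   hence "(1 + 1 / real k) ^ k <= exp 1" using False by (simp add: exp_of_nat_mult add_pos_nonneg)
   hence "real k ^ k * (1 + 1 / real k) ^ k <= real k ^ k * exp 1" by (intro mult_left_mono) auto
   hence "(real k + 1) ^ k <= real k ^ k * exp 1" using False by (simp add: power_mult_distrib[symmetric] distrib_left)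
   also have "... <= (fact k * exp (real k)) * exp 1" using Suc by (intro mult_right_mono) auto
   finally have "(real k + 1) * (real k + 1) ^ k <= (real k + 1) * ((fact k * exp (real k)) * exp 1)" by (intro mult_left_mono) auto
   thus ?thesis by (simp add: exp_add algebra_simps)
  qed simp
 qed simp
 have *: "fact (Suc k) * exp (real (Suc k)) <= exp 1 * real (Suc k) * real (Suc k) ^ Suc k" for k
 proof (induction k)
  case (Suc k)
  let ?m = "Suc k"
  have "ln (real ?m / (real ?m + 1)) <= real ?m / (real ?m + 1) - 1" by (intro ln_le_minus_one) auto
  also have "... = - 1 / (real ?m + 1)" by (simp add: field_simps)
  finally have "1 / (real ?m + 1) <= ln ((real ?m + 1) / real ?m)" by (simp add: ln_div del: of_nat_Suc)
  hence "1 <= (real ?m + 1) * ln ((real ?m + 1) / real ?m)" by (simp add: pos_divide_le_eq mult.commute del: of_nat_Suc)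
  hence "exp 1 <= exp (real (Suc ?m) * ln ((real ?m + 1) / real ?m))" by (simp add: add.commute)
  also have "... = ((real ?m + 1) / real ?m) ^ Suc ?m" by (subst exp_of_nat_mult) simp
  finally have "exp 1 * real ?m ^ Suc ?m <= (real ?m + 1) ^ Suc ?m"
   by (simp add: power_divide pos_le_divide_eq del: power_Suc of_nat_Suc)
  hence "(exp 1 * real (Suc ?m)) * (exp 1 * real ?m ^ Suc ?m) <= (exp 1 * real (Suc ?m)) * (real (Suc ?m)) ^ Suc ?m"
   by (intro mult_left_mono) (auto simp add: add.commute simp del: power_Suc)
  moreover have "(exp 1 * real (Suc ?m)) * (fact ?m * exp (real ?m)) <= (exp 1 * real (Suc ?m)) * (exp 1 * real ?m * real ?m ^ ?m)"
   using Suc by (intro mult_left_mono) (auto simp: less_imp_le simp del: fact_Suc power_Suc)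
  moreover have "fact (Suc ?m) * exp (real (Suc ?m)) = (exp 1 * real (Suc ?m)) * (fact ?m * exp (real ?m))"
   by (simp only: fact_Suc of_nat_Suc[of ?m] exp_add of_nat_mult) (simp add: algebra_simps)
  ultimately show ?case by (simp only: power_Suc mult_ac)
 qed simp
 show "fact k * exp (real k) <= exp 1 * (real k + 1) * real k ^ k"
 proof (cases k)
  case (Suc j)
  have "exp 1 * real (Suc j) * real (Suc j) ^ Suc j <= exp 1 * (real k + 1) * real k ^ k"
   unfolding Suc by (intro mult_right_mono mult_left_mono) auto
  thus ?thesis using *[of j] unfolding Suc by linarith
 qed simp
qed

section \<open>Types of words over a finite alphabet\<close>

definition word_type :: "'a set => nat => (nat => 'a) => 'a => nat" where
 "word_type A m w = (\<lambda>x\<in>A. card {k. k < m & w k = x})"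

lemma count_mset_map: "count (mset (map w [0..<m])) x = card {k. k < m & w k = x}"
proof (induction m)
 case (Suc m)
 have "{k. k < Suc m & w k = x} = (if w m = x then insert m {k. k < m & w k = x} else {k. k < m & w k = x})"
  by (auto simp: less_Suc_eq)
 thus ?case using Suc by simp
qed simp

lemma word_type_mem: "w \<in> PiE {..<m} (%_. A) ==> word_type A m w \<in> PiE A (%_. {..m})"
proof -
 have "card {k. k < m & w k = x} <= m" for x using card_mono[of "{..<m}" "{k. k < m & w k = x}"] by auto
 thus ?thesis by (auto simp: word_type_def)
qed

lemma mset_eq_of_word_type:
 assumes w: "w \<in> PiE {..<m} (%_. A)" "w' \<in> PiE {..<m} (%_. A)" and t: "word_type A m w = word_type A m w'"
 shows "mset (map w [0..<m]) = mset (map w' [0..<m])"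
proof (rule multiset_eqI)
 fix x
 show "count (mset (map w [0..<m])) x = count (mset (map w' [0..<m])) x"
 proof (cases "x \<in> A")
  case True
  thus ?thesis using fun_cong[OF t, of x] unfolding count_mset_map by (simp add: word_type_def)
 next
  case False
  hence "card {k. k < m & w k = x} = 0" "card {k. k < m & w' k = x} = 0" using w by (auto simp: PiE_iff card_eq_0_iff)
  thus ?thesis by (simp only: count_mset_map)
 qed
qed

lemma word_type_permute:
 assumes w: "w \<in> PiE {..<m} (%_. A)" "w' \<in> PiE {..<m} (%_. A)" and t: "word_type A m w = word_type A m w'"
 obtains sg where "sg permutes {..<m}" "!!i. i < m ==> w i = w' (sg i)"
proof -
 from mset_eq_of_word_type[OF assms] obtain sg where sg: "sg permutes {..<length (map w' [0..<m])}" "permute_list sg (map w' [0..<m]) = map w [0..<m]"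
  by (rule mset_eq_permutation)
 have p: "sg permutes {..<m}" using sg(1) by simp
 have "w i = w' (sg i)" if "i < m" for i
 proof -
  have "w i = permute_list sg (map w' [0..<m]) ! i" using that by (simp add: sg(2))
  also have "... = map w' [0..<m] ! sg i" using that by (intro permute_list_nth[OF sg(1)]) simp
  also have "... = w' (sg i)" using permutes_in_image[OF p, of i] that by simp
  finally show ?thesis .
 qed
 thus thesis using that p by blast
qed

lemma sum_word_type:
 assumes A: "finite A" and w: "w \<in> PiE {..<m} (%_. A)"
 shows "(\<Sum>x\<in>A. word_type A m w x) = m"
proof -
 have "(\<Sum>x\<in>A. word_type A m w x) = (\<Sum>x\<in>A. card {k \<in> {..<m}. w k = x})"
  by (intro sum.cong) (auto simp: word_type_def)
 also have "... = card (\<Union>x\<in>A. {k \<in> {..<m}. w k = x})" using A by (intro card_UN_disjoint[symmetric]) auto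
 also have "(\<Union>x\<in>A. {k \<in> {..<m}. w k = x}) = {..<m}" using w by (auto simp: PiE_iff)
 finally show ?thesis by simp
qed

lemma prod_word_type:
 fixes f :: "'a => 'b::comm_monoid_mult"
 assumes A: "finite A" and w: "w \<in> PiE {..<m} (%_. A)"
 shows "(\<Prod>k<m. f (w k)) = (\<Prod>x\<in>A. f x ^ word_type A m w x)"
proof -
 have "(\<Prod>k<m. f (w k)) = (\<Prod>x\<in>A. \<Prod>k | k \<in> {..<m} & w k = x. f (w k))"
  using A w by (intro prod.group[symmetric]) (auto simp: PiE_iff)
 also have "... = (\<Prod>x\<in>A. f x ^ word_type A m w x)" by (intro prod.cong refl) (auto simp: word_type_def)
 finally show ?thesis .
qed

text \<open>The words of one type are the arrangements of one multiset, so they are counted by a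
  multinomial coefficient; the product form avoids a division.\<close>

lemma card_word_type_class:
 assumes A: "finite A" and w: "w \<in> PiE {..<m} (%_. A)"
 shows "real (card {w' \<in> PiE {..<m} (%_. A). word_type A m w' = word_type A m w}) * (\<Prod>x\<in>A. fact (word_type A m w x)) = fact m"
proof -
 let ?M = "mset (map w [0..<m])"
 let ?C = "{w' \<in> PiE {..<m} (%_. A). word_type A m w' = word_type A m w}"
 have "bij_betw (%w'. map w' [0..<m]) ?C (permutations_of_multiset ?M)"
 proof (rule bij_betwI[where g = "%xs. \<lambda>k\<in>{..<m}. xs ! k"])
  show "(%w'. map w' [0..<m]) \<in> ?C \<rightarrow> permutations_of_multiset ?M"
  proof (rule funcsetI)
   fix w' assume "w' \<in> ?C"
   hence "mset (map w' [0..<m]) = ?M" by (intro mset_eq_of_word_type[OF _ w]) simp_all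
   thus "map w' [0..<m] \<in> permutations_of_multiset ?M" unfolding permutations_of_multiset_def by blast
  qed
  show "(%xs. \<lambda>k\<in>{..<m}. xs ! k) \<in> permutations_of_multiset ?M \<rightarrow> ?C"
  proof (rule funcsetI)
   fix xs assume "xs \<in> permutations_of_multiset ?M"
   hence xs: "mset xs = ?M" by (simp add: permutations_of_multiset_def)
   have len: "length xs = m" using arg_cong[OF xs, of size] by simp
   have "set xs = set (map w [0..<m])" using xs by (metis set_mset_mset)
   hence sub: "set xs \<subseteq> A" using w by (auto simp: PiE_iff)
   have mem: "(\<lambda>k\<in>{..<m}. xs ! k) \<in> PiE {..<m} (%_. A)" using sub len by (auto dest: nth_mem)
   have eq: "map (\<lambda>k\<in>{..<m}. xs ! k) [0..<m] = xs" using len by (auto intro: nth_equalityI)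
   have "word_type A m (\<lambda>k\<in>{..<m}. xs ! k) = word_type A m w"
   unfolding word_type_def count_mset_map[symmetric] by (simp only: eq xs)
   thus "(\<lambda>k\<in>{..<m}. xs ! k) \<in> ?C" using mem by simp
  qed
  show "(\<lambda>k\<in>{..<m}. map w' [0..<m] ! k) = w'" if "w' \<in> ?C" for w'
   using that by (auto simp: fun_eq_iff PiE_iff extensional_def)
  show "map (\<lambda>k\<in>{..<m}. xs ! k) [0..<m] = xs" if "xs \<in> permutations_of_multiset ?M" for xs
  proof -
   have "size (mset xs) = size ?M" using that by (simp only: permutations_of_multiset_def mem_Collect_eq)
   hence "length xs = m" by simp
   thus ?thesis by (auto intro: nth_equalityI)
  qed
 qed
 hence card: "card ?C = card (permutations_of_multiset ?M)" by (rule bij_betw_same_card)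
 have "(\<Prod>x\<in>set_mset ?M. fact (count ?M x)) = (\<Prod>x\<in>A. fact (word_type A m w x) :: nat)"
 proof (rule prod.mono_neutral_cong_left)
  show "set_mset ?M \<subseteq> A" using w by (auto simp: PiE_iff)
  show "\<forall>i\<in>A - set_mset ?M. fact (word_type A m w i) = (1::nat)"
  proof
   fix i assume i: "i \<in> A - set_mset ?M"
   hence "count ?M i = 0" by (simp only: not_in_iff Diff_iff)
   thus "fact (word_type A m w i) = (1::nat)"
   using i by (simp only: word_type_def restrict_apply count_mset_map[symmetric] Diff_iff if_True fact_0)
  qed
  show "fact (count ?M x) = fact (word_type A m w x)" if "x \<in> set_mset ?M" for x
   using that w unfolding word_type_def count_mset_map by (auto simp: PiE_iff)
 qed (rule A)
 hence "card ?C * (\<Prod>x\<in>A. fact (word_type A m w x)) = fact m"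
  using card_permutations_of_multiset[of ?M] by (simp add: card)
 hence "real (card ?C * (\<Prod>x\<in>A. fact (word_type A m w x))) = fact m" by simp
 thus ?thesis by (simp add: of_nat_prod)
qed

text \<open>The method of types: under independent letters drawn from the empirical distribution of
  \<open>w\<close>, the type of \<open>w\<close> itself occurs with at least inverse polynomial
  probability. Multinomial coefficient and probability balance by the Stirling bounds.\<close>

lemma word_type_class_large:
 assumes A: "finite A" and w: "w \<in> PiE {..<m} (%_. A)" and m: "0 < m"
 shows "1 <= (exp 1 * (real m + 1)) ^ card A * (real (card {w' \<in> PiE {..<m} (%_. A). word_type A m w' = word_type A m w})
  * (\<Prod>x\<in>A. (real (word_type A m w x) / real m) ^ word_type A m w x))"
proof -
 let ?t = "word_type A m w"
 let ?C = "real (card {w' \<in> PiE {..<m} (%_. A). word_type A m w' = word_type A m w})"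
 have tm: "?t x <= m" if "x \<in> A" for x using word_type_mem[OF w] that by auto
 have "fact m <= ?C * (\<Prod>x\<in>A. exp 1 * (real m + 1) * real (?t x) ^ ?t x / exp (real (?t x)))"
  unfolding card_word_type_class[OF A w, symmetric]
 proof (intro mult_left_mono prod_mono conjI)
  fix x assume x: "x \<in> A"
  have "fact (?t x) * exp (real (?t x)) <= exp 1 * (real (?t x) + 1) * real (?t x) ^ ?t x" by (rule fact_exp_bounds)
  also have "... <= exp 1 * (real m + 1) * real (?t x) ^ ?t x" using tm[OF x] by (intro mult_right_mono mult_left_mono) auto
  finally show "fact (?t x) <= exp 1 * (real m + 1) * real (?t x) ^ ?t x / exp (real (?t x))" by (simp add: pos_le_divide_eq)
 qed auto
 also have "... = ?C * ((exp 1 * (real m + 1)) ^ card A * (\<Prod>x\<in>A. real (?t x) ^ ?t x) / (\<Prod>x\<in>A. exp (real (?t x))))"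
  by (simp add: prod.distrib prod_dividef)
 also have "(\<Prod>x\<in>A. exp (real (?t x))) = exp (real m)"
  using sum_word_type[OF A w] by (simp add: exp_sum[OF A, symmetric] of_nat_sum[symmetric] del: of_nat_sum)
 finally have 1: "fact m * exp (real m) <= ?C * ((exp 1 * (real m + 1)) ^ card A * (\<Prod>x\<in>A. real (?t x) ^ ?t x))"
  by (simp add: field_simps)
 have "real m ^ m <= ?C * ((exp 1 * (real m + 1)) ^ card A * (\<Prod>x\<in>A. real (?t x) ^ ?t x))"
  using fact_exp_bounds(1)[of m] 1 by linarith
 moreover have "(\<Prod>x\<in>A. (real (?t x) / real m) ^ ?t x) = (\<Prod>x\<in>A. real (?t x) ^ ?t x) / real m ^ m"
  using sum_word_type[OF A w] by (simp add: power_divide prod_dividef power_sum[symmetric])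
 ultimately have le: "real m ^ m <= ?C * ((exp 1 * (real m + 1)) ^ card A * X)"
  and eq: "(\<Prod>x\<in>A. (real (?t x) / real m) ^ ?t x) = X / real m ^ m" if "X = (\<Prod>x\<in>A. real (?t x) ^ ?t x)" for X
  using that by simp_all
 define X where "X = (\<Prod>x\<in>A. real (?t x) ^ ?t x)"
 have "1 <= (?C * ((exp 1 * (real m + 1)) ^ card A * X)) / real m ^ m" using le[OF X_def] m by (subst le_divide_eq_1_pos) auto
 also have "... = (exp 1 * (real m + 1)) ^ card A * (?C * (X / real m ^ m))" by simp
 finally show ?thesis by (simp only: eq[OF X_def])
qed

text \<open>A symmetric function of \<open>m\<close> letters is constant on types, and there are only polynomially many types;
 hence its \<open>\<ell>\<^sup>p\<close> norm is governed by pairings with product functions.\<close>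

lemma sum_power_le_by_types:
 fixes H :: "(nat => 'a) => real"
 assumes A: "finite A" and m: "0 < m" and H0: "!!w. w \<in> PiE {..<m} (%_. A) ==> 0 <= H w"
  and sym: "!!w w'. [|w \<in> PiE {..<m} (%_. A); w' \<in> PiE {..<m} (%_. A); word_type A m w = word_type A m w'|] ==> H w = H w'"
  and V: "!!b. [|!!x. 0 <= b x; (\<Sum>x\<in>A. b x ^ Suc n) <= 1|] ==> (\<Sum>w\<in>PiE {..<m} (%_. A). H w * (\<Prod>k<m. b (w k) ^ n)) <= V"
 shows "(\<Sum>w\<in>PiE {..<m} (%_. A). H w ^ Suc n) <= (real m + 1) ^ card A * ((exp 1 * (real m + 1)) ^ card A) ^ n * V ^ Suc n"
proof -
 let ?W = "PiE {..<m} (%_. A)"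
 let ?T = "PiE A (%_. {..m})"
 have fW: "finite ?W" using A by (intro finite_PiE) auto
 have fT: "finite ?T" using A by (intro finite_PiE) auto
 define P where "P = (exp 1 * (real m + 1)) ^ card A"
 have P: "0 < P" by (simp add: P_def)
 have V0: "0 <= V" using V[of "%_. 0"] sum_nonneg[of ?W "%w. H w * (\<Prod>k<m. 0 ^ n)"] H0 by (auto intro!: mult_nonneg_nonneg)
 have cl: "(\<Sum>w | w \<in> ?W & word_type A m w = t. H w ^ Suc n) <= P ^ n * V ^ Suc n" for t
 proof (cases "\<exists>w\<in>?W. word_type A m w = t")
  case False
  hence e: "{w. w \<in> ?W & word_type A m w = t} = {}" by auto
  show ?thesis unfolding e using P V0 by simp
 next
  case True
  then obtain w where w: "w \<in> ?W" "word_type A m w = t" by blast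
  let ?cl = "{w' \<in> ?W. word_type A m w' = word_type A m w}"
  define C where "C = real (card ?cl)"
  \<comment> \<open>The p-th root of the empirical frequency: a unit vector of l^p tuned to this
    type, for which Hoelder duality is nearly attained on the type class.\<close>
  define b where "b x = root (Suc n) (real (card {k. k < m & w k = x}) / real m)" for x
  have b0: "0 <= b x" for x by (simp add: b_def)
  have bp: "b x ^ Suc n = real (word_type A m w x) / real m" if "x \<in> A" for x
   using that by (simp add: b_def word_type_def del: power_Suc)
  have "(\<Sum>x\<in>A. b x ^ Suc n) = real (\<Sum>x\<in>A. word_type A m w x) / real m"
   by (simp add: bp sum_divide_distrib del: power_Suc)
  hence b1: "(\<Sum>x\<in>A. b x ^ Suc n) <= 1" using sum_word_type[OF A w(1)] by simp
  define \<beta> where "\<beta> = (\<Prod>k<m. b (w k))"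
  have \<beta>0: "0 <= \<beta>" by (simp add: \<beta>_def b0 prod_nonneg)
  have prodb: "(\<Prod>k<m. b (w' k) ^ n) = \<beta> ^ n" if "w' \<in> ?cl" for w'
  proof -
   have "(\<Prod>k<m. b (w' k)) = \<beta>"
   using that prod_word_type[OF A, of w' m b] prod_word_type[OF A w(1), of b] by (simp add: \<beta>_def)
   thus ?thesis by (simp add: prod_power_distrib[symmetric])
  qed
  have \<beta>p: "\<beta> ^ Suc n = (\<Prod>x\<in>A. (real (word_type A m w x) / real m) ^ word_type A m w x)"
  proof -
   have "\<beta> ^ Suc n = (\<Prod>k<m. b (w k) ^ Suc n)" by (simp add: \<beta>_def prod_power_distrib[symmetric] del: power_Suc)
   also have "... = (\<Prod>x\<in>A. (b x ^ Suc n) ^ word_type A m w x)" by (rule prod_word_type[OF A w(1)])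
   finally show ?thesis by (simp add: bp del: power_Suc)
  qed
  have large: "1 <= P * (C * \<beta> ^ Suc n)" using word_type_class_large[OF A w(1) m] by (simp only: P_def C_def \<beta>p)
  have Cpos: "0 < C" using w(1) fW by (auto simp: C_def card_gt_0_iff)
  have "C * (H w * \<beta> ^ n) = (\<Sum>w'\<in>?cl. H w' * (\<Prod>k<m. b (w' k) ^ n))"
  proof -
   have "(\<Sum>w'\<in>?cl. H w' * (\<Prod>k<m. b (w' k) ^ n)) = (\<Sum>w'\<in>?cl. H w * \<beta> ^ n)"
   proof (rule sum.cong[OF refl])
   fix w' assume w': "w' \<in> ?cl"
   hence "H w = H w'" by (intro sym w(1)) auto
   thus "H w' * (\<Prod>k<m. b (w' k) ^ n) = H w * \<beta> ^ n" using prodb[OF w'] by simp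
   qed
   thus ?thesis by (simp add: C_def)
  qed
  also have "... <= (\<Sum>w'\<in>?W. H w' * (\<Prod>k<m. b (w' k) ^ n))"
   using fW H0 b0 by (intro sum_mono2) (auto intro!: mult_nonneg_nonneg prod_nonneg)
  also have "... <= V" by (rule V[OF b0 b1])
  finally have CH: "C * (H w * \<beta> ^ n) <= V" .
  have Hw: "0 <= H w" using H0 w by simp
  have "(\<Sum>w | w \<in> ?W & word_type A m w = t. H w ^ Suc n) = C * H w ^ Suc n"
  proof -
   have "(\<Sum>w' | w' \<in> ?W & word_type A m w' = t. H w' ^ Suc n) = (\<Sum>w' \<in> ?cl. H w ^ Suc n)"
   using w(2) sym[OF w(1)] by (intro sum.cong) auto
   thus ?thesis by (simp add: C_def)
  qed
  \<comment> \<open>The inserted factor is at least 1 and supplies exactly the missing powers: with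
    it, class size, value and weight combine to the p-th power of
    \<open>C * (H w * \<beta> ^ n)\<close>, up to P^n.\<close>
  also have "... <= C * H w ^ Suc n * (P * (C * \<beta> ^ Suc n)) ^ n"
  proof -
   have "C * H w ^ Suc n * 1 <= C * H w ^ Suc n * (P * (C * \<beta> ^ Suc n)) ^ n"
   using Cpos Hw by (intro mult_left_mono one_le_power large mult_nonneg_nonneg) auto
   thus ?thesis by simp
  qed
  also have "... = P ^ n * (C * (H w * \<beta> ^ n)) ^ Suc n" by (simp add: power_mult_distrib power_mult[symmetric] mult_ac)
  also have "... <= P ^ n * V ^ Suc n" using CH Cpos Hw \<beta>0 P by (intro mult_left_mono power_mono) auto
  finally show ?thesis .
 qed
 have "(\<Sum>w\<in>?W. H w ^ Suc n) = (\<Sum>t\<in>?T. \<Sum>w | w \<in> ?W & word_type A m w = t. H w ^ Suc n)"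
  using fW fT by (intro sum.group[symmetric] image_subsetI word_type_mem)
 also have "... <= (\<Sum>t\<in>?T. P ^ n * V ^ Suc n)" by (intro sum_mono cl)
 also have "... = (real m + 1) ^ card A * P ^ n * V ^ Suc n" using A by (simp add: card_PiE add.commute)
 finally show ?thesis by (simp add: P_def)
qed

section \<open>Growth of lattice walks\<close>

text \<open>\<open>lattice_step\<close> conjugated by multiplication with sqrt q. Its quadratic form
  is a sum over l of \<open>g l\<close> times lattice autocorrelations of u sqrt q, which is how
  \<rho> becomes applicable.\<close>

definition sym_step :: "'v::ab_group_add set => ('v => real) => ('v => real) => ('v => real) => 'v => real" where
 "sym_step A g q u x = (\<Sum>l\<in>A. sqrt (q x) * g l * sqrt (q (x + l)) * u (x + l))"

text \<open>A quadratic form bound for the nonsymmetric nonnegative kernel suffices: pair the resolvent equation with its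
 solution and drop the nonnegative remainder.\<close>

lemma lattice_walk_growth:
 fixes A Y :: "'v::ab_group_add set"
 assumes A: "finite A" and Y: "finite Y" and g: "!!l. 0 <= g l" and q: "!!x. 0 <= q x" "!!x. q x <= 1" "q 0 = 1"
  and w: "!!u U. [|finite U; !!x. 0 <= u x; !!x. x \<notin> U ==> u x = 0|] ==> (\<Sum>x\<in>U. u x * sym_step A g q u x) <= w * (\<Sum>x\<in>U. (u x)\<^sup>2)"
  and s: "w < s" "0 < s"
 shows "(lattice_step A g q ^^ m) (ind Y) 0 <= s ^ Suc m * sqrt (real (card Y)) / (s - w)"
proof -
 define u where "u k x = sqrt (q x) * (lattice_step A g q ^^ k) (ind Y) x" for k x
 have uS: "u (Suc k) x = sym_step A g q (u k) x" for k x
 proof -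
  have rearrange: "r * (G * qq * c) = r * G * t * (t * c)" if "t * t = qq" for r G qq c t :: real
   using that by (auto simp: mult_ac)
  have "u (Suc k) x = sqrt (q x) * lattice_step A g q ((lattice_step A g q ^^ k) (ind Y)) x" by (simp add: u_def)
  also have "... = sym_step A g q (u k) x"
   unfolding lattice_step_def[of A g q "(lattice_step A g q ^^ k) (ind Y)"] sym_step_def sum_distrib_left u_def
   by (intro sum.cong refl rearrange) (simp add: q)
  finally show ?thesis .
 qed
 have u0: "0 <= u k x" for k x
 proof (induction k arbitrary: x)
  case (Suc k)
  thus ?case unfolding uS sym_step_def by (intro sum_nonneg mult_nonneg_nonneg) (auto simp: g q)
 qed (auto simp: u_def q)
 have fin: "finite {x. u k x ~= 0}" for k
 proof (induction k)
  case 0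
  have "{x. u 0 x ~= 0} \<subseteq> Y" by (auto simp: u_def indicator_def)
  thus ?case using Y finite_subset by blast
 next
  case (Suc k)
  have "{x. u (Suc k) x ~= 0} \<subseteq> (\<Union>l\<in>A. (%y. y - l) ` {x. u k x ~= 0})"
  proof
   fix x assume "x \<in> {x. u (Suc k) x ~= 0}"
   hence "\<exists>l\<in>A. u k (x + l) ~= 0" unfolding uS sym_step_def by (auto intro: ccontr)
   then obtain l where "l \<in> A" "u k (x + l) ~= 0" by blast
   thus "x \<in> (\<Union>l\<in>A. (%y. y - l) ` {x. u k x ~= 0})" by (intro UN_I[of l] image_eqI[of _ _ "x + l"]) auto
  qed
  thus ?case using Suc A finite_subset by blast
 qed
 define U where "U = insert 0 (\<Union>k\<in>{..Suc m}. {x. u k x ~= 0})"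
 have U: "finite U" unfolding U_def using fin by auto
 have uU: "u k x = 0" if "x \<notin> U" "k <= Suc m" for k x using that by (auto simp: U_def)
 \<comment> \<open>A truncated Neumann series for the resolvent at \<open>s\<close>; applying s
   minus the kernel leaves \<open>u 0\<close> and one remainder by telescoping.\<close>
 define X where "X x = (\<Sum>k\<le>m. u k x / s ^ Suc k)" for x
 have X0: "0 <= X x" for x unfolding X_def using u0 s by (intro sum_nonneg divide_nonneg_nonneg) auto
 have XU: "X x = 0" if "x \<notin> U" for x unfolding X_def using uU[OF that] by (intro sum.neutral) auto
 have stepX: "sym_step A g q X x = (\<Sum>k\<le>m. u (Suc k) x / s ^ Suc k)" for x
 proof -
  have "sym_step A g q X x = (\<Sum>l\<in>A. \<Sum>k\<le>m. sqrt (q x) * g l * sqrt (q (x + l)) * u k (x + l) / s ^ Suc k)"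
   unfolding sym_step_def X_def sum_distrib_left by (simp add: times_divide_eq_right)
  also have "... = (\<Sum>k\<le>m. (\<Sum>l\<in>A. sqrt (q x) * g l * sqrt (q (x + l)) * u k (x + l)) / s ^ Suc k)"
   by (subst sum.swap) (simp add: sum_divide_distrib)
  finally show ?thesis by (simp add: uS sym_step_def)
 qed
 have tele: "s * X x - sym_step A g q X x = u 0 x - u (Suc m) x / s ^ Suc m" for x
 proof -
  have "s * X x = (\<Sum>k\<le>m. u k x / s ^ k)" unfolding X_def sum_distrib_left using s by (intro sum.cong refl) (simp add: field_simps)
  hence "s * X x - sym_step A g q X x = (\<Sum>k\<le>m. u k x / s ^ k - u (Suc k) x / s ^ Suc k)"
   unfolding stepX by (simp add: sum_subtractf)
  also have "... = u 0 x / s ^ 0 - u (Suc m) x / s ^ Suc m"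
   using sum_telescope[of "%k. u k x / s ^ k" m] by (simp del: power_Suc)
  finally show ?thesis by simp
 qed
 define a where "a = (\<Sum>x\<in>U. (X x)\<^sup>2)"
 have a0: "0 <= a" by (simp add: a_def sum_nonneg)
 have "(s - w) * a <= s * a - (\<Sum>x\<in>U. X x * sym_step A g q X x)" using w[OF U X0 XU] by (simp add: a_def algebra_simps)
 also have "... = (\<Sum>x\<in>U. X x * (s * X x - sym_step A g q X x))"
  by (simp add: a_def sum_distrib_left right_diff_distrib sum_subtractf power2_eq_square mult_ac)
 also have "... <= (\<Sum>x\<in>U. X x * u 0 x)" unfolding tele using X0 u0 s by (intro sum_mono mult_left_mono) auto
 also have "... <= sqrt a * sqrt (real (card Y))"
 proof -
  have "(\<Sum>x\<in>U. X x * u 0 x)\<^sup>2 <= a * (\<Sum>x\<in>U. (u 0 x)\<^sup>2)" unfolding a_def by (rule Cauchy_Schwarz_ineq_sum)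
  also have "(\<Sum>x\<in>U. (u 0 x)\<^sup>2) <= (\<Sum>x\<in>U. ind Y x)"
  proof (rule sum_mono)
   fix x
   have "(u 0 x)\<^sup>2 = q x * ind Y x" using q by (auto simp: u_def power_mult_distrib indicator_def)
   thus "(u 0 x)\<^sup>2 <= ind Y x" using q by (auto simp: indicator_def)
  qed
  also have "(\<Sum>x\<in>U. ind Y x) = real (card (U \<inter> Y))" using U by (simp add: indicator_def sum.If_cases Int_def)
  also have "... <= real (card Y)" using Y by (simp add: card_mono)
  finally have "(\<Sum>x\<in>U. X x * u 0 x)\<^sup>2 <= a * real (card Y)" using a0 by (simp add: mult_left_mono)
  hence "sqrt ((\<Sum>x\<in>U. X x * u 0 x)\<^sup>2) <= sqrt (a * real (card Y))" by (rule real_sqrt_le_mono)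
  thus ?thesis by (simp add: real_sqrt_mult)
 qed
 finally have main: "(s - w) * a <= sqrt a * sqrt (real (card Y))" .
 have sa: "sqrt a <= sqrt (real (card Y)) / (s - w)"
 proof (cases "a = 0")
  case True
  thus ?thesis using s by simp
 next
  case False
  hence "0 < sqrt a" using a0 by simp
  have "(s - w) * (sqrt a * sqrt a) <= sqrt a * sqrt (real (card Y))" using main a0 by simp
  hence "sqrt a * ((s - w) * sqrt a) <= sqrt a * sqrt (real (card Y))" by (simp only: mult.left_commute[of "s - w"])
  hence "(s - w) * sqrt a <= sqrt (real (card Y))" using \<open>0 < sqrt a\<close> by (subst (asm) mult_le_cancel_left_pos)
  thus ?thesis using s by (simp add: le_divide_eq mult.commute)
 qed
 have "u m 0 / s ^ Suc m <= X 0" unfolding X_def using u0 s by (intro member_le_sum) (auto intro!: divide_nonneg_nonneg)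
 also have "... <= sqrt a"
 proof (rule real_le_rsqrt)
  show "(X 0)\<^sup>2 <= a" unfolding a_def using U by (intro member_le_sum) (auto simp: U_def)
 qed
 also note sa
 finally have "u m 0 <= s ^ Suc m * (sqrt (real (card Y)) / (s - w))" using s by (simp add: divide_le_eq mult.commute)
 thus ?thesis by (simp add: u_def q)
qed

text \<open>If all steps leave a set of differences, then of any two consecutive positions one is far out.\<close>

lemma lattice_walk_two_steps:
 fixes B G0 :: "'v::ab_group_add set" and q :: "'v => real"
 assumes B: "finite B" and G0: "finite G0" and q: "!!x. 0 <= q x" and C: "!!F. finite F ==> (\<Sum>x\<in>F. q x) <= C"
  and \<eta>: "!!F. finite F ==> F \<inter> G0 = {} ==> (\<Sum>x\<in>F. q x) <= \<eta>"
  and out: "!!x y. x \<in> G0 ==> y \<in> G0 ==> x - y \<notin> B"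
 shows "(lattice_step B (%_. 1) q ^^ (2 * j)) (%_. 1) x <= (2 * C * \<eta>) ^ j"
proof -
 let ?S = "lattice_step B (%_. 1) q"
 have mono: "?S \<phi> x <= c * ?S (%_. 1) x" if "!!y. \<phi> y <= c" for \<phi> c x
  unfolding lattice_step_def sum_distrib_left using q that by (intro sum_mono) (simp add: mult.commute[of c] mult_left_mono)
 have shift: "(\<Sum>l\<in>F. q (x + l)) = (\<Sum>y\<in>(+) x ` F. q y)" for F x by (simp add: sum.reindex)
 have S1: "?S (%_. 1) x <= C" for x unfolding lattice_step_def using C[of "(+) x ` B"] B by (simp add: shift)
 have C0: "0 <= C" using C[of "{}"] by simp
 have \<eta>0: "0 <= \<eta>" using \<eta>[of "{}"] by simp
 have near: "?S (%_. 1) y <= \<eta>" if "y \<in> G0" for y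
 proof -
  have "(+) y ` B \<inter> G0 = {}" using out[OF _ that] by (auto) (metis add_diff_cancel_left')
  thus ?thesis unfolding lattice_step_def using \<eta>[of "(+) y ` B"] B by (simp add: shift)
 qed
 have S2: "?S (?S (%_. 1)) x <= 2 * C * \<eta>" for x
 proof -
  let ?B1 = "{l \<in> B. x + l \<in> G0}" and ?B2 = "{l \<in> B. x + l \<notin> G0}"
  have "?S (?S (%_. 1)) x = (\<Sum>l\<in>?B1. q (x + l) * ?S (%_. 1) (x + l)) + (\<Sum>l\<in>?B2. q (x + l) * ?S (%_. 1) (x + l))"
   unfolding lattice_step_def[of B _ q "?S (%_. 1)"] using B by (subst sum.union_disjoint[symmetric]) (auto intro!: sum.cong)
  also have "... <= (\<Sum>l\<in>?B1. q (x + l) * \<eta>) + (\<Sum>l\<in>?B2. q (x + l) * C)"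
   using near S1 q by (intro add_mono sum_mono mult_left_mono) auto
  also have "... = (\<Sum>l\<in>?B1. q (x + l)) * \<eta> + (\<Sum>l\<in>?B2. q (x + l)) * C" by (simp add: sum_distrib_right)
  also have "... <= C * \<eta> + \<eta> * C"
   unfolding shift using B \<eta>0 C0 by (intro add_mono mult_right_mono C \<eta>) auto
  finally show ?thesis by (simp add: mult_ac)
 qed
 show ?thesis
 proof (induction j arbitrary: x)
  case (Suc j)
  have "(?S ^^ (2 * Suc j)) (%_. 1) x = ?S (?S ((?S ^^ (2 * j)) (%_. 1))) x" by simp
  also have "... <= (2 * C * \<eta>) ^ j * ?S (?S (%_. 1)) x"
  proof -
   have 1: "?S ((?S ^^ (2 * j)) (%_. 1)) y <= (2 * C * \<eta>) ^ j * ?S (%_. 1) y" for y by (rule mono[OF Suc])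
   have "?S (?S ((?S ^^ (2 * j)) (%_. 1))) x <= (\<Sum>l\<in>B. 1 * q (x + l) * ((2 * C * \<eta>) ^ j * ?S (%_. 1) (x + l)))"
   unfolding lattice_step_def[of B _ q "?S ((?S ^^ (2 * j)) (%_. 1))"] using q 1 by (intro sum_mono mult_left_mono) auto
   also have "... = (2 * C * \<eta>) ^ j * ?S (?S (%_. 1)) x"
   unfolding lattice_step_def[of B _ q "?S (%_. 1)"] sum_distrib_left by (intro sum.cong refl) simp
   finally show ?thesis .
  qed
  also have "... <= (2 * C * \<eta>) ^ j * (2 * C * \<eta>)" using C0 \<eta>0 by (intro mult_left_mono S2) auto
  finally show ?case by (simp add: mult.commute)
 qed simp
qed

lemma sum_PiE_permute:
 fixes f :: "(nat => 'a) => 'b::comm_monoid_add"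
 assumes sg: "sg permutes {..<m}"
 shows "(\<Sum>w\<in>PiE {..<m} (%_. A). f (\<lambda>i\<in>{..<m}. w (sg i))) = (\<Sum>w\<in>PiE {..<m} (%_. A). f w)"
proof (rule sum.reindex_bij_witness[where i = "%w. \<lambda>i\<in>{..<m}. w (inv sg i)" and j = "%w. \<lambda>i\<in>{..<m}. w (sg i)"])
 note p = permutes_in_image[OF sg] permutes_in_image[OF permutes_inv[OF sg]] permutes_inverses[OF sg]
 fix w assume w: "w \<in> PiE {..<m} (%_. A)"
 show "(\<lambda>i\<in>{..<m}. (\<lambda>i\<in>{..<m}. w (sg i)) (inv sg i)) = w"
  using w p by (auto simp: fun_eq_iff PiE_iff extensional_def)
 show "(\<lambda>i\<in>{..<m}. w (sg i)) \<in> PiE {..<m} (%_. A)" using w p by (auto simp: PiE_iff)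
 show "(\<lambda>i\<in>{..<m}. (\<lambda>i\<in>{..<m}. w (inv sg i)) (sg i)) = w"
  using w p by (auto simp: fun_eq_iff PiE_iff extensional_def)
 show "(\<lambda>i\<in>{..<m}. w (inv sg i)) \<in> PiE {..<m} (%_. A)" using w p by (auto simp: PiE_iff)
qed simp

section \<open>Upper bounds for lattice sums of the symmetrised product\<close>

context stable_setup
begin

text \<open>The bump comparison loses (1 + t)^p through the oscillation of \<psi> over a bump and (1
  - t)^(- d p) through the overlap of displaced bumps, where t = dl / s. So t is chosen first, then
  s from the local bound on \<psi>, and dl = t s last.\<close>

lemma lattice_corr_le:
 assumes ep: "0 < ep"
 obtains dl where "0 < dl" "!!x u. norm u <= real CARD('d) * dl ==> 1 + \<psi> (x + u) <= 2 * (1 + \<psi> x)"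
  "!!h Z A. [|finite Z; !!z. 0 <= h z; !!z. z \<notin> Z ==> h z = 0; finite A|] ==>
   dl ^ CARD('d) * (\<Sum>l\<in>A. (\<Sum>z\<in>Z. h z * h (z + l)) ^ Suc n)
   <= (1 + ep) * \<rho> * (\<Sum>z\<in>Z. (h z)\<^sup>2 * (1 + \<psi> (lat dl z))) ^ Suc n"
proof -
 let ?d = "CARD('d)"
 let ?f = "%t::real. ((1 + t) / (1 - t) ^ ?d) ^ Suc n"
 have "(?f \<longlongrightarrow> ((1 + 0) / (1 - 0) ^ ?d) ^ Suc n) (at_right 0)" by (intro tendsto_intros) auto
 hence "\<forall>\<^sub>F t in at_right 0. ?f t < 1 + ep" using ep by (intro order_tendstoD(2)) auto
 moreover have "\<forall>\<^sub>F t in at_right (0::real). 0 < t & t < 1"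
  by (auto simp: eventually_at_right[of 0 1] intro: exI[of _ 1])
 ultimately have "\<exists>t. ?f t < 1 + ep & 0 < t & t < 1" by (intro eventually_happens'[OF _ eventually_conj]) auto
 then obtain t where t: "?f t < 1 + ep" "0 < t" "t < 1" by blast
 obtain r where r: "0 < r" "!!x u. norm u <= r ==> 1 + \<psi> (x + u) <= (1 + t) * (1 + \<psi> x)"
  using \<psi>_local_upper[OF t(2)] by blast
 define s where "s = r / real ?d"
 have d0: "0 < real ?d" by simp
 have s: "0 < s" "real ?d * s = r" using r d0 by (auto simp: s_def)
 define dl where "dl = t * s"
 have dl: "0 < dl" "dl < s" "s - dl = s * (1 - t)" using t s by (auto simp: dl_def algebra_simps)
 show thesis
 proof (rule that[of dl])
  show "0 < dl" by fact
  show "1 + \<psi> (x + u) <= 2 * (1 + \<psi> x)" if "norm u <= real ?d * dl" for x u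
  proof -
   have "real ?d * dl <= real ?d * s" using dl by (intro mult_left_mono) auto
   hence "1 + \<psi> (x + u) <= (1 + t) * (1 + \<psi> x)" using that s by (intro r) linarith
   also have "... <= 2 * (1 + \<psi> x)" using t by (intro mult_right_mono) (auto simp: less_imp_le)
   finally show ?thesis .
  qed
  fix h :: "int^'d => real" and Z A :: "(int^'d) set"
  assume h: "finite Z" "!!z. 0 <= h z" "!!z. z \<notin> Z ==> h z = 0" "finite A"
  let ?L = "dl ^ ?d * (\<Sum>l\<in>A. (\<Sum>z\<in>Z. h z * h (z + l)) ^ Suc n)"
  let ?S = "\<Sum>z\<in>Z. (h z)\<^sup>2 * (1 + \<psi> (lat dl z))"
  have S0: "0 <= ?S" by (intro sum_nonneg mult_nonneg_nonneg) (auto simp: less_imp_le)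
  have "dl ^ ?d * ((s - dl) ^ ?d) ^ Suc n * (\<Sum>l\<in>A. (\<Sum>z\<in>Z. h z * h (z + l)) ^ Suc n) <= \<rho> * ((1 + t) * s ^ ?d * ?S) ^ Suc n"
   using t s dl r h by (intro lattice_corr_bump) auto
  moreover have "dl ^ ?d * ((s - dl) ^ ?d) ^ Suc n * (\<Sum>l\<in>A. (\<Sum>z\<in>Z. h z * h (z + l)) ^ Suc n)
   = ((s ^ ?d) ^ Suc n * ((1 - t) ^ ?d) ^ Suc n) * ?L" unfolding dl(3) by (simp only: power_mult_distrib mult_ac)
  moreover have "\<rho> * ((1 + t) * s ^ ?d * ?S) ^ Suc n = ((s ^ ?d) ^ Suc n * ((1 - t) ^ ?d) ^ Suc n) * (?f t * \<rho> * ?S ^ Suc n)"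
   using t(3) by (simp add: power_divide power_mult_distrib mult_ac del: power_Suc)
  ultimately have "((s ^ ?d) ^ Suc n * ((1 - t) ^ ?d) ^ Suc n) * ?L <= ((s ^ ?d) ^ Suc n * ((1 - t) ^ ?d) ^ Suc n) * (?f t * \<rho> * ?S ^ Suc n)"
   by linarith
  moreover have "0 < (s ^ ?d) ^ Suc n * ((1 - t) ^ ?d) ^ Suc n" using s t by simp
  ultimately have "?L <= ?f t * \<rho> * ?S ^ Suc n" by (subst (asm) mult_le_cancel_left_pos)
  also have "... <= (1 + ep) * \<rho> * ?S ^ Suc n" using t(1) rho_pos S0 by (intro mult_right_mono) auto
  finally show "?L <= (1 + ep) * \<rho> * ?S ^ Suc n" .
 qed
qed

lemma Q_mult: "Q x * (1 + \<psi> x) = 1" using less_imp_neq[OF one_plus_\<psi>_pos[of x]] by (simp add: Q_def)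

definition symQ :: "nat => (nat => real^'d) => real" where
 "symQ m l = (\<Sum>sg | sg permutes {..<m}. \<Prod>k<m. Q (\<Sum>i\<le>k. l (sg i))) / fact m"

lemma symQ_nonneg: "0 <= symQ m l" unfolding symQ_def by (intro divide_nonneg_nonneg sum_nonneg prod_nonneg) auto

lemma card_permutations_lessThan: "card {sg. sg permutes {..<m::nat}} = fact m" by (rule card_permutations) auto

lemma symQ_permute:
 assumes \<tau>: "\<tau> permutes {..<m}" and l: "!!i. i < m ==> l i = l' (\<tau> i)"
 shows "symQ m l = symQ m l'"
proof -
 have "(\<Sum>sg | sg permutes {..<m}. \<Prod>k<m. Q (\<Sum>i\<le>k. l (sg i))) = (\<Sum>sg | sg permutes {..<m}. \<Prod>k<m. Q (\<Sum>i\<le>k. l' ((\<tau> \<circ> sg) i)))"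
 proof (intro sum.cong refl prod.cong arg_cong[where f = Q])
  fix sg k i assume "sg \<in> {sg. sg permutes {..<m}}" "k \<in> {..<m}" "i \<in> {..k}"
  hence "sg i < m" using permutes_in_image[of sg "{..<m}" i] by auto
  thus "l (sg i) = l' ((\<tau> \<circ> sg) i)" by (simp add: l)
 qed
 also have "... = (\<Sum>sg | sg permutes {..<m}. \<Prod>k<m. Q (\<Sum>i\<le>k. l' (sg i)))"
  by (rule setum_permutations_compose_left[OF \<tau>, symmetric])
 finally show ?thesis by (simp add: symQ_def)
qed

text \<open>Jensen for a uniformly random order. The power on \<open>Q\<close> becomes p, which
  changes the exponential rate of the sums; the result serves for finiteness and for the far part of
  the lattice.\<close>

lemma symQ_power_le: "symQ m l ^ Suc n <= (\<Sum>sg | sg permutes {..<m}. (\<Prod>k<m. Q (\<Sum>i\<le>k. l (sg i)) ^ Suc n)) / fact m"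
proof -
 let ?P = "{sg. sg permutes {..<m}}"
 have "symQ m l = (\<Sum>sg\<in>?P. 1 / fact m * (\<Prod>k<m. Q (\<Sum>i\<le>k. l (sg i))))"
  by (simp add: symQ_def sum_divide_distrib)
 also have "... ^ Suc n <= (\<Sum>sg\<in>?P. 1 / fact m * (\<Prod>k<m. Q (\<Sum>i\<le>k. l (sg i))) ^ Suc n)"
  by (intro jensen_power) (auto intro!: prod_nonneg simp: card_permutations_lessThan)
 also have "... = (\<Sum>sg | sg permutes {..<m}. (\<Prod>k<m. Q (\<Sum>i\<le>k. l (sg i)) ^ Suc n)) / fact m"
  by (simp add: prod_power_distrib sum_divide_distrib del: power_Suc)
 finally show ?thesis .
qed

text \<open>The weight is a product and the sum runs over all words, so every order contributes the
  same and the symmetrisation disappears. Pairing \<open>symQ\<close> with product weights thus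
  produces powers of a single operator.\<close>

lemma sum_symQ_times_prod:
 "(\<Sum>w\<in>PiE {..<m} (%_. A). symQ m (%i. lat dl (w i)) * (\<Prod>k<m. g (w k)))
  = (lattice_step A g (%z. Q (lat dl z)) ^^ m) (%_. 1) 0"
proof -
 let ?W = "PiE {..<m} (%_. A)"
 let ?f = "%w. \<Prod>k<m. g (w k) * Q (lat dl (\<Sum>i\<le>k. w i))"
 have latsum: "lat dl (sum f F) = (\<Sum>i\<in>F. lat dl (f i))" if "finite F" for f :: "nat => int^'d" and F
  using that by (induction F) (auto simp: lat_add)
 have each: "(\<Sum>w\<in>?W. (\<Prod>k<m. Q (\<Sum>i\<le>k. lat dl (w (sg i)))) * (\<Prod>k<m. g (w k))) = (\<Sum>w\<in>?W. ?f w)" if sg: "sg permutes {..<m}" for sg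
 proof -
  have "(\<Prod>k<m. Q (\<Sum>i\<le>k. lat dl (w (sg i)))) * (\<Prod>k<m. g (w k)) = ?f (\<lambda>i\<in>{..<m}. w (sg i))" for w
  proof -
   have "(\<Prod>k<m. g (w k)) = (\<Prod>k<m. g (w (sg k)))" using prod.permute[OF sg, of "%k. g (w k)"] by (simp add: comp_def)
   moreover have "(\<Prod>k<m. Q (\<Sum>i\<le>k. lat dl (w (sg i)))) = (\<Prod>k<m. Q (lat dl (\<Sum>i\<le>k. (\<lambda>i\<in>{..<m}. w (sg i)) i)))"
   by (intro prod.cong refl) (auto simp: latsum intro!: arg_cong[where f = Q] sum.cong)
   ultimately show ?thesis by (simp add: prod.distrib mult.commute)
  qed
  thus ?thesis using sum_PiE_permute[OF sg, of ?f A] by simp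
 qed
 have "(\<Sum>w\<in>?W. symQ m (%i. lat dl (w i)) * (\<Prod>k<m. g (w k)))
  = (\<Sum>w\<in>?W. \<Sum>sg | sg permutes {..<m}. (\<Prod>k<m. Q (\<Sum>i\<le>k. lat dl (w (sg i)))) * (\<Prod>k<m. g (w k)) / fact m)"
  by (simp add: symQ_def sum_divide_distrib sum_distrib_right)
 also have "... = (\<Sum>sg | sg permutes {..<m}. (\<Sum>w\<in>?W. (\<Prod>k<m. Q (\<Sum>i\<le>k. lat dl (w (sg i)))) * (\<Prod>k<m. g (w k))) / fact m)"
  by (subst sum.swap) (simp add: sum_divide_distrib)
 also have "... = (\<Sum>sg | sg permutes {..<m}. (\<Sum>w\<in>?W. ?f w) / fact m)" by (intro sum.cong refl) (simp add: each)
 also have "... = (\<Sum>w\<in>?W. ?f w)" by (simp add: card_permutations_lessThan)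
 finally show ?thesis
  using sum_lattice_walk[where m = m and A = A and g = g and q = "%z. Q (lat dl z)" and x = 0 and \<phi> = "%_. 1"] by simp
qed

lemma sum_symQ_power_le_walk:
 assumes "finite A"
 shows "(\<Sum>w\<in>PiE {..<m} (%_. A). symQ m (%i. lat dl (w i)) ^ Suc n)
  <= (lattice_step A (%_. 1) (%z. Q (lat dl z) ^ Suc n) ^^ m) (%_. 1) 0"
proof -
 let ?W = "PiE {..<m} (%_. A)"
 let ?f = "%w. \<Prod>k<m. Q (lat dl (\<Sum>i\<le>k. w i)) ^ Suc n"
 have latsum: "lat dl (sum f F) = (\<Sum>i\<in>F. lat dl (f i))" if "finite F" for f :: "nat => int^'d" and F
  using that by (induction F) (auto simp: lat_add)
 have each: "(\<Sum>w\<in>?W. (\<Prod>k<m. Q (\<Sum>i\<le>k. lat dl (w (sg i))) ^ Suc n)) = (\<Sum>w\<in>?W. ?f w)" if sg: "sg permutes {..<m}" for sg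
 proof -
  have "(\<Prod>k<m. Q (\<Sum>i\<le>k. lat dl (w (sg i))) ^ Suc n) = ?f (\<lambda>i\<in>{..<m}. w (sg i))" for w
   by (intro prod.cong refl) (auto simp: latsum simp del: power_Suc intro!: arg_cong[where f = "%x. Q x ^ Suc n"] sum.cong)
  thus ?thesis using sum_PiE_permute[OF sg, of ?f A] by simp
 qed
 have "(\<Sum>w\<in>?W. symQ m (%i. lat dl (w i)) ^ Suc n)
  <= (\<Sum>w\<in>?W. (\<Sum>sg | sg permutes {..<m}. (\<Prod>k<m. Q (\<Sum>i\<le>k. lat dl (w (sg i))) ^ Suc n)) / fact m)"
  by (intro sum_mono symQ_power_le)
 also have "... = (\<Sum>sg | sg permutes {..<m}. (\<Sum>w\<in>?W. (\<Prod>k<m. Q (\<Sum>i\<le>k. lat dl (w (sg i))) ^ Suc n)) / fact m)"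
  unfolding sum_divide_distrib by (rule sum.swap)
 also have "... = (\<Sum>sg | sg permutes {..<m}. (\<Sum>w\<in>?W. ?f w) / fact m)"
  by (intro sum.cong refl) (simp only: each mem_Collect_eq)
 also have "... = (\<Sum>w\<in>?W. ?f w)" by (simp add: card_permutations_lessThan)
 finally show ?thesis
  using sum_lattice_walk[where m = m and A = A and g = "%_. 1" and q = "%z. Q (lat dl z) ^ Suc n" and x = 0 and \<phi> = "%_. 1"] by (simp del: power_Suc)
qed

lemma eventually_poly_times_power_le:
 fixes x y :: real
 assumes "0 <= x" "x < y"
 shows "\<forall>\<^sub>F m in sequentially. C * (real m + 1) ^ k * x ^ m <= y ^ m"
proof (cases "x = 0")
 case True
 have "\<forall>\<^sub>F m in sequentially. 0 < (m::nat)" by (rule eventually_gt_at_top)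
 thus ?thesis by eventually_elim (use assms True in \<open>simp add: power_0_left\<close>)
next
 case False
 hence x: "0 < x" using assms by simp
 define z where "z = x / y"
 have z: "0 < z" "z < 1" using x assms by (auto simp: z_def)
 have "(%m. C * ((real m + 1) ^ k * z ^ m)) \<longlonglongrightarrow> C * 0" by (intro tendsto_intros) (use z in real_asymp)
 hence "\<forall>\<^sub>F m in sequentially. C * ((real m + 1) ^ k * z ^ m) < 1" by (intro order_tendstoD(2)) auto
 thus ?thesis
 proof eventually_elim
  case (elim m)
  have "C * ((real m + 1) ^ k * z ^ m) * y ^ m <= 1 * y ^ m" using elim assms x by (intro mult_right_mono) auto
  thus ?case using assms x by (simp add: z_def power_divide mult_ac)
 qed
qed

text \<open>The two estimates differ in quality. On \<open>A0\<close> the rate is sharp and rests on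
  duality over types; off \<open>A0\<close> the crude Jensen bound is used, and the smallness comes
  from the little mass that \<open>Q\<close> to the power p has outside a finite set.
  \<open>A0\<close> is a difference set because the letters are steps while the mass is located at
  positions.\<close>

lemma lattice_upper_bounds:
 assumes ep: "0 < ep"
 obtains dl and A0 :: "(int^'d) set" where "0 < dl" "finite A0" "!!z. z \<in> A0 ==> - z \<in> A0"
  "\<forall>\<^sub>F m in sequentially. dl ^ (CARD('d) * m) * (\<Sum>w\<in>PiE {..<m} (%_. A0). symQ m (%i. lat dl (w i)) ^ Suc n) <= ((1 + ep) * \<rho>) ^ m"
  "!!m B. [|even m; finite B; B \<inter> A0 = {}|] ==> dl ^ (CARD('d) * m) * (\<Sum>w\<in>PiE {..<m} (%_. B). symQ m (%i. lat dl (w i)) ^ Suc n) <= ep ^ m"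
proof -
 let ?d = "CARD('d)"
 obtain dl where dl: "0 < dl" and loc: "!!x u. norm u <= real ?d * dl ==> 1 + \<psi> (x + u) <= 2 * (1 + \<psi> x)"
  and corr: "!!h Z A. [|finite Z; !!z. 0 <= h z; !!z. z \<notin> Z ==> h z = 0; finite A|] ==>
   dl ^ ?d * (\<Sum>l\<in>A. (\<Sum>z\<in>Z. h z * h (z + l)) ^ Suc n)
   <= (1 + ep / 3) * \<rho> * (\<Sum>z\<in>Z. (h z)\<^sup>2 * (1 + \<psi> (lat dl z))) ^ Suc n"
  using lattice_corr_le[of "ep / 3"] ep by auto
 define D where "D = dl ^ ?d"
 have D: "0 < D" using dl by (simp add: D_def)
 define q where "q z = Q (lat dl z)" for z :: "int^'d"
 have q: "0 < q z" "q z <= 1" "q 0 = 1" for z by (simp_all add: q_def Q_le_1, simp add: Q_def)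
 \<comment> \<open>A Riemann sum bound: 1 + \<psi> grows by at most a factor 2 from a lattice point
   across its cell, which costs 2^p.\<close>
 define C where "C = 2 ^ Suc n * IQ / D"
 have Cb: "(\<Sum>z\<in>F. q z ^ Suc n) <= C" if F: "finite F" for F
 proof -
  have "ennreal (\<Sum>z\<in>F. q z ^ Suc n * dl ^ ?d) <= (NN x. ennreal (2 ^ Suc n * Q x ^ Suc n))"
  proof (rule sum_cells_le_nn_integral[OF dl F])
   fix l :: "int^'d" and x assume x: "x \<in> box (lat dl l) (lat dl l + cube_vec dl)"
   have "norm (x - lat dl l) <= real ?d * dl"
   proof (rule norm_le_cube)
   fix i show "\<bar>(x - lat dl l) $ i\<bar> <= dl" using x by (auto simp: mem_box_cart abs_le_iff dest!: spec[of _ i])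
   qed
   hence "1 + \<psi> x <= 2 * (1 + \<psi> (lat dl l))" using loc[of "x - lat dl l" "lat dl l"] by simp
   hence "1 / (1 + \<psi> (lat dl l)) <= 2 / (1 + \<psi> x)"
   using one_plus_\<psi>_pos[of x] one_plus_\<psi>_pos[of "lat dl l"] by (subst frac_le_eq) (auto simp del: one_plus_\<psi>_pos intro!: divide_nonpos_pos mult_pos_pos)
   hence "q l <= 2 * Q x" by (simp add: q_def Q_def)
   hence "q l ^ Suc n <= (2 * Q x) ^ Suc n" using q by (intro power_mono) (auto simp: less_imp_le)
   thus "ennreal (q l ^ Suc n) <= ennreal (2 ^ Suc n * Q x ^ Suc n)" by (intro ennreal_leI) (simp only: power_mult_distrib)
  qed (use q in \<open>auto simp: less_imp_le\<close>)
  also have "... = ennreal (2 ^ Suc n) * ennreal IQ"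
   by (subst nn_integral_Q[symmetric], subst nn_integral_cmult[symmetric]) (auto intro!: nn_integral_cong simp: ennreal_mult'[symmetric] simp del: power_Suc)
  also have "... = ennreal (2 ^ Suc n * IQ)" using IQ_pos by (intro ennreal_mult[symmetric]) auto
  finally have "(\<Sum>z\<in>F. q z ^ Suc n * dl ^ ?d) <= 2 ^ Suc n * IQ" using IQ_pos by (subst (asm) ennreal_le_iff) auto
  thus ?thesis using D unfolding C_def D_def by (simp add: sum_distrib_right[symmetric] le_divide_eq del: power_Suc)
 qed
 have C0: "0 < C" using IQ_pos D by (simp add: C_def)
 \<comment> \<open>Chosen so that two steps cost (ep / D)^2; the cell volume \<open>D\<close> then
   leaves ep per step.\<close>
 define \<eta> where "\<eta> = (ep / D)\<^sup>2 / (2 * C)"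
 have \<eta>0: "0 < \<eta>" using ep D C0 by (simp add: \<eta>_def)
 \<comment> \<open>The supremum over finite sets stands for the infinite sum, and a nearly optimal
   finite set leaves at most \<eta> outside.\<close>
 define SS where "SS = (%F. \<Sum>z\<in>F. q z ^ Suc n) ` {F. finite F}"
 have SSne: "SS ~= {}" by (auto simp: SS_def)
 have SSb: "bdd_above SS" unfolding SS_def by (intro bdd_aboveI2[of _ _ C] Cb) simp
 have "\<exists>y\<in>SS. Sup SS - \<eta> < y" using \<eta>0 SSne by (intro less_cSupD) auto
 then obtain G0 where G0: "finite G0" "Sup SS - \<eta> < (\<Sum>z\<in>G0. q z ^ Suc n)" by (auto simp: SS_def)
 have tailG: "(\<Sum>z\<in>F. q z ^ Suc n) <= \<eta>" if F: "finite F" "F \<inter> G0 = {}" for F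
 proof -
  have "(\<Sum>z\<in>F. q z ^ Suc n) + (\<Sum>z\<in>G0. q z ^ Suc n) = (\<Sum>z\<in>F \<union> G0. q z ^ Suc n)"
   using F G0 by (subst sum.union_disjoint) auto
  also have "... <= Sup SS" using F G0 by (intro cSup_upper SSb) (auto simp: SS_def)
  finally show ?thesis using G0(2) by linarith
 qed
 define A0 where "A0 = (%(x, y). x - y) ` (G0 \<times> G0)"
 have A0: "finite A0" unfolding A0_def using G0 by auto
 have A0sym: "- z \<in> A0" if "z \<in> A0" for z
 proof -
  obtain x y where "x \<in> G0" "y \<in> G0" "z = x - y" using \<open>z \<in> A0\<close> by (auto simp: A0_def)
  thus ?thesis unfolding A0_def by (intro image_eqI[where x = "(y, x)"]) auto
 qed
 show thesis
 proof (rule that[OF dl A0 A0sym])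
  fix m :: nat and B assume m: "even m" and B: "finite B" "B \<inter> A0 = {}"
  then obtain j where j: "m = 2 * j" by blast
  have "(\<Sum>w\<in>PiE {..<m} (%_. B). symQ m (%i. lat dl (w i)) ^ Suc n) <= (lattice_step B (%_. 1) (%z. q z ^ Suc n) ^^ m) (%_. 1) 0"
   unfolding q_def by (rule sum_symQ_power_le_walk[OF B(1)])
  also have "... <= (2 * C * \<eta>) ^ j" unfolding j
  proof (rule lattice_walk_two_steps[OF B(1) G0(1)])
   show "x - y \<notin> B" if "x \<in> G0" "y \<in> G0" for x y using that B(2) by (auto simp: A0_def)
  qed (use q Cb tailG in \<open>auto simp: less_imp_le\<close>)
  also have "2 * C * \<eta> = (ep / D)\<^sup>2" using C0 by (simp add: \<eta>_def)
  also have "((ep / D)\<^sup>2) ^ j = (ep / D) ^ m" by (simp add: j power_mult)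
  finally have "(\<Sum>w\<in>PiE {..<m} (%_. B). symQ m (%i. lat dl (w i)) ^ Suc n) <= (ep / D) ^ m" .
  hence "D ^ m * (\<Sum>w\<in>PiE {..<m} (%_. B). symQ m (%i. lat dl (w i)) ^ Suc n) <= D ^ m * (ep / D) ^ m"
   using D by (intro mult_left_mono) auto
  also have "... = ep ^ m" using D by (simp add: power_divide)
  finally show "dl ^ (?d * m) * (\<Sum>w\<in>PiE {..<m} (%_. B). symQ m (%i. lat dl (w i)) ^ Suc n) <= ep ^ m"
   by (simp add: D_def power_mult)
 next
  define kap where "kap = root (Suc n) ((1 + ep / 3) * \<rho> / D)"
  have arg: "0 < (1 + ep / 3) * \<rho> / D" using ep rho_pos D by (intro divide_pos_pos mult_pos_pos) auto
  have kap: "0 < kap" "kap ^ Suc n = (1 + ep / 3) * \<rho> / D"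
   unfolding kap_def using arg by (auto simp: real_root_gt_zero simp del: power_Suc)
  \<comment> \<open>Strictly above the form bound \<open>kap\<close>, as the resolvent argument
    requires, but with p-th power still below (1 + ep) \<rho> / D; the gap pays for the polynomial
    factors.\<close>
  define s where "s = root (Suc n) ((1 + ep / 2) * \<rho> / D)"
  have s: "kap < s" "s ^ Suc n = (1 + ep / 2) * \<rho> / D"
  proof -
   have lt: "(1 + ep / 3) * \<rho> / D < (1 + ep / 2) * \<rho> / D"
   using ep rho_pos D by (intro divide_strict_right_mono mult_strict_right_mono) auto
   thus "kap < s" unfolding kap_def s_def by (intro real_root_less_mono) auto
   show "s ^ Suc n = (1 + ep / 2) * \<rho> / D" unfolding s_def using arg lt by (simp del: power_Suc)
  qed
  \<comment> \<open>Summing over positions first gives, for each step l, the lattice autocorrelation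
    of h = u sqrt q. Its p-norm is controlled by \<rho>, and Hoelder against \<open>b l ^ n\<close>
    makes the bound uniform in b.\<close>
  have form: "(\<Sum>x\<in>U. u x * sym_step A0 (%l. b l ^ n) q u x) <= kap * (\<Sum>x\<in>U. (u x)\<^sup>2)"
   if b: "!!x. 0 <= b x" "(\<Sum>x\<in>A0. b x ^ Suc n) <= 1" and U: "finite U" and u: "!!x. 0 <= u x" "!!x. x \<notin> U ==> u x = 0" for b u :: "int^'d => real" and U
  proof (cases "\<forall>x\<in>U. u x = 0")
   case False
   define h where "h x = u x * sqrt (q x)" for x
   have h: "0 <= h x" "x \<notin> U ==> h x = 0" for x using u q by (auto simp: h_def less_imp_le)
   define S where "S = (\<Sum>x\<in>U. (u x)\<^sup>2)"
   have S: "0 < S" unfolding S_def using False U by (auto intro!: sum_pos2 simp: zero_less_power2)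
   have "(h x)\<^sup>2 * (1 + \<psi> (lat dl x)) = (u x)\<^sup>2" for x
   using Q_mult[of "lat dl x"] by (simp add: h_def q_def power_mult_distrib mult.assoc)
   hence "D * (\<Sum>l\<in>A0. (\<Sum>z\<in>U. h z * h (z + l)) ^ Suc n) <= (1 + ep / 3) * \<rho> * S ^ Suc n"
   using corr[where h = h and Z = U and A = A0, OF U h A0] by (simp add: D_def S_def del: power_Suc)
   hence F: "(\<Sum>l\<in>A0. (\<Sum>z\<in>U. h z * h (z + l)) ^ Suc n) <= (kap * S) ^ Suc n"
   unfolding power_mult_distrib kap using D by (simp add: le_divide_eq mult.commute del: power_Suc)
   have "(\<Sum>x\<in>U. u x * sym_step A0 (%l. b l ^ n) q u x) = (\<Sum>x\<in>U. \<Sum>l\<in>A0. (h x * h (x + l)) * b l ^ n)"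
   unfolding sym_step_def sum_distrib_left h_def by (intro sum.cong refl) (simp add: mult_ac)
   also have "... = (\<Sum>l\<in>A0. (\<Sum>x\<in>U. h x * h (x + l)) * b l ^ n)"
   by (subst sum.swap) (simp add: sum_distrib_right)
   also have "... <= kap * S" using h b F kap S by (intro hoelder_power_sum) (auto intro!: sum_nonneg)
   finally show ?thesis by (simp add: S_def)
  qed simp
  define K where "K = (exp 1 ^ card A0) ^ n * (1 / (s - kap)) ^ Suc n * (s ^ Suc n)"
  have bound: "D ^ m * (\<Sum>w\<in>PiE {..<m} (%_. A0). symQ m (%i. lat dl (w i)) ^ Suc n)
   <= K * (real m + 1) ^ (card A0 + card A0 * n + card A0 * Suc n) * ((1 + ep / 2) * \<rho>) ^ m" if m: "0 < m" for m
  proof -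
   \<comment> \<open>The growth estimate wants a finitely supported start function. After m steps
     the constant 1 agrees with the indicator of the reachable end points, and these are
     polynomially many because an end point depends only on the type of the word.\<close>
   define Y where "Y = (%w. \<Sum>i<m. w i) ` PiE {..<m} (%_. A0)"
   have Y: "finite Y" unfolding Y_def using A0 by (intro finite_imageI finite_PiE) auto
   have cY: "real (card Y) <= (real m + 1) ^ card A0"
   proof -
   have "Y \<subseteq> (%t. \<Sum>x\<in>A0. \<chi> i. int (t x) * x $ i) ` PiE A0 (%_. {..m})"
   proof
   fix y assume "y \<in> Y"
   then obtain w where w: "w \<in> PiE {..<m} (%_. A0)" "y = (\<Sum>i<m. w i)" by (auto simp: Y_def)
   have "y $ j = (\<Sum>x\<in>A0. int (word_type A0 m w x) * x $ j)" for j
   proof -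
   have "y $ j = (\<Sum>i<m. w i $ j)" using w by simp
   also have "... = (\<Sum>x\<in>A0. \<Sum>i | i \<in> {..<m} & w i = x. w i $ j)"
   using A0 w by (intro sum.group[symmetric]) (auto simp: PiE_iff)
   also have "... = (\<Sum>x\<in>A0. int (word_type A0 m w x) * x $ j)" by (intro sum.cong refl) (auto simp: word_type_def)
   finally show ?thesis .
   qed
   hence "y = (\<Sum>x\<in>A0. \<chi> i. int (word_type A0 m w x) * x $ i)" by (simp add: vec_eq_iff)
   thus "y \<in> (%t. \<Sum>x\<in>A0. \<chi> i. int (t x) * x $ i) ` PiE A0 (%_. {..m})"
   using word_type_mem[OF w(1)] by (intro image_eqI)
   qed
   hence "card Y <= card (PiE A0 (%_. {..m}))" using A0 by (intro surj_card_le finite_PiE) auto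
   also have "... = (m + 1) ^ card A0" using A0 by (simp add: card_PiE)
   finally have "real (card Y) <= real ((m + 1) ^ card A0)" by (rule of_nat_mono)
   thus ?thesis by (simp add: add.commute)
   qed
   define V where "V = s ^ Suc m * (real m + 1) ^ card A0 / (s - kap)"
   have s0: "0 < s" using s kap by linarith
   have "(\<Sum>w\<in>PiE {..<m} (%_. A0). symQ m (%i. lat dl (w i)) ^ Suc n)
   <= (real m + 1) ^ card A0 * ((exp 1 * (real m + 1)) ^ card A0) ^ n * V ^ Suc n"
   proof (rule sum_power_le_by_types[OF A0 m symQ_nonneg])
   fix w w' assume "w \<in> PiE {..<m} (%_. A0)" "w' \<in> PiE {..<m} (%_. A0)" "word_type A0 m w = word_type A0 m w'"
   then obtain sg where "sg permutes {..<m}" "!!i. i < m ==> w i = w' (sg i)" using word_type_permute[of w m A0 w'] by blast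
   thus "symQ m (%i. lat dl (w i)) = symQ m (%i. lat dl (w' i))" by (intro symQ_permute) auto
   next
   fix b :: "int^'d => real" assume b: "!!x. 0 <= b x" "(\<Sum>x\<in>A0. b x ^ Suc n) <= 1"
   let ?g = "%l. b l ^ n"
   have "(\<Sum>w\<in>PiE {..<m} (%_. A0). symQ m (%i. lat dl (w i)) * (\<Prod>k<m. b (w k) ^ n)) = (lattice_step A0 ?g q ^^ m) (%_. 1) 0"
   unfolding q_def by (rule sum_symQ_times_prod)
   also have "... = (lattice_step A0 ?g q ^^ m) (ind Y) 0"
   proof -
   have "(\<Sum>w\<in>PiE {..<m} (%_. A0). (\<Prod>k<m. ?g (w k) * q (0 + (\<Sum>i\<le>k. w i))) * 1)
   = (\<Sum>w\<in>PiE {..<m} (%_. A0). (\<Prod>k<m. ?g (w k) * q (0 + (\<Sum>i\<le>k. w i))) * ind Y (0 + (\<Sum>i<m. w i)))"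
   by (intro sum.cong refl) (auto simp: Y_def)
   thus ?thesis
   unfolding sum_lattice_walk[where m = m and A = A0 and g = ?g and q = q and x = 0 and \<phi> = "%_. 1", symmetric] sum_lattice_walk[where m = m and A = A0 and g = ?g and q = q and x = 0 and \<phi> = "ind Y", symmetric] .
   qed
   also have "... <= s ^ Suc m * sqrt (real (card Y)) / (s - kap)"
   using q b s s0 form[OF b] by (intro lattice_walk_growth A0 Y) (auto simp: less_imp_le)
   also have "... <= V" unfolding V_def
   proof (intro divide_right_mono mult_left_mono)
   have "sqrt (real (card Y)) <= real (card Y)" by (cases "card Y = 0") (auto simp: sqrt_le_D real_le_lsqrt self_le_power power2_eq_square intro!: real_le_lsqrt)
   thus "sqrt (real (card Y)) <= (real m + 1) ^ card A0" using cY by linarith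
   qed (use s s0 in auto)
   finally show "(\<Sum>w\<in>PiE {..<m} (%_. A0). symQ m (%i. lat dl (w i)) * (\<Prod>k<m. b (w k) ^ n)) <= V" .
   qed
   hence "D ^ m * (\<Sum>w\<in>PiE {..<m} (%_. A0). symQ m (%i. lat dl (w i)) ^ Suc n)
   <= D ^ m * ((real m + 1) ^ card A0 * ((exp 1 * (real m + 1)) ^ card A0) ^ n * V ^ Suc n)"
   using D by (intro mult_left_mono) auto
   also have "... = K * (real m + 1) ^ (card A0 + card A0 * n + card A0 * Suc n) * (D ^ m * (s ^ Suc n) ^ m)"
   unfolding V_def K_def by (simp add: power_mult_distrib power_divide power_add power_mult[symmetric] mult_ac)
   also have "D ^ m * (s ^ Suc n) ^ m = ((1 + ep / 2) * \<rho>) ^ m"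
   using D unfolding s(2) by (simp add: power_mult_distrib[symmetric])
   finally show ?thesis .
  qed
  have "\<forall>\<^sub>F m in sequentially. K * (real m + 1) ^ (card A0 + card A0 * n + card A0 * Suc n) * ((1 + ep / 2) * \<rho>) ^ m <= ((1 + ep) * \<rho>) ^ m"
   using ep rho_pos by (intro eventually_poly_times_power_le) auto
  thus "\<forall>\<^sub>F m in sequentially. dl ^ (?d * m) * (\<Sum>w\<in>PiE {..<m} (%_. A0). symQ m (%i. lat dl (w i)) ^ Suc n) <= ((1 + ep) * \<rho>) ^ m"
   using eventually_gt_at_top[of 0]
  proof eventually_elim
   case (elim m)
   thus ?case using bound[of m] by (simp add: D_def power_mult)
  qed
 qed
qed

end

section \<open>Time integrals over ordered time points\<close>

lemma PiM_density:
 assumes N: "sigma_finite_measure N" and N': "sigma_finite_measure (density N f)" and I: "finite I"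
  and f[measurable]: "f \<in> bm N"
 shows "PiM I (%_. density N f) = density (PiM I (%_. N)) (%x. \<Prod>i\<in>I. f (x i))"
proof (rule product_sigma_finite.PiM_eqI[OF product_sigma_finite_const[OF N'] I, symmetric])
 interpret product_sigma_finite "%_. N" by (rule product_sigma_finite_const[OF N])
 show "sets (density (PiM I (%_. N)) (%x. \<Prod>i\<in>I. f (x i))) = sets (PiM I (%_. density N f))"
  by (simp cong: sets_PiM_cong)
 fix A assume A: "!!i. i \<in> I ==> A i \<in> sets (density N f)"
 have "emeasure (density (PiM I (%_. N)) (%x. \<Prod>i\<in>I. f (x i))) (Pi\<^sub>E I A)
  = (\<integral>\<^sup>+x. (\<Prod>i\<in>I. f (x i)) * ind (Pi\<^sub>E I A) x \<partial>PiM I (%_. N))"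
  using A I by (intro emeasure_density) (auto intro!: sets_PiM_I_finite)
 also have "... = (\<integral>\<^sup>+x. (\<Prod>i\<in>I. f (x i) * ind (A i) (x i)) \<partial>PiM I (%_. N))"
 proof (rule nn_integral_cong)
  fix x assume "x \<in> space (PiM I (%_. N))"
  hence "ind (Pi\<^sub>E I A) x = (\<Prod>i\<in>I. ind (A i) (x i) :: ennreal)"
   using I by (auto simp: indicator_def PiE_iff space_PiM prod_zero_iff)
  thus "(\<Prod>i\<in>I. f (x i)) * ind (Pi\<^sub>E I A) x = (\<Prod>i\<in>I. f (x i) * ind (A i) (x i))"
   by (simp add: prod.distrib)
 qed
 also have "... = (\<Prod>i\<in>I. \<integral>\<^sup>+y. f y * ind (A i) y \<partial>N)"
  using A I by (intro product_nn_integral_prod) auto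
 also have "... = (\<Prod>i\<in>I. emeasure (density N f) (A i))" using A by (intro prod.cong refl) (simp add: emeasure_density)
 finally show "emeasure (density (PiM I (%_. N)) (%x. \<Prod>i\<in>I. f (x i))) (Pi\<^sub>E I A) = (\<Prod>i\<in>I. emeasure (density N f) (A i))" .
qed

text \<open>As \<open>h\<close> ignores coordinate \<open>k\<close>, the exceptional set is a graph
  over the other coordinates, hence null by Fubini.\<close>

lemma AE_PiM_lborel_neq:
 fixes h :: "('a => real) => real"
 assumes I: "finite I" "k \<in> I" and h[measurable]: "h \<in> bm (PiM I (%_. lborel))"
  and indep: "!!s y. h (s(k := y)) = h s"
 shows "AE s in PiM I (%_. lborel). s k ~= h s"
proof -
 interpret product_sigma_finite "%_::'a. lborel :: real measure" by (rule product_sigma_finite_lborel)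
 define J where "J = I - {k}"
 have IJ: "I = insert k J" "k \<notin> J" "finite J" using I by (auto simp: J_def)
 have k: "(%s. s k) \<in> bm (PiM I (%_. lborel :: real measure))"
  using measurable_component_singleton[OF I(2), of "%_. lborel :: real measure"] by simp
 have "ind {s \<in> space (PiM I (%_. lborel)). s k = h s} \<in> bm (PiM I (%_. lborel))"
  by (intro borel_measurable_indicator borel_measurable_eq k h)
 hence m: "(%s. ind {s. s k = h s} s :: ennreal) \<in> bm (PiM I (%_. lborel))"
  by (rule measurable_cong[THEN iffD1, rotated]) (auto simp: indicator_def)
 have "(\<integral>\<^sup>+s. ind {s. s k = h s} s \<partial>PiM I (%_. lborel)) = (\<integral>\<^sup>+s. (NN y. ind {s. s k = h s} (s(k := y))) \<partial>PiM J (%_. lborel))"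
  using m unfolding IJ(1) by (intro product_nn_integral_insert IJ)
 also have "... = (\<integral>\<^sup>+s. (NN y. ind {h s} y) \<partial>PiM J (%_. lborel))"
  by (intro nn_integral_cong) (simp add: indep indicator_def)
 also have "... = 0" by simp
 finally have "AE s in PiM I (%_. lborel). (ind {s. s k = h s} s :: ennreal) = 0"
  using m by (subst (asm) nn_integral_0_iff_AE) auto
 thus ?thesis by eventually_elim (auto simp: indicator_def split: if_splits)
qed

text \<open>The exponential weight of a gap between consecutive times. Its vanishing on nonpositive
  gaps encodes the ordering, so integrals can run over the whole product space.\<close>

definition kern :: "real => real => real" where "kern c u = (if 0 < u then exp (- (c * u)) else 0)"

lemma kern_nonneg[simp]: "0 <= kern c u" by (simp add: kern_def)
lemma kern_measurable[measurable]: "(%p. kern (fst p) (snd p)) \<in> bm (borel \<Otimes>\<^sub>M borel)"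
 unfolding kern_def by measurable
lemma kern_measurable2[measurable (raw)]:
 assumes [measurable]: "f \<in> bm M" "g \<in> bm M"
 shows "(%x. kern (f x) (g x)) \<in> bm M" unfolding kern_def by measurable
lemma kern_scale: "0 < t ==> kern c (t * u) = kern (t * c) u" by (simp add: kern_def zero_less_mult_iff mult_ac)
lemma kern_add: "kern (a + c) u = exp (- (a * u)) * kern c u" by (simp add: kern_def exp_add[symmetric] algebra_simps)

lemma nn_integral_kern:
 assumes b: "0 < b"
 shows "(NN y. ennreal (kern b (y - a))) = ennreal (1 / b)"
proof -
 have "(NN y. ennreal (kern b (y - a))) = (NN y. ennreal (kern b (y - a)) * ind {a..} y)"
  by (intro nn_integral_cong) (auto simp: kern_def split: split_indicator)
 also have "... = (NN y. ennreal (exp (- (b * (y - a)))) * ind {a..} y)"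
 proof (rule nn_integral_cong_AE)
  have "AE y in lborel. y ~= a" by (rule AE_lborel_singleton)
  thus "AE y in lborel. ennreal (kern b (y - a)) * ind {a..} y = ennreal (exp (- (b * (y - a)))) * ind {a..} y"
   by eventually_elim (auto simp: kern_def split: split_indicator)
 qed
 also have "... = ennreal (0 - (- exp (- (b * (a - a))) / b))"
 proof (rule nn_integral_FTC_atLeast[where F = "%y. - exp (- (b * (y - a))) / b" and T = 0 and a = a])
  show "((%y. - exp (- (b * (y - a))) / b) has_real_derivative exp (- (b * (y - a)))) (at y)" for y
   using b by (auto intro!: derivative_eq_intros)
  show "((%y. - exp (- (b * (y - a))) / b) \<longlongrightarrow> 0) at_top" using b by real_asymp
 qed auto
 finally show ?thesis using b by simp
qed

text \<open>\<open>chain m s j\<close> is the successor of the time \<open>s j\<close> in \<open>s 0 > s 1 > \<dots> > s (m - 1) > 0\<close>.\<close>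

definition chain :: "nat => (nat => real) => nat => real" where "chain m s j = (if Suc j < m then s (Suc j) else 0)"

lemma chain_measurable:
 "j \<in> I ==> {j..<m} \<subseteq> I ==> (%s. chain m s j) \<in> bm (PiM I (%_. lborel))"
proof -
 assume "j \<in> I" "{j..<m} \<subseteq> I"
 hence "Suc j < m ==> (%s. s (Suc j)) \<in> bm (PiM I (%_. lborel))"
  using measurable_component_singleton[of "Suc j" I "%_. lborel :: real measure"] by (auto simp: subset_iff)
 thus ?thesis unfolding chain_def by (cases "Suc j < m") auto
qed

text \<open>The largest time occurs in one factor only. Integrating it first gives a constant
  whatever its successor is, and the same situation with one time fewer remains.\<close>

lemma nn_integral_chain:
 fixes b :: "nat => real"
 assumes b: "!!j. 0 < b j" and "k <= m"
 shows "(\<integral>\<^sup>+s. (\<Prod>j\<in>{k..<m}. ennreal (kern (b j) (s j - chain m s j))) \<partial>PiM {k..<m} (%_. lborel)) = (\<Prod>j\<in>{k..<m}. ennreal (1 / b j))"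
 using \<open>k <= m\<close>
proof (induction k rule: inc_induct)
 case base
 interpret product_sigma_finite "%_::nat. lborel :: real measure" by (rule product_sigma_finite_lborel)
 show ?case by (simp add: PiM_empty nn_integral_count_space_finite)
next
 case (step k)
 interpret product_sigma_finite "%_::nat. lborel :: real measure" by (rule product_sigma_finite_lborel)
 have ins: "{k..<m} = insert k {Suc k..<m}" using step by auto
 have m1: "(%s. \<Prod>j\<in>{k..<m}. ennreal (kern (b j) (s j - chain m s j))) \<in> bm (PiM {k..<m} (%_. lborel))"
 proof (rule borel_measurable_prod_ennreal)
  fix j assume j: "j \<in> {k..<m}"
  hence [measurable]: "(%s. s j) \<in> bm (PiM {k..<m} (%_. lborel))" "(%s. chain m s j) \<in> bm (PiM {k..<m} (%_. lborel))"
   using measurable_component_singleton[OF j, of "%_. lborel"] chain_measurable[OF j, of m] by (auto simp: subset_iff)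
  show "(%s. ennreal (kern (b j) (s j - chain m s j))) \<in> bm (PiM {k..<m} (%_. lborel))" by measurable
 qed
 have "(\<integral>\<^sup>+s. (\<Prod>j\<in>{k..<m}. ennreal (kern (b j) (s j - chain m s j))) \<partial>PiM {k..<m} (%_. lborel))
  = (\<integral>\<^sup>+s. (NN y. (\<Prod>j\<in>{k..<m}. ennreal (kern (b j) ((s(k := y)) j - chain m (s(k := y)) j)))) \<partial>PiM {Suc k..<m} (%_. lborel))"
  using m1 unfolding ins by (intro product_nn_integral_insert) auto
 also have "... = (\<integral>\<^sup>+s. ennreal (1 / b k) * (\<Prod>j\<in>{Suc k..<m}. ennreal (kern (b j) (s j - chain m s j))) \<partial>PiM {Suc k..<m} (%_. lborel))"
 proof (rule nn_integral_cong)
  fix s :: "nat => real"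
  have "(\<Prod>j\<in>{k..<m}. ennreal (kern (b j) ((s(k := y)) j - chain m (s(k := y)) j)))
   = ennreal (kern (b k) (y - chain m s k)) * (\<Prod>j\<in>{Suc k..<m}. ennreal (kern (b j) (s j - chain m s j)))" for y
  proof -
   have "(\<Prod>j\<in>{Suc k..<m}. ennreal (kern (b j) ((s(k := y)) j - chain m (s(k := y)) j))) = (\<Prod>j\<in>{Suc k..<m}. ennreal (kern (b j) (s j - chain m s j)))"
   by (intro prod.cong refl) (auto simp: chain_def)
   thus ?thesis unfolding ins by (simp add: chain_def)
  qed
  thus "(NN y. (\<Prod>j\<in>{k..<m}. ennreal (kern (b j) ((s(k := y)) j - chain m (s(k := y)) j))))
   = ennreal (1 / b k) * (\<Prod>j\<in>{Suc k..<m}. ennreal (kern (b j) (s j - chain m s j)))"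
   using nn_integral_kern[OF b[of k], of "chain m s k"] by (simp add: nn_integral_multc)
 qed
 also have "... = ennreal (1 / b k) * (\<integral>\<^sup>+s. (\<Prod>j\<in>{Suc k..<m}. ennreal (kern (b j) (s j - chain m s j))) \<partial>PiM {Suc k..<m} (%_. lborel))"
 proof (rule nn_integral_cmult, rule borel_measurable_prod_ennreal)
  fix j assume j: "j \<in> {Suc k..<m}"
  hence [measurable]: "(%s. s j) \<in> bm (PiM {Suc k..<m} (%_. lborel))" "(%s. chain m s j) \<in> bm (PiM {Suc k..<m} (%_. lborel))"
   using measurable_component_singleton[OF j, of "%_. lborel"] chain_measurable[OF j, of m] by (auto simp: subset_iff)
  show "(%s. ennreal (kern (b j) (s j - chain m s j))) \<in> bm (PiM {Suc k..<m} (%_. lborel))" by measurable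
 qed
 also have "... = (\<Prod>j\<in>{k..<m}. ennreal (1 / b j))" unfolding step.IH ins by simp
 finally show ?case .
qed

definition chain_weight :: "nat => (nat => real) => (nat => real) => ennreal" where
 "chain_weight m c s = (\<Prod>j<m. ennreal (kern (c j) (s j - chain m s j)))"

lemma chain_weight_measurable[measurable]: "chain_weight m c \<in> bm (PiM {..<m} (%_. lborel))" unfolding chain_weight_def
proof (rule borel_measurable_prod_ennreal)
 fix j assume j: "j \<in> {..<m}"
 hence [measurable]: "(%s. s j) \<in> bm (PiM {..<m} (%_. lborel))" "(%s. chain m s j) \<in> bm (PiM {..<m} (%_. lborel))"
  using measurable_component_singleton[OF j, of "%_. lborel"] chain_measurable[OF j, of m] by (auto simp: subset_iff)
 show "(%s. ennreal (kern (c j) (s j - chain m s j))) \<in> bm (PiM {..<m} (%_. lborel))" by measurable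
qed

lemma nn_integral_chain_weight:
 assumes "!!j. 0 < b j"
 shows "(\<integral>\<^sup>+s. chain_weight m b s \<partial>PiM {..<m} (%_. lborel)) = ennreal (\<Prod>j<m. 1 / b j)"
 using nn_integral_chain[of b 0 m, OF assms] assms by (simp add: chain_weight_def atLeast0LessThan prod_ennreal less_imp_le)

lemma chain_sum: "0 < m ==> (\<Sum>j<m. s j - chain m s j) = s 0"
proof -
 assume m: "0 < m"
 have "(\<Sum>j<m. s j - chain m s j) = (\<Sum>j<m. (if j < m then s j else 0) - (if Suc j < m then s (Suc j) else 0))"
  by (intro sum.cong) (auto simp: chain_def)
 also have "... = (if 0 < m then s 0 else 0) - (if m < m then s m else 0)" by (rule sum_lessThan_telescope')
 finally show ?thesis using m by simp
qed

text \<open>The gaps telescope to the largest time \<open>s 0\<close>, so adding a constant to all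
  rates amounts to a discount in \<open>s 0\<close> alone. Exponential Chebyshev and the Laplace
  transform below both use this.\<close>

lemma chain_weight_add: "0 < m ==> chain_weight m (%j. a + c j) s = ennreal (exp (- (a * s 0))) * chain_weight m c s"
proof -
 assume m: "0 < m"
 have "(\<Prod>j<m. ennreal (exp (- (a * (s j - chain m s j))))) = ennreal (exp (\<Sum>j<m. - (a * (s j - chain m s j))))"
  by (simp add: prod_ennreal exp_sum)
 also have "(\<Sum>j<m. - (a * (s j - chain m s j))) = - (a * s 0)"
  by (simp only: sum_negf sum_distrib_left[symmetric] chain_sum[OF m])
 finally show ?thesis unfolding chain_weight_def kern_add by (simp add: ennreal_mult prod.distrib)
qed

lemma chain_weight_scale:
 assumes t: "0 < t"
 shows "chain_weight m c (\<lambda>i\<in>{..<m}. t *\<^sub>R s i) = chain_weight m (%j. t * c j) s" unfolding chain_weight_def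
proof (intro prod.cong refl)
 fix j assume "j \<in> {..<m}"
 hence "(\<lambda>i\<in>{..<m}. t *\<^sub>R s i) j - chain m (\<lambda>i\<in>{..<m}. t *\<^sub>R s i) j = t * (s j - chain m s j)"
  by (auto simp: chain_def algebra_simps)
 thus "ennreal (kern (c j) ((\<lambda>i\<in>{..<m}. t *\<^sub>R s i) j - chain m (\<lambda>i\<in>{..<m}. t *\<^sub>R s i) j)) = ennreal (kern (t * c j) (s j - chain m s j))"
  using t by (simp only: kern_scale)
qed

text \<open>The constraint concerns \<open>s 0\<close> only, because the weight vanishes unless
  \<open>s 0\<close> is the largest time and all times are positive.\<close>

definition time_integral :: "nat => real => (nat => real) => ennreal" where
 "time_integral m t c = (\<integral>\<^sup>+s. ind {..t} (s 0) * chain_weight m c s \<partial>PiM {..<m} (%_. lborel))"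

lemma first_measurable: "0 < m ==> (%s. s 0) \<in> bm (PiM {..<m::nat} (%_. lborel :: real measure))"
 using measurable_component_singleton[of 0 "{..<m}" "%_. lborel :: real measure"] by simp

text \<open>On \<open>s 0 \<le> 1\<close> the factor exp(T) exp(- T s 0) is at least 1, and once the
  constraint is gone the gaps integrate independently. T stays free and is optimised in
  \<open>scaling_constant_le\<close>.\<close>

lemma time_integral_le:
 assumes m: "0 < m" and T: "0 < T" and c: "!!j. 0 <= c j"
 shows "time_integral m 1 c <= ennreal (exp T * (\<Prod>j<m. 1 / (T + c j)))"
proof -
 note [measurable] = first_measurable[OF m]
 have "time_integral m 1 c <= (\<integral>\<^sup>+s. ennreal (exp T) * chain_weight m (%j. T + c j) s \<partial>PiM {..<m} (%_. lborel))"
  unfolding time_integral_def chain_weight_add[OF m]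
 proof (rule nn_integral_mono)
  fix s
  show "ind {..1} (s 0) * chain_weight m c s <= ennreal (exp T) * (ennreal (exp (- (T * s 0))) * chain_weight m c s)"
  proof (cases "s 0 <= 1")
   case True
   hence "T * s 0 <= T * 1" using T by (intro mult_left_mono) auto
   hence "1 <= exp T * exp (- (T * s 0))" by (simp add: exp_add[symmetric])
   hence "ennreal 1 <= ennreal (exp T) * ennreal (exp (- (T * s 0)))"
   by (subst ennreal_mult[symmetric]) (auto intro!: ennreal_leI simp del: ennreal_1)
   hence "1 * chain_weight m c s <= ennreal (exp T) * ennreal (exp (- (T * s 0))) * chain_weight m c s"
   by (intro mult_right_mono) auto
   thus ?thesis using True by (simp add: mult.assoc)
  qed simp
 qed
 also have "... = ennreal (exp T) * ennreal (\<Prod>j<m. 1 / (T + c j))"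
  using T c by (subst nn_integral_cmult, measurable) (subst nn_integral_chain_weight, auto intro: add_pos_nonneg)
 also have "... = ennreal (exp T * (\<Prod>j<m. 1 / (T + c j)))"
  using T c by (intro ennreal_mult[symmetric]) (auto intro!: prod_nonneg add_nonneg_nonneg)
 finally show ?thesis .
qed

lemma time_integral_scale:
 assumes m: "0 < m" and t: "0 < t"
 shows "time_integral m t c = ennreal (t ^ m) * time_integral m 1 (%j. t * c j)"
proof -
 note [measurable] = first_measurable[OF m]
 have "time_integral m t c = ennreal (t ^ (DIM(real) * card {..<m})) * (\<integral>\<^sup>+s. ind {..t} ((\<lambda>i\<in>{..<m}. t *\<^sub>R s i) 0) * chain_weight m c (\<lambda>i\<in>{..<m}. t *\<^sub>R s i) \<partial>PiM {..<m} (%_. lborel))"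
  unfolding time_integral_def by (rule nn_integral_PiM_scale) (use t in measurable)
 also have "(\<integral>\<^sup>+s. ind {..t} ((\<lambda>i\<in>{..<m}. t *\<^sub>R s i) 0) * chain_weight m c (\<lambda>i\<in>{..<m}. t *\<^sub>R s i) \<partial>PiM {..<m} (%_. lborel)) = time_integral m 1 (%j. t * c j)"
  unfolding time_integral_def chain_weight_scale[OF t]
  using t m by (intro nn_integral_cong arg_cong2[where f = "(*)"]) (auto simp: indicator_def mult_le_cancel_left1)
 finally show ?thesis by simp
qed

lemma exp_tail:
 fixes a :: real
 shows "(%t. ennreal (exp (- t)) * ind {a..} t) \<in> bm lborel"
  and "(NN t. ennreal (exp (- t)) * ind {a..} t) = ennreal (exp (- a))"
proof -
 show "(%t. ennreal (exp (- t)) * ind {a..} t) \<in> bm lborel" by measurable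
 have "(NN t. ennreal (exp (- t)) * ind {a..} t) = ennreal (0 - (- exp (- a)))"
 proof (rule nn_integral_FTC_atLeast[where F = "%t. - exp (- t)" and T = 0 and a = a])
  show "((%t. - exp (- t)) has_real_derivative exp (- t)) (at t)" for t :: real by (auto intro!: derivative_eq_intros)
  show "((%t::real. - exp (- t)) \<longlongrightarrow> 0) at_top" by real_asymp
 qed auto
 thus "(NN t. ennreal (exp (- t)) * ind {a..} t) = ennreal (exp (- a))" by simp
qed

text \<open>Averaging over an exponential time turns the constraint \<open>s 0 \<le> t\<close> into
  exp(- s 0), that is, into an extra rate 1 on every gap. The integral then factorises, with
  \<open>Q\<close> as the factor of a gap.\<close>

lemma laplace_time_integral:
 assumes m: "0 < m" and c: "!!j. 0 <= c j"
 shows "(NN t. ennreal (exp (- t)) * ind {0..} t * time_integral m t c) = ennreal (\<Prod>j<m. 1 / (1 + c j))"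
proof -
 note [measurable] = first_measurable[OF m]
 interpret product_sigma_finite "%_::nat. lborel :: real measure" by (rule product_sigma_finite_lborel)
 interpret P: sigma_finite_measure "PiM {..<m} (%_. lborel :: real measure)" by (rule sigma_finite) simp
 interpret PP: pair_sigma_finite "PiM {..<m} (%_. lborel :: real measure)" "lborel :: real measure" ..
 have "(NN t. ennreal (exp (- t)) * ind {0..} t * time_integral m t c)
  = (NN t. (\<integral>\<^sup>+s. ennreal (exp (- t)) * ind {0..} t * (ind {..t} (s 0) * chain_weight m c s) \<partial>PiM {..<m} (%_. lborel)))"
  unfolding time_integral_def by (intro nn_integral_cong nn_integral_cmult[symmetric]) measurable
 also have "... = (\<integral>\<^sup>+s. (NN t. ennreal (exp (- t)) * ind {0..} t * (ind {..t} (s 0) * chain_weight m c s)) \<partial>PiM {..<m} (%_. lborel))"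
 proof (rule PP.Fubini')
  have "(%(s, t). ennreal (exp (- t)) * ind {0..} t * ((if s 0 <= t then 1 else 0) * chain_weight m c s)) \<in> bm (PiM {..<m} (%_. lborel) \<Otimes>\<^sub>M lborel)"
   by measurable
  moreover have "(%(s, t). ennreal (exp (- t)) * ind {0..} t * (ind {..t} (s 0) * chain_weight m c s)) = (%(s, t). ennreal (exp (- t)) * ind {0..} t * ((if s 0 <= t then 1 else 0) * chain_weight m c s))"
   by (auto simp: fun_eq_iff indicator_def)
  ultimately show "(%(s, t). ennreal (exp (- t)) * ind {0..} t * (ind {..t} (s 0) * chain_weight m c s)) \<in> bm (PiM {..<m} (%_. lborel) \<Otimes>\<^sub>M lborel)"
   by simp
 qed
 also have "... = (\<integral>\<^sup>+s. chain_weight m (%j. 1 + c j) s \<partial>PiM {..<m} (%_. lborel))"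
 proof (rule nn_integral_cong)
  fix s :: "nat => real"
  show "(NN t. ennreal (exp (- t)) * ind {0..} t * (ind {..t} (s 0) * chain_weight m c s)) = chain_weight m (%j. 1 + c j) s"
  proof (cases "chain_weight m c s = 0")
   case True
   thus ?thesis by (simp add: chain_weight_add[OF m])
  next
   case False
   hence "0 < s j - chain m s j" if "j < m" for j
   using that by (auto simp: chain_weight_def kern_def prod_zero_iff split: if_splits)
   hence "0 <= (\<Sum>j<m. s j - chain m s j)" by (intro sum_nonneg) (auto intro: less_imp_le)
   hence s0: "0 <= s 0" by (simp add: chain_sum[OF m])
   have "(NN t. ennreal (exp (- t)) * ind {0..} t * (ind {..t} (s 0) * chain_weight m c s))
   = (NN t. (ennreal (exp (- t)) * ind {s 0..} t) * chain_weight m c s)"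
   using s0 by (intro nn_integral_cong) (auto simp: indicator_def)
   also have "... = (NN t. ennreal (exp (- t)) * ind {s 0..} t) * chain_weight m c s"
   by (rule nn_integral_multc) (rule exp_tail)
   also have "(NN t. ennreal (exp (- t)) * ind {s 0..} t) = ennreal (exp (- s 0))" by (rule exp_tail)
   finally show ?thesis by (simp add: chain_weight_add[OF m, of 1])
  qed
 qed
 also have "... = ennreal (\<Prod>j<m. 1 / (1 + c j))" using c by (intro nn_integral_chain_weight) (auto intro: add_pos_nonneg)
 finally show ?thesis .
qed

section \<open>Decomposition by the order of the times\<close>

lemma ex_decreasing_permutation:
 fixes s :: "nat => real"
 assumes inj: "inj_on s {..<m}"
 obtains sg where "sg permutes {..<m}" "!!i j. i < j ==> j < m ==> s (sg j) < s (sg i)"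
proof -
 define xs where "xs = map s [0..<m]"
 define ys where "ys = rev (sort xs)"
 have "mset ys = mset xs" by (simp add: ys_def)
 then obtain p where p: "p permutes {..<length xs}" "permute_list p xs = ys" by (rule mset_eq_permutation)
 have len: "length xs = m" "length ys = m" by (simp_all add: xs_def ys_def)
 have ysn: "ys ! i = s (p i)" if "i < m" for i
 proof -
  have "ys ! i = xs ! p i" using p that len by (metis permute_list_nth)
  moreover have "p i < m" using permutes_in_image[OF p(1), of i] that len by simp
  ultimately show ?thesis by (simp add: xs_def)
 qed
 have "distinct xs" using inj by (simp add: xs_def distinct_map atLeast0LessThan)
 hence dis: "distinct ys" by (simp add: ys_def)
 have "s (p j) < s (p i)" if ij: "i < j" "j < m" for i j
 proof -
  have "sorted (rev ys)" by (simp add: ys_def)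
  hence "ys ! j <= ys ! i" using ij len by (auto simp: sorted_rev_nth_mono)
  moreover have "ys ! j ~= ys ! i" using dis ij len by (simp add: nth_eq_iff_index_eq)
  ultimately show ?thesis using ij by (simp add: ysn)
 qed
 thus thesis using p(1) len that by simp
qed

text \<open>The quotient of two decreasing rearrangements is a strictly increasing permutation of an
  initial segment, hence the identity.\<close>

lemma unique_decreasing_permutation:
 fixes s :: "nat => real"
 assumes sg: "sg permutes {..<m}" "!!i j. i < j ==> j < m ==> s (sg j) < s (sg i)"
  and \<tau>: "\<tau> permutes {..<m}" "!!i j. i < j ==> j < m ==> s (\<tau> j) < s (\<tau> i)"
 shows "sg = \<tau>"
proof -
 define \<pi> where "\<pi> = inv \<tau> \<circ> sg"
 have \<pi>: "\<pi> permutes {..<m}" unfolding \<pi>_def by (intro permutes_compose sg permutes_inv \<tau>)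
 have \<tau>\<pi>: "\<tau> (\<pi> i) = sg i" for i by (simp add: \<pi>_def permutes_inverses[OF \<tau>(1)])
 have lt: "\<pi> i < m" if "i < m" for i using permutes_in_image[OF \<pi>, of i] that by simp
 have mono: "\<pi> i < \<pi> j" if "i < j" "j < m" for i j
 proof (rule ccontr)
  assume "~ \<pi> i < \<pi> j"
  then consider "\<pi> i = \<pi> j" | "\<pi> j < \<pi> i" by linarith
  thus False
  proof cases
   case 1
   thus False using sg(2)[OF that] \<tau>\<pi>[of i] \<tau>\<pi>[of j] by simp
  next
   case 2
   hence "s (\<tau> (\<pi> i)) < s (\<tau> (\<pi> j))" using \<tau>(2)[of "\<pi> j" "\<pi> i"] lt[of i] that by simp
   thus False using sg(2)[OF that] by (simp add: \<tau>\<pi>)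
  qed
 qed
 have ge: "i <= \<pi> i" if "i < m" for i using that
 proof (induction i)
  case (Suc i)
  thus ?case using mono[of i "Suc i"] by simp
 qed simp
 have le: "\<pi> (m - Suc i) <= m - Suc i" if "i < m" for i using that
 proof (induction i)
  case 0
  thus ?case using lt[of "m - 1"] by simp
 next
  case (Suc i)
  have "m - Suc (Suc i) < m - Suc i" "m - Suc i < m" using Suc by auto
  from mono[OF this] show ?case using Suc by simp
 qed
 have "\<pi> i = i" for i
 proof (cases "i < m")
  case True
  thus ?thesis using ge[of i] le[of "m - Suc i"] by simp
 next
  case False
  thus ?thesis using permutes_not_in[OF \<pi>, of i] by simp
 qed
 thus ?thesis using \<tau>\<pi> by (metis ext)
qed

lemma chain_weight_nonzeroD:
 assumes "chain_weight m c s ~= 0"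
 shows "!!i j. i < j ==> j < m ==> s j < s i" "!!i. i < m ==> 0 < s i"
proof -
 have *: "0 < s j - chain m s j" if "j < m" for j
  using that assms by (auto simp: chain_weight_def kern_def prod_zero_iff split: if_splits)
 have step: "s (Suc i) < s i" if "Suc i < m" for i using *[of i] that by (simp add: chain_def)
 show dec: "s j < s i" if "i < j" "j < m" for i j using that
 proof (induction j)
  case (Suc j)
  thus ?case using step[of j] by (cases "i = j") auto
 qed simp
 have last: "0 < s (m - 1)" if "0 < m" using *[of "m - 1"] that by (simp add: chain_def)
 show "0 < s i" if "i < m" for i
 proof (cases "i = m - 1")
  case False
  thus ?thesis using dec[of i "m - 1"] last that by (simp add: order_less_trans)
 qed (use last that in auto)
qed

lemma chain_weight_decreasing:
 assumes "!!i j. i < j ==> j < m ==> s j < s i" "!!i. i < m ==> 0 < s i"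
 shows "chain_weight m c s = ennreal (\<Prod>j<m. exp (- (c j * (s j - chain m s j))))"
proof -
 have "0 < s j - chain m s j" if "j < m" for j using assms that by (auto simp: chain_def)
 thus ?thesis by (simp add: chain_weight_def kern_def prod_ennreal[symmetric])
qed

text \<open>Exactly one permutation sorts distinct times; in every other term some gap is not
  positive and the weight vanishes. The rates \<open>c\<close> depend on the permutation because
  they will be \<psi> at partial sums taken in sorted order.\<close>

lemma ordered_decomposition:
 fixes \<phi> :: "(nat => real) => real" and c :: "(nat => nat) => nat => real"
 assumes m: "0 < m" and s: "inj_on s {..<m}" "!!i. i < m ==> s i ~= 0"
  and \<phi>: "!!sg. [|sg permutes {..<m}; !!i j. i < j ==> j < m ==> s (sg j) < s (sg i); !!i. i < m ==> 0 < s i|] ==>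
   \<phi> s = (\<Prod>j<m. exp (- (c sg j * (s (sg j) - chain m (\<lambda>i\<in>{..<m}. s (sg i)) j))))"
 shows "ennreal (\<phi> s) * (\<Prod>i<m. ind {0..1} (s i)) = (\<Sum>sg | sg permutes {..<m}. ind {..1} ((\<lambda>i\<in>{..<m}. s (sg i)) 0) * chain_weight m (c sg) (\<lambda>i\<in>{..<m}. s (sg i)))"
proof -
 let ?s = "%sg. \<lambda>i\<in>{..<m}. s (sg i)"
 obtain sg where sg: "sg permutes {..<m}" "!!i j. i < j ==> j < m ==> s (sg j) < s (sg i)"
  using ex_decreasing_permutation[OF s(1)] by blast
 have im: "\<tau> i < m \<longleftrightarrow> i < m" if "\<tau> permutes {..<m}" for \<tau> i using permutes_in_image[OF that, of i] by simp
 have other: "chain_weight m (c \<tau>) (?s \<tau>) = 0" if \<tau>: "\<tau> permutes {..<m}" "\<tau> ~= sg" for \<tau>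
 proof (rule ccontr)
  assume nz: "chain_weight m (c \<tau>) (?s \<tau>) ~= 0"
  have "s (\<tau> j) < s (\<tau> i)" if "i < j" "j < m" for i j using chain_weight_nonzeroD(1)[OF nz that] that by simp
  thus False using unique_decreasing_permutation[where sg = sg and \<tau> = \<tau> and s = s and m = m, OF sg \<tau>(1)] \<tau>(2) by blast
 qed
 have "(\<Sum>\<tau> | \<tau> permutes {..<m}. ind {..1} (?s \<tau> 0) * chain_weight m (c \<tau>) (?s \<tau>))
  = (\<Sum>\<tau> | \<tau> permutes {..<m}. if \<tau> = sg then ind {..1} (?s sg 0) * chain_weight m (c sg) (?s sg) else 0)"
  using other by (intro sum.cong) auto
 also have "... = ind {..1} (?s sg 0) * chain_weight m (c sg) (?s sg)" using sg(1) by (simp add: sum.delta finite_permutations)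
 also have "... = ennreal (\<phi> s) * (\<Prod>i<m. ind {0..1} (s i))"
 proof (cases "\<forall>i<m. 0 < s i & s i <= 1")
  case True
  have "chain_weight m (c sg) (?s sg) = ennreal (\<Prod>j<m. exp (- (c sg j * (?s sg j - chain m (?s sg) j))))"
   using True sg im[OF sg(1)] by (intro chain_weight_decreasing) auto
  also have "... = ennreal (\<phi> s)" using \<phi>[OF sg] True by simp
  finally show ?thesis using True m im[OF sg(1), of 0] by (simp add: indicator_def less_imp_le)
 next
  case False
  have z: "(\<Prod>i<m. ind {0..1} (s i) :: ennreal) = 0"
  proof -
   obtain i where "i < m" "~ (0 < s i & s i <= 1)" using False by blast
   hence "(ind {0..1} (s i) :: ennreal) = 0" using s(2)[of i] by (auto simp: indicator_def)
   thus ?thesis using \<open>i < m\<close> by (auto intro!: prod_zero)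
  qed
  have zz: "ind {..1} (?s sg 0) * chain_weight m (c sg) (?s sg) = 0"
  proof (rule ccontr)
   assume "ind {..1} (?s sg 0) * chain_weight m (c sg) (?s sg) ~= 0"
   hence nz: "chain_weight m (c sg) (?s sg) ~= 0" and s1: "s (sg 0) <= 1" using m by (auto simp: indicator_def split: if_splits)
   have pos: "0 < s (sg i)" if "i < m" for i using chain_weight_nonzeroD(2)[OF nz that] that by simp
   have le1: "s (sg i) <= 1" if "i < m" for i using sg(2)[of 0 i] s1 that by (cases "i = 0") auto
   have "0 < s i & s i <= 1" if "i < m" for i
   using pos[of "inv sg i"] le1[of "inv sg i"] im[OF permutes_inv[OF sg(1)], of i] that by (simp add: permutes_inverses[OF sg(1)])
   thus False using False by blast
  qed
  show ?thesis by (simp only: zz z mult_zero_right)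
 qed
 finally show ?thesis ..
qed

section \<open>Characteristic functions of occupation measures\<close>

definition unif01 :: "real measure" where "unif01 = density lborel (%s. ind {0..1} s)"

lemma sets_unif01[simp, measurable_cong]: "sets unif01 = sets borel" by (simp add: unif01_def)
lemma borel_measurable_unif01[simp]: "borel_measurable unif01 = borel_measurable borel" by (rule measurable_cong_sets) simp_all
lemma space_unif01[simp]: "space unif01 = UNIV" by (simp add: unif01_def)
lemma prob_space_unif01: "prob_space unif01" by (rule prob_spaceI) (simp add: unif01_def emeasure_density)

text \<open>The grid approximates a time from the right, so right-continuous paths are limits of step paths; unlike the
 paths themselves, the step paths are jointly measurable in time and chance.\<close>

definition grid :: "nat => real => real" where "grid N s = (real (nat \<lfloor>real (Suc N) * s\<rfloor>) + 1) / real (Suc N)"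

lemma grid_pos: "0 < grid N s" unfolding grid_def by (intro divide_pos_pos) (auto intro: add_nonneg_pos)

lemma grid_at_right: "filterlim (%N. grid N s) (at_right (max 0 s)) sequentially"
proof (rule tendsto_imp_filterlim_at_right)
 have b: "max 0 s < grid N s & grid N s <= max 0 s + 1 / real (Suc N)" for N
 proof -
  define r where "r = real (Suc N)"
  have r: "0 < r" by (simp add: r_def)
  define k where "k = real (nat \<lfloor>r * s\<rfloor>)"
  have k: "k <= r * max 0 s" "r * max 0 s < k + 1"
  proof -
   show "k <= r * max 0 s"
   proof (cases "0 <= s")
   case True
   hence "0 <= r * s" using r by simp
   thus ?thesis unfolding k_def using True by simp
   next
   case False
   hence "r * s < 0" using r by (simp add: mult_pos_neg)
   thus ?thesis unfolding k_def using False r by simp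
   qed
   have "r * max 0 s = max 0 (r * s)" using r by (simp add: max_mult_distrib_left)
   thus "r * max 0 s < k + 1" unfolding k_def by linarith
  qed
  have "max 0 s < (k + 1) / r" using k r by (simp add: less_divide_eq mult.commute)
  moreover have "(k + 1) / r <= max 0 s + 1 / r" using k r by (simp add: add_divide_distrib divide_le_eq mult.commute)
  ultimately show ?thesis by (simp add: grid_def k_def r_def)
 qed
 show "\<forall>\<^sub>F N in sequentially. max 0 s < grid N s" using b by simp
 show "(%N. grid N s) \<longlonglongrightarrow> max 0 s"
 proof (rule tendsto_sandwich[where f = "%_. max 0 s" and h = "%N. max 0 s + 1 / real (Suc N)"])
  show "(%N. max 0 s + 1 / real (Suc N)) \<longlonglongrightarrow> max 0 s"
   using tendsto_add[OF tendsto_const[of "max 0 s"] LIMSEQ_Suc[OF lim_1_over_n]] by simp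
  show "\<forall>\<^sub>F N in sequentially. max 0 s <= grid N s" by (rule always_eventually) (use b less_imp_le in blast)
  show "\<forall>\<^sub>F N in sequentially. grid N s <= max 0 s + 1 / real (Suc N)" using b by simp
 qed simp
qed

lemma measurable_grid:
 fixes Z :: "real => 'a => 'b::topological_space"
 assumes Z: "!!t. 0 <= t ==> Z t \<in> bm P"
 shows "(%(s, om). Z (grid N s) om) \<in> bm (borel \<Otimes>\<^sub>M P)"
proof -
 have "(%p. (%k p. Z ((real k + 1) / real (Suc N)) (snd p)) (nat \<lfloor>real (Suc N) * fst p\<rfloor>) p) \<in> bm (borel \<Otimes>\<^sub>M P)"
 proof (rule measurable_compose_countable[where f = "%k p. Z ((real k + 1) / real (Suc N)) (snd p)" and g = "%p. nat \<lfloor>real (Suc N) * fst p\<rfloor>"])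
  show "(%p. Z ((real k + 1) / real (Suc N)) (snd p)) \<in> bm (borel \<Otimes>\<^sub>M P)" for k
   by (rule measurable_compose[OF measurable_snd Z]) simp
  show "(%p. nat \<lfloor>real (Suc N) * fst p\<rfloor>) \<in> measurable (borel \<Otimes>\<^sub>M P) (count_space UNIV)"
   by measurable
 qed
 thus ?thesis by (simp add: grid_def case_prod_beta)
qed

definition avg_cis :: "nat => (real => 'a => real^'d) => real^'d => 'a => complex" where
 "avg_cis N Z l om = (\<integral>s. cis (l \<bullet> Z (grid N s) om) \<partial>unif01)"

lemma cis_measurable[measurable]: "cis \<in> bm borel" by (intro borel_measurable_continuous_onI continuous_intros)

lemma prod_cis: "(\<Prod>k\<in>A. cis (f k)) = cis (\<Sum>k\<in>A. f k)"
 by (induction A rule: infinite_finite_induct) (auto simp: cis_mult)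

lemma measurable_avg_cis:
 fixes Z :: "real => 'a => real^'d::finite"
 assumes Z: "!!t. 0 <= t ==> Z t \<in> bm P"
 shows "(%(l, om). avg_cis N Z l om) \<in> bm (borel \<Otimes>\<^sub>M P)"
proof -
 interpret prob_space unif01 by (rule prob_space_unif01)
 note measurable_grid[OF Z, measurable]
 have [measurable]: "(%x. Z (grid N (snd x)) (snd (fst x))) \<in> bm ((borel \<Otimes>\<^sub>M P) \<Otimes>\<^sub>M unif01)"
  using measurable_compose[of "%x. (snd x, snd (fst x))" "(borel \<Otimes>\<^sub>M P) \<Otimes>\<^sub>M unif01" "borel \<Otimes>\<^sub>M P", OF _ measurable_grid[where N = N, OF Z]]
  by simp
 have "(%x. \<integral>s. cis (fst x \<bullet> Z (grid N s) (snd x)) \<partial>unif01) \<in> bm (borel \<Otimes>\<^sub>M P)"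
  by (intro borel_measurable_lebesgue_integral) (simp add: case_prod_beta, measurable)
 thus ?thesis by (simp add: avg_cis_def case_prod_beta)
qed

lemma norm_avg_cis_le: "norm (avg_cis N Z l om) <= 1"
proof -
 interpret prob_space unif01 by (rule prob_space_unif01)
 show ?thesis
 proof (cases "integrable unif01 (%s. cis (l \<bullet> Z (grid N s) om))")
  case True
  thus ?thesis unfolding avg_cis_def using integral_norm_bound[of unif01 "%s. cis (l \<bullet> Z (grid N s) om)"] prob_space by simp
 qed (simp add: avg_cis_def not_integrable_integral_eq)
qed

text \<open>Defined as a limit along step paths so that it is jointly measurable in frequency and
  chance whatever the paths are. On right-continuous paths it is the characteristic function of the
  occupation measure over uniform time.\<close>

definition occ_cis :: "(real => 'a => real^'d) => real^'d => 'a => complex" where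
 "occ_cis Z l om = lim (%N. avg_cis N Z l om)"

lemma measurable_occ_cis:
 fixes Z :: "real => 'a => real^'d::finite"
 assumes Z: "!!t. 0 <= t ==> Z t \<in> bm P"
 shows "(%(l, om). occ_cis Z l om) \<in> bm (borel \<Otimes>\<^sub>M P)" "occ_cis Z z \<in> bm P"
  "avg_cis N Z z \<in> bm P"
proof -
 have "(%p. lim (%N. (%(l, om). avg_cis N Z l om) p)) \<in> bm (borel \<Otimes>\<^sub>M P)"
  by (rule borel_measurable_lim_metric) (rule measurable_avg_cis[OF Z])
 thus 1: "(%(l, om). occ_cis Z l om) \<in> bm (borel \<Otimes>\<^sub>M P)" by (simp add: occ_cis_def case_prod_beta)
 have z: "z \<in> space borel" by simp
 show "occ_cis Z z \<in> bm P" using measurable_Pair2[OF 1 z] by simp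
 show "avg_cis N Z z \<in> bm P" using measurable_Pair2[OF measurable_avg_cis[where N = N, OF Z] z] by simp
qed

text \<open>For negative s the grid points decrease to 0, hence the value at \<open>max 0 s\<close>;
  with it the statements hold on the whole real line without side conditions.\<close>

lemma path_limit:
 fixes Z :: "real => 'a => real^'d::finite"
 assumes rc: "\<forall>t\<ge>0. continuous (at_right t) (%s. Z s om)"
 shows "(%N. Z (grid N s) om) \<longlonglongrightarrow> Z (max 0 s) om"
  "(%s. Z (max 0 s) om) \<in> bm borel"
  "(%N. avg_cis N Z l om) \<longlonglongrightarrow> (\<integral>s. cis (l \<bullet> Z (max 0 s) om) \<partial>unif01)"
  "occ_cis Z l om = (\<integral>s. cis (l \<bullet> Z (max 0 s) om) \<partial>unif01)"
proof -
 interpret prob_space unif01 by (rule prob_space_unif01)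
 show lim: "(%N. Z (grid N s) om) \<longlonglongrightarrow> Z (max 0 s) om" for s
 proof -
  have "((%s. Z s om) \<longlongrightarrow> Z (max 0 s) om) (at_right (max 0 s))" using rc by (simp add: continuous_within)
  thus ?thesis by (rule filterlim_compose[OF _ grid_at_right])
 qed
 have gm[measurable]: "(%s. Z (grid N s) om) \<in> bm borel" for N
 proof -
  have "(%(s, x). Z (grid N s) om) \<in> bm (borel \<Otimes>\<^sub>M count_space (UNIV :: unit set))"
   by (rule measurable_grid) simp
  from measurable_Pair1[OF this, of "()"] show ?thesis by simp
 qed
 show m[measurable]: "(%s. Z (max 0 s) om) \<in> bm borel" by (rule borel_measurable_LIMSEQ_metric[OF gm lim])
 show L: "(%N. avg_cis N Z l om) \<longlonglongrightarrow> (\<integral>s. cis (l \<bullet> Z (max 0 s) om) \<partial>unif01)"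
  unfolding avg_cis_def
 proof (rule integral_dominated_convergence[where w = "%_. 1"])
  show "AE s in unif01. (%N. cis (l \<bullet> Z (grid N s) om)) \<longlonglongrightarrow> cis (l \<bullet> Z (max 0 s) om)"
   by (intro AE_I2 tendsto_intros lim)
  show "(%s. cis (l \<bullet> Z (max 0 s) om)) \<in> bm unif01" unfolding borel_measurable_unif01 by measurable
  show "(%s. cis (l \<bullet> Z (grid N s) om)) \<in> bm unif01" for N unfolding borel_measurable_unif01 by measurable
  show "integrable unif01 (%_. 1 :: real)" by (rule integrable_const)
  show "AE s in unif01. norm (cis (l \<bullet> Z (grid N s) om)) <= 1" for N by simp
 qed
 thus "occ_cis Z l om = (\<integral>s. cis (l \<bullet> Z (max 0 s) om) \<partial>unif01)" unfolding occ_cis_def by (rule limI)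
qed

locale levy_exp = prob_space M for M :: "'a measure" +
 fixes X :: "real => 'a => real^'d::finite" and \<psi> :: "real^'d => real"
 assumes psi_m[measurable]: "\<psi> \<in> bm borel" and psi_nn: "!!x. 0 <= \<psi> x"
  and levy: "levy_process_exp M X \<psi>"
begin

lemma X_m: "0 <= t ==> X t \<in> bm M"
 and X_0: "AE om in M. X 0 om = 0"
 and X_rc: "AE om in M. \<forall>t\<ge>0. continuous (at_right t) (%s. X s om)"
 and X_indep: "0 <= r 0 ==> (!!k. k < n ==> r k <= r (Suc k)) ==> indep_vars (%_. borel) (%k om. X (r (Suc k)) om - X (r k) om) {..<n}"
 and X_stat: "0 <= s ==> s <= u ==> distr M borel (%om. X u om - X s om) = distr M borel (X (u - s))"
 and X_chf: "0 <= u ==> expectation (%om. cis (\<xi> \<bullet> X u om)) = complex_of_real (exp (- (u * \<psi> \<xi>)))"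
 using levy unfolding levy_process_exp_def by (auto elim: eventually_mono)

lemma expectation_cis_increment:
 assumes "0 <= s" "s <= u"
 shows "expectation (%om. cis (\<xi> \<bullet> (X u om - X s om))) = complex_of_real (exp (- ((u - s) * \<psi> \<xi>)))"
proof -
 have [measurable]: "X u \<in> bm M" "X s \<in> bm M" "X (u - s) \<in> bm M" using assms by (auto intro: X_m)
 have "expectation (%om. cis (\<xi> \<bullet> (X u om - X s om))) = (\<integral>y. cis (\<xi> \<bullet> y) \<partial>distr M borel (%om. X u om - X s om))"
  by (subst integral_distr) auto
 also have "... = expectation (%om. cis (\<xi> \<bullet> X (u - s) om))"
  unfolding X_stat[OF assms] by (subst integral_distr) auto
 finally show ?thesis using X_chf[where u = "u - s" and \<xi> = \<xi>] assms by simp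
qed

text \<open>The values of the path are partial sums of independent increments. Regrouping the phase
  by increments gives each increment the sum of the frequencies of all times at or beyond its right
  end; with decreasing times these are the initial sums of \<open>l\<close>.\<close>

lemma expectation_cis_decreasing:
 fixes l :: "nat => real^'d" and s :: "nat => real"
 assumes dec: "!!i j. i < j ==> j < m ==> s j < s i" and pos: "!!i. i < m ==> 0 < s i"
 shows "expectation (%om. \<Prod>k<m. cis (l k \<bullet> X (s k) om)) = complex_of_real (\<Prod>j<m. exp (- (\<psi> (\<Sum>i\<le>j. l i) * (s j - chain m s j))))"
proof -
 \<comment> \<open>The times in increasing order, started at 0, as the independence of increments
   asks for; the index j becomes m - j.\<close>
 define tt where "tt i = (if i = 0 then 0 else if i <= m then s (m - i) else s 0 + 1)" for i
 have tt0: "tt 0 = 0" by (simp add: tt_def)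
 have ttm: "tt i <= tt (Suc i)" if "i < m" for i
  using that dec[of "m - Suc i" "m - i"] pos[of "m - 1"] by (cases "i = 0") (auto simp: tt_def less_imp_le)
 have tts: "tt (m - j) = s j" if "j < m" for j using that by (simp add: tt_def)
 have tt_nn: "0 <= tt i" if "i <= m" for i using that pos[of "m - i"] by (auto simp: tt_def less_imp_le)
 define \<xi> where "\<xi> i = (\<Sum>j<m - i. l j)" for i
 define inc where "inc i om = X (tt (Suc i)) om - X (tt i) om" for i om
 have [measurable]: "inc i \<in> bm M" if "i < m" for i
  unfolding inc_def using that X_m[OF tt_nn, of i] X_m[OF tt_nn, of "Suc i"] by (intro borel_measurable_diff) auto
 have key: "(\<Prod>k<m. cis (l k \<bullet> X (s k) om)) = (\<Prod>i<m. cis (\<xi> i \<bullet> inc i om))" if X0: "X 0 om = 0" for om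
 proof -
  have Xs: "X (s j) om = (\<Sum>i<m - j. inc i om)" if "j < m" for j
   using sum_lessThan_telescope[of "%i. X (tt i) om" "m - j"] X0 that by (simp add: inc_def tts tt0)
  have "(\<Sum>k<m. l k \<bullet> X (s k) om) = (\<Sum>k<m. \<Sum>i<m - k. l k \<bullet> inc i om)"
   by (simp add: Xs inner_sum_right)
  also have "... = (\<Sum>k<m. \<Sum>i<m. if i < m - k then l k \<bullet> inc i om else 0)"
  proof (rule sum.cong[OF refl])
   fix k assume "k \<in> {..<m}"
   have "{i. i < m & i < m - k} = {..<m - k}" by auto
   thus "(\<Sum>i<m - k. l k \<bullet> inc i om) = (\<Sum>i<m. if i < m - k then l k \<bullet> inc i om else 0)"
   by (simp add: sum.inter_filter[symmetric])
  qed
  also have "... = (\<Sum>i<m. \<Sum>k<m. if k < m - i then l k \<bullet> inc i om else 0)"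
   by (subst sum.swap) (intro sum.cong refl if_cong, auto)
  also have "... = (\<Sum>i<m. \<xi> i \<bullet> inc i om)"
  proof (rule sum.cong[OF refl])
   fix i assume "i \<in> {..<m}"
   have "{k. k < m & k < m - i} = {..<m - i}" by auto
   thus "(\<Sum>k<m. if k < m - i then l k \<bullet> inc i om else 0) = \<xi> i \<bullet> inc i om"
   by (simp add: sum.inter_filter[symmetric] \<xi>_def inner_sum_left)
  qed
  finally show ?thesis by (simp add: prod_cis)
 qed
 have "expectation (%om. \<Prod>k<m. cis (l k \<bullet> X (s k) om)) = expectation (%om. \<Prod>i<m. cis (\<xi> i \<bullet> inc i om))"
 proof (rule integral_cong_AE)
  show "AE om in M. (\<Prod>k<m. cis (l k \<bullet> X (s k) om)) = (\<Prod>i<m. cis (\<xi> i \<bullet> inc i om))"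
   using X_0 by eventually_elim (rule key)
  show "(%om. \<Prod>k<m. cis (l k \<bullet> X (s k) om)) \<in> bm M"
  proof (rule borel_measurable_prod)
   fix k assume "k \<in> {..<m}"
   hence [measurable]: "X (s k) \<in> bm M" using pos[of k] by (intro X_m) auto
   show "(%om. cis (l k \<bullet> X (s k) om)) \<in> bm M" by measurable
  qed
  show "(%om. \<Prod>i<m. cis (\<xi> i \<bullet> inc i om)) \<in> bm M" by (rule borel_measurable_prod) simp
 qed
 also have "... = (\<Prod>i<m. expectation (%om. cis (\<xi> i \<bullet> inc i om)))"
 proof (rule indep_vars_lebesgue_integral)
  have "indep_vars (%_. borel) inc {..<m}" unfolding inc_def[abs_def] using X_indep[where r = tt and n = m] tt0 ttm by simp
  thus "indep_vars (%_. borel) (%i om. cis (\<xi> i \<bullet> inc i om)) {..<m}" by (rule indep_vars_compose2) measurable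
  show "integrable M (%om. cis (\<xi> i \<bullet> inc i om))" if "i \<in> {..<m}" for i
   using that by (intro integrable_const_bound[where B = 1]) auto
 qed simp
 also have "... = (\<Prod>i<m. complex_of_real (exp (- ((tt (Suc i) - tt i) * \<psi> (\<xi> i)))))"
  unfolding inc_def using tt_nn ttm by (intro prod.cong refl expectation_cis_increment) auto
 also have "... = complex_of_real (\<Prod>i<m. exp (- ((tt (Suc i) - tt i) * \<psi> (\<xi> i))))" by simp
 also have "(\<Prod>i<m. exp (- ((tt (Suc i) - tt i) * \<psi> (\<xi> i)))) = (\<Prod>j<m. exp (- (\<psi> (\<Sum>i\<le>j. l i) * (s j - chain m s j))))"
 proof (rule prod.reindex_bij_witness[where i = "%j. m - Suc j" and j = "%j. m - Suc j"])
  fix i assume i: "i \<in> {..<m}"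
  hence "tt (Suc i) = s (m - Suc i)" by (simp add: tt_def)
  moreover have "tt i = chain m s (m - Suc i)" using i by (cases "i = 0") (auto simp: tt_def chain_def Suc_diff_Suc)
  moreover have "\<xi> i = (\<Sum>j\<le>m - Suc i. l j)"
  proof -
   have "m - i = Suc (m - Suc i)" using i by auto
   thus ?thesis by (simp add: \<xi>_def lessThan_Suc_atMost)
  qed
  ultimately show "exp (- (\<psi> (\<Sum>j\<le>m - Suc i. l j) * (s (m - Suc i) - chain m s (m - Suc i)))) = exp (- ((tt (Suc i) - tt i) * \<psi> (\<xi> i)))"
   by (simp add: mult.commute)
 qed auto
 finally show ?thesis .
qed

definition phi :: "nat => (nat => real^'d) => (nat => real) => complex" where
 "phi m l s = expectation (%om. \<Prod>k<m. cis (l k \<bullet> X (max 0 (s k)) om))"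

lemma phi_permuted:
 assumes sg: "sg permutes {..<m}" and dec: "!!i j. i < j ==> j < m ==> s (sg j) < s (sg i)" and pos: "!!i. i < m ==> 0 < s i"
 shows "phi m l s = complex_of_real (\<Prod>j<m. exp (- (\<psi> (\<Sum>i\<le>j. l (sg i)) * (s (sg j) - chain m (\<lambda>i\<in>{..<m}. s (sg i)) j))))"
proof -
 have im: "sg i < m \<longleftrightarrow> i < m" for i using permutes_in_image[OF sg, of i] by simp
 have "(\<Prod>k<m. cis (l k \<bullet> X (max 0 (s k)) om)) = (\<Prod>k<m. cis (l (sg k) \<bullet> X (s (sg k)) om))" for om
 proof -
  have "(\<Prod>k<m. cis (l k \<bullet> X (max 0 (s k)) om)) = (\<Prod>k<m. cis (l (sg k) \<bullet> X (max 0 (s (sg k))) om))"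
   using prod.permute[OF sg, of "%k. cis (l k \<bullet> X (max 0 (s k)) om)"] by (simp add: comp_def)
  also have "... = (\<Prod>k<m. cis (l (sg k) \<bullet> X (s (sg k)) om))"
   using pos im by (intro prod.cong refl) (auto simp: max_def dest: less_imp_le)
  finally show ?thesis .
 qed
 hence "phi m l s = complex_of_real (\<Prod>j<m. exp (- (\<psi> (\<Sum>i\<le>j. l (sg i)) * (s (sg j) - chain m (%i. s (sg i)) j))))"
  unfolding phi_def using expectation_cis_decreasing[of m "%i. s (sg i)" "%i. l (sg i)"] dec pos im by simp
 also have "(\<Prod>j<m. exp (- (\<psi> (\<Sum>i\<le>j. l (sg i)) * (s (sg j) - chain m (%i. s (sg i)) j))))
  = (\<Prod>j<m. exp (- (\<psi> (\<Sum>i\<le>j. l (sg i)) * (s (sg j) - chain m (\<lambda>i\<in>{..<m}. s (sg i)) j))))"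
  by (intro prod.cong refl) (simp add: chain_def)
 finally show ?thesis .
qed

lemma prod_norm_le_1: "(!!k. k \<in> A ==> norm (f k) <= 1) ==> norm (prod f A :: complex) <= 1"
 by (induction A rule: infinite_finite_induct) (auto simp: norm_mult intro: mult_le_one)

lemma norm_occ_cis_le: "AE om in M. \<forall>l. norm (occ_cis X l om) <= 1" using X_rc
proof eventually_elim
 case (elim om)
 show ?case
 proof
  fix l
  have "(%N. avg_cis N X l om) \<longlonglongrightarrow> occ_cis X l om" using path_limit(3,4)[where Z = X and om = om, OF elim, where l = l] by simp
  thus "norm (occ_cis X l om) <= 1" by (rule Lim_bounded[OF tendsto_norm]) (auto simp: norm_avg_cis_le)
 qed
qed

lemma avg_cis_moment_limit:
 "(%N. expectation (%om. \<Prod>k<m. avg_cis N X (l k) om)) \<longlonglongrightarrow> expectation (%om. \<Prod>k<m. occ_cis X (l k) om)"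
proof (rule integral_dominated_convergence[where w = "%_. 1"])
 show "AE om in M. (%N. \<Prod>k<m. avg_cis N X (l k) om) \<longlonglongrightarrow> (\<Prod>k<m. occ_cis X (l k) om)" using X_rc
 proof eventually_elim
  case (elim om)
  have "(%N. avg_cis N X (l k) om) \<longlonglongrightarrow> occ_cis X (l k) om" for k using path_limit(3,4)[where Z = X and om = om, OF elim, where l = "l k"] by simp
  thus ?case by (intro tendsto_prod)
 qed
 show "AE om in M. norm (\<Prod>k<m. avg_cis N X (l k) om) <= 1" for N by (intro AE_I2 prod_norm_le_1 norm_avg_cis_le)
qed (auto intro!: borel_measurable_prod measurable_occ_cis X_m)

text \<open>Joint measurability in time and chance is available for the step paths, so Fubini is
  applied there. Dominated convergence then passes to the limit on both sides, and
  \<open>phi\<close> is measurable as a limit.\<close>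

lemma phi_measurable_and_moment:
 shows "phi m l \<in> bm (PiM {..<m} (%_. unif01))"
  and "expectation (%om. \<Prod>k<m. occ_cis X (l k) om) = (\<integral>s. phi m l s \<partial>PiM {..<m} (%_. unif01))"
proof -
 let ?P = "PiM {..<m} (%_. unif01)"
 interpret U: prob_space unif01 by (rule prob_space_unif01)
 interpret PU: product_prob_space "%_::nat. unif01" by unfold_locales
 interpret P: prob_space ?P by (rule prob_space_PiM) (rule prob_space_unif01)
 interpret MP: pair_prob_space M ?P ..
 define f where "f N s om = (\<Prod>k<m. cis (l k \<bullet> X (grid N (s k)) om))" for N s om
 have fm: "(%(om, s). f N s om) \<in> bm (M \<Otimes>\<^sub>M ?P)" for N unfolding f_def case_prod_beta
 proof (rule borel_measurable_prod)
  fix k assume k: "k \<in> {..<m}"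
  have "(%x. (snd x k, fst x)) \<in> measurable (M \<Otimes>\<^sub>M ?P) (borel \<Otimes>\<^sub>M M)"
   using k measurable_component_singleton[OF k, of "%_. unif01"] by (auto intro!: measurable_Pair measurable_compose[OF measurable_snd])
  from measurable_compose[OF this measurable_grid[where N = N, OF X_m]]
  have [measurable]: "(%x. X (grid N (snd x k)) (fst x)) \<in> bm (M \<Otimes>\<^sub>M ?P)" by simp
  show "(%x. cis (l k \<bullet> X (grid N (snd x k)) (fst x))) \<in> bm (M \<Otimes>\<^sub>M ?P)" by measurable
 qed
 have fb: "norm (f N s om) <= 1" for N s om unfolding f_def by (rule prod_norm_le_1) simp
 have fint: "integrable (M \<Otimes>\<^sub>M ?P) (%(om, s). f N s om)" for N
  using fb fm by (intro MP.integrable_const_bound[where B = 1]) auto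
 have prodN: "(\<Prod>k<m. avg_cis N X (l k) om) = (\<integral>s. f N s om \<partial>?P)" if "om \<in> space M" for N om
  unfolding avg_cis_def f_def
 proof (rule PU.product_integral_prod[symmetric])
  fix k
  have "(%s. X (grid N s) om) \<in> bm borel" using measurable_Pair1[OF measurable_grid[where N = N, OF X_m] that] by simp
  hence [measurable]: "(%s. X (grid N s) om) \<in> bm unif01" by simp
  show "integrable unif01 (%s. cis (l k \<bullet> X (grid N s) om))" by (intro U.integrable_const_bound[where B = 1]) auto
 qed simp
 have swap: "expectation (%om. \<Prod>k<m. avg_cis N X (l k) om) = (\<integral>s. expectation (%om. f N s om) \<partial>?P)" for N
 proof -
  have "expectation (%om. \<Prod>k<m. avg_cis N X (l k) om) = expectation (%om. (\<integral>s. f N s om \<partial>?P))"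
   by (rule Bochner_Integration.integral_cong) (auto simp: prodN)
  also have "... = (\<integral>s. expectation (%om. f N s om) \<partial>?P)" by (rule MP.Fubini_integral[OF fint, symmetric])
  finally show ?thesis .
 qed
 have Efm[measurable]: "(%s. expectation (%om. f N s om)) \<in> bm ?P" for N
  using MP.Fubini_integrable fm by (intro borel_measurable_lebesgue_integral) (use measurable_pair_swap[OF fm] in \<open>simp add: case_prod_beta\<close>)
 have limE: "(%N. expectation (%om. f N s om)) \<longlonglongrightarrow> phi m l s" for s unfolding phi_def
 proof (rule integral_dominated_convergence[where w = "%_. 1"])
  show "AE om in M. (%N. f N s om) \<longlonglongrightarrow> (\<Prod>k<m. cis (l k \<bullet> X (max 0 (s k)) om))" using X_rc
  proof eventually_elim
   case (elim om)
   show ?case unfolding f_def by (intro tendsto_intros path_limit(1)[where Z = X and om = om, OF elim])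
  qed
  show "(%om. \<Prod>k<m. cis (l k \<bullet> X (max 0 (s k)) om)) \<in> bm M"
  proof (rule borel_measurable_prod)
   fix k
   have [measurable]: "X (max 0 (s k)) \<in> bm M" by (intro X_m) simp
   show "(%om. cis (l k \<bullet> X (max 0 (s k)) om)) \<in> bm M" by measurable
  qed
  show "(%om. f N s om) \<in> bm M" for N unfolding f_def
  proof (rule borel_measurable_prod)
   fix k
   have [measurable]: "X (grid N (s k)) \<in> bm M" using grid_pos[of N "s k"] by (intro X_m) simp
   show "(%om. cis (l k \<bullet> X (grid N (s k)) om)) \<in> bm M" by measurable
  qed
 qed (use fb in auto)
 show phim: "phi m l \<in> bm ?P" by (rule borel_measurable_LIMSEQ_metric[OF Efm limE])
 have "(%N. \<integral>s. expectation (%om. f N s om) \<partial>?P) \<longlonglongrightarrow> (\<integral>s. phi m l s \<partial>?P)"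
 proof (rule integral_dominated_convergence[where w = "%_. 1"])
  show "AE s in ?P. (%N. expectation (%om. f N s om)) \<longlonglongrightarrow> phi m l s" using limE by simp
  show "AE s in ?P. norm (expectation (%om. f N s om)) <= 1" for N
  proof (rule AE_I2)
   fix s
   show "norm (expectation (%om. f N s om)) <= 1"
   proof (cases "integrable M (%om. f N s om)")
   case True
   have "norm (expectation (%om. f N s om)) <= expectation (%om. norm (f N s om))" by (rule integral_norm_bound)
   also have "... <= expectation (%om. 1)" using True fb by (intro integral_mono) auto
   finally show ?thesis by (simp add: prob_space)
   qed (simp add: not_integrable_integral_eq)
  qed
 qed (use phim Efm in auto)
 moreover note avg_cis_moment_limit[where m = m and l = l]
 ultimately show "expectation (%om. \<Prod>k<m. occ_cis X (l k) om) = (\<integral>s. phi m l s \<partial>?P)"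
  unfolding swap using LIMSEQ_unique by blast
qed

end

definition Phi_nn :: "(real^'d => real) => nat => (nat => real^'d) => ennreal" where
 "Phi_nn \<psi> m l = (\<Sum>sg | sg permutes {..<m}. time_integral m 1 (%j. \<psi> (\<Sum>i\<le>j. l (sg i))))"

lemma Phi_nn_le:
 assumes m: "0 < m" and T: "0 < T" and \<psi>: "!!x. 0 <= \<psi> x"
 shows "Phi_nn \<psi> m l <= ennreal (exp T * (\<Sum>sg | sg permutes {..<m}. \<Prod>j<m. 1 / (T + \<psi> (\<Sum>i\<le>j. l (sg i)))))"
proof -
 have "Phi_nn \<psi> m l <= (\<Sum>sg | sg permutes {..<m}. ennreal (exp T * (\<Prod>j<m. 1 / (T + \<psi> (\<Sum>i\<le>j. l (sg i))))))"
  unfolding Phi_nn_def using \<psi> by (intro sum_mono time_integral_le m T)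
 also have "... = ennreal (exp T * (\<Sum>sg | sg permutes {..<m}. \<Prod>j<m. 1 / (T + \<psi> (\<Sum>i\<le>j. l (sg i)))))"
  unfolding sum_distrib_left
  by (intro sum_ennreal mult_nonneg_nonneg prod_nonneg divide_nonneg_nonneg add_nonneg_nonneg) (use T \<psi> in auto)
 finally show ?thesis .
qed

lemma Phi_nn_finite: "0 < m ==> (!!x. 0 <= \<psi> x) ==> Phi_nn \<psi> m l < \<top>"
 using Phi_nn_le[of m 1 \<psi> l] by (meson ennreal_less_top order_le_less_trans zero_less_one)

definition Phi :: "(real^'d => real) => nat => (nat => real^'d) => real" where
 "Phi \<psi> m l = enn2real (Phi_nn \<psi> m l)"

context levy_exp
begin

text \<open>Coinciding or vanishing times form a null set; off it the sorting permutation is unique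
  and \<open>phi_permuted\<close> evaluates the expectation. Since \<psi> is real,
  \<open>phi\<close> is real and nonnegative at positive distinct times, and the Bochner integral
  can be computed as a nonnegative one.\<close>

lemma expectation_prod_occ_cis:
 assumes m: "0 < m"
 shows "expectation (%om. \<Prod>k<m. occ_cis X (l k) om) = complex_of_real (Phi \<psi> m l)"
proof -
 let ?P = "PiM {..<m} (%_. unif01)"
 let ?L = "PiM {..<m} (%_. lborel :: real measure)"
 let ?c = "%sg j. \<psi> (\<Sum>i\<le>j. l (sg i))"
 have PL: "?P = density ?L (%x. \<Prod>i<m. ind {0..1} (x i))"
 proof -
  have "sigma_finite_measure unif01" using prob_space_unif01 by (simp add: prob_space_imp_sigma_finite)
  thus ?thesis unfolding unif01_def by (intro PiM_density) (auto simp: sigma_finite_lborel)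
 qed
 have indm[measurable]: "(%x. \<Prod>i<m. ind {0..1} (x i) :: ennreal) \<in> bm ?L"
  by (rule borel_measurable_prod_ennreal) (auto intro!: measurable_compose[OF measurable_component_singleton])
 have good: "AE s in ?L. inj_on s {..<m} & (\<forall>i<m. s i ~= 0)"
 proof -
  have "AE s in ?L. \<forall>i\<in>{..<m}. s i ~= 0" by (intro AE_finite_allI AE_PiM_lborel_neq) auto
  moreover have "AE s in ?L. \<forall>i\<in>{..<m}. \<forall>j\<in>{..<m} - {i}. s i ~= s j"
   by (intro AE_finite_allI AE_PiM_lborel_neq) (auto intro!: measurable_compose[OF measurable_component_singleton])
  ultimately show ?thesis by eventually_elim (auto simp: inj_on_def)
 qed
 have dec: "ennreal (Re (phi m l s)) * (\<Prod>i<m. ind {0..1} (s i)) = (\<Sum>sg | sg permutes {..<m}. ind {..1} ((\<lambda>i\<in>{..<m}. s (sg i)) 0) * chain_weight m (?c sg) (\<lambda>i\<in>{..<m}. s (sg i)))"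
  if s: "inj_on s {..<m} & (\<forall>i<m. s i ~= 0)" for s
  using s phi_permuted[of _ m s l] by (intro ordered_decomposition[where \<phi> = "%s. Re (phi m l s)"] m) (auto simp del: of_real_prod)
 have real: "phi m l s = complex_of_real (Re (phi m l s)) & 0 <= Re (phi m l s)"
  if s: "inj_on s {..<m}" "!!i. i < m ==> 0 < s i" for s
 proof -
  obtain sg where "sg permutes {..<m}" "!!i j. i < j ==> j < m ==> s (sg j) < s (sg i)"
   using ex_decreasing_permutation[OF s(1)] by blast
  from phi_permuted[where sg = sg and s = s and m = m and l = l, OF this s(2)] show ?thesis by (auto intro!: prod_nonneg simp del: of_real_prod)
 qed
 have AEP: "AE s in ?P. phi m l s = complex_of_real (Re (phi m l s)) & 0 <= Re (phi m l s)" unfolding PL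
 proof (subst AE_density[OF indm], use good in eventually_elim, intro impI)
  fix s :: "nat => real" assume s: "inj_on s {..<m} & (\<forall>i<m. s i ~= 0)" "0 < (\<Prod>i<m. ind {0..1} (s i) :: ennreal)"
  have nz: "(\<Prod>i<m. ind {0..1} (s i) :: ennreal) ~= 0" using less_imp_neq[OF s(2)] by (rule not_sym)
  have "0 < s i" if i: "i < m" for i
  proof -
   have "(ind {0..1} (s i) :: ennreal) ~= 0" using nz i by (auto simp: prod_zero_iff)
   thus ?thesis using s(1) i by (auto simp: indicator_def less_le split: if_splits)
  qed
  thus "phi m l s = complex_of_real (Re (phi m l s)) & 0 <= Re (phi m l s)" using real s(1) by blast
 qed
 have phim: "phi m l \<in> bm ?P" by (rule phi_measurable_and_moment)
 have Rem: "(%s. Re (phi m l s)) \<in> bm ?P" using phim by measurable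
 have "sets ?P = sets ?L" unfolding PL by simp
 hence Rem'[measurable]: "(%s. Re (phi m l s)) \<in> bm ?L" using Rem measurable_cong_sets by blast
 have "(\<integral>s. phi m l s \<partial>?P) = (\<integral>s. complex_of_real (Re (phi m l s)) \<partial>?P)"
  using AEP phim Rem by (intro integral_cong_AE) (auto elim: eventually_mono intro: borel_measurable_of_real)
 also have "... = complex_of_real (\<integral>s. Re (phi m l s) \<partial>?P)" by simp
 also have "(\<integral>s. Re (phi m l s) \<partial>?P) = enn2real (\<integral>\<^sup>+s. ennreal (Re (phi m l s)) \<partial>?P)"
  using AEP Rem by (intro integral_eq_nn_integral) (auto elim: eventually_mono)
 also have "(\<integral>\<^sup>+s. ennreal (Re (phi m l s)) \<partial>?P) = (\<integral>\<^sup>+s. (\<Prod>i<m. ind {0..1} (s i)) * ennreal (Re (phi m l s)) \<partial>?L)"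
  unfolding PL by (rule nn_integral_density) measurable
 also have "... = (\<integral>\<^sup>+s. (\<Sum>sg | sg permutes {..<m}. ind {..1} ((\<lambda>i\<in>{..<m}. s (sg i)) 0) * chain_weight m (?c sg) (\<lambda>i\<in>{..<m}. s (sg i))) \<partial>?L)"
  by (rule nn_integral_cong_AE) (use good in eventually_elim, subst mult.commute, rule dec)
 also have "... = (\<Sum>sg | sg permutes {..<m}. \<integral>\<^sup>+s. ind {..1} ((\<lambda>i\<in>{..<m}. s (sg i)) 0) * chain_weight m (?c sg) (\<lambda>i\<in>{..<m}. s (sg i)) \<partial>?L)"
 proof (rule nn_integral_sum)
  fix sg assume sg: "sg \<in> {sg. sg permutes {..<m}}"
  have "sg i \<in> {..<m}" if "i \<in> {..<m}" for i using permutes_in_image[of sg "{..<m}" i] sg that by simp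
  hence "(%s. \<lambda>i\<in>{..<m}. s (sg i)) \<in> measurable ?L ?L"
   by (intro measurable_restrict measurable_component_singleton)
  moreover have "(%s. ind {..1} (s 0) * chain_weight m (?c sg) s) \<in> bm ?L"
   using first_measurable[OF m] by (intro borel_measurable_times_ennreal chain_weight_measurable) simp
  ultimately show "(%s. ind {..1} ((\<lambda>i\<in>{..<m}. s (sg i)) 0) * chain_weight m (?c sg) (\<lambda>i\<in>{..<m}. s (sg i))) \<in> bm ?L"
   by (rule measurable_compose)
 qed
 also have "... = Phi_nn \<psi> m l" unfolding Phi_nn_def time_integral_def
 proof (rule sum.cong[OF refl])
  fix sg assume sg: "sg \<in> {sg. sg permutes {..<m}}"
  show "(\<integral>\<^sup>+s. ind {..1} ((\<lambda>i\<in>{..<m}. s (sg i)) 0) * chain_weight m (?c sg) (\<lambda>i\<in>{..<m}. s (sg i)) \<partial>?L)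
   = (\<integral>\<^sup>+s. ind {..1} (s 0) * chain_weight m (?c sg) s \<partial>?L)" using sg first_measurable[OF m]
   by (intro nn_integral_PiM_permute[where f = "%s. ind {..1} (s 0) * chain_weight m (?c sg) s"] borel_measurable_times_ennreal chain_weight_measurable)
   (auto simp: sigma_finite_lborel)
 qed
 finally show ?thesis using phi_measurable_and_moment(2)[where m = m and l = l] by (simp add: Phi_def)
qed

end

section \<open>The additive process and the moments of its occupation transform\<close>

lemma Basis_cart_eq: "(Basis :: (real^'p::finite) set) = range (%i. axis i 1)" by (auto simp: Basis_vec_def)

lemma prod_Basis_cart: "(\<Prod>b\<in>(Basis :: (real^'p::finite) set). f b) = (\<Prod>i\<in>UNIV. f (axis i 1))"
 unfolding Basis_cart_eq by (subst prod.reindex) (auto simp: inj_on_def axis_eq_axis)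

lemma vec_lambda_measurable:
 assumes "!!i. sets (N i) = sets (borel :: real measure)"
 shows "(%f. \<chi> i. f i) \<in> measurable (PiM (UNIV :: 'd::finite set) N) (borel :: (real^'d) measure)"
proof (subst borel_measurable_euclidean_space, intro ballI)
 fix b :: "real^'d" assume "b \<in> Basis"
 then obtain i where b: "b = axis i 1" by (auto simp: Basis_cart_eq)
 have "(%f. f i) \<in> measurable (PiM (UNIV :: 'd set) N) (N i)" by (rule measurable_component_singleton) simp
 also have "measurable (PiM (UNIV :: 'd set) N) (N i) = borel_measurable (PiM (UNIV :: 'd set) N)"
  by (rule measurable_cong_sets) (simp_all add: assms)
 finally show "(%f. (\<chi> i. f i) \<bullet> b) \<in> bm (PiM (UNIV :: 'd set) N)" unfolding b by (simp add: inner_axis)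
qed

text \<open>\<open>occupation\<close> integrates over a vector type, while Fubini for independent
  components lives on a product of functions; this identifies the two Lebesgue measures.\<close>

lemma lborel_cart_eq: "distr (PiM (UNIV :: 'p::finite set) (%_. lborel)) borel (%f. \<chi> i. f i) = (lborel :: (real^'p) measure)"
proof (rule lborel_eqI[symmetric])
 interpret product_sigma_finite "%_::'p. lborel :: real measure" by (rule product_sigma_finite_lborel)
 have m: "(%f. \<chi> i. f i) \<in> bm (PiM (UNIV :: 'p set) (%_. lborel :: real measure))" by (rule vec_lambda_measurable) simp
 fix l u :: "real^'p" assume le: "!!b. b \<in> Basis ==> l \<bullet> b <= u \<bullet> b"
 have le': "l $ i <= u $ i" for i using le[of "axis i 1"] by (simp add: inner_axis Basis_cart_eq)
 have "(%f. \<chi> i. f i) -` box l u \<inter> space (PiM (UNIV :: 'p set) (%_. lborel :: real measure)) = PiE UNIV (%i. {l $ i<..<u $ i})"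
  by (auto simp: mem_box_cart space_PiM PiE_iff)
 hence "emeasure (distr (PiM (UNIV :: 'p set) (%_. lborel)) borel (%f. \<chi> i. f i)) (box l u) = (\<Prod>i\<in>UNIV. ennreal (u $ i - l $ i))"
  using le' by (subst emeasure_distr[OF m]) (simp_all add: emeasure_PiM)
 also have "... = ennreal (\<Prod>b\<in>Basis. (u - l) \<bullet> b)"
  using le' by (simp add: prod_Basis_cart inner_axis prod_ennreal)
 finally show "emeasure (distr (PiM (UNIV :: 'p set) (%_. lborel)) borel (%f. \<chi> i. f i)) (box l u) = ennreal (\<Prod>b\<in>Basis. (u - l) \<bullet> b)" .
qed simp

text \<open>Convexity of the m-th power with weights 1 - th and th. It separates two signed sums
  before any moment is expanded, so that no mixed words arise; with small th nearly nothing is lost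
  on the first summand.\<close>

lemma even_power_split:
 fixes a b th :: real
 assumes th: "0 < th" "th < 1" and m: "even m"
 shows "(a + b) ^ m <= (a / (1 - th)) ^ m + (b / th) ^ m"
proof (cases "m = 0")
 case False
 then obtain k where k: "m = Suc k" by (cases m) auto
 define w where "w i = (if i then th else 1 - th)" for i
 define y where "y i = (if i then \<bar>b\<bar> / th else \<bar>a\<bar> / (1 - th))" for i
 have "(\<Sum>i\<in>{True, False}. w i * y i) ^ Suc k <= (\<Sum>i\<in>{True, False}. w i * y i ^ Suc k)"
  by (rule jensen_power) (use th in \<open>auto simp: w_def y_def\<close>)
 hence "(\<bar>b\<bar> + \<bar>a\<bar>) ^ Suc k <= th * (\<bar>b\<bar> / th) ^ Suc k + (1 - th) * (\<bar>a\<bar> / (1 - th)) ^ Suc k"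
  using th by (simp add: w_def y_def del: power_Suc)
 also have "... <= 1 * (\<bar>b\<bar> / th) ^ Suc k + 1 * (\<bar>a\<bar> / (1 - th)) ^ Suc k"
  using th by (intro add_mono mult_right_mono zero_le_power divide_nonneg_nonneg) auto
 finally have 1: "(\<bar>b\<bar> + \<bar>a\<bar>) ^ m <= (\<bar>b\<bar> / th) ^ m + (\<bar>a\<bar> / (1 - th)) ^ m" by (simp add: k del: power_Suc)
 have "(a + b) ^ m <= (\<bar>b\<bar> + \<bar>a\<bar>) ^ m"
 proof -
  have "(a + b) ^ m = \<bar>a + b\<bar> ^ m" using m by (simp add: power_even_abs)
  also have "... <= (\<bar>b\<bar> + \<bar>a\<bar>) ^ m" by (intro power_mono) auto
  finally show ?thesis .
 qed
 moreover have "(\<bar>b\<bar> / th) ^ m = (b / th) ^ m" "(\<bar>a\<bar> / (1 - th)) ^ m = (a / (1 - th)) ^ m"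
  using m by (simp_all add: power_divide power_even_abs)
 ultimately show ?thesis using 1 by linarith
qed simp

locale additive_stable = prob_space M + stable_setup \<alpha> \<psi> n
 for M :: "'a measure" and \<alpha> and \<psi> :: "real^'d::finite => real" and n +
 fixes X :: "'p::finite => real => 'a => real^'d" and \<eta> :: "real^'d => real => 'a => real"
 assumes card_p: "CARD('p) = Suc n"
  and X_levy: "!!j. levy_process_exp M (X j) \<psi>"
  and X_ind: "indep_vars (%_. PiM {0..} (%_. borel)) (%j om. restrict (%t. X j t om) {0..}) UNIV"
  and lt: "local_time M X \<eta>"
begin

lemma levy_X: "levy_exp M (X j) \<psi>" by unfold_locales (use X_levy in auto)

lemma X_meas: "0 <= t ==> X j t \<in> bm M" by (rule levy_exp.X_m[OF levy_X])

definition occ :: "real^'d => 'a => complex" where "occ l om = (\<Prod>j\<in>UNIV. occ_cis (X j) l om)"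

lemma occ_measurable[measurable]: "occ l \<in> bm M" "(%(l, om). occ l om) \<in> bm (borel \<Otimes>\<^sub>M M)"
 unfolding occ_def case_prod_beta by (intro borel_measurable_prod measurable_occ_cis X_meas; simp)
  (intro borel_measurable_prod, use measurable_occ_cis(1)[OF X_meas] in \<open>simp add: case_prod_beta\<close>)

lemma paths_rc: "AE om in M. \<forall>j. \<forall>t\<ge>0. continuous (at_right t) (%s. X j s om)"
 using levy_exp.X_rc[OF levy_X] by (intro AE_all_countable[THEN iffD2] allI) (auto)

lemma norm_occ_le: "AE om in M. \<forall>l. norm (occ l om) <= 1"
proof -
 have "AE om in M. \<forall>j. \<forall>l. norm (occ_cis (X j) l om) <= 1"
  by (rule AE_all_countable[THEN iffD2]) (intro allI levy_exp.norm_occ_cis_le[OF levy_X])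
 thus ?thesis by eventually_elim (auto simp: occ_def intro!: levy_exp.prod_norm_le_1[OF levy_X])
qed

text \<open>Independence is given for whole paths with the product sigma-algebra. Each
  \<open>avg_cis N\<close> depends on countably many coordinates and is therefore a measurable
  functional of the path; independence is used there, and the factorisation survives the
  limit.\<close>

lemma expectation_prod_occ:
 assumes m: "0 < m"
 shows "expectation (%om. \<Prod>k<m. occ (l k) om) = complex_of_real (Phi \<psi> m l ^ Suc n)"
proof -
 have swap: "(\<Prod>k<m. \<Prod>j\<in>UNIV. f j k) = (\<Prod>j\<in>UNIV. \<Prod>k<m. f j k)" for f :: "'p => nat => complex"
  by (rule prod.swap)
 have N: "expectation (%om. \<Prod>j\<in>UNIV. \<Prod>k<m. avg_cis N (X j) (l k) om) = (\<Prod>j\<in>UNIV. expectation (%om. \<Prod>k<m. avg_cis N (X j) (l k) om))" for N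
 proof (rule indep_vars_lebesgue_integral)
  let ?Z = "%(t::real) (p :: real => real^'d). p t"
  let ?Y = "%p. \<Prod>k<m. avg_cis N ?Z (l k) p"
  have Zm: "0 <= t ==> ?Z t \<in> bm (PiM {0..} (%_. borel))" for t by (rule measurable_component_singleton) simp
  have "indep_vars (%_. borel) (%j om. ?Y (restrict (%t. X j t om) {0..})) UNIV"
   by (rule indep_vars_compose2[OF X_ind]) (intro borel_measurable_prod measurable_occ_cis Zm)
  moreover have "?Y (restrict (%t. X j t om) {0..}) = (\<Prod>k<m. avg_cis N (X j) (l k) om)" for j om
   using grid_pos[of N] by (simp add: avg_cis_def less_imp_le)
  ultimately show "indep_vars (%_. borel) (%j om. \<Prod>k<m. avg_cis N (X j) (l k) om) UNIV" by simp
  show "integrable M (%om. \<Prod>k<m. avg_cis N (X j) (l k) om)" for j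
   by (intro integrable_const_bound[where B = 1] AE_I2 levy_exp.prod_norm_le_1[OF levy_X] norm_avg_cis_le borel_measurable_prod measurable_occ_cis X_meas)
 qed simp
 have "(%N. expectation (%om. \<Prod>j\<in>UNIV. \<Prod>k<m. avg_cis N (X j) (l k) om)) \<longlonglongrightarrow> (\<Prod>j\<in>(UNIV :: 'p set). complex_of_real (Phi \<psi> m l))"
  unfolding N
 proof (rule tendsto_prod)
  fix j
  show "(%N. expectation (%om. \<Prod>k<m. avg_cis N (X j) (l k) om)) \<longlonglongrightarrow> complex_of_real (Phi \<psi> m l)"
   using levy_exp.avg_cis_moment_limit[where m = m and l = l, OF levy_X[of j]] by (simp add: levy_exp.expectation_prod_occ_cis[OF levy_X m])
 qed
 moreover have "(%N. expectation (%om. \<Prod>j\<in>UNIV. \<Prod>k<m. avg_cis N (X j) (l k) om)) \<longlonglongrightarrow> expectation (%om. \<Prod>k<m. occ (l k) om)"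
 proof (rule integral_dominated_convergence[where w = "%_. 1"])
  show "AE om in M. (%N. \<Prod>j\<in>UNIV. \<Prod>k<m. avg_cis N (X j) (l k) om) \<longlonglongrightarrow> (\<Prod>k<m. occ (l k) om)"
   using paths_rc
  proof eventually_elim
   case (elim om)
   have "(%N. avg_cis N (X j) (l k) om) \<longlonglongrightarrow> occ_cis (X j) (l k) om" for j k using path_limit(3,4)[where Z = "X j" and om = om and l = "l k"] elim by simp
   thus ?case unfolding occ_def swap by (intro tendsto_prod)
  qed
  show "AE om in M. norm (\<Prod>j\<in>UNIV. \<Prod>k<m. avg_cis N (X j) (l k) om) <= 1" for N
   by (intro AE_I2 levy_exp.prod_norm_le_1[OF levy_X] norm_avg_cis_le)
 qed (auto intro!: borel_measurable_prod measurable_occ_cis X_meas occ_measurable)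
 ultimately have "expectation (%om. \<Prod>k<m. occ (l k) om) = (\<Prod>j\<in>(UNIV :: 'p set). complex_of_real (Phi \<psi> m l))"
  by (rule LIMSEQ_unique[symmetric])
 thus ?thesis by (simp add: card_p)
qed

lemma Phi_nonneg: "0 <= Phi \<psi> m l" by (simp add: Phi_def)

lemma occ_minus: "AE om in M. \<forall>l. occ (- l) om = cnj (occ l om)" using paths_rc
proof eventually_elim
 case (elim om)
 show ?case
 proof
  fix l
  have "occ_cis (X j) (- l) om = cnj (occ_cis (X j) l om)" for j
  proof -
   have "\<forall>t\<ge>0. continuous (at_right t) (%s. X j s om)" using elim by blast
   note L = path_limit(4)[where Z = "X j" and om = om, OF this]
   show ?thesis unfolding L using Bochner_Integration.integral_cnj[of unif01 "%s. cis (l \<bullet> X j (max 0 s) om)"] by (simp add: cis_cnj)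
  qed
  thus "occ (- l) om = cnj (occ l om)" by (simp add: occ_def cnj_prod)
 qed
qed

definition occ_sum :: "real => (int^'d => real) => (int^'d) set => 'a => real" where
 "occ_sum dl w A om = Re (\<Sum>l\<in>A. of_real (w l) * occ (lat dl l) om)"

lemma occ_sum_complex:
 assumes A: "finite A" "!!l. l \<in> A ==> - l \<in> A" and w: "!!l. w (- l) = w l"
 shows "AE om in M. (\<Sum>l\<in>A. of_real (w l) * occ (lat dl l) om) = of_real (occ_sum dl w A om)" using occ_minus
proof eventually_elim
 case (elim om)
 have "cnj (\<Sum>l\<in>A. of_real (w l) * occ (lat dl l) om) = (\<Sum>l\<in>A. of_real (w (- l)) * occ (lat dl (- l)) om)"
  using elim w by (simp add: cnj_sum lat_minus)
 also have "... = (\<Sum>l\<in>A. of_real (w l) * occ (lat dl l) om)"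
  by (rule sum.reindex_bij_witness[where i = uminus and j = uminus]) (use A in auto)
 finally have eq: "cnj (\<Sum>l\<in>A. of_real (w l) * occ (lat dl l) om) = (\<Sum>l\<in>A. of_real (w l) * occ (lat dl l) om)" .
 have "Im z = 0" if "cnj z = z" for z using that by (simp add: complex_eq_iff)
 from this[OF eq] have "Im (\<Sum>l\<in>A. of_real (w l) * occ (lat dl l) om) = 0" .
 thus ?case by (simp add: occ_sum_def complex_eq_iff)
qed

lemma occ_sum_moment:
 assumes A: "finite A" "!!l. l \<in> A ==> - l \<in> A" and w: "!!l. w (- l) = w l" and m: "0 < m"
 shows "expectation (%om. occ_sum dl w A om ^ m) = (\<Sum>v\<in>PiE {..<m} (%_. A). (\<Prod>k<m. w (v k)) * Phi \<psi> m (%i. lat dl (v i)) ^ Suc n)"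
  and "integrable M (%om. occ_sum dl w A om ^ m)"
proof -
 have [measurable]: "occ_sum dl w A \<in> bm M" unfolding occ_sum_def by measurable
 have ccx: "AE om in M. (\<Sum>l\<in>A. of_real (w l) * occ (lat dl l) om) = of_real (occ_sum dl w A om)"
  by (rule occ_sum_complex) (use A w in auto)
 have bound: "AE om in M. norm (occ_sum dl w A om) <= (\<Sum>l\<in>A. \<bar>w l\<bar>)" using norm_occ_le
 proof eventually_elim
  case (elim om)
  have "norm (occ_sum dl w A om) <= norm (\<Sum>l\<in>A. of_real (w l) * occ (lat dl l) om)" using abs_Re_le_cmod[of "\<Sum>l\<in>A. of_real (w l) * occ (lat dl l) om"] by (simp add: occ_sum_def)
  also have "... <= (\<Sum>l\<in>A. norm (of_real (w l) * occ (lat dl l) om))" by (rule norm_sum)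
  also have "... <= (\<Sum>l\<in>A. \<bar>w l\<bar>)" using elim by (intro sum_mono) (simp add: norm_mult mult_left_le)
  finally show ?case .
 qed
 show "integrable M (%om. occ_sum dl w A om ^ m)"
 proof (rule integrable_const_bound[where B = "(\<Sum>l\<in>A. \<bar>w l\<bar>) ^ m"])
  show "AE om in M. norm (occ_sum dl w A om ^ m) <= (\<Sum>l\<in>A. \<bar>w l\<bar>) ^ m"
   using bound by eventually_elim (simp add: norm_power power_mono power_abs)
 qed measurable
 have oint: "integrable M (%om. \<Prod>k<m. occ (lat dl (v k)) om)" for v
 proof (rule integrable_const_bound[where B = 1])
  show "AE om in M. norm (\<Prod>k<m. occ (lat dl (v k)) om) <= 1"
   using norm_occ_le by eventually_elim (auto intro!: levy_exp.prod_norm_le_1[OF levy_X])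
 qed measurable
 have "complex_of_real (expectation (%om. occ_sum dl w A om ^ m)) = expectation (%om. complex_of_real (occ_sum dl w A om ^ m))"
  by (rule integral_complex_of_real[symmetric])
 also have "... = expectation (%om. \<Sum>v\<in>PiE {..<m} (%_. A). of_real (\<Prod>k<m. w (v k)) * (\<Prod>k<m. occ (lat dl (v k)) om))"
 proof (rule integral_cong_AE)
  show "AE om in M. complex_of_real (occ_sum dl w A om ^ m) = (\<Sum>v\<in>PiE {..<m} (%_. A). of_real (\<Prod>k<m. w (v k)) * (\<Prod>k<m. occ (lat dl (v k)) om))"
   using ccx
  proof eventually_elim
   case (elim om)
   have "complex_of_real (occ_sum dl w A om ^ m) = (\<Prod>k<m. \<Sum>l\<in>A. of_real (w l) * occ (lat dl l) om)"
   by (simp add: elim)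
   also have "... = (\<Sum>v\<in>PiE {..<m} (%_. A). \<Prod>k<m. of_real (w (v k)) * occ (lat dl (v k)) om)"
   by (rule prod_sum_PiE) (use A in auto)
   finally show ?case by (simp add: prod.distrib)
  qed
 qed measurable
 also have "... = (\<Sum>v\<in>PiE {..<m} (%_. A). expectation (%om. of_real (\<Prod>k<m. w (v k)) * (\<Prod>k<m. occ (lat dl (v k)) om)))"
  by (rule Bochner_Integration.integral_sum) (intro integrable_mult_right oint)
 also have "... = (\<Sum>v\<in>PiE {..<m} (%_. A). of_real (\<Prod>k<m. w (v k)) * complex_of_real (Phi \<psi> m (%i. lat dl (v i)) ^ Suc n))"
  by (intro sum.cong refl) (simp only: integral_mult_right_zero expectation_prod_occ[OF m])
 also have "... = complex_of_real (\<Sum>v\<in>PiE {..<m} (%_. A). (\<Prod>k<m. w (v k)) * Phi \<psi> m (%i. lat dl (v i)) ^ Suc n)"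
  by (simp only: of_real_sum of_real_mult)
 finally show "expectation (%om. occ_sum dl w A om ^ m) = (\<Sum>v\<in>PiE {..<m} (%_. A). (\<Prod>k<m. w (v k)) * Phi \<psi> m (%i. lat dl (v i)) ^ Suc n)"
  by (simp only: of_real_eq_iff)
qed

section \<open>The occupation measure\<close>

definition path_sum :: "'a => ('p => real) => real^'d" where
 "path_sum om s = (\<Sum>j\<in>UNIV. X j (max 0 (s j)) om)"

definition good :: "'a => bool" where
 "good om \<longleftrightarrow> (\<forall>j. \<forall>t\<ge>0. continuous (at_right t) (%s. X j s om)) &
  continuous_on UNIV (%x. \<eta> x 1 om) & (\<forall>x. 0 <= \<eta> x 1 om) &
  (\<forall>A\<in>sets borel. occupation X om (cube 1) A = (NN x. ind A x * ennreal (\<eta> x 1 om)))"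

lemma AE_good: "AE om in M. good om"
proof -
 have "AE om in M. continuous_on (UNIV \<times> {0..}) (%(x,t). \<eta> x t om) &
   (\<forall>t\<ge>0. (\<forall>x. 0 <= \<eta> x t om) &
   (\<forall>A\<in>sets borel. occupation X om (cube t) A = (NN  x. ind A x * ennreal (\<eta> x t om))))"
  using lt unfolding local_time_def by auto
 with paths_rc show ?thesis
 proof eventually_elim
  case (elim om)
  have "continuous_on UNIV ((%(x,t). \<eta> x t om) \<circ> (%x. (x, 1)))"
   using elim by (intro continuous_on_compose continuous_intros) (auto intro: continuous_on_subset)
  thus ?case using elim unfolding good_def by (auto simp: comp_def)
 qed
qed

lemma eta_meas[measurable]: "\<eta> x t \<in> bm M" using lt by (simp add: local_time_def)

lemma path_sum_measurable:
 assumes "good om"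
 shows "path_sum om \<in> bm (PiM UNIV (%_. unif01))" "path_sum om \<in> bm (PiM UNIV (%_. lborel))"
proof -
 have p: "(%s. X j (max 0 s) om) \<in> bm borel" for j
  by (rule path_limit(2)[where Z = "X j"]) (use assms in \<open>simp add: good_def\<close>)
 show "path_sum om \<in> bm (PiM UNIV (%_. unif01))" unfolding path_sum_def[abs_def]
 proof (rule borel_measurable_sum)
  fix j :: 'p
  have "(%s. s j) \<in> measurable (PiM UNIV (%_. unif01)) borel"
   using measurable_component_singleton[of j UNIV "%_. unif01"] by simp
  from measurable_compose[OF this p[of j]] show "(%s. X j (max 0 (s j)) om) \<in> bm (PiM UNIV (%_. unif01))" .
 qed
 show "path_sum om \<in> bm (PiM UNIV (%_. lborel))" unfolding path_sum_def[abs_def]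
 proof (rule borel_measurable_sum)
  fix j :: 'p
  have "(%s. s j) \<in> measurable (PiM UNIV (%_. lborel :: real measure)) borel"
   using measurable_component_singleton[of j UNIV "%_. lborel :: real measure"] by simp
  from measurable_compose[OF this p[of j]] show "(%s. X j (max 0 (s j)) om) \<in> bm (PiM UNIV (%_. lborel))" .
 qed
qed

text \<open>With uniformly sampled times the occupation measure of the unit cube becomes the law of
  \<open>path_sum\<close>. Integrals against \<eta> can thereby be computed along the path, and
  conversely.\<close>

lemma occupation_eq_distr:
 assumes g: "good om"
 shows "distr (PiM UNIV (%_. unif01)) borel (path_sum om) = density lborel (%x. ennreal (\<eta> x 1 om))"
proof (rule measure_eqI)
 let ?L = "PiM (UNIV :: 'p set) (%_. lborel :: real measure)"
 have [measurable]: "(%x. \<eta> x 1 om) \<in> bm borel" using g by (intro borel_measurable_continuous_onI) (simp add: good_def)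
 have PL: "PiM (UNIV :: 'p set) (%_. unif01) = density ?L (%x. \<Prod>i\<in>UNIV. ind {0..1} (x i))"
 proof -
  have "sigma_finite_measure unif01" using prob_space_unif01 by (simp add: prob_space_imp_sigma_finite)
  thus ?thesis unfolding unif01_def by (intro PiM_density) (auto simp: sigma_finite_lborel)
 qed
 fix A assume "A \<in> sets (distr (PiM UNIV (%_. unif01)) borel (path_sum om))"
 hence A[measurable]: "A \<in> sets borel" by simp
 note pm = path_sum_measurable[OF g]
 have indm: "(%x. \<Prod>i\<in>UNIV. ind {0..1} (x i) :: ennreal) \<in> bm ?L"
  by (rule borel_measurable_prod_ennreal) (auto intro!: measurable_compose[OF measurable_component_singleton])
 have Am: "(%s. ind A (path_sum om s) :: ennreal) \<in> bm ?L"
  using measurable_compose[OF pm(2), of "ind A :: _ => ennreal" borel] by simp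
 have "emeasure (distr (PiM UNIV (%_. unif01)) borel (path_sum om)) A = (\<integral>\<^sup>+s. ind A (path_sum om s) \<partial>PiM UNIV (%_. unif01))"
  using pm by (subst nn_integral_indicator[symmetric], simp) (subst nn_integral_distr, auto)
 also have "... = (\<integral>\<^sup>+s. (\<Prod>i\<in>UNIV. ind {0..1} (s i)) * ind A (path_sum om s) \<partial>?L)"
  unfolding PL by (rule nn_integral_density[OF indm Am])
 also have "... = (\<integral>\<^sup>+s. (\<Prod>i\<in>UNIV. ind {0..1} ((\<chi> i. s i) $ i)) * ind A (path_sum om (%i. (\<chi> i. s i) $ i)) \<partial>?L)"
  by simp
 also have "... = (\<integral>\<^sup>+s. (\<Prod>i\<in>UNIV. ind {0..1} (s $ i)) * ind A (path_sum om (%i. s $ i)) \<partial>distr ?L borel (%f. \<chi> i. f i))"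
 proof (rule nn_integral_distr[symmetric, where f = "%s. (\<Prod>i\<in>UNIV. ind {0..1} (s $ i)) * ind A (path_sum om (%i. s $ i))"])
  have bm: "(%s :: real^'p. s $ i) \<in> bm borel" for i by (intro borel_measurable_continuous_onI continuous_intros)
  show "(%f. \<chi> i. f i) \<in> bm ?L" by (rule vec_lambda_measurable) simp
  have p: "(%s. X j (max 0 s) om) \<in> bm borel" for j
   by (rule path_limit(2)[where Z = "X j"]) (use g in \<open>simp add: good_def\<close>)
  have "(%s :: real^'p. path_sum om (%i. s $ i)) \<in> bm borel"
   unfolding path_sum_def by (intro borel_measurable_sum measurable_compose[OF bm p])
  hence "(%s :: real^'p. ind A (path_sum om (%i. s $ i)) :: ennreal) \<in> bm borel" by (rule measurable_compose) simp
  moreover have "(%s :: real^'p. \<Prod>i\<in>UNIV. ind {0..1} (s $ i) :: ennreal) \<in> bm borel"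
   by (intro borel_measurable_prod_ennreal measurable_compose[OF bm]) simp
  ultimately show "(%s :: real^'p. (\<Prod>i\<in>UNIV. ind {0..1} (s $ i)) * ind A (path_sum om (%i. s $ i)) :: ennreal) \<in> bm (distr ?L borel (%f. \<chi> i. f i))"
   unfolding measurable_distr_eq1 by (intro borel_measurable_times_ennreal)
 qed
 also have "... = (NN s. (\<Prod>i\<in>UNIV. ind {0..1} (s $ i)) * ind A (path_sum om (%i. s $ i)))"
  by (simp only: lborel_cart_eq)
 also have "... = occupation X om (cube 1) A" unfolding occupation_def
 proof (rule nn_integral_cong)
  fix s :: "real^'p"
  show "(\<Prod>i\<in>UNIV. ind {0..1} (s $ i)) * ind A (path_sum om (%i. s $ i)) = ind (cube 1) s * (ind A (\<Sum>j\<in>UNIV. X j (s $ j) om) :: ennreal)"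
  proof (cases "s \<in> cube 1")
   case True
   hence "!!j. 0 <= s $ j & s $ j <= 1" by (simp add: cube_def)
   thus ?thesis using True by (simp add: path_sum_def indicator_def max_def)
  next
   case False
   then obtain j where "~ (0 <= s $ j & s $ j <= 1)" by (auto simp: cube_def)
   hence "(\<Prod>i\<in>UNIV. ind {0..1} (s $ i) :: ennreal) = 0" by (intro prod_zero bexI[of _ j]) auto
   thus ?thesis using False by simp
  qed
 qed
 also have "... = (NN x. ind A x * ennreal (\<eta> x 1 om))" using g A by (simp add: good_def)
 also have "... = emeasure (density lborel (%x. ennreal (\<eta> x 1 om))) A"
  by (subst emeasure_density) (auto simp: mult.commute)
 finally show "emeasure (distr (PiM UNIV (%_. unif01)) borel (path_sum om)) A = emeasure (density lborel (%x. ennreal (\<eta> x 1 om))) A" .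
qed simp

lemma nn_integral_path_sum:
 assumes g: "good om" and [measurable]: "F \<in> bm borel"
 shows "(\<integral>\<^sup>+s. F (path_sum om s) \<partial>PiM UNIV (%_. unif01)) = (NN x. ennreal (\<eta> x 1 om) * F x)"
proof -
 have [measurable]: "(%x. \<eta> x 1 om) \<in> bm borel" using g by (intro borel_measurable_continuous_onI) (simp add: good_def)
 have "(\<integral>\<^sup>+s. F (path_sum om s) \<partial>PiM UNIV (%_. unif01)) = (\<integral>\<^sup>+x. F x \<partial>distr (PiM UNIV (%_. unif01)) borel (path_sum om))"
  using path_sum_measurable[OF g] by (subst nn_integral_distr) auto
 also have "... = (NN x. ennreal (\<eta> x 1 om) * F x)"
  unfolding occupation_eq_distr[OF g] by (rule nn_integral_density) measurable
 finally show ?thesis .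
qed

lemma occ_eq_integral:
 assumes g: "good om"
 shows "occ l om = (\<integral>s. cis (l \<bullet> path_sum om s) \<partial>PiM UNIV (%_. unif01))"
proof -
 interpret U: prob_space unif01 by (rule prob_space_unif01)
 interpret PU: product_prob_space "%_::'p. unif01" by unfold_locales
 have rc: "\<forall>t\<ge>0. continuous (at_right t) (%s. X j s om)" for j using g by (simp add: good_def)
 have "occ l om = (\<Prod>j\<in>UNIV. \<integral>s. cis (l \<bullet> X j (max 0 s) om) \<partial>unif01)"
  unfolding occ_def by (intro prod.cong refl path_limit(4) rc)
 also have "... = (\<integral>s. (\<Prod>j\<in>UNIV. cis (l \<bullet> X j (max 0 (s j)) om)) \<partial>PiM UNIV (%_. unif01))"
 proof (rule PU.product_integral_prod[symmetric])
  fix j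
  have [measurable]: "(%s. X j (max 0 s) om) \<in> bm unif01" using path_limit(2)[where Z = "X j" and om = om, OF rc] by simp
  show "integrable unif01 (%s. cis (l \<bullet> X j (max 0 s) om))" by (intro U.integrable_const_bound[where B = 1]) auto
 qed simp
 also have "... = (\<integral>s. cis (l \<bullet> path_sum om s) \<partial>PiM UNIV (%_. unif01))"
  by (simp add: prod_cis path_sum_def inner_sum_right)
 finally show ?thesis .
qed

end

section \<open>The Fejer kernel\<close>

definition fejer :: "nat => real => real" where
 "fejer r y = (cmod (\<Sum>k<r. cis (real k * y)))\<^sup>2 / real r"

lemma fejer_nonneg[simp]: "0 <= fejer r y" by (simp add: fejer_def)

lemma fejer_measurable[measurable]: "fejer r \<in> bm borel" unfolding fejer_def[abs_def] by measurable

lemma fejer_expand: "fejer r y = (\<Sum>j<r. \<Sum>k<r. cos ((real j - real k) * y)) / real r"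
proof -
 let ?D = "\<Sum>k<r. cis (real k * y)"
 have "complex_of_real ((cmod ?D)\<^sup>2) = ?D * cnj ?D" by (rule complex_norm_square)
 also have "... = (\<Sum>j<r. \<Sum>k<r. cis ((real j - real k) * y))"
  by (simp add: cnj_sum sum_product cis_cnj cis_mult left_diff_distrib)
 finally have "Re (complex_of_real ((cmod ?D)\<^sup>2)) = Re (\<Sum>j<r. \<Sum>k<r. cis ((real j - real k) * y))" by (rule arg_cong)
 thus ?thesis by (simp add: fejer_def)
qed

lemma nn_integral_fejer_period:
 assumes r: "0 < r" and dl: "0 < dl"
 shows "(NN y. ennreal (fejer r (dl * y)) * ind {- (pi / dl)..pi / dl} y) = ennreal (2 * pi / dl)"
proof -
 define A where "A j k y = (if j = k then y else sin ((real j - real k) * (dl * y)) / ((real j - real k) * dl))" for j k :: nat and y :: real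
 define F where "F y = (\<Sum>j<r. \<Sum>k<r. A j k y) / real r" for y
 have A: "(A j k has_real_derivative cos ((real j - real k) * (dl * y))) (at y)" for j k y
 proof (cases "j = k")
  case True
  hence "A j k = (%y. y)" by (simp add: A_def fun_eq_iff)
  thus ?thesis using True by simp
 next
  case False
  hence "A j k = (%y. sin ((real j - real k) * (dl * y)) / ((real j - real k) * dl))" by (simp add: A_def fun_eq_iff)
  moreover have "(... has_real_derivative cos ((real j - real k) * (dl * y)) * ((real j - real k) * dl) / ((real j - real k) * dl)) (at y)"
   by (auto intro!: derivative_eq_intros)
  ultimately show ?thesis using False dl by simp
 qed
 have "(NN y. ennreal (fejer r (dl * y)) * ind {- (pi / dl)..pi / dl} y) = F (pi / dl) - F (- (pi / dl))"
 proof (rule nn_integral_FTC_Icc)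
  show "(F has_real_derivative fejer r (dl * y)) (at y)" for y
   unfolding F_def[abs_def] fejer_expand by (intro DERIV_cdivide DERIV_sum A)
 qed (use dl in \<open>auto intro: order_trans[of _ 0]\<close>)
 also have "F (pi / dl) - F (- (pi / dl)) = 2 * pi / dl"
 proof -
  have Apm: "A j k (pi / dl) - A j k (- (pi / dl)) = (if j = k then 2 * pi / dl else 0)" for j k
  proof (cases "j = k")
   case False
   have s: "sin ((real j - real k) * pi) = 0" unfolding sin_times_pi_eq_0 by (intro Ints_diff Ints_of_nat)
   have "(real j - real k) * (dl * (pi / dl)) = (real j - real k) * pi" using dl by simp
   moreover have "(real j - real k) * (dl * (- (pi / dl))) = - ((real j - real k) * pi)" using dl by simp
   ultimately show ?thesis using False by (simp only: A_def if_False s sin_minus)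
  qed (simp add: A_def)
  have "F (pi / dl) - F (- (pi / dl)) = (\<Sum>j<r. \<Sum>k<r. A j k (pi / dl) - A j k (- (pi / dl))) / real r"
   by (simp add: F_def sum_subtractf diff_divide_distrib)
  also have "... = 2 * pi / dl" unfolding Apm using r by (simp add: sum.delta)
  finally show ?thesis .
 qed
 finally show ?thesis .
qed

text \<open>Multiplying the Dirichlet sum by 1 - exp(i th) telescopes it to a difference of two
  numbers of modulus 1.\<close>

lemma fejer_tail: "0 < r ==> fejer r th * (2 - 2 * cos th) <= 4 / real r"
proof -
 assume r: "0 < r"
 let ?D = "\<Sum>k<r. cis (real k * th)"
 have "?D * (1 - cis th) = 1 - cis (real r * th)"
 proof -
  have D: "?D = (\<Sum>k<r. cis th ^ k)" by (intro sum.cong refl) (simp add: Complex.DeMoivre)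
  have "?D * (1 - cis th) = 1 - cis th ^ r" unfolding D using power_diff_1_eq[of "cis th" r] by (simp add: algebra_simps)
  thus ?thesis by (simp only: Complex.DeMoivre)
 qed
 hence "cmod (?D * (1 - cis th)) <= 2" using norm_triangle_ineq4[of 1 "cis (real r * th)"] by simp
 hence "(cmod ?D * cmod (1 - cis th))\<^sup>2 <= 2\<^sup>2" unfolding norm_mult by (intro power_mono) auto
 moreover have "(cmod (1 - cis th))\<^sup>2 = 2 - 2 * cos th"
  unfolding cmod_power2 using sin_cos_squared_add[of th] by (simp add: power2_eq_square algebra_simps)
 ultimately have "(cmod ?D)\<^sup>2 * (2 - 2 * cos th) <= 4" by (simp add: power_mult_distrib)
 hence "(cmod ?D)\<^sup>2 * (2 - 2 * cos th) / real r <= 4 / real r" using r by (intro divide_right_mono) auto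
 thus ?thesis by (simp add: fejer_def)
qed

text \<open>The mass over a period is 2 \<pi> / dl for every r, and off the peak the kernel decays
  uniformly like 1 / r. \<open>a'\<close> caps the window at half a period, where the cosine is
  still monotone.\<close>

lemma fejer_concentrates:
 assumes dl: "0 < dl" and a: "0 < a" and kap: "kap < 1"
 shows "\<forall>\<^sub>F r in sequentially. ennreal (kap * (2 * pi / dl)) <= (NN y. ennreal (fejer r (dl * y)) * ind {-a..a} y)"
proof -
 define b where "b = pi / dl"
 define a' where "a' = min a b"
 have b: "0 < b" using dl by (simp add: b_def)
 have a': "0 < a'" "a' <= a" "a' <= b" using a b by (auto simp: a'_def)
 have db: "dl * b = pi" using dl by (simp add: b_def)
 define c where "c = 2 - 2 * cos (dl * a')"
 have da: "0 < dl * a'" "dl * a' <= pi" using dl a' mult_left_mono[OF a'(3), of dl] db by auto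
 have c: "0 < c" using cos_monotone_0_pi[of 0 "dl * a'"] da by (simp add: c_def)
 have ev: "\<forall>\<^sub>F r in sequentially. 4 / (c * real r) <= 1 - kap"
 proof -
  have "(%r. 4 / (c * real r)) \<longlonglongrightarrow> 0" using c by real_asymp
  from order_tendstoD(2)[OF this, of "1 - kap"] kap show ?thesis by (auto elim: eventually_mono)
 qed
 show ?thesis using ev eventually_gt_at_top[of 0]
 proof eventually_elim
  case (elim r)
  let ?I = "\<integral>\<^sup>+y. ennreal (fejer r (dl * y)) * ind {-a..a} y \<partial>lborel"
  have pw: "ennreal (fejer r (dl * y)) * ind {-b..b} y <= ennreal (fejer r (dl * y)) * ind {-a..a} y + ennreal (1 - kap) * ind {-b..b} y" for y
  proof (cases "y \<in> {-b..b} & y \<notin> {-a..a}")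
   case True
   hence y: "\<bar>y\<bar> <= b" "a' < \<bar>y\<bar>" using a' by auto
   have "dl * a' <= dl * \<bar>y\<bar>" "dl * \<bar>y\<bar> <= pi" using y dl mult_left_mono[OF y(1), of dl] db by auto
   hence "cos (dl * \<bar>y\<bar>) <= cos (dl * a')" using da by (intro cos_monotone_0_pi_le) auto
   moreover have "cos (dl * \<bar>y\<bar>) = cos (dl * y)" by (cases "0 <= y") auto
   ultimately have "c <= 2 - 2 * cos (dl * y)" by (simp add: c_def)
   hence "fejer r (dl * y) * c <= fejer r (dl * y) * (2 - 2 * cos (dl * y))" by (intro mult_left_mono) auto
   also have "... <= 4 / real r" using fejer_tail elim by simp
   finally have "fejer r (dl * y) <= 4 / (c * real r)" using c elim by (simp add: field_simps)
   also have "... <= 1 - kap" using elim by simp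
   finally show ?thesis using True by (simp add: ennreal_leI)
  next
   case False
   thus ?thesis by (auto simp: indicator_def)
  qed
  have "ennreal (2 * b) = (NN y. ennreal (fejer r (dl * y)) * ind {-b..b} y)"
   using nn_integral_fejer_period[of r dl] elim dl by (simp add: b_def)
  also have "... <= (NN y. ennreal (fejer r (dl * y)) * ind {-a..a} y + ennreal (1 - kap) * ind {-b..b} y)"
   by (rule nn_integral_mono) (rule pw)
  also have "... = ?I + (NN y. ennreal (1 - kap) * ind {-b..b} y)" by (rule nn_integral_add) measurable
  also have "(NN y. ennreal (1 - kap) * ind {-b..b} y) = ennreal (1 - kap) * ennreal (2 * b)"
   using b by (subst nn_integral_cmult_indicator) auto
  also have "... = ennreal ((1 - kap) * (2 * b))" using kap b by (simp add: ennreal_mult)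
  finally have le: "ennreal (2 * b) <= ?I + ennreal ((1 - kap) * (2 * b))" .
  have "ennreal (kap * (2 * b)) <= ?I"
  proof (cases ?I)
   case (real i)
   hence "ennreal (2 * b) <= ennreal (i + (1 - kap) * (2 * b))" using le kap b by simp
   hence "2 * b <= i + (1 - kap) * (2 * b)" using real kap b by (subst (asm) ennreal_le_iff) auto
   hence "kap * (2 * b) <= i" by (simp add: algebra_simps)
   thus ?thesis unfolding real by (rule ennreal_leI)
  qed simp
  thus ?case by (simp add: b_def)
 qed
qed

definition int_cube :: "nat => (int^'d::finite) set" where
 "int_cube r = (%u. \<chi> i. int (u i)) ` PiE UNIV (%_. {..<r})"

lemma inj_int_cube: "inj_on (%u. (\<chi> i. int (u i)) :: int^'d::finite) S" by (auto simp: inj_on_def vec_eq_iff)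

lemma finite_int_cube[simp]: "finite (int_cube r :: (int^'d::finite) set)"
 unfolding int_cube_def by (intro finite_imageI finite_PiE) auto

lemma card_int_cube: "card (int_cube r :: (int^'d::finite) set) = r ^ CARD('d)"
 unfolding int_cube_def by (subst card_image[OF inj_int_cube]) (simp add: card_PiE)

definition fejer_kernel :: "nat => real => real^'d::finite => real" where
 "fejer_kernel r dl x = (\<Prod>i\<in>UNIV. fejer r (dl * x $ i))"

definition cube_diffs :: "nat => (int^'d::finite) set" where
 "cube_diffs r = (%(u, v). u - v) ` (int_cube r \<times> int_cube r)"

text \<open>The Fejer coefficient, in closed form the product of 1 - |z_i| / r over the coordinates.
  As a count of pairs it is visibly even, nonnegative and at most 1, which is all that the moment
  bound uses.\<close>

definition fejer_weight :: "nat => int^'d::finite => real" where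
 "fejer_weight r z = real (card {p \<in> int_cube r \<times> int_cube r. (%(u, v). u - v) p = z}) / real r ^ CARD('d)"

lemma finite_cube_diffs[simp]: "finite (cube_diffs r)" by (simp add: cube_diffs_def)

lemma uminus_cube_diffs: "z \<in> cube_diffs r ==> - z \<in> cube_diffs r"
 unfolding cube_diffs_def by (auto simp: image_iff) (metis minus_diff_eq)

lemma fejer_weight_minus: "fejer_weight r (- z) = fejer_weight r z"
proof -
 have "bij_betw (%(u, v). (v, u)) {p \<in> int_cube r \<times> int_cube r. (%(u, v). u - v) p = - z} {p \<in> int_cube r \<times> int_cube r. (%(u, v). u - v) p = z}"
  by (rule bij_betwI[where g = "%(u, v). (v, u)"]) (auto simp: equation_minus_iff)
 thus ?thesis by (simp add: fejer_weight_def bij_betw_same_card)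
qed

lemma fejer_weight_nonneg: "0 <= fejer_weight r z" by (simp add: fejer_weight_def)

lemma fejer_weight_le_1: "0 < r ==> fejer_weight r (z :: int^'d::finite) <= 1"
proof -
 assume r: "0 < r"
 have "card {p \<in> int_cube r \<times> int_cube r. (%(u, v). u - v) p = z} <= card (int_cube r :: (int^'d) set)"
  by (rule card_inj_on_le[where f = fst]) (auto simp: inj_on_def)
 hence "real (card {p \<in> int_cube r \<times> int_cube r. (%(u, v). u - v) p = z}) <= real r ^ CARD('d)"
  by (simp add: card_int_cube flip: of_nat_power)
 thus ?thesis using r by (simp add: fejer_weight_def)
qed

lemma sum_cube_diffs:
 fixes g :: "int^'d::finite => complex"
 shows "(\<Sum>u\<in>int_cube r. \<Sum>v\<in>int_cube r. g (u - v)) / of_nat r ^ CARD('d) = (\<Sum>z\<in>cube_diffs r. of_real (fejer_weight r z) * g z)"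
proof -
 let ?G = "int_cube r :: (int^'d) set"
 have "(\<Sum>u\<in>?G. \<Sum>v\<in>?G. g (u - v)) = (\<Sum>p\<in>?G \<times> ?G. g ((%(u, v). u - v) p))"
  by (simp add: sum.cartesian_product case_prod_beta)
 also have "... = (\<Sum>z\<in>cube_diffs r. \<Sum>p\<in>{p \<in> ?G \<times> ?G. (%(u, v). u - v) p = z}. g ((%(u, v). u - v) p))"
  by (rule sum.group[symmetric]) (auto simp: cube_diffs_def)
 also have "... = (\<Sum>z\<in>cube_diffs r. of_nat (card {p \<in> ?G \<times> ?G. (%(u, v). u - v) p = z}) * g z)"
 proof (rule sum.cong[OF refl])
  fix z
  have "(\<Sum>p\<in>{p \<in> ?G \<times> ?G. (%(u, v). u - v) p = z}. g ((%(u, v). u - v) p)) = (\<Sum>p\<in>{p \<in> ?G \<times> ?G. (%(u, v). u - v) p = z}. g z)"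
   by (rule sum.cong) auto
  thus "(\<Sum>p\<in>{p \<in> ?G \<times> ?G. (%(u, v). u - v) p = z}. g ((%(u, v). u - v) p)) = of_nat (card {p \<in> ?G \<times> ?G. (%(u, v). u - v) p = z}) * g z"
   by simp
 qed
 finally show ?thesis by (simp add: fejer_weight_def sum_divide_distrib)
qed

lemma fejer_kernel_expand:
 fixes x :: "real^'d::finite"
 shows "complex_of_real (fejer_kernel r dl x) = (\<Sum>z\<in>cube_diffs r. of_real (fejer_weight r z) * cis (lat dl z \<bullet> x))"
proof -
 define S where "S = (\<Sum>z\<in>int_cube r. cis (lat dl z \<bullet> x))"
 have "(\<Prod>i\<in>UNIV. \<Sum>k<r. cis (real k * (dl * x $ i))) = (\<Sum>u\<in>PiE UNIV (%_. {..<r}). \<Prod>i\<in>UNIV. cis (real (u i) * (dl * x $ i)))"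
  by (rule prod_sum_PiE) auto
 also have "... = (\<Sum>u\<in>PiE UNIV (%_. {..<r}). cis (lat dl (\<chi> i. int (u i)) \<bullet> x))"
  by (simp add: prod_cis inner_vec_def mult_ac)
 also have "... = S" unfolding S_def int_cube_def by (subst sum.reindex[OF inj_int_cube]) simp
 finally have S: "(\<Prod>i\<in>UNIV. \<Sum>k<r. cis (real k * (dl * x $ i))) = S" .
 have "fejer_kernel r dl x = (\<Prod>i\<in>UNIV. (cmod (\<Sum>k<r. cis (real k * (dl * x $ i))))\<^sup>2) / real r ^ CARD('d)"
  by (simp add: fejer_kernel_def fejer_def prod_dividef)
 also have "... = (cmod S)\<^sup>2 / real r ^ CARD('d)" by (simp add: prod_power_distrib[symmetric] prod_norm S)
 finally have "complex_of_real (fejer_kernel r dl x) = S * cnj S / of_nat r ^ CARD('d)"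
  by (simp add: complex_norm_square[symmetric])
 also have "S * cnj S = (\<Sum>u\<in>int_cube r. \<Sum>v\<in>int_cube r. cis (lat dl (u - v) \<bullet> x))"
  by (simp add: S_def cnj_sum sum_product cis_cnj cis_mult lat_diff inner_diff_left)
 finally show ?thesis by (simp only: sum_cube_diffs[where g = "%z. cis (lat dl z \<bullet> x)"])
qed

lemma fejer_kernel_nonneg[simp]: "0 <= fejer_kernel r dl x" by (simp add: fejer_kernel_def prod_nonneg)

lemma fejer_kernel_measurable[measurable]: "fejer_kernel r dl \<in> bm (borel :: (real^'d::finite) measure)"
proof -
 have [measurable]: "(%x::real^'d. x $ i) \<in> bm borel" for i by (intro borel_measurable_continuous_onI continuous_intros)
 show ?thesis unfolding fejer_kernel_def[abs_def] by measurable
qed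

lemma nn_integral_fejer_kernel_box:
 assumes a: "0 <= a"
 shows "(NN x. ennreal (fejer_kernel r dl x) * ind {x :: real^'d::finite. \<forall>i. \<bar>x $ i\<bar> <= a} x)
  = (NN y. ennreal (fejer r (dl * y)) * ind {-a..a} y) ^ CARD('d)"
proof -
 let ?P = "PiM (UNIV :: 'd set) (%_. lborel :: real measure)"
 interpret product_sigma_finite "%_::'d. lborel :: real measure" by (rule product_sigma_finite_lborel)
 let ?f = "%x::real^'d. \<Prod>i\<in>UNIV. ennreal (fejer r (dl * x $ i)) * ind {-a..a} (x $ i)"
 have xm[measurable]: "(%x::real^'d. x $ i) \<in> bm borel" for i by (intro borel_measurable_continuous_onI continuous_intros)
 have vm: "(%f. \<chi> i. f i) \<in> bm ?P" by (rule vec_lambda_measurable) simp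
 have "ennreal (fejer_kernel r dl x) * ind {x. \<forall>i. \<bar>x $ i\<bar> <= a} x = ?f x" for x :: "real^'d"
 proof (cases "\<forall>i. \<bar>x $ i\<bar> <= a")
  case True
  hence "!!i. x $ i \<in> {-a..a}" by (simp add: abs_le_iff) (metis minus_le_iff)
  thus ?thesis using True by (simp add: fejer_kernel_def prod_ennreal)
 next
  case False
  then obtain i where "~ \<bar>x $ i\<bar> <= a" by blast
  hence "x $ i \<notin> {-a..a}" by auto
  hence "?f x = 0" by (intro prod_zero bexI[of _ i]) auto
  thus ?thesis using False by simp
 qed
 hence "(NN x. ennreal (fejer_kernel r dl x) * ind {x :: real^'d. \<forall>i. \<bar>x $ i\<bar> <= a} x) = (\<integral>\<^sup>+x. ?f x \<partial>distr ?P borel (%f. \<chi> i. f i))"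
  by (simp add: lborel_cart_eq)
 also have "... = (\<integral>\<^sup>+f. ?f (\<chi> i. f i) \<partial>?P)"
 proof (rule nn_integral_distr[OF vm])
  show "?f \<in> bm (distr ?P borel (%f. \<chi> i. f i))" unfolding measurable_distr_eq1 by measurable
 qed
 also have "... = (\<integral>\<^sup>+f. (\<Prod>i\<in>UNIV. ennreal (fejer r (dl * f i)) * ind {-a..a} (f i)) \<partial>?P)" by simp
 also have "... = (\<Prod>i\<in>(UNIV :: 'd set). \<integral>\<^sup>+y. ennreal (fejer r (dl * y)) * ind {-a..a} y \<partial>lborel)"
  by (rule product_nn_integral_prod) auto
 finally show ?thesis by simp
qed

section \<open>Upper bound for the moments of the local time\<close>

context additive_stable
begin

lemma fejer_occupation:
 assumes g: "good om"
 shows "(NN x. ennreal (\<eta> x 1 om) * ennreal (fejer_kernel r dl x)) = ennreal (occ_sum dl (fejer_weight r) (cube_diffs r) om)"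
  and "0 <= occ_sum dl (fejer_weight r) (cube_diffs r) om"
proof -
 let ?U = "PiM (UNIV :: 'p set) (%_. unif01)"
 interpret U: prob_space ?U by (rule prob_space_PiM) (rule prob_space_unif01)
 define H where "H s = (\<Sum>z\<in>cube_diffs r. of_real (fejer_weight r z) * cis (lat dl z \<bullet> path_sum om s))" for s
 have pm[measurable]: "path_sum om \<in> bm ?U" by (rule path_sum_measurable[OF g])
 have ci: "integrable ?U (%s. cis (l \<bullet> path_sum om s))" for l by (intro U.integrable_const_bound[where B = 1]) auto
 have Hi: "integrable ?U H" unfolding H_def by (intro Bochner_Integration.integrable_sum integrable_mult_right ci)
 have K: "fejer_kernel r dl (path_sum om s) = Re (H s)" for s
  using arg_cong[OF fejer_kernel_expand[of r dl "path_sum om s"], of Re] by (simp only: H_def Re_complex_of_real)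
 have "(\<integral>s. H s \<partial>?U) = (\<Sum>z\<in>cube_diffs r. of_real (fejer_weight r z) * occ (lat dl z) om)"
  unfolding H_def by (subst Bochner_Integration.integral_sum) (auto intro!: integrable_mult_right ci sum.cong simp: occ_eq_integral[OF g])
 hence I: "(\<integral>s. Re (H s) \<partial>?U) = occ_sum dl (fejer_weight r) (cube_diffs r) om"
  using integral_Re[OF Hi] by (simp only: occ_sum_def)
 have nn: "0 <= Re (H s)" for s by (metis K fejer_kernel_nonneg)
 have "(NN x. ennreal (\<eta> x 1 om) * ennreal (fejer_kernel r dl x)) = (\<integral>\<^sup>+s. ennreal (fejer_kernel r dl (path_sum om s)) \<partial>?U)"
  by (rule nn_integral_path_sum[OF g, symmetric]) measurable
 also have "... = (\<integral>\<^sup>+s. ennreal (Re (H s)) \<partial>?U)" by (simp only: K)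
 also have "... = ennreal (\<integral>s. Re (H s) \<partial>?U)" by (rule nn_integral_eq_integral) (use Hi nn in auto)
 finally show "(NN x. ennreal (\<eta> x 1 om) * ennreal (fejer_kernel r dl x)) = ennreal (occ_sum dl (fejer_weight r) (cube_diffs r) om)"
  unfolding I .
 show "0 <= occ_sum dl (fejer_weight r) (cube_diffs r) om" unfolding I[symmetric] by (rule integral_nonneg_AE) (simp add: nn)
qed

text \<open>Continuity keeps \<eta> close to its value at 0 on a small box, and the kernel puts
  almost the full mass of one period there. Everything else, including the other peaks of the
  periodic kernel, contributes nonnegatively and is dropped; no control of \<eta> away from 0 is
  required.\<close>

lemma local_time_le_fejer:
 assumes g: "good om" and dl: "0 < dl" and v: "0 <= v" "v < \<eta> 0 1 om"
 shows "\<forall>\<^sub>F r in sequentially. v <= (dl / (2 * pi)) ^ CARD('d) * occ_sum dl (fejer_weight r) (cube_diffs r) om"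
proof -
 define q where "q = \<eta> 0 1 om"
 \<comment> \<open>kap^(d+1) = v / q: one factor pays for the continuity of \<eta>, and one factor
   per coordinate for the concentration of the kernel.\<close>
 define kap where "kap = root (Suc CARD('d)) (v / q)"
 have q: "0 < q" "v < q" using v by (auto simp: q_def)
 have kap: "0 <= kap" "kap < 1" "kap ^ Suc CARD('d) = v / q"
 proof -
  show "0 <= kap" unfolding kap_def using v q by (intro real_root_ge_zero) auto
  show p: "kap ^ Suc CARD('d) = v / q" unfolding kap_def using v q by (intro real_root_pow_pos2) auto
  show "kap < 1"
  proof (rule ccontr)
   assume "~ kap < 1"
   hence "1 <= kap ^ Suc CARD('d)" by (intro one_le_power) simp
   thus False unfolding p using q by (simp add: less_divide_eq)
  qed
 qed
 have "isCont (%x. \<eta> x 1 om) 0" using g by (simp add: good_def continuous_on_eq_continuous_at)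
 hence "\<forall>\<^sub>F x in at 0. kap * q < \<eta> x 1 om"
  unfolding isCont_def by (rule order_tendstoD(1)) (use kap q in \<open>simp add: q_def[symmetric]\<close>)
 then obtain e where e: "0 < e" "!!x. x ~= 0 ==> dist x 0 < e ==> kap * q < \<eta> x 1 om" unfolding eventually_at by auto
 define a where "a = e / (2 * real CARD('d))"
 have a: "0 < a" using e by (simp add: a_def)
 have near: "kap * q <= \<eta> x 1 om" if "\<forall>i. \<bar>x $ i\<bar> <= a" for x
 proof (cases "x = 0")
  case True
  thus ?thesis using kap q by (simp add: q_def[symmetric])
 next
  case False
  have "norm x <= (\<Sum>i\<in>UNIV. \<bar>x $ i\<bar>)" by (rule norm_le_l1_cart)
  also have "... <= real CARD('d) * a" using that sum_bounded_above[of UNIV "%i. \<bar>x $ i\<bar>" a] by simp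
  also have "... = e / 2" by (simp add: a_def)
  also have "... < e" using e by simp
  finally show ?thesis using e(2)[OF False] by simp
 qed
 show ?thesis using fejer_concentrates[OF dl a kap(2)]
 proof eventually_elim
  case (elim r)
  let ?B = "{x :: real^'d. \<forall>i. \<bar>x $ i\<bar> <= a}"
  let ?I = "\<integral>\<^sup>+y. ennreal (fejer r (dl * y)) * ind {-a..a} y \<partial>lborel"
  have "(%x::real^'d. x $ i) \<in> bm borel" for i by (intro borel_measurable_continuous_onI continuous_intros)
  hence [measurable]: "?B \<in> sets borel" by measurable
  have "ennreal (v * (2 * pi / dl) ^ CARD('d)) = ennreal (kap * q) * ennreal (kap * (2 * pi / dl)) ^ CARD('d)"
  proof -
   have "v * (2 * pi / dl) ^ CARD('d) = (kap * q) * (kap * (2 * pi / dl)) ^ CARD('d)"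
   using kap(3) q by (simp add: power_mult_distrib field_simps)
   thus ?thesis using kap q dl by (simp add: ennreal_mult ennreal_power)
  qed
  also have "... <= ennreal (kap * q) * ?I ^ CARD('d)" using elim by (intro mult_left_mono power_mono) auto
  also have "... = ennreal (kap * q) * (NN x. ennreal (fejer_kernel r dl x) * ind ?B x)"
   using nn_integral_fejer_kernel_box[where 'd = 'd and a = a and r = r and dl = dl] a by simp
  also have "... = (NN x. ennreal (kap * q) * (ennreal (fejer_kernel r dl x) * ind ?B x))"
   by (rule nn_integral_cmult[symmetric]) measurable
  also have "... <= (NN x. ennreal (\<eta> x 1 om) * ennreal (fejer_kernel r dl x))"
   using near by (intro nn_integral_mono) (auto simp: indicator_def intro!: mult_right_mono ennreal_leI)
  also have "... = ennreal (occ_sum dl (fejer_weight r) (cube_diffs r) om)" by (rule fejer_occupation[OF g])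
  finally have "v * (2 * pi / dl) ^ CARD('d) <= occ_sum dl (fejer_weight r) (cube_diffs r) om"
   using fejer_occupation(2)[OF g, of dl r] by (simp add: ennreal_le_iff)
  hence "(dl / (2 * pi)) ^ CARD('d) * (v * (2 * pi / dl) ^ CARD('d)) <= (dl / (2 * pi)) ^ CARD('d) * occ_sum dl (fejer_weight r) (cube_diffs r) om"
   using dl by (intro mult_left_mono) auto
  moreover have "(dl / (2 * pi)) ^ CARD('d) * (2 * pi / dl) ^ CARD('d) = 1" using dl by (simp flip: power_mult_distrib)
  ultimately show ?case by (metis mult.assoc mult.commute mult.right_neutral)
 qed
qed

text \<open>Fatou in r: every level below the local time is eventually exceeded by the Fejer sums.
  The shift to \<open>Suc r\<close> discards r = 0, where the kernel degenerates.\<close>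

lemma moment_le_fejer:
 assumes dl: "0 < dl" and m: "0 < m" "even m"
  and C: "!!r. 0 < r ==> (dl / (2 * pi)) ^ (CARD('d) * m) * expectation (%om. occ_sum dl (fejer_weight r) (cube_diffs r) om ^ m) <= C"
 shows "(\<integral>\<^sup>+om. ennreal (\<eta> 0 1 om ^ m) \<partial>M) <= ennreal C"
proof -
 define V where "V r om = (dl / (2 * pi)) ^ CARD('d) * occ_sum dl (fejer_weight r) (cube_diffs r) om" for r om
 have [measurable]: "V r \<in> bm M" for r unfolding V_def occ_sum_def by measurable
 have "(\<integral>\<^sup>+om. ennreal (\<eta> 0 1 om ^ m) \<partial>M) <= (\<integral>\<^sup>+om. liminf (%r. ennreal (V (Suc r) om ^ m)) \<partial>M)"
 proof (rule nn_integral_mono_AE, use AE_good in eventually_elim)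
  fix om assume g: "good om"
  have nn: "0 <= \<eta> 0 1 om" using g by (simp add: good_def)
  show "ennreal (\<eta> 0 1 om ^ m) <= liminf (%r. ennreal (V (Suc r) om ^ m))" unfolding le_Liminf_iff
  proof (intro allI impI)
   fix y assume y: "y < ennreal (\<eta> 0 1 om ^ m)"
   then obtain y' where y': "y = ennreal y'" "0 <= y'" by (cases y) auto
   hence y'm: "y' < \<eta> 0 1 om ^ m" using y by (simp add: ennreal_less_iff)
   define u where "u = root m y'"
   have u: "0 <= u" "u ^ m = y'" using y' m by (auto simp: u_def)
   have uq: "u < \<eta> 0 1 om" using y'm u(2) nn by (metis power_less_imp_less_base)
   define v where "v = (u + \<eta> 0 1 om) / 2"
   have v: "0 <= v" "v < \<eta> 0 1 om" "u < v" using u uq by (auto simp: v_def)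
   have "y' < v ^ m" using power_strict_mono[OF v(3) u(1) m(1)] u(2) by simp
   have "\<forall>\<^sub>F r in sequentially. v <= V r om" unfolding V_def by (rule local_time_le_fejer[OF g dl v(1,2)])
   hence "\<forall>\<^sub>F r in sequentially. v <= V (Suc r) om" by (rule eventually_sequentially_Suc[THEN iffD2])
   thus "\<forall>\<^sub>F r in sequentially. y < ennreal (V (Suc r) om ^ m)"
   proof eventually_elim
   case (elim r)
   hence "v ^ m <= V (Suc r) om ^ m" using v by (intro power_mono) auto
   thus ?case using \<open>y' < v ^ m\<close> y' by (simp add: ennreal_less_iff)
   qed
  qed
 qed
 also have "... <= liminf (%r. \<integral>\<^sup>+om. ennreal (V (Suc r) om ^ m) \<partial>M)"
  by (rule nn_integral_liminf) measurable
 also have "... <= ennreal C"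
 proof (rule Liminf_le[OF sequentially_bot])
  have "(\<integral>\<^sup>+om. ennreal (V (Suc r) om ^ m) \<partial>M) <= ennreal C" for r
  proof -
   have i: "integrable M (%om. occ_sum dl (fejer_weight (Suc r)) (cube_diffs (Suc r)) om ^ m)"
   by (rule occ_sum_moment(2)) (use m in \<open>auto simp: uminus_cube_diffs fejer_weight_minus\<close>)
   have eq: "V (Suc r) om ^ m = (dl / (2 * pi)) ^ (CARD('d) * m) * occ_sum dl (fejer_weight (Suc r)) (cube_diffs (Suc r)) om ^ m" for om
   unfolding V_def by (simp only: power_mult_distrib power_mult)
   have "(\<integral>\<^sup>+om. ennreal (V (Suc r) om ^ m) \<partial>M) = ennreal (expectation (%om. V (Suc r) om ^ m))"
   by (rule nn_integral_eq_integral) (use i m in \<open>auto simp: eq zero_le_even_power\<close>)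
   also have "expectation (%om. V (Suc r) om ^ m) <= C" unfolding eq integral_mult_right_zero by (rule C) simp
   finally show ?thesis by (simp add: ennreal_leI)
  qed
  thus "\<forall>\<^sub>F r in sequentially. (\<integral>\<^sup>+om. ennreal (V (Suc r) om ^ m) \<partial>M) <= ennreal C"
   by (intro always_eventually allI)
 qed
 finally show ?thesis .
qed

end

context stable_setup
begin

text \<open>\<open>gam\<close> is the growth exponent: up to exponential factors the m-th moment is
  m^(gam m). \<open>av\<close>, defined next, is the power of time that each of the m points
  contributes to the p-th power of the norm; d < \<alpha> p says that it is positive.\<close>

definition gam :: real where "gam = real CARD('d) / \<alpha>"
definition av :: real where "av = real (Suc n) - gam"

lemma gam_pos: "0 < gam" using \<alpha>0 by (simp add: gam_def)
lemma av_pos: "0 < av"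
proof -
 have "gam < real (Suc n)" unfolding gam_def using \<alpha>0 dp by (subst divide_less_eq) (simp add: mult.commute)
 thus ?thesis by (simp add: av_def)
qed

text \<open>Homogeneity gives T + \<psi>(T^(1/\<alpha>) x) = T (1 + \<psi>(x)). The discount T
  therefore amounts to a dilation of the frequencies, and the lattice estimates, made once for
  \<open>symQ\<close>, apply for every T.\<close>

lemma Phi_scaled_le:
 fixes l :: "nat => real^'d"
 assumes m: "0 < m" and T: "0 < T"
 shows "Phi \<psi> m (%i. (T powr (1 / \<alpha>)) *\<^sub>R l i) <= exp T * fact m / T ^ m * symQ m l"
proof -
 have scale: "\<psi> (\<Sum>i\<le>j. (T powr (1 / \<alpha>)) *\<^sub>R l (sg i)) = T * \<psi> (\<Sum>i\<le>j. l (sg i))" for j and sg :: "nat => nat"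
  using \<psi>_scale[of "T powr (1 / \<alpha>)" "\<Sum>i\<le>j. l (sg i)"] T \<alpha>0 by (simp add: scaleR_sum_right powr_powr)
 have tm: "1 / (T + T * \<psi> x) = Q x / T" for x using T one_plus_\<psi>_pos[of x] by (simp add: Q_def field_simps)
 have "Phi_nn \<psi> m (%i. (T powr (1 / \<alpha>)) *\<^sub>R l i) <= ennreal (exp T * (\<Sum>sg | sg permutes {..<m}. \<Prod>j<m. Q (\<Sum>i\<le>j. l (sg i)) / T))"
  using Phi_nn_le[OF m T, of \<psi> "%i. (T powr (1 / \<alpha>)) *\<^sub>R l i"] by (simp add: scale tm)
 also have "exp T * (\<Sum>sg | sg permutes {..<m}. \<Prod>j<m. Q (\<Sum>i\<le>j. l (sg i)) / T) = exp T * fact m / T ^ m * symQ m l"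
  by (simp add: symQ_def prod_dividef flip: sum_divide_distrib)
 finally show ?thesis unfolding Phi_def by (rule enn2real_leI[rotated]) (use T symQ_nonneg in auto)
qed

text \<open>As a function of T the left-hand side is, up to constants, exp(p T) T^(- av m), and its
  minimum is at T = av m / p. The minimal value brings in (p / av)^av; Stirling's bound replaces the
  factorial.\<close>

lemma scaling_constant_le:
 assumes m: "0 < m"
 defines "T \<equiv> av * real m / real (Suc n)"
 shows "(T powr (1 / \<alpha>)) ^ (CARD('d) * m) * (exp T * fact m / T ^ m) ^ Suc n
  <= (exp 1 * (real m + 1)) ^ Suc n * ((real (Suc n) / av) powr av * real m powr gam * exp (- gam)) ^ m"
proof -
 define p where "p = real (Suc n)"
 define q where "q = p / av"
 have p: "0 < p" by (simp add: p_def)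
 have q: "0 < q" using p av_pos by (simp add: q_def)
 have T: "T = real m / q" "0 < T" using av_pos p m by (auto simp: T_def q_def p_def field_simps)
 have f: "fact m <= exp 1 * (real m + 1) * (real m ^ m * exp (- real m))"
  using fact_exp_bounds(2)[of m] by (simp add: exp_minus field_simps)
 have "exp T * fact m / T ^ m <= exp T * (exp 1 * (real m + 1) * (real m ^ m * exp (- real m))) / T ^ m"
  using f T by (intro divide_right_mono mult_left_mono) auto
 also have "... = exp 1 * (real m + 1) * (exp (T - real m) * q ^ m)"
 proof -
  have 1: "real m ^ m / T ^ m = q ^ m" unfolding power_divide[symmetric] using m q by (simp add: T(1))
  have 2: "exp (T - real m) = exp T * exp (- real m)" by (simp add: mult_exp_exp)
  show ?thesis unfolding 2 1[symmetric] by simp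
 qed
 finally have "(exp T * fact m / T ^ m) ^ Suc n <= (exp 1 * (real m + 1) * (exp (T - real m) * q ^ m)) ^ Suc n"
  using T by (intro power_mono) auto
 also have "... = (exp 1 * (real m + 1)) ^ Suc n * (exp (T - real m) * q ^ m) ^ Suc n" by (rule power_mult_distrib)
 also have "(exp (T - real m) * q ^ m) ^ Suc n = (exp (- gam) * q powr p) ^ m"
 proof -
  have e: "p * (T - real m) = real m * (- gam)"
   using p av_pos unfolding T(1) q_def av_def p_def[symmetric] by (simp add: field_simps)
  have "exp (T - real m) ^ Suc n = exp (p * (T - real m))" unfolding p_def by (rule exp_of_nat_mult[symmetric])
  also have "... = exp (- gam) ^ m" unfolding e by (rule exp_of_nat_mult)
  finally have 1: "exp (T - real m) ^ Suc n = exp (- gam) ^ m" .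
  have "(q ^ m) ^ Suc n = (q ^ Suc n) ^ m" by (simp only: power_mult[symmetric] mult.commute)
  also have "q ^ Suc n = q powr p" unfolding p_def using q by (simp only: powr_realpow)
  finally show ?thesis using 1 by (simp only: power_mult_distrib)
 qed
 finally have 1: "(exp T * fact m / T ^ m) ^ Suc n <= (exp 1 * (real m + 1)) ^ Suc n * (exp (- gam) * q powr p) ^ m" .
 have 2: "(T powr (1 / \<alpha>)) ^ (CARD('d) * m) = (real m powr gam * q powr (- gam)) ^ m"
 proof -
  have "(T powr (1 / \<alpha>)) ^ CARD('d) = (T powr (1 / \<alpha>)) powr real CARD('d)"
   by (rule powr_realpow[symmetric]) (use T(2) in simp)
  also have "... = T powr gam" by (simp add: powr_powr gam_def)
  also have "... = real m powr gam * q powr (- gam)" unfolding T(1) using q by (simp add: powr_divide powr_minus_divide)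
  finally show ?thesis by (simp only: power_mult)
 qed
 have "(T powr (1 / \<alpha>)) ^ (CARD('d) * m) * (exp T * fact m / T ^ m) ^ Suc n
  <= (real m powr gam * q powr (- gam)) ^ m * ((exp 1 * (real m + 1)) ^ Suc n * (exp (- gam) * q powr p) ^ m)"
  unfolding 2 using 1 by (intro mult_left_mono) auto
 also have "... = (exp 1 * (real m + 1)) ^ Suc n * ((q powr (- gam) * q powr p) * real m powr gam * exp (- gam)) ^ m"
  by (simp only: power_mult_distrib mult_ac)
 also have "q powr (- gam) * q powr p = q powr av" using q by (simp add: av_def p_def flip: powr_add)
 finally show ?thesis by (simp add: q_def p_def)
qed

end

context additive_stable
begin

lemma occ_sum_moment_le:
 assumes A: "finite A" "!!z. z \<in> A ==> - z \<in> A" and w: "!!z. w (- z) = w z" "!!z. 0 <= w z" "!!z. w z <= 1"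
  and m: "0 < m" and T: "0 < T"
 shows "expectation (%om. occ_sum (T powr (1 / \<alpha>) * dl) w A om ^ m)
  <= (exp T * fact m / T ^ m) ^ Suc n * (\<Sum>v\<in>PiE {..<m} (%_. A). symQ m (%i. lat dl (v i)) ^ Suc n)"
proof -
 have lat: "lat (T powr (1 / \<alpha>) * dl) z = (T powr (1 / \<alpha>)) *\<^sub>R lat dl z" for z :: "int^'d"
  by (simp add: vec_eq_iff)
 have "expectation (%om. occ_sum (T powr (1 / \<alpha>) * dl) w A om ^ m) =
  (\<Sum>v\<in>PiE {..<m} (%_. A). (\<Prod>k<m. w (v k)) * Phi \<psi> m (%i. lat (T powr (1 / \<alpha>) * dl) (v i)) ^ Suc n)"
  by (rule occ_sum_moment(1)) (use A w m in auto)
 also have "... <= (\<Sum>v\<in>PiE {..<m} (%_. A). (exp T * fact m / T ^ m * symQ m (%i. lat dl (v i))) ^ Suc n)"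
 proof (rule sum_mono)
  fix v :: "nat => int^'d"
  let ?F = "Phi \<psi> m (%i. lat (T powr (1 / \<alpha>) * dl) (v i)) ^ Suc n"
  have "(\<Prod>k<m. w (v k)) * ?F <= 1 * ?F"
   by (intro mult_right_mono prod_le_1) (use w Phi_nonneg in \<open>auto simp del: power_Suc\<close>)
  also have "1 * ?F <= (exp T * fact m / T ^ m * symQ m (%i. lat dl (v i))) ^ Suc n"
   unfolding mult_1 lat using Phi_scaled_le[OF m T, of "%i. lat dl (v i)"] Phi_nonneg by (intro power_mono)
  finally show "(\<Prod>k<m. w (v k)) * ?F <= (exp T * fact m / T ^ m * symQ m (%i. lat dl (v i))) ^ Suc n" .
 qed
 also have "... = (exp T * fact m / T ^ m) ^ Suc n * (\<Sum>v\<in>PiE {..<m} (%_. A). symQ m (%i. lat dl (v i)) ^ Suc n)"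
  by (simp only: power_mult_distrib sum_distrib_left)
 finally show ?thesis .
qed

text \<open>The Fejer sum is nonnegative, but its parts over \<open>A0\<close> and over the
  complement are not, hence the restriction to even orders. Each part is symmetric under z -> - z,
  so it is real and its moment is a sum over words in its own letters.\<close>

lemma moment_upper:
 assumes th: "0 < th" "th < 1"
 shows "\<forall>\<^sub>F m in sequentially. even m --> (\<integral>\<^sup>+om. ennreal (\<eta> 0 1 om ^ m) \<partial>M)
  <= ennreal (2 * (exp 1 * (real m + 1)) ^ Suc n *
   (((real (Suc n) / av) powr av * real m powr gam * exp (- gam)) * ((1 + th) / (1 - th) * \<rho> / (2 * pi) ^ CARD('d))) ^ m)"
proof -
 let ?d = "CARD('d)"
 \<comment> \<open>Puts both parts under the same R: (1 + ep) \<rho> / (1 - th) by ep <= th, and ep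
   / th by ep <= th \<rho>.\<close>
 define ep where "ep = min th (th * \<rho>)"
 define R where "R = (1 + th) / (1 - th) * \<rho>"
 have ep: "0 < ep" "ep <= th" "ep <= th * \<rho>" using th rho_pos by (auto simp: ep_def)
 have R0: "0 < R" using th rho_pos by (simp add: R_def)
 have R1: "(1 + ep) * \<rho> / (1 - th) <= R" unfolding R_def using th rho_pos ep by (simp add: divide_right_mono)
 have R2: "ep / th <= R"
 proof -
  have "ep / th <= 1 * \<rho>" using ep(3) th by (simp add: divide_le_eq mult.commute)
  also have "... <= R" unfolding R_def using th rho_pos by (intro mult_right_mono) (auto simp: le_divide_eq)
  finally show ?thesis .
 qed
 obtain dl and A0 :: "(int^'d) set" where dl: "0 < dl" and A0: "finite A0" "!!z. z \<in> A0 ==> - z \<in> A0"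
  and ev: "\<forall>\<^sub>F m in sequentially. dl ^ (?d * m) * (\<Sum>w\<in>PiE {..<m} (%_. A0). symQ m (%i. lat dl (w i)) ^ Suc n) <= ((1 + ep) * \<rho>) ^ m"
  and far: "!!m B. [|even m; finite B; B \<inter> A0 = {}|] ==> dl ^ (?d * m) * (\<Sum>w\<in>PiE {..<m} (%_. B). symQ m (%i. lat dl (w i)) ^ Suc n) <= ep ^ m"
  using lattice_upper_bounds[OF ep(1)] by blast
 show ?thesis using ev eventually_gt_at_top[of 0]
 proof eventually_elim
  case (elim m)
  show ?case
  proof
   assume ev: "even m"
   have m: "0 < m" using elim by simp
   define T where "T = av * real m / real (Suc n)"
   have T: "0 < T" using av_pos m by (simp add: T_def)
   \<comment> \<open>The mesh in the original frequencies grows with m. This does no harm because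
     \<open>moment_le_fejer\<close> holds for every mesh, while dl and \<open>A0\<close> are fixed
     before m.\<close>
   define dl' where "dl' = T powr (1 / \<alpha>) * dl"
   have dl': "0 < dl'" using dl T by (simp add: dl'_def)
   define W where "W = (exp T * fact m / T ^ m) ^ Suc n"
   have W: "0 <= W" using T by (simp add: W_def)
   define K where "K = (T powr (1 / \<alpha>)) ^ (?d * m) * W"
   define N where "N = (exp 1 * (real m + 1)) ^ Suc n"
   define g where "g = (real (Suc n) / av) powr av * real m powr gam * exp (- gam)"
   have K: "K <= N * g ^ m" unfolding K_def W_def N_def g_def T_def by (rule scaling_constant_le[OF m])
   define C where "C = 2 * N * (g * (R / (2 * pi) ^ ?d)) ^ m"
   have "(\<integral>\<^sup>+om. ennreal (\<eta> 0 1 om ^ m) \<partial>M) <= ennreal C"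
   proof (rule moment_le_fejer[OF dl' m ev])
   fix r :: nat assume r: "0 < r"
   let ?w = "fejer_weight r :: int^'d => real" and ?D = "cube_diffs r :: (int^'d) set"
   define Z where "Z = occ_sum dl' ?w"
   define S where "S B = (\<Sum>v\<in>PiE {..<m} (%_. B). symQ m (%i. lat dl (v i)) ^ Suc n)" for B
   have B: "integrable M (%om. Z B om ^ m)" "expectation (%om. Z B om ^ m) <= W * S B"
   if "finite B" "!!z. z \<in> B ==> - z \<in> B" for B
   proof -
   show "integrable M (%om. Z B om ^ m)" unfolding Z_def
   by (rule occ_sum_moment(2)) (use that m in \<open>auto simp: fejer_weight_minus\<close>)
   show "expectation (%om. Z B om ^ m) <= W * S B" unfolding Z_def W_def S_def dl'_def
   by (rule occ_sum_moment_le) (use that m T r in \<open>auto simp: fejer_weight_minus fejer_weight_nonneg fejer_weight_le_1\<close>)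
   qed
   define B1 where "B1 = ?D \<inter> A0"
   define B2 where "B2 = ?D - A0"
   have f: "finite B1" "finite B2" by (auto simp: B1_def B2_def)
   have s1: "!!z. z \<in> B1 ==> - z \<in> B1" using A0 uminus_cube_diffs by (auto simp: B1_def)
   have s2: "!!z. z \<in> B2 ==> - z \<in> B2" using A0(2)[of "- z" for z] uminus_cube_diffs by (auto simp: B2_def)
   have split: "Z ?D om = Z B1 om + Z B2 om" for om
   unfolding Z_def occ_sum_def B1_def B2_def by (subst sum.Int_Diff[of ?D _ A0]) auto
   have "expectation (%om. Z ?D om ^ m) <= expectation (%om. (Z B1 om / (1 - th)) ^ m + (Z B2 om / th) ^ m)"
   proof (rule integral_mono)
   show "integrable M (%om. Z ?D om ^ m)" by (rule B) (auto simp: uminus_cube_diffs)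
   show "integrable M (%om. (Z B1 om / (1 - th)) ^ m + (Z B2 om / th) ^ m)"
   unfolding power_divide by (intro Bochner_Integration.integrable_add integrable_divide B f s1 s2) auto
   show "Z ?D om ^ m <= (Z B1 om / (1 - th)) ^ m + (Z B2 om / th) ^ m" for om
   unfolding split by (rule even_power_split[OF th ev])
   qed
   also have "... = expectation (%om. Z B1 om ^ m) / (1 - th) ^ m + expectation (%om. Z B2 om ^ m) / th ^ m"
   unfolding power_divide using B(1)[OF f(1) s1] B(1)[OF f(2) s2] by simp
   also have "... <= W * S A0 / (1 - th) ^ m + W * S B2 / th ^ m"
   proof (intro add_mono divide_right_mono)
   have "S B1 <= S A0" unfolding S_def
   by (rule sum_mono2) (use A0 f symQ_nonneg in \<open>auto simp: B1_def PiE_iff simp del: power_Suc intro!: finite_PiE\<close>)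
   hence "W * S B1 <= W * S A0" using W by (rule mult_left_mono)
   thus "expectation (%om. Z B1 om ^ m) <= W * S A0" using B(2)[OF f(1) s1] by linarith
   show "expectation (%om. Z B2 om ^ m) <= W * S B2" by (rule B(2)[OF f(2) s2])
   qed (use th in auto)
   finally have "(dl' / (2 * pi)) ^ (?d * m) * expectation (%om. Z ?D om ^ m) <= (dl' / (2 * pi)) ^ (?d * m) * (W * S A0 / (1 - th) ^ m + W * S B2 / th ^ m)"
   using dl' by (intro mult_left_mono) auto
   also have "... = K / (2 * pi) ^ (?d * m) * ((dl ^ (?d * m) * S A0) / (1 - th) ^ m + (dl ^ (?d * m) * S B2) / th ^ m)"
   unfolding K_def dl'_def power_mult_distrib power_divide by (simp add: distrib_left add_divide_distrib mult_ac)
   also have "... <= K / (2 * pi) ^ (?d * m) * (((1 + ep) * \<rho>) ^ m / (1 - th) ^ m + ep ^ m / th ^ m)"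
   proof (intro mult_left_mono add_mono divide_right_mono)
   show "dl ^ (?d * m) * S A0 <= ((1 + ep) * \<rho>) ^ m" unfolding S_def using elim by blast
   show "dl ^ (?d * m) * S B2 <= ep ^ m" unfolding S_def by (rule far[OF ev f(2)]) (auto simp: B2_def)
   qed (use th W in \<open>auto simp: K_def\<close>)
   also have "... <= K / (2 * pi) ^ (?d * m) * (R ^ m + R ^ m)"
   proof (intro mult_left_mono add_mono)
   show "((1 + ep) * \<rho>) ^ m / (1 - th) ^ m <= R ^ m"
   unfolding power_divide[symmetric] using R1 th ep rho_pos by (intro power_mono) auto
   show "ep ^ m / th ^ m <= R ^ m" unfolding power_divide[symmetric] using R2 th ep by (intro power_mono) auto
   qed (use W in \<open>auto simp: K_def\<close>)
   also have "... <= (N * g ^ m) / (2 * pi) ^ (?d * m) * (R ^ m + R ^ m)"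
   using K R0 by (intro mult_right_mono divide_right_mono) auto
   also have "... = C" unfolding C_def power_mult_distrib power_divide power_mult by simp
   finally show "(dl' / (2 * pi)) ^ (?d * m) * expectation (%om. occ_sum dl' ?w ?D om ^ m) <= C" unfolding Z_def .
   qed
   thus "(\<integral>\<^sup>+om. ennreal (\<eta> 0 1 om ^ m) \<partial>M)
   <= ennreal (2 * (exp 1 * (real m + 1)) ^ Suc n *
   (((real (Suc n) / av) powr av * real m powr gam * exp (- gam)) * ((1 + th) / (1 - th) * \<rho> / (2 * pi) ^ CARD('d))) ^ m)"
   unfolding C_def N_def g_def R_def .
  qed
 qed
qed

end

section \<open>Growth of symmetric walks\<close>

lemma walk_step_mono: "(!!x. \<phi> x <= \<phi>' x) ==> walk_step N g q \<phi> x <= walk_step N g q \<phi>' x"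
 unfolding walk_step_def by (intro nn_integral_mono mult_left_mono) auto

lemma walk_step_funpow_mono: "(!!x. \<phi> x <= \<phi>' x) ==> (walk_step N g q ^^ k) \<phi> x <= (walk_step N g q ^^ k) \<phi>' x"
 by (induction k arbitrary: x) (auto intro: walk_step_mono)

text \<open>Evenness of \<open>g\<close> makes the step operator symmetric for the bilinear form
  with weight \<open>q\<close>, which is what the growth argument rests on. The operator itself is
  allowed to be unbounded.\<close>

locale symmetric_walk =
 fixes g q :: "'v::euclidean_space => ennreal"
 assumes gm[measurable]: "g \<in> bm borel" and qm[measurable]: "q \<in> bm borel"
  and g_even: "!!x. g (- x) = g x"
begin

abbreviation "S \<equiv> walk_step lborel g q"

definition pair :: "('v => ennreal) => ('v => ennreal) => ennreal" where
 "pair \<phi> \<chi>' = (NN x. q x * \<phi> x * \<chi>' x)"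

lemma S_measurable[measurable]: "\<phi> \<in> bm borel ==> S \<phi> \<in> bm borel"
 by (rule borel_measurable_walk_step) (auto simp: sigma_finite_lborel)

lemma S_funpow_measurable[measurable]: "\<phi> \<in> bm borel ==> (S ^^ k) \<phi> \<in> bm borel" by (induction k) auto

lemma S_cmult:
 assumes [measurable]: "\<phi> \<in> bm borel"
 shows "S (%x. c * \<phi> x) x = c * S \<phi> x"
 unfolding walk_step_def by (subst nn_integral_cmult[symmetric]) (auto simp: mult_ac)

lemma S_funpow_cmult:
 assumes \<phi>: "\<phi> \<in> bm borel"
 shows "(S ^^ k) (%x. c * \<phi> x) = (%x. c * (S ^^ k) \<phi> x)"
proof (induction k)
 case (Suc k)
 show ?case using S_cmult[OF S_funpow_measurable[OF \<phi>], of c k] by (simp add: Suc fun_eq_iff)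
qed simp

lemma pair_sym: "pair \<phi> \<chi>' = pair \<chi>' \<phi>" by (simp add: pair_def mult_ac)

lemma S_shift:
 assumes [measurable]: "\<phi> \<in> bm borel"
 shows "S \<phi> x = (NN y. g (y - x) * q y * \<phi> y)"
 unfolding walk_step_def using nn_integral_lborel_shift[of "%y. g (y - x) * q y * \<phi> y" x] by simp

lemma pair_S:
 assumes [measurable]: "\<phi> \<in> bm borel" "\<chi>' \<in> bm borel"
 shows "pair \<phi> (S \<chi>') = pair (S \<phi>) \<chi>'"
proof -
 have "pair \<phi> (S \<chi>') = (NN x. (NN y. q x * \<phi> x * (g (y - x) * q y * \<chi>' y)))"
  unfolding pair_def by (subst S_shift, simp, subst nn_integral_cmult) auto
 also have "... = (NN y. (NN x. q x * \<phi> x * (g (y - x) * q y * \<chi>' y)))" by (rule lborel_pair.Fubini') measurable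
 also have "... = (NN y. (NN x. q y * \<chi>' y * (g (x - y) * q x * \<phi> x)))"
  using g_even[of "x - y" for x y] by (intro nn_integral_cong) (simp add: mult_ac)
 also have "... = pair \<chi>' (S \<phi>)" unfolding pair_def by (subst S_shift, simp, subst nn_integral_cmult) auto
 finally show ?thesis by (simp add: pair_sym)
qed

lemma pair_S_funpow:
 assumes \<phi>: "\<phi> \<in> bm borel" and \<chi>': "\<chi>' \<in> bm borel"
 shows "pair ((S ^^ i) \<phi>) \<chi>' = pair \<phi> ((S ^^ i) \<chi>')" using \<chi>'
proof (induction i arbitrary: \<chi>')
 case (Suc i)
 have "pair ((S ^^ Suc i) \<phi>) \<chi>' = pair ((S ^^ i) \<phi>) (S \<chi>')"
  using pair_S[OF S_funpow_measurable[OF \<phi>, of i] Suc.prems] by simp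
 also have "... = pair \<phi> ((S ^^ i) (S \<chi>'))" by (rule Suc.IH) (use Suc.prems in measurable)
 finally show ?case by (simp add: funpow_swap1)
qed simp

lemma pair_Cauchy_Schwarz:
 assumes [measurable]: "\<phi> \<in> bm borel" "\<chi>' \<in> bm borel"
 shows "(pair \<phi> \<chi>')\<^sup>2 <= pair \<phi> \<phi> * pair \<chi>' \<chi>'"
proof -
 have d: "pair a b = (\<integral>\<^sup>+x. a x * b x \<partial>density lborel q)"
  if [measurable]: "a \<in> bm borel" "b \<in> bm borel" for a b
  unfolding pair_def by (subst nn_integral_density) (auto simp: mult_ac)
 show ?thesis unfolding d[OF assms] d[OF assms(1) assms(1)] d[OF assms(2) assms(2)]
  using Cauchy_Schwarz_nn_integral[of \<phi> "density lborel q" \<chi>'] by (simp add: power2_eq_square)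
qed

text \<open>By Cauchy-Schwarz and symmetry the values at even powers form a log-convex sequence, so
  consecutive ratios increase. The first ratio is at least kap^2: Cauchy-Schwarz bounds kap^2 by the
  product of the first two values, and the first is at most 1. Thus one vector with a large form
  suffices. Finiteness allows the passage to real numbers.\<close>

lemma pair_growth:
 assumes u[measurable]: "u \<in> bm borel" and fin: "!!k. pair u ((S ^^ k) u) < \<top>"
  and 0: "pair u u <= 1" and kap: "0 <= kap" "ennreal kap <= pair u (S u)"
 shows "ennreal (kap ^ (2 * Suc j)) <= pair u ((S ^^ (2 * Suc j)) u)"
proof -
 define c where "c j = enn2real (pair u ((S ^^ (2 * j)) u))" for j
 have c: "pair u ((S ^^ (2 * j)) u) = ennreal (c j)" for j unfolding c_def using fin by simp
 have cnn: "0 <= c j" for j by (simp add: c_def)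
 have split: "pair ((S ^^ i) u) ((S ^^ k) u) = pair u ((S ^^ (i + k)) u)" for i k
  using pair_S_funpow[OF u, of "(S ^^ k) u" i] by (simp add: funpow_add)
 have diag: "pair ((S ^^ i) u) ((S ^^ i) u) = ennreal (c i)" for i unfolding split c[symmetric] by (simp add: mult_2)
 have cs: "(pair u ((S ^^ (i + k)) u))\<^sup>2 <= ennreal (c i * c k)" for i k
  using pair_Cauchy_Schwarz[of "(S ^^ i) u" "(S ^^ k) u"] unfolding diag split by (simp add: ennreal_mult cnn)
 have c0: "c 0 <= 1" using 0 c[of 0] cnn[of 0] by simp
 have k1: "kap\<^sup>2 <= c 0 * c 1"
 proof -
  have "ennreal (kap\<^sup>2) <= (pair u (S u))\<^sup>2" using kap by (simp add: ennreal_power[symmetric] power_mono)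
  also have "... <= ennreal (c 0 * c 1)" using cs[of 0 1] by simp
  finally show ?thesis by (subst (asm) ennreal_le_iff) (auto simp: cnn)
 qed
 have c1: "kap\<^sup>2 <= c 1" using k1 mult_right_mono[OF c0 cnn[of 1]] by simp
 have lc: "(c (Suc j))\<^sup>2 <= c j * c (Suc (Suc j))" for j
 proof -
  have "j + Suc (Suc j) = 2 * Suc j" by simp
  hence "(ennreal (c (Suc j)))\<^sup>2 <= ennreal (c j * c (Suc (Suc j)))" using cs[of j "Suc (Suc j)"] by (simp only: c)
  thus ?thesis by (simp add: ennreal_power cnn)
 qed
 have ratio: "kap\<^sup>2 * c j <= c (Suc j)" for j
 proof (induction j)
  case 0
  have "kap\<^sup>2 * c 0 <= kap\<^sup>2 * 1" using c0 by (intro mult_left_mono) auto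
  thus ?case using c1 by simp
 next
  case (Suc j)
  show ?case
  proof (cases "c (Suc j) = 0")
   case False
   hence p: "0 < c (Suc j)" using cnn[of "Suc j"] by linarith
   have "kap\<^sup>2 * (c (Suc j))\<^sup>2 <= kap\<^sup>2 * (c j * c (Suc (Suc j)))" by (intro mult_left_mono lc) auto
   also have "... = (kap\<^sup>2 * c j) * c (Suc (Suc j))" by simp
   also have "... <= c (Suc j) * c (Suc (Suc j))" by (intro mult_right_mono Suc cnn)
   finally have "c (Suc j) * (kap\<^sup>2 * c (Suc j)) <= c (Suc j) * c (Suc (Suc j))" by (simp add: power2_eq_square mult_ac)
   thus ?thesis using p by (simp add: mult_le_cancel_left)
  qed (simp add: cnn)
 qed
 have "kap ^ (2 * Suc j) <= c (Suc j)"
 proof (induction j)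
  case (Suc j)
  have "kap ^ (2 * Suc (Suc j)) = kap\<^sup>2 * kap ^ (2 * Suc j)" by (simp add: power2_eq_square)
  also have "... <= kap\<^sup>2 * c (Suc j)" by (intro mult_left_mono Suc) auto
  also have "... <= c (Suc (Suc j))" by (rule ratio)
  finally show ?case .
 qed (use c1 in \<open>simp add: power2_eq_square\<close>)
 thus ?thesis unfolding c by (rule ennreal_leI)
qed

end

section \<open>The norm of the symmetrised time integrals\<close>

lemma time_integral_cong: "(!!j. j < m ==> c j = c' j) ==> time_integral m t c = time_integral m t c'"
 unfolding time_integral_def chain_weight_def by (intro nn_integral_cong arg_cong2[where f = "(*)"] prod.cong) auto

lemma measurable_time_integral:
 assumes f[measurable]: "f \<in> bm N" and c: "!!j. j < m ==> (%x. c x j) \<in> bm N" and m: "0 < m"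
 shows "(%x. time_integral m (f x) (c x)) \<in> bm N"
proof -
 let ?P = "PiM {..<m} (%_. lborel :: real measure)"
 interpret product_sigma_finite "%_::nat. lborel :: real measure" by (rule product_sigma_finite_lborel)
 interpret P: sigma_finite_measure ?P by (rule sigma_finite) simp
 have s0[measurable]: "(%p. snd p 0) \<in> bm (N \<Otimes>\<^sub>M ?P)"
  by (rule measurable_compose[OF measurable_snd first_measurable[OF m]])
 have "(%p. (if snd p 0 <= f (fst p) then 1 else 0) * (\<Prod>j<m. ennreal (kern (c (fst p) j) (snd p j - chain m (snd p) j)))) \<in> bm (N \<Otimes>\<^sub>M ?P)"
 proof (intro borel_measurable_times_ennreal borel_measurable_prod_ennreal)
  show "(%p. (if snd p 0 <= f (fst p) then 1 else 0) :: ennreal) \<in> bm (N \<Otimes>\<^sub>M ?P)" by measurable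
  fix j assume j: "j \<in> {..<m}"
  have "(%s. s j) \<in> bm ?P" using measurable_component_singleton[OF j, of "%_. lborel :: real measure"] by simp
  hence [measurable]: "(%p. snd p j) \<in> bm (N \<Otimes>\<^sub>M ?P)" by (rule measurable_compose[OF measurable_snd])
  have "(%s. chain m s j) \<in> bm ?P" using chain_measurable[OF j, of m] by (simp add: subset_iff)
  hence [measurable]: "(%p. chain m (snd p) j) \<in> bm (N \<Otimes>\<^sub>M ?P)" by (rule measurable_compose[OF measurable_snd])
  have [measurable]: "(%p. c (fst p) j) \<in> bm (N \<Otimes>\<^sub>M ?P)" by (rule measurable_compose[OF measurable_fst c]) (use j in simp)
  show "(%p. ennreal (kern (c (fst p) j) (snd p j - chain m (snd p) j))) \<in> bm (N \<Otimes>\<^sub>M ?P)" by measurable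
 qed
 moreover have eq: "ind {..y} z = (if z <= y then 1 else 0 :: ennreal)" for y z :: real by (simp add: indicator_def)
 ultimately have "(%(x, s). ind {..f x} (s 0) * chain_weight m (c x) s) \<in> bm (N \<Otimes>\<^sub>M ?P)"
  by (simp only: case_prod_unfold chain_weight_def eq)
 thus ?thesis unfolding time_integral_def by (rule P.borel_measurable_nn_integral)
qed

definition Phi_time :: "(real^'d => real) => nat => real => (nat => real^'d) => ennreal" where
 "Phi_time \<psi> m t l = (\<Sum>sg | sg permutes {..<m}. time_integral m t (%j. \<psi> (\<Sum>i\<le>j. l (sg i))))"

lemma Phi_time_1: "Phi_time \<psi> m 1 = Phi_nn \<psi> m" by (simp add: Phi_time_def Phi_nn_def fun_eq_iff)

lemma Phi_nn_cong:
 assumes "!!i. i < m ==> l i = l' i"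
 shows "Phi_nn \<psi> m l = Phi_nn \<psi> m l'" unfolding Phi_nn_def
proof (rule sum.cong[OF refl], rule time_integral_cong)
 fix sg j assume sg: "sg \<in> {sg. sg permutes {..<m}}" and j: "j < m"
 have "sg i < m" if "i <= j" for i using permutes_in_image[of sg "{..<m}" i] sg that j by simp
 hence "(\<Sum>i\<le>j. l (sg i)) = (\<Sum>i\<le>j. l' (sg i))" by (intro sum.cong refl assms) auto
 thus "\<psi> (\<Sum>i\<le>j. l (sg i)) = \<psi> (\<Sum>i\<le>j. l' (sg i))" by simp
qed

lemma measurable_Phi_time:
 assumes [measurable]: "\<psi> \<in> bm borel" and f: "f \<in> bm N"
  and l: "!!k. k < m ==> (%x. l x k) \<in> bm N" and m: "0 < m"
 shows "(%x. Phi_time \<psi> m (f x) (l x)) \<in> bm N" unfolding Phi_time_def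
proof (rule borel_measurable_sum)
 fix sg assume sg: "sg \<in> {sg. sg permutes {..<m}}"
 show "(%x. time_integral m (f x) (%j. \<psi> (\<Sum>i\<le>j. l x (sg i)))) \<in> bm N"
 proof (rule measurable_time_integral[OF f _ m])
  fix j assume j: "j < m"
  have "sg i < m" if "i <= j" for i using permutes_in_image[of sg "{..<m}" i] sg that j by simp
  hence "(%x. \<Sum>i\<le>j. l x (sg i)) \<in> bm N" by (intro borel_measurable_sum l) auto
  thus "(%x. \<psi> (\<Sum>i\<le>j. l x (sg i))) \<in> bm N" by measurable
 qed
qed

context stable_setup
begin

abbreviation "P m \<equiv> PiM {..<m::nat} (%_. lborel :: (real^'d) measure)"

lemma component_measurable: "k < m ==> (%l. l k) \<in> bm (P m)"
 using measurable_component_singleton[of k "{..<m}" "%_. lborel :: (real^'d) measure"] by simp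

lemma measurable_Phi_nn: "0 < m ==> Phi_nn \<psi> m \<in> bm (P m)"
 using measurable_Phi_time[of \<psi> "%_. 1" "P m" m "%l. l"] component_measurable[of _ m] by (simp add: Phi_time_1)

definition Phi_norm :: "nat => ennreal" where "Phi_norm m = (\<integral>\<^sup>+l. Phi_nn \<psi> m l ^ Suc n \<partial>P m)"

lemma Phi_time_scale:
 assumes m: "0 < m" and t: "0 < t"
 shows "Phi_time \<psi> m t l = ennreal (t ^ m) * Phi_nn \<psi> m (\<lambda>i\<in>{..<m}. (t powr (1 / \<alpha>)) *\<^sub>R l i)"
proof -
 have scale: "\<psi> (\<Sum>i\<le>j. (t powr (1 / \<alpha>)) *\<^sub>R l (sg i)) = t * \<psi> (\<Sum>i\<le>j. l (sg i))" for j and sg :: "nat => nat"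
  using \<psi>_scale[of "t powr (1 / \<alpha>)" "\<Sum>i\<le>j. l (sg i)"] t \<alpha>0 by (simp add: scaleR_sum_right powr_powr)
 have R: "Phi_nn \<psi> m (\<lambda>i\<in>{..<m}. (t powr (1 / \<alpha>)) *\<^sub>R l i) = (\<Sum>sg | sg permutes {..<m}. time_integral m 1 (%j. t * \<psi> (\<Sum>i\<le>j. l (sg i))))"
  by (subst Phi_nn_cong[where l' = "%i. (t powr (1 / \<alpha>)) *\<^sub>R l i"]) (simp_all add: Phi_nn_def scale)
 show ?thesis unfolding R Phi_time_def sum_distrib_left by (intro sum.cong refl time_integral_scale m t)
qed

lemma laplace_Phi:
 assumes m: "0 < m"
 shows "(NN t. ennreal (exp (- t)) * ind {0..} t * Phi_time \<psi> m t l) = ennreal (fact m * symQ m l)"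
proof -
 have tm: "(%t. time_integral m t c) \<in> bm lborel" for c by (rule measurable_time_integral[OF _ _ m]) auto
 have "(NN t. ennreal (exp (- t)) * ind {0..} t * Phi_time \<psi> m t l)
  = (\<Sum>sg | sg permutes {..<m}. (NN t. ennreal (exp (- t)) * ind {0..} t * time_integral m t (%j. \<psi> (\<Sum>i\<le>j. l (sg i)))))"
  unfolding Phi_time_def sum_distrib_left by (rule nn_integral_sum) (use tm in measurable)
 also have "... = (\<Sum>sg | sg permutes {..<m}. ennreal (\<Prod>j<m. Q (\<Sum>i\<le>j. l (sg i))))"
  unfolding Q_def by (intro sum.cong refl laplace_time_integral m \<psi>_nn)
 also have "... = ennreal (fact m * symQ m l)" by (subst sum_ennreal) (auto simp: symQ_def intro!: prod_nonneg)
 finally show ?thesis .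
qed

text \<open>Each of the m points contributes t^p from its p time integrals and t^(- d/\<alpha>) from
  the rescaling of its frequency, together t^av.\<close>

lemma Phi_time_power:
 assumes m: "0 < m" and t: "0 < t"
 shows "(\<integral>\<^sup>+l. Phi_time \<psi> m t l ^ Suc n \<partial>P m) = ennreal (t powr (av * real m)) * Phi_norm m"
proof -
 define r where "r = t powr (1 / \<alpha>)"
 have r: "0 < r" using t by (simp add: r_def)
 define A where "A = (\<integral>\<^sup>+l. Phi_nn \<psi> m (\<lambda>i\<in>{..<m}. r *\<^sub>R l i) ^ Suc n \<partial>P m)"
 have J: "Phi_norm m = ennreal (r ^ (CARD('d) * m)) * A" unfolding Phi_norm_def A_def
  using nn_integral_PiM_scale[of "{..<m}" r "%l. Phi_nn \<psi> m l ^ Suc n"] r measurable_Phi_nn[OF m] by simp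
 have rm: "(%l. \<lambda>i\<in>{..<m}. r *\<^sub>R l i) \<in> measurable (P m) (P m)"
  by (rule measurable_restrict) (use component_measurable in \<open>auto intro!: borel_measurable_scaleR\<close>)
 have "(\<integral>\<^sup>+l. Phi_time \<psi> m t l ^ Suc n \<partial>P m) = (\<integral>\<^sup>+l. ennreal ((t ^ m) ^ Suc n) * Phi_nn \<psi> m (\<lambda>i\<in>{..<m}. r *\<^sub>R l i) ^ Suc n \<partial>P m)"
  unfolding Phi_time_scale[OF m t] r_def[symmetric] power_mult_distrib using t by (simp add: ennreal_power del: power_Suc)
 also have "... = ennreal ((t ^ m) ^ Suc n) * A"
  unfolding A_def by (rule nn_integral_cmult) (use measurable_compose[OF rm measurable_Phi_nn[OF m]] in measurable)
 also have "(t ^ m) ^ Suc n = t powr (av * real m) * r ^ (CARD('d) * m)"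
 proof -
  have "r ^ (CARD('d) * m) = t powr (gam * real m)"
   unfolding r_def using t by (subst powr_realpow[symmetric]) (auto simp: powr_powr gam_def)
  moreover have "(t ^ m) ^ Suc n = t powr (real (Suc n) * real m)"
  proof -
   have "(t ^ m) ^ Suc n = t ^ (m * Suc n)" by (rule power_mult[symmetric])
   also have "... = t powr real (m * Suc n)" by (rule powr_realpow[OF t, symmetric])
   also have "real (m * Suc n) = real (Suc n) * real m" by (simp only: of_nat_mult mult.commute)
   finally show ?thesis .
  qed
  ultimately show ?thesis by (simp add: av_def left_diff_distrib flip: powr_add)
 qed
 finally show ?thesis unfolding J using t r by (simp add: ennreal_mult mult.assoc)
qed

text \<open>\<open>j\<close> is any positive upper bound of the norm rather than its value; nothing
  about finiteness or positivity of the norm has to be known here.\<close>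

lemma hoelder_step:
 assumes m: "0 < m" and t: "0 < t" and b[measurable]: "b \<in> bm borel"
  and b1: "(NN x. b x ^ Suc n) <= 1" and j: "0 < j" "Phi_norm m <= ennreal j"
 shows "(\<integral>\<^sup>+l. (\<Prod>k<m. b (l k) ^ n) * Phi_time \<psi> m t l \<partial>P m)
  <= ennreal (t powr (av * real m / real (Suc n)) * j powr (1 / real (Suc n)))"
proof -
 interpret product_sigma_finite "%_::nat. lborel :: (real^'d) measure" by (rule product_sigma_finite_lborel)
 let ?K = "t powr (av * real m / real (Suc n)) * j powr (1 / real (Suc n))"
 have bm[measurable]: "(%l. \<Prod>k<m. b (l k)) \<in> bm (P m)"
  by (intro borel_measurable_prod_ennreal measurable_compose[OF component_measurable b]) auto
 have K: "0 < ?K" using t j by simp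
 have "?K ^ Suc n = ?K powr real (Suc n)" by (rule powr_realpow[OF K, symmetric])
 also have "... = t powr (av * real m) * j" using t j by (simp add: powr_mult powr_powr del: of_nat_Suc)
 finally have Kp: "?K ^ Suc n = t powr (av * real m) * j" .
 have "(\<integral>\<^sup>+l. Phi_time \<psi> m t l * (\<Prod>k<m. b (l k)) ^ n \<partial>P m) <= ennreal ?K"
 proof (rule hoelder_power_nn[OF _ bm _ _ K])
  show "Phi_time \<psi> m t \<in> bm (P m)" by (rule measurable_Phi_time[OF _ _ component_measurable m]) auto
  have "(\<integral>\<^sup>+l. Phi_time \<psi> m t l ^ Suc n \<partial>P m) <= ennreal (t powr (av * real m)) * ennreal j"
   unfolding Phi_time_power[OF m t] using j by (intro mult_left_mono) auto
  also have "... = ennreal ?K ^ Suc n" using K j by (simp only: ennreal_power[OF less_imp_le[OF K]] Kp) (simp add: ennreal_mult)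
  finally show "(\<integral>\<^sup>+l. Phi_time \<psi> m t l ^ Suc n \<partial>P m) <= ennreal ?K ^ Suc n" .
  have "(\<integral>\<^sup>+l. (\<Prod>k<m. b (l k)) ^ Suc n \<partial>P m) = (\<integral>\<^sup>+l. (\<Prod>k<m. b (l k) ^ Suc n) \<partial>P m)"
   by (simp only: prod_power_distrib)
  also have "... = (\<Prod>k<m. \<integral>\<^sup>+x. b x ^ Suc n \<partial>lborel)" by (rule product_nn_integral_prod) auto
  also have "... <= 1" using b1 by (intro prod_le_1) auto
  finally show "(\<integral>\<^sup>+l. (\<Prod>k<m. b (l k)) ^ Suc n \<partial>P m) <= 1" .
 qed
 thus ?thesis by (simp only: prod_power_distrib mult.commute)
qed

text \<open>A share ep of the exponential is kept for integrability and gives 1 / ep. The remaining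
  factor exp(- (1 - ep) t) t^x is replaced by its maximum, attained at t = x / (1 - ep).\<close>

lemma gamma_integral_le:
 assumes ep: "0 < ep" "ep < 1" and x: "0 < x"
 shows "(NN t. ennreal (exp (- t)) * ind {0..} t * ennreal (t powr x)) <= ennreal ((x / (exp 1 * (1 - ep))) powr x / ep)"
proof -
 let ?C = "(x / (exp 1 * (1 - ep))) powr x"
 have pw: "exp (- t) * t powr x <= ?C * exp (- (ep * t))" if "0 <= t" for t
 proof (cases "t = 0")
  case False
  hence t: "0 < t" using that by simp
  define y where "y = (1 - ep) * t / x"
  have y: "0 < y" using t ep x by (simp add: y_def)
  have "ln y <= y - 1" using y by (rule ln_le_minus_one)
  hence "x * ln y <= x * (y - 1)" using x by (intro mult_left_mono) auto
  hence le: "x * ln y <= (1 - ep) * t - x" using x by (simp add: y_def right_diff_distrib)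
  have lny: "ln y = ln (1 - ep) + ln t - ln x" using t ep x by (simp add: y_def ln_mult ln_div)
  have lnC: "ln (x / (exp 1 * (1 - ep))) = ln x - 1 - ln (1 - ep)" using ep x by (simp add: ln_mult ln_div)
  have "x * ln t - t <= x * ln (x / (exp 1 * (1 - ep))) - ep * t"
   unfolding lnC using le unfolding lny by (simp add: algebra_simps)
  hence "exp (x * ln t - t) <= exp (x * ln (x / (exp 1 * (1 - ep))) - ep * t)" by simp
  thus ?thesis using t ep x by (simp add: powr_def exp_diff exp_minus field_simps)
 qed simp
 have "(NN t. ennreal (exp (- t)) * ind {0..} t * ennreal (t powr x)) <= (NN t. ennreal (?C * exp (- (ep * t))) * ind {0..} t)"
  by (intro nn_integral_mono) (auto simp: indicator_def ennreal_mult'[symmetric] intro!: ennreal_leI pw)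
 also have "... = ennreal (0 - (- ?C / ep * exp (- (ep * 0))))"
 proof (rule nn_integral_FTC_atLeast[where F = "%t. - ?C / ep * exp (- (ep * t))" and T = 0 and a = 0])
  show "((%t. - ?C / ep * exp (- (ep * t))) has_real_derivative ?C * exp (- (ep * t))) (at t)" for t
   using ep by (auto intro!: derivative_eq_intros)
  show "((%t. - ?C / ep * exp (- (ep * t))) \<longlongrightarrow> 0) at_top" using ep by real_asymp
 qed auto
 finally show ?thesis by simp
qed

text \<open>The bridge from operator powers back to time 1. A product weight does not see
  permutations, so m! times the walk is the pairing with the Laplace transform of
  \<open>Phi_time\<close>. Hoelder at each fixed t and scaling in t leave a gamma integral with
  exponent x = av m / p.\<close>

lemma walk_le_Phi_norm:
 assumes m: "0 < m" and b[measurable]: "b \<in> bm borel"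
  and b1: "(NN x. b x ^ Suc n) <= 1" and j: "0 < j" "Phi_norm m <= ennreal j"
  and ep: "0 < ep" "ep < 1"
 defines "x \<equiv> av * real m / real (Suc n)"
 shows "ennreal (fact m) * (walk_step lborel (%l. b l ^ n) (%l. ennreal (Q l)) ^^ m) (%_. 1) 0
  <= ennreal ((x / (exp 1 * (1 - ep))) powr x / ep * j powr (1 / real (Suc n)))"
proof -
 interpret product_sigma_finite "%_::nat. lborel :: (real^'d) measure" by (rule product_sigma_finite_lborel)
 interpret PS: sigma_finite_measure "P m" by (rule sigma_finite) simp
 interpret PP: pair_sigma_finite "P m" "lborel :: real measure" ..
 let ?q = "%l. ennreal (Q l)"
 let ?g = "%l. \<Prod>k<m. b (l k) ^ n"
 have x: "0 < x" using av_pos m by (simp add: x_def)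
 have gm[measurable]: "?g \<in> bm (P m)"
  by (intro borel_measurable_prod_ennreal measurable_compose[OF component_measurable]) auto
 have sm: "(%l. \<Sum>i\<le>k. l i) \<in> bm (P m)" if "k < m" for k
  using that by (intro borel_measurable_sum component_measurable) auto
 have qm: "(%l. \<Prod>k<m. ?q (\<Sum>i\<le>k. l i)) \<in> bm (P m)"
  by (intro borel_measurable_prod_ennreal measurable_compose[OF sm]) auto
 have walk: "(walk_step lborel (%l. b l ^ n) ?q ^^ m) (%_. 1) 0 = (\<integral>\<^sup>+l. ?g l * (\<Prod>k<m. ?q (\<Sum>i\<le>k. l i)) \<partial>P m)"
  by (subst nn_integral_walk[symmetric]) (auto simp: sigma_finite_lborel prod.distrib)
 have "ennreal (fact m) * (walk_step lborel (%l. b l ^ n) ?q ^^ m) (%_. 1) 0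
  = (\<Sum>sg | sg permutes {..<m}. \<integral>\<^sup>+l. ?g l * (\<Prod>k<m. ?q (\<Sum>i\<le>k. l (sg i))) \<partial>P m)"
 proof -
  have perm: "(\<integral>\<^sup>+l. ?g l * (\<Prod>k<m. ?q (\<Sum>i\<le>k. l (sg i))) \<partial>P m) = (\<integral>\<^sup>+l. ?g l * (\<Prod>k<m. ?q (\<Sum>i\<le>k. l i)) \<partial>P m)"
   if sg: "sg permutes {..<m}" for sg
  proof -
   have im: "sg i < m \<longleftrightarrow> i < m" for i using permutes_in_image[OF sg, of i] by simp
   have "?g l * (\<Prod>k<m. ?q (\<Sum>i\<le>k. l (sg i))) = (%l. ?g l * (\<Prod>k<m. ?q (\<Sum>i\<le>k. l i))) (\<lambda>i\<in>{..<m}. l (sg i))" for l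
   proof -
   have "?g l = (\<Prod>k<m. b (l (sg k)) ^ n)" using prod.permute[OF sg, of "%k. b (l k) ^ n"] by (simp add: comp_def)
   also have "... = ?g (\<lambda>i\<in>{..<m}. l (sg i))" by simp
   finally have 1: "?g l = ?g (\<lambda>i\<in>{..<m}. l (sg i))" .
   have 2: "(\<Prod>k<m. ?q (\<Sum>i\<le>k. l (sg i))) = (\<Prod>k<m. ?q (\<Sum>i\<le>k. (\<lambda>i\<in>{..<m}. l (sg i)) i))"
   by (intro prod.cong refl arg_cong[where f = ?q] sum.cong) auto
   show ?thesis unfolding 1 2 ..
   qed
   hence "(\<integral>\<^sup>+l. ?g l * (\<Prod>k<m. ?q (\<Sum>i\<le>k. l (sg i))) \<partial>P m) = (\<integral>\<^sup>+l. (%l. ?g l * (\<Prod>k<m. ?q (\<Sum>i\<le>k. l i))) (\<lambda>i\<in>{..<m}. l (sg i)) \<partial>P m)"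
   by (rule nn_integral_cong)
   also have "... = (\<integral>\<^sup>+l. ?g l * (\<Prod>k<m. ?q (\<Sum>i\<le>k. l i)) \<partial>P m)"
   by (rule nn_integral_PiM_permute[OF sigma_finite_lborel finite_lessThan sg]) (rule borel_measurable_times_ennreal[OF gm qm])
   finally show ?thesis .
  qed
  have ef: "ennreal (fact m) = of_nat (fact m)" using ennreal_of_nat_eq_real_of_nat[of "fact m"] by simp
  have "(\<Sum>sg | sg permutes {..<m}. \<integral>\<^sup>+l. ?g l * (\<Prod>k<m. ?q (\<Sum>i\<le>k. l (sg i))) \<partial>P m) = (\<Sum>sg | sg permutes {..<m}. \<integral>\<^sup>+l. ?g l * (\<Prod>k<m. ?q (\<Sum>i\<le>k. l i)) \<partial>P m)"
   by (rule sum.cong[OF refl], rule perm) simp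
  also have "... = of_nat (fact m) * (\<integral>\<^sup>+l. ?g l * (\<Prod>k<m. ?q (\<Sum>i\<le>k. l i)) \<partial>P m)"
   unfolding sum_constant card_permutations_lessThan ..
  finally show ?thesis unfolding walk ef by (rule sym)
 qed
 also have "... = (\<integral>\<^sup>+l. ?g l * ennreal (fact m * symQ m l) \<partial>P m)"
 proof -
  have qm': "(%l. \<Prod>k<m. ?q (\<Sum>i\<le>k. l (sg i))) \<in> bm (P m)" if sg: "sg permutes {..<m}" for sg
  proof -
   have im: "sg i < m" if "i < m" for i using permutes_in_image[OF sg, of i] that by simp
   have sm: "(%l. \<Sum>i\<le>k. l (sg i)) \<in> bm (P m)" if "k < m" for k
   using that im by (intro borel_measurable_sum component_measurable) auto
   show ?thesis by (intro borel_measurable_prod_ennreal measurable_compose[OF sm]) auto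
  qed
  have "?g l * ennreal (fact m * symQ m l) = (\<Sum>sg | sg permutes {..<m}. ?g l * (\<Prod>k<m. ?q (\<Sum>i\<le>k. l (sg i))))" for l
  proof -
   have "ennreal (fact m * symQ m l) = (\<Sum>sg | sg permutes {..<m}. ennreal (\<Prod>k<m. Q (\<Sum>i\<le>k. l (sg i))))"
   by (subst sum_ennreal) (auto simp: symQ_def intro!: prod_nonneg)
   thus ?thesis by (simp add: prod_ennreal sum_distrib_left)
  qed
  thus ?thesis by (simp only:) (rule nn_integral_sum[symmetric], use gm qm' in \<open>auto intro!: borel_measurable_times_ennreal\<close>)
 qed
 also have "... = (\<integral>\<^sup>+l. (NN t. ?g l * (ennreal (exp (- t)) * ind {0..} t * Phi_time \<psi> m t l)) \<partial>P m)"
 proof (rule nn_integral_cong)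
  fix l
  have [measurable]: "(%t. Phi_time \<psi> m t l) \<in> bm lborel" by (rule measurable_Phi_time[OF _ _ _ m]) auto
  show "?g l * ennreal (fact m * symQ m l) = (NN t. ?g l * (ennreal (exp (- t)) * ind {0..} t * Phi_time \<psi> m t l))"
   unfolding laplace_Phi[OF m, symmetric] by (rule nn_integral_cmult[symmetric]) measurable
 qed
 also have "... = (NN t. (\<integral>\<^sup>+l. ?g l * (ennreal (exp (- t)) * ind {0..} t * Phi_time \<psi> m t l) \<partial>P m))"
 proof (rule PP.Fubini'[symmetric])
  have [measurable]: "(%p. Phi_time \<psi> m (snd p) (fst p)) \<in> bm (P m \<Otimes>\<^sub>M lborel)"
   by (rule measurable_Phi_time[OF _ _ _ m]) (auto intro!: measurable_compose[OF measurable_fst component_measurable])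
  have [measurable]: "(%p. ?g (fst p)) \<in> bm (P m \<Otimes>\<^sub>M (lborel :: real measure))"
   by (rule measurable_compose[OF measurable_fst gm])
  show "(%(l, t). ?g l * (ennreal (exp (- t)) * ind {0..} t * Phi_time \<psi> m t l)) \<in> bm (P m \<Otimes>\<^sub>M lborel)"
   unfolding case_prod_beta by measurable
 qed
 also have "... <= (NN t. ennreal (exp (- t)) * ind {0..} t * ennreal (t powr x) * ennreal (j powr (1 / real (Suc n))))"
 proof (rule nn_integral_mono_AE)
  have "AE t in lborel. t ~= (0::real)" by (rule AE_lborel_singleton)
  thus "AE t in lborel. (\<integral>\<^sup>+l. ?g l * (ennreal (exp (- t)) * ind {0..} t * Phi_time \<psi> m t l) \<partial>P m)
   <= ennreal (exp (- t)) * ind {0..} t * ennreal (t powr x) * ennreal (j powr (1 / real (Suc n)))"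
  proof eventually_elim
   case (elim t)
   show ?case
   proof (cases "0 < t")
   case True
   have pm: "Phi_time \<psi> m t \<in> bm (P m)" by (rule measurable_Phi_time[OF _ _ component_measurable m]) auto
   have "(\<integral>\<^sup>+l. ?g l * (ennreal (exp (- t)) * ind {0..} t * Phi_time \<psi> m t l) \<partial>P m)
   = ennreal (exp (- t)) * (\<integral>\<^sup>+l. ?g l * Phi_time \<psi> m t l \<partial>P m)"
   using True gm pm by (subst nn_integral_cmult[symmetric]) (auto simp: mult_ac)
   also have "... <= ennreal (exp (- t)) * ennreal (t powr x * j powr (1 / real (Suc n)))"
   unfolding x_def by (intro mult_left_mono hoelder_step m True b b1 j) auto
   finally show ?thesis using True by (simp add: ennreal_mult mult.assoc)
   next
   case False
   thus ?thesis using elim by simp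
   qed
  qed
 qed
 also have "... = (NN t. ennreal (exp (- t)) * ind {0..} t * ennreal (t powr x)) * ennreal (j powr (1 / real (Suc n)))"
  by (rule nn_integral_multc) measurable
 also have "... <= ennreal ((x / (exp 1 * (1 - ep))) powr x / ep) * ennreal (j powr (1 / real (Suc n)))"
  by (intro mult_right_mono gamma_integral_le ep x) auto
 also have "... = ennreal ((x / (exp 1 * (1 - ep))) powr x / ep * j powr (1 / real (Suc n)))"
  by (rule ennreal_mult[symmetric]) (use ep in auto)
 finally show ?thesis .
qed

end

lemma convex_power_ennreal:
 assumes ep: "0 < ep" "ep < 1"
 shows "(ennreal (1 - ep) * a + ennreal ep * ennreal d) ^ Suc n <= ennreal (1 - ep) * a ^ Suc n + ennreal ep * ennreal d ^ Suc n"
proof (cases a)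
 case (real a')
 define d' where "d' = max d 0"
 have d: "ennreal d = ennreal d'" "0 <= d'" by (auto simp: d'_def ennreal_neg max_def)
 define w where "w i = (if i then ep else 1 - ep)" for i
 define y where "y i = (if i then d' else a')" for i
 have "(\<Sum>i\<in>{True, False}. w i * y i) ^ Suc n <= (\<Sum>i\<in>{True, False}. w i * y i ^ Suc n)"
  by (rule jensen_power) (use ep d real in \<open>auto simp: w_def y_def\<close>)
 hence "((1 - ep) * a' + ep * d') ^ Suc n <= (1 - ep) * a' ^ Suc n + ep * d' ^ Suc n"
  by (simp add: w_def y_def add.commute del: power_Suc)
 hence "ennreal (((1 - ep) * a' + ep * d') ^ Suc n) <= ennreal ((1 - ep) * a' ^ Suc n + ep * d' ^ Suc n)" by (rule ennreal_leI)
 thus ?thesis unfolding d real using ep d(2) real by (simp add: ennreal_mult ennreal_power[symmetric] del: power_Suc)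
next
 case top
 have "ennreal (1 - ep) * a ^ Suc n = \<top>" using ep by (simp add: top ennreal_mult_eq_top_iff)
 thus ?thesis by simp
qed

section \<open>Lower bounds from a near-optimal autocorrelation\<close>

context stable_setup
begin

text \<open>The Hoelder-extremal weight for a near-optimal h is its autocorrelation divided by its
  norm; with it the form is almost the p-th root of \<rho>. Since that weight may vanish, a share ep
  of normalised \<open>Q\<close> is mixed in. It is bounded below on balls, which lets constants
  dominate the compactly supported vector \<open>u\<close> at both ends of the walk.\<close>

lemma walk_lower:
 assumes c: "0 < c" "c < \<rho>" and ep: "0 < ep" "ep < 1"
 obtains b C where "b \<in> bm borel" "(NN x. b x ^ Suc n) <= 1" "0 < C"
  "!!j. ennreal (C * ((1 - ep) ^ n * c powr (1 / real (Suc n))) ^ (2 * Suc j))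
   <= (walk_step lborel (%l. b l ^ n) (%l. ennreal (Q l)) ^^ (Suc (Suc (2 * Suc j)))) (%_. 1) 0"
proof -
 have "\<exists>h R B. h \<in> bm borel & (\<forall>x. 0 <= h x) & (\<forall>x. h x <= B) & (\<forall>x. R < norm x --> h x = 0) &
  (NN x. ennreal ((h x)\<^sup>2 * (1 + \<psi> x))) <= 1 & ennreal c < (NN l. corr h l ^ Suc n)"
  by (rule near_optimal_truncated[OF less_imp_le[OF c(1)] c(2)]) blast
 then obtain h R B where hm[measurable]: "h \<in> bm borel" and h0: "!!x. 0 <= h x" and hB: "!!x. h x <= B"
  and hR: "!!x. R < norm x ==> h x = 0" and h1: "(NN x. ennreal ((h x)\<^sup>2 * (1 + \<psi> x))) <= 1"
  and hc: "ennreal c < (NN l. corr h l ^ Suc n)" by blast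
 let ?p = "real (Suc n)"
 have corrm[measurable]: "corr h \<in> bm borel" by (rule borel_measurable_corr) measurable
 define Fp where "Fp = enn2real (NN l. corr h l ^ Suc n)"
 have "(NN l. corr h l ^ Suc n) <= ennreal (\<rho> * 1 ^ Suc n)" by (rule nn_integral_corr_power_le_rho) (use hm h0 h1 in auto)
 hence Fp: "(NN l. corr h l ^ Suc n) = ennreal Fp" unfolding Fp_def
  by (simp add: ennreal_enn2real_if) (metis ennreal_less_top not_le)
 have cF: "c < Fp" using hc unfolding Fp using c by (simp add: ennreal_less_iff)
 define \<phi> where "\<phi> = Fp powr (1 / ?p)"
 define k where "k = IQ powr (1 / ?p)"
 have \<phi>: "0 < \<phi>" "\<phi> ^ Suc n = Fp" using cF c unfolding \<phi>_def by (auto simp: powr_powr simp flip: powr_realpow simp del: of_nat_Suc power_Suc)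
 have k: "0 < k" "k ^ Suc n = IQ" using IQ_pos unfolding k_def by (auto simp: powr_powr simp flip: powr_realpow simp del: of_nat_Suc power_Suc)
 \<comment> \<open>\<phi> and k are the L^p norms of the two functions, so the convex combination
   stays in the unit ball.\<close>
 define b where "b x = ennreal (1 - ep) * (corr h x * ennreal (1 / \<phi>)) + ennreal ep * ennreal (Q x / k)" for x
 have b[measurable]: "b \<in> bm borel" unfolding b_def by measurable
 have b1: "(NN x. b x ^ Suc n) <= 1"
 proof -
  have 1: "(NN x. (corr h x * ennreal (1 / \<phi>)) ^ Suc n) = 1"
  proof -
   have "(NN x. (corr h x * ennreal (1 / \<phi>)) ^ Suc n) = (NN x. corr h x ^ Suc n * ennreal ((1 / \<phi>) ^ Suc n))"
   using \<phi> by (simp add: power_mult_distrib ennreal_power del: power_Suc)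
   also have "... = ennreal Fp * ennreal ((1 / \<phi>) ^ Suc n)" unfolding Fp[symmetric] by (rule nn_integral_multc) measurable
   also have "(1 / \<phi>) ^ Suc n = 1 / Fp" by (simp only: power_divide \<phi>(2) power_one)
   finally show ?thesis using cF c by (simp flip: ennreal_mult)
  qed
  have 2: "(NN x. ennreal (Q x / k) ^ Suc n) = 1"
  proof -
   have "(NN x. ennreal (Q x / k) ^ Suc n) = (NN x. ennreal (Q x ^ Suc n) * ennreal (1 / IQ))"
   using k IQ_pos by (intro nn_integral_cong) (simp only: ennreal_power[OF divide_nonneg_nonneg[OF Q_nonneg less_imp_le[OF k(1)]]] power_divide k(2), simp flip: ennreal_mult del: power_Suc)
   also have "... = ennreal IQ * ennreal (1 / IQ)" unfolding nn_integral_Q[symmetric] by (rule nn_integral_multc) measurable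
   finally show ?thesis using IQ_pos by (simp flip: ennreal_mult)
  qed
  have "(NN x. b x ^ Suc n) <= (NN x. ennreal (1 - ep) * (corr h x * ennreal (1 / \<phi>)) ^ Suc n + ennreal ep * ennreal (Q x / k) ^ Suc n)"
   unfolding b_def by (intro nn_integral_mono convex_power_ennreal ep)
  also have "... = ennreal (1 - ep) * (NN x. (corr h x * ennreal (1 / \<phi>)) ^ Suc n) + ennreal ep * (NN x. ennreal (Q x / k) ^ Suc n)"
   by (subst nn_integral_add) (auto simp: nn_integral_cmult simp del: power_Suc)
  also have "... = 1" unfolding 1 2 using ep by (simp flip: ennreal_plus)
  finally show ?thesis .
 qed
 have b_even: "b (- x) = b x" for x unfolding b_def by (simp add: corr_minus[OF hm])
 interpret W: symmetric_walk "%l. b l ^ n" "%l. ennreal (Q l)" by unfold_locales (auto simp: b_even)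
 obtain C0 where C0: "0 < C0" "!!\<xi>. \<psi> \<xi> <= C0 * norm \<xi> powr \<alpha>" using \<psi>_bounds by blast
 define R0 where "R0 = max R 0"
 define q0 where "q0 = 1 / (1 + C0 * (R0 + 1) powr \<alpha>)"
 have q0: "0 < q0" using C0 by (auto simp: q0_def intro!: divide_pos_pos add_pos_nonneg)
 have psi_le: "1 + \<psi> x <= 1 / q0" if "norm x <= R0 + 1" for x
 proof -
  have "C0 * norm x powr \<alpha> <= C0 * (R0 + 1) powr \<alpha>" using that C0 \<alpha>0 by (intro mult_left_mono powr_mono2) auto
  thus ?thesis using C0(2)[of x] by (simp add: q0_def)
 qed
 have Q_ge: "q0 <= Q x" if "norm x <= R0 + 1" for x
  using psi_le[OF that] q0 one_plus_\<psi>_pos[of x] by (simp add: Q_def field_simps)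
 \<comment> \<open>Chosen so that Q u = h: the form with weight \<open>Q\<close> then reads off the
   autocorrelation of h, and the square of \<open>u\<close> under it is the weighted norm of
   h.\<close>
 define u where "u x = ennreal (h x * (1 + \<psi> x))" for x
 have um[measurable]: "u \<in> bm borel" unfolding u_def by measurable
 define U where "U = max B 1 / q0"
 have U: "0 < U" using q0 by (simp add: U_def)
 have u_le: "u x <= ennreal U" for x
 proof (cases "norm x <= R0 + 1")
  case True
  have "h x * (1 + \<psi> x) <= max B 1 * (1 / q0)"
   using psi_le[OF True] hB[of x] h0[of x] by (intro mult_mono) (auto intro: add_nonneg_nonneg)
  thus ?thesis unfolding u_def U_def by (intro ennreal_leI) simp
 next
  case False
  thus ?thesis using hR[of x] by (simp add: u_def R0_def)
 qed
 have u_0: "u x = 0" if "R0 < norm x" for x using hR[of x] that by (simp add: u_def R0_def)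
 have Qu: "ennreal (Q x) * u x = ennreal (h x)" for x using h0[of x] Q_mult[of x] by (simp add: u_def flip: ennreal_mult)
 define g0 where "g0 = (ep * q0 / k) ^ n"
 have g0: "0 < g0" using ep q0 k by (simp add: g0_def)
 have g_ge: "ennreal g0 <= b x ^ n" if "norm x <= R0 + 1" for x
 proof -
  have "ennreal (ep * q0 / k) <= ennreal ep * ennreal (Q x / k)"
   using Q_ge[OF that] ep k q0 by (simp flip: ennreal_mult) (intro divide_right_mono mult_left_mono, auto)
  also have "... <= b x" unfolding b_def by simp
  finally have "ennreal (ep * q0 / k) ^ n <= b x ^ n" by (intro power_mono) auto
  thus ?thesis using ep q0 k by (simp add: g0_def ennreal_power)
 qed
 define v0 where "v0 = measure lborel (ball (0::real^'d) 1)"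
 have v0: "0 < v0" "emeasure lborel (ball (0::real^'d) 1) = ennreal v0"
  unfolding v0_def using content_ball_pos[of 1 "0::real^'d"] emeasure_lborel_ball_finite[of "0::real^'d" 1]
  by (auto intro!: emeasure_eq_ennreal_measure simp: less_top)
 define C3 where "C3 = g0 * q0 * v0 / U"
 have C3: "0 < C3" using g0 q0 v0 U by (simp add: C3_def)
 have S1_ge: "ennreal C3 * u x <= W.S (%_. 1) x" for x
 proof (cases "norm x <= R0")
  case True
  have "ennreal C3 * u x <= ennreal C3 * ennreal U" using u_le by (intro mult_left_mono) auto
  also have "... = ennreal (g0 * q0) * ennreal v0" using U g0 q0 v0 by (simp add: C3_def flip: ennreal_mult)
  also have "... = (NN l. ennreal (g0 * q0) * ind (ball (0::real^'d) 1) l)"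
   unfolding v0(2)[symmetric] by (rule nn_integral_cmult_indicator[symmetric]) simp
  also have "... <= W.S (%_. 1) x" unfolding walk_step_def
  proof (rule nn_integral_mono)
   fix l :: "real^'d"
   show "ennreal (g0 * q0) * ind (ball 0 1) l <= b l ^ n * ennreal (Q (x + l)) * 1"
   proof (cases "l \<in> ball 0 1")
   case l: True
   have "norm l <= R0 + 1" using l by (simp add: R0_def)
   moreover have "norm (x + l) <= R0 + 1" using norm_triangle_ineq[of x l] l True by simp
   ultimately have "ennreal g0 * ennreal q0 <= b l ^ n * ennreal (Q (x + l))" by (intro mult_mono g_ge ennreal_leI Q_ge) auto
   thus ?thesis using l g0 q0 by (simp add: ennreal_mult)
   qed simp
  qed
  finally show ?thesis .
 qed (simp add: u_0)
 have g_u: "ennreal (g0 / U) * u x <= b x ^ n" for x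
 proof (cases "norm x <= R0")
  case True
  have "ennreal (g0 / U) * u x <= ennreal (g0 / U) * ennreal U" using u_le by (intro mult_left_mono) auto
  also have "... = ennreal g0" using U g0 by (simp flip: ennreal_mult)
  also have "... <= b x ^ n" using True by (intro g_ge) simp
  finally show ?thesis .
 qed (simp add: u_0)
 \<comment> \<open>This serves the finiteness of the forms that \<open>pair_growth\<close> asks
   for.\<close>
 have S1_le: "W.S (%_. 1) x <= ennreal k" for x
 proof -
  have "(NN l. ennreal (Q (x + l)) * b l ^ n) <= ennreal k"
  proof (rule hoelder_power_nn[OF _ _ _ b1 k(1)])
   have "(NN l. ennreal (Q (x + l)) ^ Suc n) = (NN l. ennreal (Q l ^ Suc n))"
   using nn_integral_lborel_shift[of "%l. ennreal (Q l ^ Suc n)" x] by (simp add: ennreal_power del: power_Suc)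
   thus "(NN l. ennreal (Q (x + l)) ^ Suc n) <= ennreal k ^ Suc n"
   using k nn_integral_Q by (simp add: ennreal_power del: power_Suc)
  qed measurable
  thus ?thesis by (simp add: walk_step_def mult.commute)
 qed
 have Sk_le: "(W.S ^^ i) u x <= ennreal U * ennreal k ^ i" for i x
 proof (induction i arbitrary: x)
  case (Suc i)
  have "(W.S ^^ Suc i) u x <= W.S (%x. (ennreal U * ennreal k ^ i) * 1) x" by (simp, rule walk_step_mono) (use Suc in simp)
  also have "... = (ennreal U * ennreal k ^ i) * W.S (%_. 1) x" by (rule W.S_cmult) simp
  also have "... <= (ennreal U * ennreal k ^ i) * ennreal k" using S1_le by (intro mult_left_mono) auto
  finally show ?case by (simp add: mult_ac)
 qed (simp add: u_le)
 have pair_u: "W.pair u \<phi>' = (NN x. ennreal (h x) * \<phi>' x)" for \<phi>' unfolding W.pair_def Qu ..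
 have hfin: "(NN x. ennreal (h x)) < \<top>"
 proof -
  have "(NN x. ennreal (h x)) <= (NN x. ennreal B * ind (cball (0::real^'d) R) x)"
   using hR hB by (intro nn_integral_mono) (auto simp: indicator_def not_le intro!: ennreal_leI)
  also have "... = ennreal B * emeasure lborel (cball (0::real^'d) R)" by (rule nn_integral_cmult_indicator) simp
  also have "... < \<top>" using emeasure_lborel_cball_finite[of "0::real^'d" R] by (simp add: ennreal_mult_less_top)
  finally show ?thesis .
 qed
 have fin: "W.pair u ((W.S ^^ i) u) < \<top>" for i
 proof -
  have "W.pair u ((W.S ^^ i) u) <= (NN x. ennreal (h x) * (ennreal U * ennreal k ^ i))"
   unfolding pair_u by (intro nn_integral_mono mult_left_mono Sk_le) auto
  also have "... = (NN x. ennreal (h x)) * (ennreal U * ennreal k ^ i)" by (rule nn_integral_multc) measurable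
  also have "... < \<top>" using hfin by (simp add: ennreal_mult_less_top power_less_top_ennreal)
  finally show ?thesis .
 qed
 have uu: "W.pair u u <= 1"
 proof -
  have "ennreal (h x) * u x = ennreal ((h x)\<^sup>2 * (1 + \<psi> x))" for x
   using h0[of x] by (simp add: u_def power2_eq_square mult_ac flip: ennreal_mult)
  thus ?thesis unfolding pair_u using h1 by simp
 qed
 define kap where "kap = (1 - ep) ^ n * \<phi>"
 have kap0: "0 <= kap" using ep \<phi> by (simp add: kap_def)
 have kap: "ennreal kap <= W.pair u (W.S u)"
 proof -
  have hs: "ennreal (Q (x + l)) * u (x + l) = ennreal (h (x + l))" for x l by (rule Qu)
  have "W.pair u (W.S u) = (NN x. (NN l. ennreal (h x) * (b l ^ n * ennreal (h (x + l)))))"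
   unfolding pair_u walk_step_def mult.assoc hs by (intro nn_integral_cong nn_integral_cmult[symmetric]) measurable
  also have "... = (NN l. (NN x. ennreal (h x) * (b l ^ n * ennreal (h (x + l)))))" by (rule lborel_pair.Fubini') measurable
  also have "... = (NN l. b l ^ n * corr h l)"
   unfolding corr_def by (intro nn_integral_cong, subst nn_integral_cmult[symmetric]) (auto simp: mult_ac add.commute)
  \<comment> \<open>The \<open>Q\<close> share of the weight is dropped here; on the remaining share
    Hoelder's inequality is an equality.\<close>
  also have "... >= (NN l. (ennreal (1 - ep) * (corr h l * ennreal (1 / \<phi>))) ^ n * corr h l)"
   unfolding b_def by (intro nn_integral_mono mult_right_mono power_mono) auto
  also have "(NN l. (ennreal (1 - ep) * (corr h l * ennreal (1 / \<phi>))) ^ n * corr h l)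
   = (NN l. ennreal (((1 - ep) / \<phi>) ^ n) * corr h l ^ Suc n)"
  proof (rule nn_integral_cong)
   fix l
   have "ennreal (((1 - ep) / \<phi>) ^ n) = ennreal (1 - ep) ^ n * ennreal (1 / \<phi>) ^ n"
   using ep \<phi> by (simp add: ennreal_power flip: ennreal_mult power_mult_distrib)
   thus "(ennreal (1 - ep) * (corr h l * ennreal (1 / \<phi>))) ^ n * corr h l = ennreal (((1 - ep) / \<phi>) ^ n) * corr h l ^ Suc n"
   by (simp add: power_mult_distrib mult_ac)
  qed
  also have "... = ennreal (((1 - ep) / \<phi>) ^ n) * ennreal Fp" unfolding Fp[symmetric] by (rule nn_integral_cmult) measurable
  also have "... = ennreal kap"
  proof -
   have "((1 - ep) / \<phi>) ^ n * Fp = kap" unfolding \<phi>(2)[symmetric] kap_def using \<phi>(1) by (simp add: power_divide)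
   thus ?thesis using ep \<phi> cF c by (simp flip: ennreal_mult)
  qed
  finally show ?thesis .
 qed
 define C where "C = (g0 / U) * C3"
 show ?thesis
 proof (rule that[OF b b1])
  show "0 < C" using g0 U C3 by (simp add: C_def)
  fix j
  let ?k = "2 * Suc j"
  have "c powr (1 / ?p) <= \<phi>" unfolding \<phi>_def using c cF by (intro powr_mono2) auto
  hence "((1 - ep) ^ n * c powr (1 / ?p)) ^ ?k <= kap ^ ?k" unfolding kap_def using ep by (intro power_mono mult_left_mono) auto
  moreover have C: "0 < C" using g0 U C3 by (simp add: C_def)
  ultimately have "ennreal (C * ((1 - ep) ^ n * c powr (1 / ?p)) ^ ?k) <= ennreal (C * kap ^ ?k)"
   by (intro ennreal_leI mult_left_mono) auto
  also have "... = ennreal C * ennreal (kap ^ ?k)" by (rule ennreal_mult) (use C kap0 in auto)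
  also have "... <= ennreal C * W.pair u ((W.S ^^ ?k) u)" by (intro mult_left_mono W.pair_growth um fin uu kap0 kap) auto
  also have "... = ennreal (g0 / U) * (ennreal C3 * W.pair u ((W.S ^^ ?k) u))"
   using g0 U C3 by (simp add: C_def ennreal_mult mult.assoc del: times_divide_eq_left)
  also have "... = (NN l. ennreal (g0 / U) * u l * ennreal (Q l) * (ennreal C3 * (W.S ^^ ?k) u l))"
  proof -
   have [measurable]: "(W.S ^^ ?k) u \<in> bm borel" by (rule W.S_funpow_measurable) measurable
   show ?thesis unfolding W.pair_def by (subst nn_integral_cmult[symmetric], measurable, subst nn_integral_cmult[symmetric], measurable) (simp add: mult_ac)
  qed
  \<comment> \<open>Both ends are traded for steps of the walk: the left \<open>u\<close> is
    dominated by the weight of a first step from 0, the right one by a last step applied to the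
    constant 1. This accounts for the two extra steps in the statement.\<close>
  also have "... <= (NN l. b l ^ n * ennreal (Q l) * (W.S ^^ ?k) (W.S (%_. 1)) l)"
  proof (intro nn_integral_mono mult_mono g_u order_refl)
   fix l
   have "ennreal C3 * (W.S ^^ ?k) u l = (W.S ^^ ?k) (%x. ennreal C3 * u x) l"
   using W.S_funpow_cmult[OF um, of ?k "ennreal C3"] by simp
   also have "... <= (W.S ^^ ?k) (W.S (%_. 1)) l" by (rule walk_step_funpow_mono) (rule S1_ge)
   finally show "ennreal C3 * (W.S ^^ ?k) u l <= (W.S ^^ ?k) (W.S (%_. 1)) l" .
  qed auto
  also have "... = W.S ((W.S ^^ ?k) (W.S (%_. 1))) 0" by (simp add: walk_step_def)
  also have "... = (W.S ^^ Suc (Suc ?k)) (%_. 1) 0" by (simp only: funpow_swap1 funpow.simps comp_apply)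
  finally show "ennreal (C * ((1 - ep) ^ n * c powr (1 / ?p)) ^ ?k) <= (W.S ^^ Suc (Suc ?k)) (%_. 1) 0" .
 qed
qed

text \<open>The walk grows at a rate close to the p-th root of \<rho>; taking p-th powers in
  \<open>walk_le_Phi_norm\<close> turns this into a bound on the norm. Apart from a constant, all
  losses are powers of 1 - ep per step.\<close>

lemma Phi_norm_lower:
 assumes c: "0 < c" "c < \<rho>" and ep: "0 < ep" "ep < 1"
 obtains C where "0 < C" "!!m. even m ==> 4 <= m ==>
  ennreal (C * (((real (Suc n) / av) powr av * real m powr gam * exp (- gam)) * ((1 - ep) powr (real (n * Suc n) + av) * c)) ^ m) <= Phi_norm m"
proof -
 let ?p = "real (Suc n)"
 obtain b C0 where b: "b \<in> bm borel" "(NN x. b x ^ Suc n) <= 1" and C0: "0 < C0"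
  and w: "!!j. ennreal (C0 * ((1 - ep) ^ n * c powr (1 / ?p)) ^ (2 * Suc j))
   <= (walk_step lborel (%l. b l ^ n) (%l. ennreal (Q l)) ^^ (Suc (Suc (2 * Suc j)))) (%_. 1) 0"
  using walk_lower[OF c ep] by blast
 define kap where "kap = (1 - ep) ^ n * c powr (1 / ?p)"
 have kap: "0 < kap" using ep c by (simp add: kap_def)
 define C where "C = (ep * C0 / kap\<^sup>2) ^ Suc n"
 have C: "0 < C" using ep C0 kap by (simp add: C_def)
 show ?thesis
 proof (rule that[OF C])
  fix m :: nat assume "even m" "4 <= m"
  obtain i where i: "m = 2 * i" using \<open>even m\<close> by (rule evenE)
  define j where "j = i - 2"
  have mj: "m = Suc (Suc (2 * Suc j))" using i \<open>4 <= m\<close> by (simp add: j_def)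
  have m: "0 < m" by (simp add: mj)
  define x where "x = av * real m / ?p"
  define Z where "Z = x / (exp 1 * (1 - ep))"
  have x: "0 < x" using av_pos m by (simp add: x_def)
  have Z: "0 < Z" using x ep by (simp add: Z_def)
  define G where "G = (?p / av) powr av * real m powr gam * exp (- gam)"
  define L where "L = C * (G * ((1 - ep) powr (real (n * Suc n) + av) * c)) ^ m"
  have main: "L <= i" if i: "0 < i" "Phi_norm m <= ennreal i" for i
  proof -
   let ?i = "i powr (1 / ?p)"
   have "ennreal (fact m * (C0 * kap ^ (2 * Suc j))) <= ennreal (fact m) * (walk_step lborel (%l. b l ^ n) (%l. ennreal (Q l)) ^^ m) (%_. 1) 0"
   using w[of j] C0 kap unfolding mj kap_def by (subst ennreal_mult) (auto intro!: mult_left_mono simp del: funpow.simps)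
   also have "... <= ennreal (Z powr x / ep * ?i)" unfolding Z_def x_def by (rule walk_le_Phi_norm[OF m b i ep])
   finally have "fact m * (C0 * kap ^ (2 * Suc j)) <= Z powr x / ep * ?i" using Z ep i by (subst (asm) ennreal_le_iff) auto
   hence "ep * (fact m * (C0 * kap ^ (2 * Suc j))) <= ep * (Z powr x / ep * ?i)" using ep by (intro mult_left_mono) auto
   moreover have "ep * (Z powr x / ep * ?i) = Z powr x * ?i" using ep by simp
   moreover have "fact m * (ep * C0 / kap\<^sup>2) * kap ^ m = ep * (fact m * (C0 * kap ^ (2 * Suc j)))"
   proof -
   have "kap ^ m = kap\<^sup>2 * kap ^ (2 * Suc j)" by (simp add: mj power2_eq_square)
   thus ?thesis using kap by (simp del: power_Suc mult_Suc_right)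
   qed
   ultimately have "fact m * (ep * C0 / kap\<^sup>2) * kap ^ m <= Z powr x * ?i" by (simp only:)
   hence "(fact m * (ep * C0 / kap\<^sup>2) * kap ^ m) ^ Suc n <= (Z powr x * ?i) ^ Suc n"
   using ep C0 kap by (intro power_mono) auto
   hence 1: "(fact m) ^ Suc n * C * (kap ^ m) ^ Suc n <= (Z powr x) ^ Suc n * ?i ^ Suc n"
   by (simp only: power_mult_distrib C_def)
   have i2: "?i ^ Suc n = i" using i by (simp add: powr_powr flip: powr_realpow del: power_Suc of_nat_Suc)
   have zx: "(Z powr x) ^ Suc n = (Z powr av) ^ m"
   proof -
   have "(Z powr x) ^ Suc n = Z powr (x * ?p)" using Z by (simp add: powr_powr flip: powr_realpow del: power_Suc of_nat_Suc)
   also have "x * ?p = av * real m" by (simp add: x_def del: of_nat_Suc)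
   also have "Z powr (av * real m) = (Z powr av) ^ m" using Z by (simp add: powr_powr flip: powr_realpow)
   finally show ?thesis .
   qed
   have kp: "(kap ^ m) ^ Suc n = ((1 - ep) ^ (n * Suc n) * c) ^ m"
   proof -
   have "(kap ^ m) ^ Suc n = (kap ^ Suc n) ^ m" by (simp only: power_mult[symmetric] mult.commute)
   also have "kap ^ Suc n = (1 - ep) ^ (n * Suc n) * (c powr (1 / ?p)) ^ Suc n" by (simp only: kap_def power_mult_distrib power_mult)
   also have "(c powr (1 / ?p)) ^ Suc n = c" using c by (simp add: powr_powr flip: powr_realpow del: power_Suc of_nat_Suc)
   finally show ?thesis .
   qed
   \<comment> \<open>The choice of x makes (p / av) (1 - ep) Z equal to m / e, so the exponents
     \<open>av\<close> and \<open>gam\<close> of m / e add up to p, and p copies of the Stirling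
     lower bound remain.\<close>
   have G: "G * (1 - ep) powr av * Z powr av = (real m / exp 1) ^ Suc n"
   proof -
   have "(?p / av) * ((1 - ep) * Z) = real m / exp 1" using av_pos ep by (simp add: Z_def x_def del: of_nat_Suc)
   hence 1: "(?p / av) powr av * ((1 - ep) powr av * Z powr av) = (real m / exp 1) powr av"
   using av_pos ep Z by (simp flip: powr_mult del: of_nat_Suc)
   have "(real m / exp 1) powr gam = real m powr gam / (exp 1 powr gam)" by (simp add: powr_divide)
   also have "exp 1 powr gam = exp gam" by (simp add: powr_def)
   finally have 2: "real m powr gam * exp (- gam) = (real m / exp 1) powr gam" by (simp add: exp_minus divide_inverse)
   have "G * (1 - ep) powr av * Z powr av = ((?p / av) powr av * ((1 - ep) powr av * Z powr av)) * (real m powr gam * exp (- gam))"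
   unfolding G_def by (simp only: mult_ac)
   also have "... = (real m / exp 1) powr av * (real m / exp 1) powr gam" unfolding 1 2 ..
   also have "... = (real m / exp 1) powr ?p" by (simp add: av_def flip: powr_add)
   also have "... = (real m / exp 1) ^ Suc n" using m by (intro powr_realpow) simp
   finally show ?thesis .
   qed
   have f: "((real m / exp 1) ^ Suc n) ^ m <= (fact m) ^ Suc n"
   proof -
   have "((real m / exp 1) ^ Suc n) ^ m = ((real m / exp 1) ^ m) ^ Suc n" by (simp only: power_mult[symmetric] mult.commute)
   also have "... <= (fact m) ^ Suc n"
   proof (rule power_mono)
   have "(real m / exp 1) ^ m = real m ^ m / exp (real m)" by (simp add: power_divide exp_of_nat_mult[symmetric])
   thus "(real m / exp 1) ^ m <= fact m" using fact_exp_bounds(1)[of m] by (simp add: divide_le_eq)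
   qed simp
   finally show ?thesis .
   qed
   have "L * (Z powr av) ^ m = C * ((G * (1 - ep) powr av * Z powr av) * ((1 - ep) ^ (n * Suc n) * c)) ^ m"
   proof -
   have "(1 - ep) powr (real (n * Suc n) + av) = (1 - ep) ^ (n * Suc n) * (1 - ep) powr av"
   using ep powr_realpow[of "1 - ep" "n * Suc n"] by (simp only: powr_add)
   thus ?thesis unfolding L_def by (simp only: power_mult_distrib mult_ac)
   qed
   also have "... = C * ((real m / exp 1) ^ Suc n) ^ m * ((1 - ep) ^ (n * Suc n) * c) ^ m" unfolding G by (simp only: power_mult_distrib mult.assoc)
   also have "... <= C * (fact m) ^ Suc n * ((1 - ep) ^ (n * Suc n) * c) ^ m"
   using f C ep c by (intro mult_right_mono mult_left_mono) auto
   also have "... <= i * (Z powr av) ^ m" using 1 unfolding i2 zx kp by (simp only: mult_ac)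
   finally show ?thesis using Z by (simp add: mult_le_cancel_right)
  qed
  \<comment> \<open>\<open>main\<close> speaks of positive real upper bounds of the norm. If the
    norm were below L, the midpoint would be such a bound and still smaller than L.\<close>
  have "ennreal L <= Phi_norm m"
  proof (rule ccontr)
   assume "~ ennreal L <= Phi_norm m"
   hence lt: "Phi_norm m < ennreal L" by simp
   then obtain j0 where j0: "Phi_norm m = ennreal j0" "0 <= j0" by (cases "Phi_norm m") auto
   have "j0 < L" using lt j0 by (simp add: ennreal_less_iff)
   hence "L <= (j0 + L) / 2" by (intro main) (use j0 in \<open>auto intro!: ennreal_leI\<close>)
   thus False using \<open>j0 < L\<close> by simp
  qed
  thus "ennreal (C * (((?p / av) powr av * real m powr gam * exp (- gam)) * ((1 - ep) powr (real (n * Suc n) + av) * c)) ^ m) <= Phi_norm m"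
   unfolding L_def G_def .
 qed
qed

end

section \<open>Gaussian mollification\<close>

definition gauss :: "(real^'d::finite) measure" where
 "gauss = distr (PiM UNIV (%_. std_normal_distribution)) borel (%f. \<chi> i. f i)"

definition gauss_density :: "real^'d::finite => real" where
 "gauss_density y = (1 / sqrt (2 * pi)) ^ CARD('d) * exp (- (norm y)\<^sup>2 / 2)"

lemma sets_gauss[simp, measurable_cong]: "sets gauss = sets borel" by (simp add: gauss_def)
lemma space_gauss[simp]: "space gauss = UNIV" by (simp add: gauss_def)

lemma prob_space_gauss: "prob_space (gauss :: (real^'d::finite) measure)" unfolding gauss_def
proof (rule prob_space.prob_space_distr)
 show "prob_space (PiM (UNIV :: 'd set) (%_. std_normal_distribution))"
  by (rule prob_space_PiM) (rule prob_space_normal_density, simp)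
qed (rule vec_lambda_measurable, simp)

lemma norm_sq_vec: "(norm (x :: real^'d::finite))\<^sup>2 = (\<Sum>i\<in>UNIV. (x $ i)\<^sup>2)"
 unfolding power2_norm_eq_inner inner_vec_def by (simp add: power2_eq_square)

lemma gauss_density_prod: "gauss_density (y :: real^'d::finite) = (\<Prod>i\<in>UNIV. std_normal_density (y $ i))"
proof -
 have "(\<Prod>i\<in>UNIV. std_normal_density (y $ i)) = (\<Prod>i\<in>(UNIV :: 'd set). 1 / sqrt (2 * pi)) * (\<Prod>i\<in>UNIV. exp (- (y $ i)\<^sup>2 / 2))"
  unfolding std_normal_density_def by (rule prod.distrib)
 also have "(\<Prod>i\<in>UNIV. exp (- (y $ i)\<^sup>2 / 2)) = exp (\<Sum>i\<in>UNIV. - (y $ i)\<^sup>2 / 2)" by (simp add: exp_sum)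
 also have "(\<Sum>i\<in>UNIV. - (y $ i)\<^sup>2 / 2) = - (norm y)\<^sup>2 / 2" by (simp add: norm_sq_vec sum_divide_distrib sum_negf)
 finally show ?thesis by (simp add: gauss_density_def)
qed

lemma gauss_density_nonneg[simp]: "0 <= gauss_density y" by (simp add: gauss_density_def)
lemma gauss_density_measurable[measurable]: "gauss_density \<in> bm borel" unfolding gauss_density_def[abs_def] by measurable

lemma gauss_eq_density: "gauss = density lborel (%y :: real^'d::finite. ennreal (gauss_density y))"
proof -
 let ?L = "PiM (UNIV :: 'd set) (%_. lborel :: real measure)"
 let ?v = "%f :: 'd => real. \<chi> i. f i"
 have "sigma_finite_measure std_normal_distribution" by (rule prob_space_imp_sigma_finite, rule prob_space_normal_density) simp
 hence "PiM (UNIV :: 'd set) (%_. std_normal_distribution) = density ?L (%f. \<Prod>i\<in>UNIV. ennreal (std_normal_density (f i)))"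
  by (intro PiM_density) (auto simp: sigma_finite_lborel)
 also have "(%f. \<Prod>i\<in>UNIV. ennreal (std_normal_density (f i))) = (%f. ennreal (gauss_density (?v f)))"
  by (simp add: gauss_density_prod prod_ennreal fun_eq_iff)
 finally have "gauss = distr (density ?L (%f. ennreal (gauss_density (?v f)))) borel ?v" by (simp add: gauss_def)
 also have "... = density (distr ?L borel ?v) (%y. ennreal (gauss_density y))"
  by (rule density_distr[symmetric]) (simp, rule vec_lambda_measurable, simp)
 finally show ?thesis by (simp add: lborel_cart_eq)
qed

lemma gauss_char: "(\<integral>y. cis (x \<bullet> y) \<partial>gauss) = complex_of_real (exp (- (norm (x :: real^'d::finite))\<^sup>2 / 2))"
proof -
 let ?N = "PiM (UNIV :: 'd set) (%_. std_normal_distribution)"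
 have ps: "prob_space std_normal_distribution" by (rule prob_space_normal_density) simp
 interpret N1: prob_space std_normal_distribution by (rule ps)
 interpret PN: product_prob_space "%_::'d. std_normal_distribution" by unfold_locales
 have one: "(\<integral>t. cis (c * t) \<partial>std_normal_distribution) = complex_of_real (exp (- c\<^sup>2 / 2))" for c
  using fun_cong[OF char_std_normal_distribution, of c] by (simp add: char_def cis_conv_exp)
 have "(\<integral>y. cis (x \<bullet> y) \<partial>gauss) = (\<integral>f. cis (x \<bullet> (\<chi> i. f i)) \<partial>?N)"
  unfolding gauss_def by (rule integral_distr) (rule vec_lambda_measurable, simp, measurable)
 also have "... = (\<integral>f. (\<Prod>i\<in>UNIV. cis (x $ i * f i)) \<partial>?N)" by (simp add: prod_cis inner_vec_def)
 also have "... = (\<Prod>i\<in>UNIV. \<integral>t. cis (x $ i * t) \<partial>std_normal_distribution)"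
  by (rule PN.product_integral_prod) (auto intro!: N1.integrable_const_bound[where B = 1])
 also have "... = (\<Prod>i\<in>UNIV. complex_of_real (exp (- (x $ i)\<^sup>2 / 2)))" by (simp only: one)
 also have "... = complex_of_real (exp (\<Sum>i\<in>UNIV. - (x $ i)\<^sup>2 / 2))" by (simp add: exp_sum)
 also have "(\<Sum>i\<in>UNIV. - (x $ i)\<^sup>2 / 2) = - (norm x)\<^sup>2 / 2" by (simp add: norm_sq_vec sum_divide_distrib sum_negf)
 finally show ?thesis .
qed

text \<open>The density of a centred normal law with variance sg^(-2) in each coordinate. It
  concentrates at 0 as sg grows, and its Fourier transform is positive, so damping by it keeps all
  moment integrands nonnegative.\<close>

definition gauss_kernel :: "real => real^'d::finite => real" where
 "gauss_kernel sg x = (sg / sqrt (2 * pi)) ^ CARD('d) * exp (- (norm (sg *\<^sub>R x))\<^sup>2 / 2)"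

lemma gauss_kernel_nonneg: "0 < sg ==> 0 <= gauss_kernel sg x" by (simp add: gauss_kernel_def)
lemma gauss_kernel_measurable[measurable]: "gauss_kernel sg \<in> bm borel" unfolding gauss_kernel_def[abs_def] by measurable

lemma nn_integral_gauss_kernel:
 assumes sg: "0 < sg"
 shows "(NN x. ennreal (gauss_kernel sg (x :: real^'d::finite))) = 1"
proof -
 have "1 = emeasure gauss (space (gauss :: (real^'d) measure))" using prob_space.emeasure_space_1[OF prob_space_gauss] by simp
 also have "... = (NN x. ennreal (gauss_density (x :: real^'d)))" unfolding gauss_eq_density by (subst emeasure_density) auto
 also have "... = ennreal (sg ^ CARD('d)) * (NN x. ennreal (gauss_density (sg *\<^sub>R (x :: real^'d))))"
  using nn_integral_lborel_scale[OF sg, of "%x :: real^'d. ennreal (gauss_density x)"] by simp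
 also have "... = (NN x. ennreal (sg ^ CARD('d)) * ennreal (gauss_density (sg *\<^sub>R (x :: real^'d))))"
  by (rule nn_integral_cmult[symmetric]) measurable
 also have "... = (NN x. ennreal (gauss_kernel sg (x :: real^'d)))"
  using sg by (intro nn_integral_cong) (simp add: gauss_kernel_def gauss_density_def power_divide flip: ennreal_mult)
 finally show ?thesis by simp
qed

text \<open>Jensen over the orders reduces the norm to a walk whose positions carry the weight Q^p;
  each step then has total mass \<open>IQ\<close>.\<close>

lemma (in stable_setup) Phi_norm_finite:
 assumes m: "0 < m"
 shows "Phi_norm m < \<top>"
proof -
 let ?q = "%x. ennreal (Q x ^ Suc n)"
 interpret product_sigma_finite "%_::nat. lborel :: (real^'d) measure" by (rule product_sigma_finite_lborel)
 have qm: "?q \<in> bm borel" by measurable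
 have sm: "(%l. \<Sum>i\<le>k. l i) \<in> bm (P m)" if "k < m" for k
  using that by (intro borel_measurable_sum component_measurable) auto
 have Wm: "(%l. \<Prod>k<m. ?q (\<Sum>i\<le>k. l i)) \<in> bm (P m)"
  by (intro borel_measurable_prod_ennreal measurable_compose[OF sm qm]) auto
 define W where "W = (\<integral>\<^sup>+l. (\<Prod>k<m. ?q (\<Sum>i\<le>k. l i)) \<partial>P m)"
 have "W = (walk_step lborel (%_. 1) ?q ^^ m) (%_. 1) 0"
  unfolding W_def by (subst nn_integral_walk[symmetric]) (auto simp: sigma_finite_lborel simp del: power_Suc)
 also have "... <= ennreal IQ ^ m"
 proof -
  have "(walk_step lborel (%_. 1) ?q ^^ i) (%_. 1) x <= ennreal IQ ^ i" for i x
  proof (induction i arbitrary: x)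
   case (Suc i)
   have "(walk_step lborel (%_. 1) ?q ^^ Suc i) (%_. 1) x <= walk_step lborel (%_. 1) ?q (%_. ennreal IQ ^ i) x"
   by (simp del: power_Suc, rule walk_step_mono) (rule Suc)
   also have "... = (NN l. ?q (x + l) * ennreal IQ ^ i)" by (simp add: walk_step_def del: power_Suc)
   also have "... = (NN l. ?q (x + l)) * ennreal IQ ^ i" by (rule nn_integral_multc) measurable
   also have "(NN l. ?q (x + l)) = ennreal IQ" using nn_integral_lborel_shift[OF qm, of x] nn_integral_Q by simp
   finally show ?case by simp
  qed simp
  thus ?thesis .
 qed
 finally have W: "W < \<top>" by (rule le_less_trans) (simp add: power_less_top_ennreal)
 have perm: "(\<integral>\<^sup>+l. (\<Prod>k<m. ?q (\<Sum>i\<le>k. l (sg i))) \<partial>P m) = W" and permm: "(%l. \<Prod>k<m. ?q (\<Sum>i\<le>k. l (sg i))) \<in> bm (P m)"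
  if sg: "sg permutes {..<m}" for sg
 proof -
  have im: "sg i < m" if "i < m" for i using permutes_in_image[OF sg, of i] that by simp
  have eq: "(\<Prod>k<m. ?q (\<Sum>i\<le>k. l (sg i))) = (%l. \<Prod>k<m. ?q (\<Sum>i\<le>k. l i)) (\<lambda>i\<in>{..<m}. l (sg i))" for l
   by (intro prod.cong refl arg_cong[where f = ?q] sum.cong) auto
  have "(\<integral>\<^sup>+l. (\<Prod>k<m. ?q (\<Sum>i\<le>k. l (sg i))) \<partial>P m) = (\<integral>\<^sup>+l. (%l. \<Prod>k<m. ?q (\<Sum>i\<le>k. l i)) (\<lambda>i\<in>{..<m}. l (sg i)) \<partial>P m)"
   by (intro nn_integral_cong eq)
  also have "... = W" unfolding W_def by (rule nn_integral_PiM_permute[OF sigma_finite_lborel finite_lessThan sg Wm])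
  finally show "(\<integral>\<^sup>+l. (\<Prod>k<m. ?q (\<Sum>i\<le>k. l (sg i))) \<partial>P m) = W" .
  have "(%l. \<Sum>i\<le>k. l (sg i)) \<in> bm (P m)" if "k < m" for k
   using that im by (intro borel_measurable_sum component_measurable) auto
  thus "(%l. \<Prod>k<m. ?q (\<Sum>i\<le>k. l (sg i))) \<in> bm (P m)"
   by (intro borel_measurable_prod_ennreal measurable_compose[OF _ qm]) auto
 qed
 have pw: "Phi_nn \<psi> m l ^ Suc n <= ennreal ((exp 1 * fact m) ^ Suc n) * (\<Sum>sg | sg permutes {..<m}. \<Prod>k<m. ?q (\<Sum>i\<le>k. l (sg i)))" for l
 proof -
  have "Phi_nn \<psi> m l <= ennreal (exp 1 * fact m * symQ m l)"
   using Phi_nn_le[OF m, of 1 \<psi> l] by (simp add: symQ_def Q_def)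
  hence "Phi_nn \<psi> m l ^ Suc n <= ennreal (exp 1 * fact m * symQ m l) ^ Suc n" by (intro power_mono) auto
  also have "... = ennreal ((exp 1 * fact m) ^ Suc n * symQ m l ^ Suc n)"
   using symQ_nonneg[of m l] by (subst ennreal_power) (simp, simp only: power_mult_distrib)
  also have "... <= ennreal ((exp 1 * fact m) ^ Suc n * (\<Sum>sg | sg permutes {..<m}. (\<Prod>k<m. Q (\<Sum>i\<le>k. l (sg i)) ^ Suc n)))"
  proof (intro ennreal_leI mult_left_mono)
   let ?S = "\<Sum>sg | sg permutes {..<m}. (\<Prod>k<m. Q (\<Sum>i\<le>k. l (sg i)) ^ Suc n)"
   have "symQ m l ^ Suc n <= ?S / fact m" by (rule symQ_power_le)
   also have "... <= ?S / 1" by (intro divide_left_mono sum_nonneg prod_nonneg) auto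
   finally show "symQ m l ^ Suc n <= ?S" by simp
  qed simp
  also have "... = ennreal ((exp 1 * fact m) ^ Suc n) * (\<Sum>sg | sg permutes {..<m}. \<Prod>k<m. ?q (\<Sum>i\<le>k. l (sg i)))"
   by (subst ennreal_mult) (auto intro!: sum_nonneg prod_nonneg simp: prod_ennreal sum_ennreal prod_nonneg simp del: power_Suc)
  finally show ?thesis .
 qed
 have "Phi_norm m <= (\<integral>\<^sup>+l. ennreal ((exp 1 * fact m) ^ Suc n) * (\<Sum>sg | sg permutes {..<m}. \<Prod>k<m. ?q (\<Sum>i\<le>k. l (sg i))) \<partial>P m)"
  unfolding Phi_norm_def by (rule nn_integral_mono) (rule pw)
 also have "... = ennreal ((exp 1 * fact m) ^ Suc n) * (\<integral>\<^sup>+l. (\<Sum>sg | sg permutes {..<m}. \<Prod>k<m. ?q (\<Sum>i\<le>k. l (sg i))) \<partial>P m)"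
  by (rule nn_integral_cmult) (rule borel_measurable_sum, rule permm, simp)
 also have "(\<integral>\<^sup>+l. (\<Sum>sg | sg permutes {..<m}. \<Prod>k<m. ?q (\<Sum>i\<le>k. l (sg i))) \<partial>P m) = (\<Sum>sg | sg permutes {..<m}. W)"
 proof -
  have "(\<integral>\<^sup>+l. (\<Sum>sg | sg permutes {..<m}. \<Prod>k<m. ?q (\<Sum>i\<le>k. l (sg i))) \<partial>P m) = (\<Sum>sg | sg permutes {..<m}. \<integral>\<^sup>+l. (\<Prod>k<m. ?q (\<Sum>i\<le>k. l (sg i))) \<partial>P m)"
   by (rule nn_integral_sum) (rule permm, simp)
  also have "... = (\<Sum>sg | sg permutes {..<m}. W)" by (rule sum.cong[OF refl]) (rule perm, simp)
  finally show ?thesis .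
 qed
 also have "ennreal ((exp 1 * fact m) ^ Suc n) * ... < \<top>"
  using W by (simp add: ennreal_mult_less_top sum_constant of_nat_less_top del: power_Suc)
 finally show ?thesis .
qed

context additive_stable
begin

text \<open>The occupation measure integrated against \<open>gauss_kernel sg\<close>, written on the
  Fourier side so that its moments become integrals of the moments of \<open>occ\<close>.\<close>

definition mol :: "real => 'a => real" where
 "mol sg om = (sg / sqrt (2 * pi)) ^ CARD('d) * Re (\<integral>y. occ (sg *\<^sub>R y) om \<partial>gauss)"

lemma occ_pair_measurable: "(%p. occ (sg *\<^sub>R snd p) (fst p)) \<in> bm (M \<Otimes>\<^sub>M gauss)"
proof -
 have "(%p. (sg *\<^sub>R snd p, fst p)) \<in> measurable (M \<Otimes>\<^sub>M gauss) (borel \<Otimes>\<^sub>M M)" by measurable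
 from measurable_compose[OF this occ_measurable(2)] show ?thesis by simp
qed

lemma mol_measurable[measurable]: "mol sg \<in> bm M"
proof -
 interpret G: prob_space gauss by (rule prob_space_gauss)
 have "(%om. \<integral>y. occ (sg *\<^sub>R y) om \<partial>gauss) \<in> bm M"
  by (rule G.borel_measurable_lebesgue_integral) (use occ_pair_measurable in \<open>simp add: case_prod_beta\<close>)
 thus ?thesis unfolding mol_def[abs_def] by measurable
qed

lemma mol_good:
 assumes g: "good om" and sg: "0 < sg"
 shows "(NN x. ennreal (\<eta> x 1 om) * ennreal (gauss_kernel sg x)) = ennreal (mol sg om)" (is ?A)
  and "0 <= mol sg om" (is ?B)
  and "complex_of_real (mol sg om) = of_real ((sg / sqrt (2 * pi)) ^ CARD('d)) * (\<integral>y. occ (sg *\<^sub>R y) om \<partial>gauss)" (is ?C)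
proof -
 let ?U = "PiM (UNIV :: 'p set) (%_. unif01)"
 interpret U: prob_space ?U by (rule prob_space_PiM) (rule prob_space_unif01)
 interpret G: prob_space "gauss :: (real^'d) measure" by (rule prob_space_gauss)
 interpret PP: pair_prob_space "gauss :: (real^'d) measure" ?U ..
 let ?E = "%s. exp (- (norm (sg *\<^sub>R path_sum om s))\<^sup>2 / 2)"
 have pm[measurable]: "path_sum om \<in> bm ?U" by (rule path_sum_measurable[OF g])
 have Ei: "integrable ?U ?E" by (intro U.integrable_const_bound[where B = 1]) auto
 have "(%p. cis ((sg *\<^sub>R fst p) \<bullet> path_sum om (snd p))) \<in> bm (gauss \<Otimes>\<^sub>M ?U)" by measurable
 hence int: "integrable (gauss \<Otimes>\<^sub>M ?U) (%(y, s). cis ((sg *\<^sub>R y) \<bullet> path_sum om s))"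
  by (intro PP.integrable_const_bound[where B = 1]) (auto simp: case_prod_beta)
 have "(\<integral>y. occ (sg *\<^sub>R y) om \<partial>gauss) = (\<integral>y. (\<integral>s. cis ((sg *\<^sub>R y) \<bullet> path_sum om s) \<partial>?U) \<partial>gauss)"
  by (simp only: occ_eq_integral[OF g])
 also have "... = (\<integral>s. (\<integral>y. cis ((sg *\<^sub>R y) \<bullet> path_sum om s) \<partial>gauss) \<partial>?U)"
  by (rule PP.Fubini_integral[OF int, symmetric])
 also have "... = (\<integral>s. complex_of_real (?E s) \<partial>?U)"
 proof (rule Bochner_Integration.integral_cong[OF refl])
  fix s
  have "(sg *\<^sub>R y) \<bullet> path_sum om s = (sg *\<^sub>R path_sum om s) \<bullet> y" for y by (simp add: inner_commute)
  thus "(\<integral>y. cis ((sg *\<^sub>R y) \<bullet> path_sum om s) \<partial>gauss) = complex_of_real (?E s)" by (simp only: gauss_char)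
 qed
 also have "... = complex_of_real (\<integral>s. ?E s \<partial>?U)" by (rule integral_of_real) (use Ei in auto)
 finally have I: "(\<integral>y. occ (sg *\<^sub>R y) om \<partial>gauss) = complex_of_real (\<integral>s. ?E s \<partial>?U)" .
 have mol: "mol sg om = (sg / sqrt (2 * pi)) ^ CARD('d) * (\<integral>s. ?E s \<partial>?U)" unfolding mol_def I by (simp only: Re_complex_of_real)
 thus ?C unfolding I by (simp only: of_real_mult)
 have mol': "mol sg om = (\<integral>s. gauss_kernel sg (path_sum om s) \<partial>?U)" unfolding mol gauss_kernel_def by (rule integral_mult_right_zero[symmetric])
 show ?B unfolding mol' by (rule integral_nonneg_AE) (simp add: gauss_kernel_nonneg[OF sg])
 have "(NN x. ennreal (\<eta> x 1 om) * ennreal (gauss_kernel sg x)) = (\<integral>\<^sup>+s. ennreal (gauss_kernel sg (path_sum om s)) \<partial>?U)"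
  by (rule nn_integral_path_sum[OF g, symmetric]) measurable
 also have "... = ennreal (mol sg om)" unfolding mol'
 proof (rule nn_integral_eq_integral)
  show "integrable ?U (%s. gauss_kernel sg (path_sum om s))" unfolding gauss_kernel_def by (intro integrable_mult_right Ei)
 qed (simp add: gauss_kernel_nonneg[OF sg])
 finally show ?A .
qed

text \<open>Near 0 continuity bounds \<eta>. Away from 0 it may be large, but there the kernel is
  uniformly small and \<eta> has total mass 1.\<close>

lemma mol_le_local_time:
 assumes g: "good om" and \<iota>: "0 < \<iota>"
 shows "\<forall>\<^sub>F j in sequentially. mol (real (Suc j)) om <= \<eta> 0 1 om + \<iota>"
proof -
 have [measurable]: "(%x. \<eta> x 1 om) \<in> bm borel" using g by (intro borel_measurable_continuous_onI) (simp add: good_def)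
 have eta0: "0 <= \<eta> x 1 om" for x using g by (simp add: good_def)
 have mass: "(NN x. ennreal (\<eta> x 1 om)) = 1"
 proof -
  interpret U: prob_space "PiM (UNIV :: 'p set) (%_. unif01)" by (rule prob_space_PiM) (rule prob_space_unif01)
  show ?thesis using nn_integral_path_sum[OF g, of "%_. 1"] U.emeasure_space_1 by simp
 qed
 have "isCont (%x. \<eta> x 1 om) 0" using g by (simp add: good_def continuous_on_eq_continuous_at)
 hence "\<forall>\<^sub>F x in at 0. \<eta> x 1 om < \<eta> 0 1 om + \<iota> / 2"
  unfolding isCont_def by (rule order_tendstoD(2)) (use \<iota> in simp)
 then obtain e where e: "0 < e" "!!x. x ~= 0 ==> dist x 0 < e ==> \<eta> x 1 om < \<eta> 0 1 om + \<iota> / 2"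
  unfolding eventually_at by auto
 \<comment> \<open>For sg at least 1 the Gaussian exponent sg^2 e^2 / 2 is at least a sg, and a
   linear exponent already beats the prefactor sg^d.\<close>
 define a where "a = e\<^sup>2 / 2"
 have a: "0 < a" using e by (simp add: a_def)
 let ?t = "%j. (1 / (a * sqrt (2 * pi))) ^ CARD('d) * ((a * real (Suc j)) ^ CARD('d) / exp (a * real (Suc j)))"
 have "?t \<longlonglongrightarrow> (1 / (a * sqrt (2 * pi))) ^ CARD('d) * 0"
 proof (intro tendsto_mult_left filterlim_compose[OF tendsto_power_div_exp_0])
  show "filterlim (%j. a * real (Suc j)) at_top sequentially" using a by real_asymp
 qed
 hence "?t \<longlonglongrightarrow> 0" by simp
 hence "\<forall>\<^sub>F j in sequentially. ?t j < \<iota> / 2" by (rule order_tendstoD(2)) (use \<iota> in simp)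
 thus ?thesis
 proof eventually_elim
  case (elim j)
  define sg where "sg = real (Suc j)"
  have sg: "1 <= sg" by (simp add: sg_def)
  have far: "gauss_kernel sg x <= \<iota> / 2" if x: "e <= norm x" for x :: "real^'d"
  proof -
   have "sg * a <= sg\<^sup>2 * (e\<^sup>2 / 2)" unfolding a_def using sg by (intro mult_right_mono) (auto simp: power2_eq_square)
   also have "... <= sg\<^sup>2 * ((norm x)\<^sup>2 / 2)" using x e by (intro mult_left_mono divide_right_mono power_mono) auto
   also have "... = (norm (sg *\<^sub>R x))\<^sup>2 / 2" by (simp add: power_mult_distrib)
   finally have "gauss_kernel sg x <= (sg / sqrt (2 * pi)) ^ CARD('d) * exp (- (sg * a))"
   unfolding gauss_kernel_def using sg by (intro mult_left_mono) auto
   also have "... = ?t j"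
   proof -
   have pw: "(1 / (a * sqrt (2 * pi))) ^ CARD('d) * (a * sg) ^ CARD('d) = (sg / sqrt (2 * pi)) ^ CARD('d)"
   unfolding power_mult_distrib[symmetric] using a by simp
   show ?thesis unfolding sg_def[symmetric] times_divide_eq_right pw by (simp add: exp_minus divide_inverse mult.commute)
   qed
   finally show ?thesis using elim by linarith
  qed
  have near: "\<eta> x 1 om <= \<eta> 0 1 om + \<iota> / 2" if "norm x < e" for x
   using e(2)[of x] that \<iota> by (cases "x = 0") (auto intro: less_imp_le)
  have pw: "ennreal (\<eta> x 1 om) * ennreal (gauss_kernel sg x) <= ennreal (\<eta> 0 1 om + \<iota> / 2) * ennreal (gauss_kernel sg x) + ennreal (\<iota> / 2) * ennreal (\<eta> x 1 om)" for x
  proof (cases "norm x < e")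
   case True
   have "ennreal (\<eta> x 1 om) * ennreal (gauss_kernel sg x) <= ennreal (\<eta> 0 1 om + \<iota> / 2) * ennreal (gauss_kernel sg x)"
   by (intro mult_right_mono ennreal_leI near True) auto
   thus ?thesis by (rule order_trans) simp
  next
   case False
   have "ennreal (\<eta> x 1 om) * ennreal (gauss_kernel sg x) <= ennreal (\<eta> x 1 om) * ennreal (\<iota> / 2)"
   using False by (intro mult_left_mono ennreal_leI far) auto
   thus ?thesis by (rule order_trans) (simp add: mult.commute)
  qed
  have "ennreal (mol sg om) <= (NN x. ennreal (\<eta> 0 1 om + \<iota> / 2) * ennreal (gauss_kernel sg x) + ennreal (\<iota> / 2) * ennreal (\<eta> x 1 om))"
   using sg by (subst mol_good(1)[OF g, symmetric]) (auto intro!: nn_integral_mono pw)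
  also have "... = ennreal (\<eta> 0 1 om + \<iota> / 2) * (NN x. ennreal (gauss_kernel sg (x :: real^'d))) + ennreal (\<iota> / 2) * (NN x. ennreal (\<eta> x 1 om))"
   by (subst nn_integral_add) (auto simp: nn_integral_cmult)
  also have "... = ennreal (\<eta> 0 1 om + \<iota>)"
   using sg \<iota> eta0[of 0] by (simp add: mass nn_integral_gauss_kernel flip: ennreal_plus)
  finally show "mol (real (Suc j)) om <= \<eta> 0 1 om + \<iota>"
   using \<iota> eta0[of 0] by (subst (asm) ennreal_le_iff) (auto simp: sg_def)
 qed
qed

end

context additive_stable
begin

text \<open>Each point carries (2 \<pi>)^(-d/2) from the kernel and the same from the Gaussian
  density of its frequency; the substitution l = sg y absorbs the power of sg. This is the
  finite-resolution form of Fourier inversion.\<close>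

lemma mol_moment:
 assumes m: "0 < m" and sg: "0 < sg"
 shows "(\<integral>\<^sup>+om. ennreal (mol sg om ^ m) \<partial>M)
  = (\<integral>\<^sup>+l. ennreal (\<Prod>k<m. (1 / (2 * pi)) ^ CARD('d) * exp (- (norm (l k /\<^sub>R sg))\<^sup>2 / 2)) * Phi_nn \<psi> m l ^ Suc n \<partial>P m)"
proof -
 let ?G = "PiM {..<m} (%_. gauss :: (real^'d) measure)"
 define A where "A = (sg / sqrt (2 * pi)) ^ CARD('d)"
 have A: "0 < A" using sg by (simp add: A_def)
 interpret G1: prob_space "gauss :: (real^'d) measure" by (rule prob_space_gauss)
 interpret PG: product_prob_space "%_::nat. gauss :: (real^'d) measure" by unfold_locales
 interpret G: prob_space ?G by (rule prob_space_PiM) (rule prob_space_gauss)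
 interpret MG: pair_prob_space M ?G ..
 have setsG: "sets ?G = sets (P m)" by (intro sets_PiM_cong refl) simp
 have compG: "(%y. y k) \<in> bm ?G" if "k < m" for k
  using component_measurable[OF that] measurable_cong_sets[OF setsG refl] by blast
 define f where "f om y = (\<Prod>k<m. occ (sg *\<^sub>R y k) om)" for om and y :: "nat => real^'d"
 have fm: "(%(om, y). f om y) \<in> bm (M \<Otimes>\<^sub>M ?G)" unfolding f_def case_prod_beta
 proof (rule borel_measurable_prod)
  fix k assume "k \<in> {..<m}"
  hence [measurable]: "(%p. snd p k) \<in> bm (M \<Otimes>\<^sub>M ?G)"
   by (intro measurable_compose[OF measurable_snd compG]) simp
  have "(%p. (sg *\<^sub>R snd p k, fst p)) \<in> measurable (M \<Otimes>\<^sub>M ?G) (borel \<Otimes>\<^sub>M M)" by measurable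
  from measurable_compose[OF this occ_measurable(2)]
  show "(%p. occ (sg *\<^sub>R snd p k) (fst p)) \<in> bm (M \<Otimes>\<^sub>M ?G)" by simp
 qed
 have fb: "AE om in M. \<forall>y. norm (f om y) <= 1"
  using norm_occ_le by eventually_elim (auto simp: f_def intro!: levy_exp.prod_norm_le_1[OF levy_X])
 have fint: "integrable (M \<Otimes>\<^sub>M ?G) (%(om, y). f om y)"
 proof (rule MG.integrable_const_bound[where B = 1, OF _ fm])
  show "AE p in M \<Otimes>\<^sub>M ?G. norm (case p of (om, y) => f om y) <= 1"
  proof (rule MG.AE_pair_measure)
   show "{p \<in> space (M \<Otimes>\<^sub>M ?G). norm (case p of (om, y) => f om y) <= 1} \<in> sets (M \<Otimes>\<^sub>M ?G)"
   using borel_measurable_le[OF measurable_compose[OF fm borel_measurable_norm] borel_measurable_const[of 1]] by simp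
   show "AE om in M. AE y in ?G. norm (case (om, y) of (om, y) => f om y) <= 1" using fb by eventually_elim simp
  qed
 qed
 have Ef: "expectation (%om. f om y) = complex_of_real (Phi \<psi> m (%i. sg *\<^sub>R y i) ^ Suc n)" for y
  unfolding f_def by (rule expectation_prod_occ[OF m])
 have occm: "(%y. occ (sg *\<^sub>R y) om) \<in> bm gauss" if "om \<in> space M" for om
  using measurable_Pair2[OF occ_pair_measurable that, of sg] by simp
 have molf: "AE om in M. complex_of_real (mol sg om ^ m) = of_real (A ^ m) * (\<integral>y. f om y \<partial>?G)"
  using AE_good norm_occ_le AE_space
 proof eventually_elim
  case (elim om)
  have oi: "integrable gauss (%y. occ (sg *\<^sub>R y) om)"
   by (rule G1.integrable_const_bound[where B = 1]) (use elim occm in auto)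
  have "complex_of_real (mol sg om ^ m) = (of_real A * (\<integral>y. occ (sg *\<^sub>R y) om \<partial>gauss)) ^ m"
   unfolding of_real_power mol_good(3)[OF elim(1) sg] A_def ..
  also have "... = of_real (A ^ m) * (\<Prod>k<m. \<integral>y. occ (sg *\<^sub>R y) om \<partial>gauss)" by (simp add: power_mult_distrib)
  also have "(\<Prod>k<m. \<integral>y. occ (sg *\<^sub>R y) om \<partial>gauss) = (\<integral>y. f om y \<partial>?G)"
   unfolding f_def by (rule PG.product_integral_prod[symmetric]) (use oi in auto)
  finally show ?case .
 qed
 have mol_bound: "AE om in M. norm (mol sg om ^ m) <= A ^ m" using molf fb
 proof eventually_elim
  case (elim om)
  have "norm (\<integral>y. f om y \<partial>?G) <= 1"
  proof (cases "integrable ?G (f om)")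
   case True
   have "norm (\<integral>y. f om y \<partial>?G) <= (\<integral>y. norm (f om y) \<partial>?G)" by (rule integral_norm_bound)
   also have "... <= (\<integral>y. 1 \<partial>?G)" using True elim by (intro integral_mono) auto
   finally show ?thesis by (simp add: G.prob_space)
  qed (simp add: not_integrable_integral_eq)
  hence "norm (complex_of_real (mol sg om ^ m)) <= A ^ m * 1" unfolding elim(1) norm_mult using A by (intro mult_mono) (auto simp: norm_power)
  thus ?case by (simp only: norm_of_real) simp
 qed
 have mint: "integrable M (%om. mol sg om ^ m)" by (rule integrable_const_bound[OF mol_bound]) measurable
 have Phm: "Phi_nn \<psi> m \<in> bm (P m)" by (rule measurable_Phi_nn[OF m])
 define R where "R y = (\<lambda>i\<in>{..<m}. sg *\<^sub>R y i)" for y :: "nat => real^'d"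
 have Rm: "R \<in> measurable (P m) (P m)" unfolding R_def[abs_def]
  by (rule measurable_restrict) (use component_measurable in \<open>auto intro!: borel_measurable_scaleR\<close>)
 have PhR: "ennreal (Phi \<psi> m (%i. sg *\<^sub>R y i)) = Phi_nn \<psi> m (R y)" for y
 proof -
  have "Phi_nn \<psi> m (%i. sg *\<^sub>R y i) = Phi_nn \<psi> m (R y)" by (rule Phi_nn_cong) (simp add: R_def)
  thus ?thesis unfolding Phi_def using Phi_nn_finite[OF m, where l = "%i. sg *\<^sub>R y i" and \<psi> = \<psi>] by simp
 qed
 have "complex_of_real (expectation (%om. mol sg om ^ m)) = expectation (%om. complex_of_real (mol sg om ^ m))"
  by (rule integral_complex_of_real[symmetric])
 also have "... = expectation (%om. of_real (A ^ m) * (\<integral>y. f om y \<partial>?G))"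
  by (rule integral_cong_AE) (use molf fm in \<open>auto intro!: borel_measurable_times G.borel_measurable_lebesgue_integral\<close>)
 also have "... = of_real (A ^ m) * expectation (%om. (\<integral>y. f om y \<partial>?G))" by (rule integral_mult_right_zero)
 also have "expectation (%om. (\<integral>y. f om y \<partial>?G)) = (\<integral>y. expectation (%om. f om y) \<partial>?G)"
  by (rule MG.Fubini_integral[OF fint, symmetric])
 also have "... = complex_of_real (\<integral>y. Phi \<psi> m (%i. sg *\<^sub>R y i) ^ Suc n \<partial>?G)"
  unfolding Ef by (rule integral_complex_of_real)
 finally have E: "expectation (%om. mol sg om ^ m) = A ^ m * (\<integral>y. Phi \<psi> m (%i. sg *\<^sub>R y i) ^ Suc n \<partial>?G)"
  by (simp only: of_real_mult[symmetric] of_real_eq_iff)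
 have phiint: "integrable ?G (%y. Phi \<psi> m (%i. sg *\<^sub>R y i) ^ Suc n)"
 proof -
  have "integrable ?G (%y. expectation (%om. f om y))" by (rule MG.integrable_snd[OF fint])
  hence "integrable ?G (%y. Re (complex_of_real (Phi \<psi> m (%i. sg *\<^sub>R y i) ^ Suc n)))" unfolding Ef by (rule integrable_Re)
  thus ?thesis by (simp only: Re_complex_of_real)
 qed
 have PhRm: "(%y. Phi_nn \<psi> m (R y) ^ Suc n) \<in> bm (P m)" using measurable_compose[OF Rm Phm] by measurable
 have "(\<integral>\<^sup>+om. ennreal (mol sg om ^ m) \<partial>M) = ennreal (expectation (%om. mol sg om ^ m))"
  by (rule nn_integral_eq_integral[OF mint]) (use AE_good in eventually_elim, simp add: mol_good(2)[OF _ sg])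
 also have "... = ennreal (A ^ m) * ennreal (\<integral>y. Phi \<psi> m (%i. sg *\<^sub>R y i) ^ Suc n \<partial>?G)"
  unfolding E using A Phi_nonneg by (intro ennreal_mult integral_nonneg_AE AE_I2 zero_le_power) auto
 also have "ennreal (\<integral>y. Phi \<psi> m (%i. sg *\<^sub>R y i) ^ Suc n \<partial>?G) = (\<integral>\<^sup>+y. ennreal (Phi \<psi> m (%i. sg *\<^sub>R y i) ^ Suc n) \<partial>?G)"
  by (rule nn_integral_eq_integral[OF phiint, symmetric]) (auto intro!: zero_le_power Phi_nonneg simp del: power_Suc)
 also have "... = (\<integral>\<^sup>+y. Phi_nn \<psi> m (R y) ^ Suc n \<partial>?G)"
  by (simp only: ennreal_power[OF Phi_nonneg, symmetric] PhR)
 also have "?G = density (P m) (%y. \<Prod>k<m. ennreal (gauss_density (y k)))"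
 proof -
  have "sigma_finite_measure (gauss :: (real^'d) measure)" by (rule prob_space_imp_sigma_finite[OF prob_space_gauss])
  thus ?thesis unfolding gauss_eq_density by (intro PiM_density) (auto simp: sigma_finite_lborel)
 qed
 also have "(\<integral>\<^sup>+y. Phi_nn \<psi> m (R y) ^ Suc n \<partial>...) = (\<integral>\<^sup>+y. (\<Prod>k<m. ennreal (gauss_density (y k))) * Phi_nn \<psi> m (R y) ^ Suc n \<partial>P m)"
  by (rule nn_integral_density[OF _ PhRm]) (intro borel_measurable_prod_ennreal measurable_compose[OF component_measurable], auto)
 finally have E1: "(\<integral>\<^sup>+om. ennreal (mol sg om ^ m) \<partial>M) = ennreal (A ^ m) * (\<integral>\<^sup>+y. (\<Prod>k<m. ennreal (gauss_density (y k))) * Phi_nn \<psi> m (R y) ^ Suc n \<partial>P m)" .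
 define F where "F l = ennreal (\<Prod>k<m. (1 / (2 * pi)) ^ CARD('d) * exp (- (norm (l k /\<^sub>R sg))\<^sup>2 / 2)) * Phi_nn \<psi> m l ^ Suc n" for l :: "nat => real^'d"
 have Fm: "F \<in> bm (P m)"
 proof -
  have "(%l. (1 / (2 * pi)) ^ CARD('d) * exp (- (norm (l k /\<^sub>R sg))\<^sup>2 / 2)) \<in> bm (P m)" if "k < m" for k
   by (rule measurable_compose[OF component_measurable[OF that], where g = "%x. (1 / (2 * pi)) ^ CARD('d) * exp (- (norm (x /\<^sub>R sg))\<^sup>2 / 2)"]) measurable
  hence "(%l. \<Prod>k<m. (1 / (2 * pi)) ^ CARD('d) * exp (- (norm (l k /\<^sub>R sg))\<^sup>2 / 2)) \<in> bm (P m)"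
   by (intro borel_measurable_prod) auto
  thus ?thesis unfolding F_def using Phm by measurable
 qed
 have "(\<integral>\<^sup>+l. F l \<partial>P m) = ennreal (sg ^ (CARD('d) * m)) * (\<integral>\<^sup>+y. F (R y) \<partial>P m)"
  using nn_integral_PiM_scale[OF _ sg Fm] by (simp add: R_def)
 also have "... = ennreal (sg ^ (CARD('d) * m)) * (\<integral>\<^sup>+y. ennreal ((1 / sqrt (2 * pi)) ^ (CARD('d) * m)) * ((\<Prod>k<m. ennreal (gauss_density (y k))) * Phi_nn \<psi> m (R y) ^ Suc n) \<partial>P m)"
 proof (intro arg_cong2[where f = "(*)"] refl nn_integral_cong)
  fix y
  have s2: "(1 / (2 * pi)) ^ CARD('d) = (1 / sqrt (2 * pi)) ^ CARD('d) * (1 / sqrt (2 * pi)) ^ CARD('d)"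
   unfolding power_mult_distrib[symmetric] by (simp add: real_sqrt_mult_self)
  have "(1 / (2 * pi)) ^ CARD('d) * exp (- (norm (R y k /\<^sub>R sg))\<^sup>2 / 2) = (1 / sqrt (2 * pi)) ^ CARD('d) * gauss_density (y k)" if "k < m" for k
   unfolding gauss_density_def s2 using that sg by (simp add: R_def)
  hence "(\<Prod>k<m. (1 / (2 * pi)) ^ CARD('d) * exp (- (norm (R y k /\<^sub>R sg))\<^sup>2 / 2)) = (\<Prod>k<m. (1 / sqrt (2 * pi)) ^ CARD('d) * gauss_density (y k))"
   by (intro prod.cong refl) simp
  also have "... = (1 / sqrt (2 * pi)) ^ (CARD('d) * m) * (\<Prod>k<m. gauss_density (y k))" by (simp only: prod.distrib prod_constant card_lessThan power_mult)
  finally have pr: "(\<Prod>k<m. (1 / (2 * pi)) ^ CARD('d) * exp (- (norm (R y k /\<^sub>R sg))\<^sup>2 / 2)) = ..." .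
  have "ennreal ((1 / sqrt (2 * pi)) ^ (CARD('d) * m) * (\<Prod>k<m. gauss_density (y k))) = ennreal ((1 / sqrt (2 * pi)) ^ (CARD('d) * m)) * (\<Prod>k<m. ennreal (gauss_density (y k)))"
   by (subst ennreal_mult) (auto intro!: prod_nonneg simp: prod_ennreal)
  thus "F (R y) = ennreal ((1 / sqrt (2 * pi)) ^ (CARD('d) * m)) * ((\<Prod>k<m. ennreal (gauss_density (y k))) * Phi_nn \<psi> m (R y) ^ Suc n)"
   unfolding F_def pr by (simp only: mult.assoc)
 qed
 also have "... = ennreal (sg ^ (CARD('d) * m)) * (ennreal ((1 / sqrt (2 * pi)) ^ (CARD('d) * m)) * (\<integral>\<^sup>+y. (\<Prod>k<m. ennreal (gauss_density (y k))) * Phi_nn \<psi> m (R y) ^ Suc n \<partial>P m))"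
 proof -
  have "(%y. (\<Prod>k<m. ennreal (gauss_density (y k))) * Phi_nn \<psi> m (R y) ^ Suc n) \<in> bm (P m)"
   by (intro borel_measurable_times_ennreal PhRm borel_measurable_prod_ennreal measurable_compose[OF component_measurable]) auto
  thus ?thesis by (simp only: nn_integral_cmult)
 qed
 also have "... = ennreal (A ^ m) * (\<integral>\<^sup>+y. (\<Prod>k<m. ennreal (gauss_density (y k))) * Phi_nn \<psi> m (R y) ^ Suc n \<partial>P m)"
 proof -
  have "A ^ m = sg ^ (CARD('d) * m) * (1 / sqrt (2 * pi)) ^ (CARD('d) * m)"
   unfolding A_def by (simp only: power_mult power_mult_distrib[symmetric]) simp
  thus ?thesis using sg by (simp add: ennreal_mult mult.assoc)
 qed
 finally have "(\<integral>\<^sup>+l. F l \<partial>P m) = (\<integral>\<^sup>+om. ennreal (mol sg om ^ m) \<partial>M)" unfolding E1 .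
 thus ?thesis by (simp only: F_def)
qed

text \<open>The damping is at most 1, so the bound does not depend on sg. At order 2 m it provides
  the uniform integrability for the limit of the m-th moments.\<close>

lemma mol_moment_le:
 assumes m: "0 < m" and sg: "0 < sg"
 shows "(\<integral>\<^sup>+om. ennreal (mol sg om ^ m) \<partial>M) <= Phi_norm m" unfolding mol_moment[OF assms] Phi_norm_def
proof (rule nn_integral_mono)
 fix l :: "nat => real^'d"
 have p1: "(1 / (2 * pi)) ^ CARD('d) <= 1" using pi_gt3 by (intro power_le_one) auto
 have "(\<Prod>k<m. (1 / (2 * pi)) ^ CARD('d) * exp (- (norm (l k /\<^sub>R sg))\<^sup>2 / 2)) <= 1"
 proof (intro prod_le_1 conjI)
  fix k
  have "(1 / (2 * pi)) ^ CARD('d) * exp (- (norm (l k /\<^sub>R sg))\<^sup>2 / 2) <= 1 * 1" by (intro mult_mono p1) auto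
  thus "(1 / (2 * pi)) ^ CARD('d) * exp (- (norm (l k /\<^sub>R sg))\<^sup>2 / 2) <= 1" by simp
 qed simp
 hence "ennreal (\<Prod>k<m. (1 / (2 * pi)) ^ CARD('d) * exp (- (norm (l k /\<^sub>R sg))\<^sup>2 / 2)) * Phi_nn \<psi> m l ^ Suc n <= 1 * Phi_nn \<psi> m l ^ Suc n"
  by (intro mult_right_mono) (auto simp: ennreal_le_1 simp del: power_Suc)
 thus "ennreal (\<Prod>k<m. (1 / (2 * pi)) ^ CARD('d) * exp (- (norm (l k /\<^sub>R sg))\<^sup>2 / 2)) * Phi_nn \<psi> m l ^ Suc n <= Phi_nn \<psi> m l ^ Suc n"
  by (simp only: mult_1)
qed

text \<open>Fatou on the frequency side: as sg grows the Gaussian damping tends to 1, which leaves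
  (2 \<pi>)^(-d) per point.\<close>

lemma liminf_mol_moment:
 assumes m: "0 < m"
 shows "ennreal ((1 / (2 * pi)) ^ (CARD('d) * m)) * Phi_norm m <= liminf (%j. \<integral>\<^sup>+om. ennreal (mol (real (Suc j)) om ^ m) \<partial>M)"
proof -
 let ?w = "%j l. \<Prod>k<m. (1 / (2 * pi)) ^ CARD('d) * exp (- (norm (l k /\<^sub>R real (Suc j) :: real^'d))\<^sup>2 / 2)"
 have Phm: "Phi_nn \<psi> m \<in> bm (P m)" by (rule measurable_Phi_nn[OF m])
 have wm: "(%l. ennreal (?w j l) * Phi_nn \<psi> m l ^ Suc n) \<in> bm (P m)" for j
 proof -
  have "(%l. (1 / (2 * pi)) ^ CARD('d) * exp (- (norm (l k /\<^sub>R real (Suc j)))\<^sup>2 / 2)) \<in> bm (P m)" if "k < m" for k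
   by (rule measurable_compose[OF component_measurable[OF that], where g = "%x. (1 / (2 * pi)) ^ CARD('d) * exp (- (norm (x /\<^sub>R real (Suc j)))\<^sup>2 / 2)"]) measurable
  hence "?w j \<in> bm (P m)" by (intro borel_measurable_prod) auto
  thus ?thesis using Phm by measurable
 qed
 have lim: "(%j. ennreal (?w j l) * Phi_nn \<psi> m l ^ Suc n) \<longlonglongrightarrow> ennreal ((1 / (2 * pi)) ^ (CARD('d) * m)) * Phi_nn \<psi> m l ^ Suc n" for l
 proof -
  have "(%j. norm (l k /\<^sub>R real (Suc j))) \<longlonglongrightarrow> 0" for k
  proof -
   have "(%j. norm (l k) * (1 / real (Suc j))) \<longlonglongrightarrow> norm (l k) * 0"
   by (intro tendsto_mult_left LIMSEQ_Suc[OF lim_1_over_n])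
   thus ?thesis by (simp add: divide_inverse mult.commute)
  qed
  hence "?w j l = ?w j l & (%j. ?w j l) \<longlonglongrightarrow> (\<Prod>k<m. (1 / (2 * pi)) ^ CARD('d) * exp (- 0\<^sup>2 / 2))" for j
   by (intro conjI refl tendsto_prod tendsto_mult_left tendsto_exp tendsto_divide tendsto_minus tendsto_power tendsto_const) auto
  hence "(%j. ?w j l) \<longlonglongrightarrow> (\<Prod>k<m. (1 / (2 * pi)) ^ CARD('d) * exp (- 0\<^sup>2 / 2))" by blast
  also have "(\<Prod>k<m. (1 / (2 * pi)) ^ CARD('d) * exp (- 0\<^sup>2 / 2)) = (1 / (2 * pi)) ^ (CARD('d) * m)"
   by (simp add: power_mult)
  finally have "(%j. Phi_nn \<psi> m l ^ Suc n * ennreal (?w j l)) \<longlonglongrightarrow> Phi_nn \<psi> m l ^ Suc n * ennreal ((1 / (2 * pi)) ^ (CARD('d) * m))"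
   using Phi_nn_finite[OF m, where l = l and \<psi> = \<psi>] by (intro ennreal_tendsto_cmult tendsto_ennrealI) (auto simp: power_less_top_ennreal simp del: power_Suc)
  thus ?thesis by (simp only: mult.commute)
 qed
 have "ennreal ((1 / (2 * pi)) ^ (CARD('d) * m)) * Phi_norm m = (\<integral>\<^sup>+l. ennreal ((1 / (2 * pi)) ^ (CARD('d) * m)) * Phi_nn \<psi> m l ^ Suc n \<partial>P m)"
  unfolding Phi_norm_def by (rule nn_integral_cmult[symmetric]) (use Phm in measurable)
 also have "... = (\<integral>\<^sup>+l. liminf (%j. ennreal (?w j l) * Phi_nn \<psi> m l ^ Suc n) \<partial>P m)"
  by (intro nn_integral_cong lim_imp_Liminf[symmetric] lim) simp
 also have "... <= liminf (%j. \<integral>\<^sup>+l. ennreal (?w j l) * Phi_nn \<psi> m l ^ Suc n \<partial>P m)"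
  by (rule nn_integral_liminf) (rule wm)
 also have "... = liminf (%j. \<integral>\<^sup>+om. ennreal (mol (real (Suc j)) om ^ m) \<partial>M)"
  by (simp only: mol_moment[OF m, of "real (Suc _)"] of_nat_0_less_iff zero_less_Suc)
 finally show ?thesis .
qed

text \<open>Pathwise only an upper bound on the limit of the mollifications is used, so a reverse
  Fatou lemma is required; it applies after truncation at K. What exceeds K is paid for by the
  moment of order 2 m, bounded uniformly in sg.\<close>

lemma moment_lower:
 assumes m: "0 < m"
 shows "ennreal ((1 / (2 * pi)) ^ (CARD('d) * m)) * Phi_norm m <= (\<integral>\<^sup>+om. ennreal (\<eta> 0 1 om ^ m) \<partial>M)"
proof (rule ennreal_le_epsilon)
 let ?I = "\<integral>\<^sup>+om. ennreal (\<eta> 0 1 om ^ m) \<partial>M"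
 fix e :: real assume I: "?I < \<top>" and e: "0 < e"
 define D where "D = enn2real (Phi_norm (2 * m))"
 have D: "Phi_norm (2 * m) = ennreal D" "0 <= D" using Phi_norm_finite[of "2 * m"] m by (auto simp: D_def)
 \<comment> \<open>K >= 1 gives K^m >= K, so D / K^m is at most e / 2.\<close>
 define K where "K = max 1 (2 * D / e)"
 have K: "1 <= K" "2 * D / e <= K" by (auto simp: K_def)
 have KD: "D / K ^ m <= e / 2"
 proof -
  have "2 * D / e <= K ^ m" using K self_le_power[OF K(1) m] by linarith
  thus ?thesis using e K by (simp add: field_simps)
 qed
 define V where "V j om = mol (real (Suc j)) om" for j om
 have [measurable]: "V j \<in> bm M" for j unfolding V_def by measurable
 let ?T = "%j om. ennreal (min (V j om) K ^ m)"
 have Ej: "(\<integral>\<^sup>+om. ennreal (V j om ^ m) \<partial>M) <= (\<integral>\<^sup>+om. ?T j om \<partial>M) + ennreal (e / 2)" for j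
 proof -
  have "(\<integral>\<^sup>+om. ennreal (V j om ^ m) \<partial>M) <= (\<integral>\<^sup>+om. ?T j om + ennreal (V j om ^ (2 * m)) * ennreal (1 / K ^ m) \<partial>M)"
  proof (rule nn_integral_mono_AE, use AE_good in eventually_elim)
   fix om assume g: "good om"
   have v: "0 <= V j om" unfolding V_def by (rule mol_good(2)[OF g]) simp
   have "V j om ^ m <= min (V j om) K ^ m + V j om ^ (2 * m) * (1 / K ^ m)"
   proof (cases "V j om <= K")
   case False
   have "V j om ^ m * K ^ m <= V j om ^ m * V j om ^ m" using False K v by (intro mult_left_mono power_mono) auto
   hence "V j om ^ m * K ^ m <= V j om ^ (2 * m)" by (simp only: mult_2 power_add)
   moreover have "0 < K ^ m" using K by simp
   ultimately have "V j om ^ m <= V j om ^ (2 * m) / K ^ m" by (simp only: pos_le_divide_eq)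
   hence "V j om ^ m <= V j om ^ (2 * m) * (1 / K ^ m)" by simp
   moreover have "0 <= min (V j om) K ^ m" using v K by simp
   ultimately show ?thesis by linarith
   next
   case True
   moreover have "0 <= V j om ^ (2 * m) * (1 / K ^ m)" using v K by simp
   ultimately show ?thesis by (simp add: min_def)
   qed
   hence "ennreal (V j om ^ m) <= ennreal (min (V j om) K ^ m + V j om ^ (2 * m) * (1 / K ^ m))" by (rule ennreal_leI)
   also have "... = ?T j om + ennreal (V j om ^ (2 * m)) * ennreal (1 / K ^ m)"
   using v K by (subst ennreal_plus) (auto simp: ennreal_mult[symmetric])
   finally show "ennreal (V j om ^ m) <= ?T j om + ennreal (V j om ^ (2 * m)) * ennreal (1 / K ^ m)" .
  qed
  also have "... = (\<integral>\<^sup>+om. ?T j om \<partial>M) + (\<integral>\<^sup>+om. ennreal (V j om ^ (2 * m)) \<partial>M) * ennreal (1 / K ^ m)"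
   by (subst nn_integral_add) (auto simp: nn_integral_multc)
  also have "... <= (\<integral>\<^sup>+om. ?T j om \<partial>M) + ennreal D * ennreal (1 / K ^ m)"
   unfolding V_def D(1)[symmetric] using m by (intro add_left_mono mult_right_mono mol_moment_le) auto
  also have "ennreal D * ennreal (1 / K ^ m) <= ennreal (e / 2)" using D K KD by (simp add: ennreal_leI flip: ennreal_mult)
  finally show ?thesis by (simp add: add_left_mono)
 qed
 have "limsup (%j. \<integral>\<^sup>+om. ?T j om \<partial>M) <= (\<integral>\<^sup>+om. limsup (%j. ?T j om) \<partial>M)"
 proof (rule nn_integral_limsup[where w = "%_. ennreal (K ^ m)"])
  show "AE om in M. ?T j om <= ennreal (K ^ m)" for j
  proof (use AE_good in eventually_elim)
   fix om assume g: "good om"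
   have v: "0 <= V j om" unfolding V_def by (rule mol_good(2)[OF g]) simp
   thus "?T j om <= ennreal (K ^ m)" using K by (intro ennreal_leI power_mono) auto
  qed
 qed (auto simp: emeasure_space_1)
 also have "... <= ?I"
 proof (rule nn_integral_mono_AE, use AE_good in eventually_elim)
  fix om assume g: "good om"
  have e0: "0 <= \<eta> 0 1 om" using g by (simp add: good_def)
  have "limsup (%j. ?T j om) <= ennreal ((\<eta> 0 1 om + 1 / real (Suc i)) ^ m)" for i
  proof (rule Limsup_bounded)
   show "\<forall>\<^sub>F j in sequentially. ?T j om <= ennreal ((\<eta> 0 1 om + 1 / real (Suc i)) ^ m)"
   using mol_le_local_time[OF g, of "1 / real (Suc i)", OF divide_pos_pos[OF zero_less_one of_nat_0_less_iff[THEN iffD2, OF zero_less_Suc]]]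
   proof eventually_elim
   case (elim j)
   have v: "0 <= V j om" unfolding V_def by (rule mol_good(2)[OF g]) simp
   have "min (V j om) K <= \<eta> 0 1 om + 1 / real (Suc i)" using elim by (simp add: V_def)
   thus ?case using v K by (intro ennreal_leI power_mono) auto
   qed
  qed
  moreover have "(%i. ennreal ((\<eta> 0 1 om + 1 / real (Suc i)) ^ m)) \<longlonglongrightarrow> ennreal ((\<eta> 0 1 om + 0) ^ m)"
   by (intro tendsto_ennrealI tendsto_power tendsto_add tendsto_const LIMSEQ_Suc[OF lim_1_over_n])
  ultimately have "limsup (%j. ?T j om) <= ennreal ((\<eta> 0 1 om + 0) ^ m)" by (intro LIMSEQ_le_const) auto
  thus "limsup (%j. ?T j om) <= ennreal (\<eta> 0 1 om ^ m)" by simp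
 qed
 also have "?I < ?I + ennreal (e / 2)" using I e by (simp add: ennreal_lessI less_top)
 finally have "\<forall>\<^sub>F j in sequentially. (\<integral>\<^sup>+om. ?T j om \<partial>M) < ?I + ennreal (e / 2)" by (rule Limsup_lessD)
 hence "\<forall>\<^sub>F j in sequentially. (\<integral>\<^sup>+om. ennreal (V j om ^ m) \<partial>M) <= ?I + ennreal e"
 proof eventually_elim
  case (elim j)
  have "(\<integral>\<^sup>+om. ennreal (V j om ^ m) \<partial>M) <= (?I + ennreal (e / 2)) + ennreal (e / 2)"
   using Ej[of j] add_right_mono[OF less_imp_le[OF elim], of "ennreal (e / 2)"] by (rule order_trans)
  also have "... = ?I + ennreal e" using e by (simp add: add.assoc flip: ennreal_plus)
  finally show ?case .
 qed
 hence "liminf (%j. \<integral>\<^sup>+om. ennreal (V j om ^ m) \<partial>M) <= ?I + ennreal e" by (rule Liminf_le[OF sequentially_bot])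
 thus "ennreal ((1 / (2 * pi)) ^ (CARD('d) * m)) * Phi_norm m <= ?I + ennreal e"
  using liminf_mol_moment[OF m] unfolding V_def by (rule order_trans[rotated])
qed

end

section \<open>The moment limit and the constant\<close>

context additive_stable
begin

definition Lc :: real where "Lc = (real (Suc n) / av) powr av * \<rho> / (2 * pi) ^ CARD('d)"

lemma Lc_pos: "0 < Lc" unfolding Lc_def using av_pos rho_pos by (intro divide_pos_pos mult_pos_pos) auto

lemma AE_eta_nonneg: "AE om in M. 0 <= \<eta> 0 1 om" using AE_good by eventually_elim (simp add: good_def)

text \<open>The upper bound is available for large even orders, so a given even power is dominated
  by 1 plus a larger one.\<close>

lemma eta_integrable: "integrable M (%om. \<eta> 0 1 om ^ (2 * m))"
proof -
 obtain N where N: "!!k. N <= k ==> even k ==> (\<integral>\<^sup>+om. ennreal (\<eta> 0 1 om ^ k) \<partial>M) < \<top>"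
 proof -
  have "\<forall>\<^sub>F k in sequentially. even k --> (\<integral>\<^sup>+om. ennreal (\<eta> 0 1 om ^ k) \<partial>M) < \<top>"
   using moment_upper[of "1 / 2", simplified] by (auto elim!: eventually_mono intro: le_less_trans ennreal_less_top)
  thus ?thesis using that unfolding eventually_sequentially by blast
 qed
 define k where "k = 2 * (m + N)"
 have k: "(\<integral>\<^sup>+om. ennreal (\<eta> 0 1 om ^ k) \<partial>M) < \<top>" by (rule N) (auto simp: k_def)
 have "(\<integral>\<^sup>+om. ennreal (norm (\<eta> 0 1 om ^ (2 * m))) \<partial>M) <= (\<integral>\<^sup>+om. 1 + ennreal (\<eta> 0 1 om ^ k) \<partial>M)"
 proof (rule nn_integral_mono_AE, use AE_eta_nonneg in eventually_elim)
  fix om assume e: "0 <= \<eta> 0 1 om"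
  have "\<eta> 0 1 om ^ (2 * m) <= 1 + \<eta> 0 1 om ^ k"
  proof (cases "\<eta> 0 1 om <= 1")
   case True
   have "\<eta> 0 1 om ^ (2 * m) <= 1" using True e by (rule power_le_one[rotated])
   moreover have "0 <= \<eta> 0 1 om ^ k" using e by simp
   ultimately show ?thesis by linarith
  next
   case False
   hence "\<eta> 0 1 om ^ (2 * m) <= \<eta> 0 1 om ^ k" by (intro power_increasing) (auto simp: k_def)
   thus ?thesis by linarith
  qed
  hence "ennreal (\<eta> 0 1 om ^ (2 * m)) <= ennreal (1 + \<eta> 0 1 om ^ k)" by (rule ennreal_leI)
  thus "ennreal (norm (\<eta> 0 1 om ^ (2 * m))) <= 1 + ennreal (\<eta> 0 1 om ^ k)" using e by (simp add: ennreal_plus)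
 qed
 also have "... = 1 + (\<integral>\<^sup>+om. ennreal (\<eta> 0 1 om ^ k) \<partial>M)"
  by (subst nn_integral_add) (auto simp: emeasure_space_1)
 also have "... < \<top>" using k by (simp add: less_top[symmetric])
 finally show ?thesis by (intro integrableI_bounded) (auto simp: less_top)
qed

definition lmom :: "nat => real" where "lmom m = expectation (%om. \<eta> 0 1 om ^ (2 * m))"

lemma nn_lmom: "(\<integral>\<^sup>+om. ennreal (\<eta> 0 1 om ^ (2 * m)) \<partial>M) = ennreal (lmom m)"
 unfolding lmom_def by (rule nn_integral_eq_integral[OF eta_integrable]) simp

lemma lmom_nonneg: "0 <= lmom m" unfolding lmom_def by (rule integral_nonneg_AE) simp

lemma lmom_lower:
 assumes c: "0 < c" "c < \<rho>" and ep: "0 < ep" "ep < 1"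
 obtains C where "0 < C" "!!m. 2 <= m ==>
  C * ((real (Suc n) / av) powr av * real (2 * m) powr gam * exp (- gam) * ((1 - ep) powr (real (n * Suc n) + av) * c / (2 * pi) ^ CARD('d))) ^ (2 * m) <= lmom m"
proof -
 obtain C where C: "0 < C" and low: "!!m. even m ==> 4 <= m ==>
  ennreal (C * (((real (Suc n) / av) powr av * real m powr gam * exp (- gam)) * ((1 - ep) powr (real (n * Suc n) + av) * c)) ^ m) <= Phi_norm m"
  using Phi_norm_lower[OF c ep] by blast
 show ?thesis
 proof (rule that[OF C])
  fix m :: nat assume m: "2 <= m"
  let ?g = "(real (Suc n) / av) powr av * real (2 * m) powr gam * exp (- gam)"
  let ?q = "(1 - ep) powr (real (n * Suc n) + av) * c"
  have "ennreal (C * (?g * (?q / (2 * pi) ^ CARD('d))) ^ (2 * m)) = ennreal ((1 / (2 * pi)) ^ (CARD('d) * (2 * m)) * (C * (?g * ?q) ^ (2 * m)))"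
  proof -
   have "C * (g * (q / a)) ^ k = (1 / a) ^ k * (C * (g * q) ^ k)" for g q a :: real and k
   by (simp add: power_mult_distrib power_divide)
   moreover have "(1 / (2 * pi)) ^ (CARD('d) * (2 * m)) = (1 / (2 * pi) ^ CARD('d)) ^ (2 * m)"
   by (simp only: power_mult power_one_over)
   ultimately show ?thesis by (simp only:)
  qed
  also have "... = ennreal ((1 / (2 * pi)) ^ (CARD('d) * (2 * m))) * ennreal (C * (?g * ?q) ^ (2 * m))"
   using C by (intro ennreal_mult) auto
  also have "... <= ennreal ((1 / (2 * pi)) ^ (CARD('d) * (2 * m))) * Phi_norm (2 * m)"
   using m by (intro mult_left_mono low) auto
  also have "... <= ennreal (lmom m)" unfolding nn_lmom[symmetric] using m by (intro moment_lower) simp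
  finally show "C * (?g * (?q / (2 * pi) ^ CARD('d))) ^ (2 * m) <= lmom m" using lmom_nonneg[of m] by (simp add: ennreal_le_iff)
 qed
qed

text \<open>A vanishing even moment would make the local time vanish almost surely, and with it the
  higher moments, against the lower bound.\<close>

lemma lmom_pos: "0 < lmom m"
proof (rule ccontr)
 assume "~ 0 < lmom m"
 hence "lmom m = 0" using lmom_nonneg[of m] by simp
 hence "AE om in M. \<eta> 0 1 om ^ (2 * m) = 0"
  unfolding lmom_def by (subst (asm) integral_nonneg_eq_0_iff_AE[OF eta_integrable]) auto
 hence "AE om in M. \<eta> 0 1 om ^ (2 * (m + 2)) = 0" by eventually_elim (simp add: distrib_left power_add)
 hence "lmom (m + 2) = 0" unfolding lmom_def by (subst integral_nonneg_eq_0_iff_AE[OF eta_integrable]) auto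
 moreover have "0 < lmom (m + 2)"
 proof -
  obtain C where "0 < C" and low: "!!m. 2 <= m ==>
   C * ((real (Suc n) / av) powr av * real (2 * m) powr gam * exp (- gam) * ((1 - 1 / 2) powr (real (n * Suc n) + av) * (\<rho> / 2) / (2 * pi) ^ CARD('d))) ^ (2 * m) <= lmom m"
   by (rule lmom_lower[of "\<rho> / 2" "1 / 2"]) (use rho_pos in auto)
  have "0 < C * ((real (Suc n) / av) powr av * real (2 * (m + 2)) powr gam * exp (- gam) * ((1 - 1 / 2) powr (real (n * Suc n) + av) * (\<rho> / 2) / (2 * pi) ^ CARD('d))) ^ (2 * (m + 2))"
   using \<open>0 < C\<close> av_pos rho_pos by (intro mult_pos_pos zero_less_power divide_pos_pos) auto
  also have "... <= lmom (m + 2)" by (rule low) simp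
  finally show ?thesis .
 qed
 ultimately show False by simp
qed

lemma ln_power_form:
 assumes m: "0 < m" and K: "0 < K" and s: "0 < s"
 shows "ln (K * ((real (Suc n) / av) powr av * real (2 * m) powr gam * exp (- gam) * (s * \<rho> / (2 * pi) ^ CARD('d))) ^ (2 * m)) / real (2 * m) - gam * ln (real (2 * m))
  = ln K / real (2 * m) + (ln Lc - gam) + ln s"
proof -
 have eq: "(real (Suc n) / av) powr av * real (2 * m) powr gam * exp (- gam) * (s * \<rho> / (2 * pi) ^ CARD('d)) = Lc * s * (real (2 * m) powr gam * exp (- gam))"
  unfolding Lc_def by (simp only: times_divide_eq_right times_divide_eq_left mult_ac)
 have pos: "0 < Lc * s * (real (2 * m) powr gam * exp (- gam))" using Lc_pos s m by (intro mult_pos_pos) auto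
 have "ln (Lc * s * (real (2 * m) powr gam * exp (- gam))) = ln Lc + ln s + (gam * ln (real (2 * m)) - gam)"
  using Lc_pos s m by (simp add: ln_mult ln_powr)
 hence "ln (K * (Lc * s * (real (2 * m) powr gam * exp (- gam))) ^ (2 * m)) = ln K + real (2 * m) * (ln Lc + ln s + (gam * ln (real (2 * m)) - gam))"
  using K pos by (subst ln_mult) (auto simp: ln_realpow)
 thus ?thesis unfolding eq using m by (simp add: add_divide_distrib)
qed

text \<open>Both bounds have the shape of \<open>ln_power_form\<close>: a factor K that is
  subexponential in m, and a loss s per order that tends to 1 with th or ep. In the lower bound s
  also accounts for replacing \<rho> by (1 - ep) \<rho>.\<close>

lemma ln_lmom_limit:
 "(%m. ln (lmom m) / real (2 * m) - gam * ln (real (2 * m))) \<longlonglongrightarrow> ln Lc - gam"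
proof (rule order_tendstoI)
 fix y assume y: "ln Lc - gam < y"
 have "((%th::real. ln ((1 + th) / (1 - th))) \<longlongrightarrow> 0) (at_right 0)" by real_asymp
 hence "\<forall>\<^sub>F th in at_right (0::real). ln ((1 + th) / (1 - th)) < y - (ln Lc - gam)"
  by (rule order_tendstoD(2)) (use y in simp)
 moreover have "\<forall>\<^sub>F th in at_right (0::real). th \<in> {0<..<1}" by (rule eventually_at_right_real) simp
 ultimately have "\<forall>\<^sub>F th in at_right (0::real). ln ((1 + th) / (1 - th)) < y - (ln Lc - gam) & th \<in> {0<..<1}"
  by (rule eventually_conj)
 then obtain th :: real where th: "0 < th" "th < 1" "ln ((1 + th) / (1 - th)) < y - (ln Lc - gam)"
  using eventually_happens[of _ "at_right (0::real)"] by (auto simp: trivial_limit_at_right_real)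
 define s where "s = (1 + th) / (1 - th)"
 have s: "0 < s" using th by (simp add: s_def)
 let ?K = "%m. 2 * (exp 1 * (real (2 * m) + 1)) ^ Suc n"
 have "(%m. (ln 2 + real (Suc n) * (1 + ln (real (2 * m) + 1))) / real (2 * m)) \<longlonglongrightarrow> 0" by real_asymp
 moreover have lnK: "ln (?K m) = ln 2 + real (Suc n) * (1 + ln (real (2 * m) + 1))" for m
 proof -
  have "ln (?K m) = ln 2 + ln ((exp 1 * (real (2 * m) + 1)) ^ Suc n)"
   by (rule ln_mult_pos) (auto intro!: zero_less_power mult_pos_pos add_nonneg_pos)
  also have "ln ((exp 1 * (real (2 * m) + 1)) ^ Suc n) = real (Suc n) * ln (exp 1 * (real (2 * m) + 1))" by (rule ln_realpow)
  also have "ln (exp 1 * (real (2 * m) + 1)) = 1 + ln (real (2 * m) + 1)" by (subst ln_mult_pos) (auto intro!: add_nonneg_pos)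
  finally show ?thesis .
 qed
 ultimately have "(%m. ln (?K m) / real (2 * m)) \<longlonglongrightarrow> 0" by (simp only: lnK)
 hence "(%m. ln (?K m) / real (2 * m) + (ln Lc - gam) + ln s) \<longlonglongrightarrow> 0 + (ln Lc - gam) + ln s"
  by (intro tendsto_add tendsto_const)
 hence ev1: "\<forall>\<^sub>F m in sequentially. ln (?K m) / real (2 * m) + (ln Lc - gam) + ln s < y"
  by (rule order_tendstoD(2)) (use th in \<open>simp add: s_def\<close>)
 have "\<forall>\<^sub>F m in sequentially. even (2 * m) --> (\<integral>\<^sup>+om. ennreal (\<eta> 0 1 om ^ (2 * m)) \<partial>M)
  <= ennreal (?K m * (((real (Suc n) / av) powr av * real (2 * m) powr gam * exp (- gam)) * (s * \<rho> / (2 * pi) ^ CARD('d))) ^ (2 * m))"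
 proof -
  have "filterlim (%m::nat. 2 * m) sequentially sequentially" by (rule filterlim_subseq) (simp add: strict_mono_def)
  from eventually_compose_filterlim[OF moment_upper[OF th(1,2)] this] show ?thesis unfolding s_def .
 qed
 thus "\<forall>\<^sub>F m in sequentially. ln (lmom m) / real (2 * m) - gam * ln (real (2 * m)) < y"
  using ev1 eventually_gt_at_top[of 0]
 proof eventually_elim
  case (elim m)
  let ?B = "?K m * (((real (Suc n) / av) powr av * real (2 * m) powr gam * exp (- gam)) * (s * \<rho> / (2 * pi) ^ CARD('d))) ^ (2 * m)"
  have K: "0 < ?K m" by (intro mult_pos_pos zero_less_power add_nonneg_pos) auto
  have "0 <= ?B" using K s rho_pos by (intro mult_nonneg_nonneg zero_le_power divide_nonneg_nonneg) auto
  moreover have "ennreal (lmom m) <= ennreal ?B" using elim(1) by (simp only: nn_lmom) simp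
  ultimately have "lmom m <= ?B" by (subst (asm) ennreal_le_iff)
  hence "ln (lmom m) <= ln ?B" using lmom_pos[of m] by (intro ln_mono) auto
  hence "ln (lmom m) / real (2 * m) - gam * ln (real (2 * m)) <= ln ?B / real (2 * m) - gam * ln (real (2 * m))"
   by (intro diff_right_mono divide_right_mono) auto
  also have "... = ln (?K m) / real (2 * m) + (ln Lc - gam) + ln s" by (rule ln_power_form[OF elim(3) K s])
  also have "... < y" by (rule elim(2))
  finally show ?case .
 qed
next
 fix y assume y: "y < ln Lc - gam"
 define q where "q = real (n * Suc n) + av"
 have "((%ep::real. (q + 1) * ln (1 - ep)) \<longlongrightarrow> 0) (at_right 0)" by real_asymp
 hence "\<forall>\<^sub>F ep in at_right (0::real). y - (ln Lc - gam) < (q + 1) * ln (1 - ep)"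
  by (rule order_tendstoD(1)) (use y in simp)
 moreover have "\<forall>\<^sub>F ep in at_right (0::real). ep \<in> {0<..<1}" by (rule eventually_at_right_real) simp
 ultimately have "\<forall>\<^sub>F ep in at_right (0::real). y - (ln Lc - gam) < (q + 1) * ln (1 - ep) & ep \<in> {0<..<1}"
  by (rule eventually_conj)
 then obtain ep :: real where ep: "0 < ep" "ep < 1" "y - (ln Lc - gam) < (q + 1) * ln (1 - ep)"
  using eventually_happens[of _ "at_right (0::real)"] by (auto simp: trivial_limit_at_right_real)
 define s where "s = (1 - ep) powr q * (1 - ep)"
 have s: "0 < s" using ep by (simp add: s_def)
 have lns: "ln s = (q + 1) * ln (1 - ep)" unfolding s_def using ep by (subst ln_mult_pos) (auto simp: ln_powr algebra_simps)
 obtain C where C: "0 < C" and low: "!!m. 2 <= m ==>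
  C * ((real (Suc n) / av) powr av * real (2 * m) powr gam * exp (- gam) * ((1 - ep) powr q * ((1 - ep) * \<rho>) / (2 * pi) ^ CARD('d))) ^ (2 * m) <= lmom m"
  unfolding q_def by (rule lmom_lower[of "(1 - ep) * \<rho>" ep]) (use ep rho_pos in auto)
 have "(%m. ln C / real (2 * m)) \<longlonglongrightarrow> 0" by real_asymp
 hence "(%m. ln C / real (2 * m) + (ln Lc - gam) + ln s) \<longlonglongrightarrow> 0 + (ln Lc - gam) + ln s"
  by (intro tendsto_add tendsto_const)
 hence "\<forall>\<^sub>F m in sequentially. y < ln C / real (2 * m) + (ln Lc - gam) + ln s"
  by (rule order_tendstoD(1)) (use ep in \<open>simp add: lns\<close>)
 thus "\<forall>\<^sub>F m in sequentially. y < ln (lmom m) / real (2 * m) - gam * ln (real (2 * m))"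
  using eventually_ge_at_top[of 2]
 proof eventually_elim
  case (elim m)
  let ?B = "C * ((real (Suc n) / av) powr av * real (2 * m) powr gam * exp (- gam) * (s * \<rho> / (2 * pi) ^ CARD('d))) ^ (2 * m)"
  have m: "0 < m" using elim by simp
  have "0 < ?B" using C s av_pos rho_pos m by (intro mult_pos_pos zero_less_power divide_pos_pos) auto
  moreover have "?B <= lmom m" using low[OF elim(2)] by (simp only: s_def mult.assoc)
  ultimately have "ln ?B <= ln (lmom m)" by (intro ln_mono)
  have "y < ln C / real (2 * m) + (ln Lc - gam) + ln s" by (rule elim(1))
  also have "... = ln ?B / real (2 * m) - gam * ln (real (2 * m))" by (rule ln_power_form[OF m C s, symmetric])
  also have "... <= ln (lmom m) / real (2 * m) - gam * ln (real (2 * m))"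
   using \<open>ln ?B <= ln (lmom m)\<close> by (intro diff_right_mono divide_right_mono) auto
  finally show ?case .
 qed
qed

text \<open>The rate is gam Lc^(-1/gam). The exponent -1/gam = -\<alpha>/d turns (2 \<pi>)^(-d) into
  (2 \<pi>)^\<alpha>, and (p / av)^av into a power av/gam of av / p = 1 - d / (\<alpha> p).\<close>

lemma constant_eq:
 "- gam * exp (- (ln Lc - gam + gam) / gam) = - ((2 * pi) powr \<alpha>) * (real CARD('d) / \<alpha>) *
   (1 - real CARD('d) / (\<alpha> * real (Suc n))) powr ((\<alpha> * real (Suc n) - real CARD('d)) / real CARD('d)) * \<rho> powr (- \<alpha> / real CARD('d))"
proof -
 define p where "p = real (Suc n)"
 define d where "d = real CARD('d)"
 have p: "0 < p" and d: "0 < d" by (simp_all add: p_def d_def)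
 have gam: "gam = d / \<alpha>" by (simp add: gam_def d_def)
 have av: "av = p - d / \<alpha>" by (simp add: av_def gam p_def)
 have b: "1 - d / (\<alpha> * p) = av / p" using p \<alpha>0 by (simp add: av field_simps)
 have x: "(\<alpha> * p - d) / d = av / gam" using \<alpha>0 d by (simp add: av gam field_simps)
 have "exp (- (ln Lc - gam + gam) / gam) = Lc powr (- 1 / gam)" using Lc_pos by (simp add: powr_def)
 also have "... = ((p / av) powr av) powr (- 1 / gam) * \<rho> powr (- 1 / gam) / ((2 * pi) powr d) powr (- 1 / gam)"
  unfolding Lc_def p_def[symmetric] using p av_pos rho_pos by (simp add: powr_divide powr_mult powr_realpow[symmetric] d_def)
 also have "((2 * pi) powr d) powr (- 1 / gam) = (2 * pi) powr (- \<alpha>)" using d by (simp add: powr_powr gam)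
 also have "((p / av) powr av) powr (- 1 / gam) = (av / p) powr (av / gam)"
  using p av_pos by (simp add: powr_powr powr_divide powr_minus_divide)
 finally have "exp (- (ln Lc - gam + gam) / gam) = (av / p) powr (av / gam) * \<rho> powr (- 1 / gam) * (2 * pi) powr \<alpha>"
  by (simp add: powr_minus divide_inverse)
 moreover have "- 1 / gam = - \<alpha> / d" by (simp add: gam)
 ultimately show ?thesis unfolding p_def[symmetric] d_def[symmetric] b x by (simp add: gam mult_ac)
qed

lemma tail:
 "((%t. t powr (- \<alpha> / real CARD('d)) * ln (measure M {om \<in> space M. \<eta> 0 1 om >= t}))
  \<longlongrightarrow> - ((2 * pi) powr \<alpha>) * (real CARD('d) / \<alpha>) *
   (1 - real CARD('d) / (\<alpha> * real (Suc n))) powr ((\<alpha> * real (Suc n) - real CARD('d)) / real CARD('d)) *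
   \<rho> powr (- \<alpha> / real CARD('d))) at_top"
proof -
 interpret moment_asymptotics M "\<eta> 0 1" gam "ln Lc - gam"
 proof unfold_locales
  show "0 < expectation (%om. \<eta> 0 1 om ^ (2 * m))" for m using lmom_pos[of m] by (simp only: lmom_def)
  show "(%m. ln (expectation (%om. \<eta> 0 1 om ^ (2 * m))) / real (2 * m) - gam * ln (real (2 * m))) \<longlonglongrightarrow> ln Lc - gam"
   using ln_lmom_limit by (simp only: lmom_def)
 qed (rule eta_meas AE_eta_nonneg gam_pos eta_integrable)+
 have "- 1 / gam = - \<alpha> / real CARD('d)" by (simp add: gam_def)
 thus ?thesis using tail_limit unfolding constant_eq by simp
qed

end

theorem theorem1p1:
  fixes M :: "'a measure"
    and X :: "'p::finite \<Rightarrow> real \<Rightarrow> 'a \<Rightarrow> real^'d::finite"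
    and \<psi> :: "real^'d \<Rightarrow> real"
    and \<alpha> :: real
    and \<eta> :: "real^'d \<Rightarrow> real \<Rightarrow> 'a \<Rightarrow> real"
  assumes "prob_space M"
    and "0 < \<alpha>" and "\<alpha> \<le> 2"
    and "real CARD('d) < \<alpha> * real CARD('p)"
    and "stable_exponent \<alpha> \<psi>"
    and "\<forall>j. levy_process_exp M (X j) \<psi>"
    and "prob_space.indep_vars M (\<lambda>_. Pi\<^sub>M {0..} (\<lambda>_. borel))
           (\<lambda>j \<omega>. restrict (\<lambda>t. X j t \<omega>) {0..}) UNIV"
    and "local_time M X \<eta>"
  shows "((\<lambda>t. t powr (- \<alpha> / real CARD('d)) *
              ln (measure M {\<omega> \<in> space M. \<eta> 0 1 \<omega> \<ge> t}))
          \<longlongrightarrow> - ((2 * pi) powr \<alpha>) * (real CARD('d) / \<alpha>) *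
                (1 - real CARD('d) / (\<alpha> * real CARD('p)))
                  powr ((\<alpha> * real CARD('p) - real CARD('d)) / real CARD('d)) *
                stable_rho CARD('p) \<psi> powr (- \<alpha> / real CARD('d))) at_top"
proof -
  obtain n where n: "CARD('p) = Suc n" using zero_less_card_finite[where 'a = 'p] gr0_conv_Suc by blast
  interpret prob_space M by fact
  have "additive_stable M \<alpha> \<psi> n X \<eta>"
    by unfold_locales (use assms n in auto)
  then show ?thesis unfolding n by (rule additive_stable.tail)
qed

end
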